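(* Let $X$ be a compact connected Riemann surface of genus $g$, and let $(a_1,\dots,a_g,b_1,\dots,b_g)$ be a symplectic basis of $H_1(X,\mathbb{Z})$. Let $\omega$ and $\omega'$ be two holomorphic differentials on $X$. Then $$\sum_{k=1}^{g}\left(\int_{a_k}\omega\int_{b_k}\omega'-\int_{b_k}\omega\int_{a_k}\omega'\right)=0.$$ If moreover $\omega$ is nonzero, then $$i\sum_{k=1}^{g}\left(\int_{a_k}\omega\int_{b_k}\overline{\omega}-\int_{b_k}\omega\int_{a_k}\overline{\omega}\right)>0.$$
   Context: A basis $(a_1,\dots,a_g,b_1,\dots,b_g)$ of $H_1(X,\mathbb{Z})$ is called symplectic if the intersection products satisfy $(a_j,a_k)=(b_j,b_k)=0$ and $(a_j,b_k)=\delta_{jk}$ for $1\le j,k\le g$ (with respect to the orientation of $X$ given by the complex structure). *)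

theory Defs
  imports "HOL-Analysis.Analysis" "HOL-Homology.Homology"
begin

text \<open>A chart is a pair of its domain and its coordinate function.\<close>

type_synonym 'a chart = "'a set \<times> ('a \<Rightarrow> complex)"

definition chart_image :: "'a chart \<Rightarrow> complex set" where
  "chart_image c = snd c ` fst c"

definition transition :: "'a chart \<Rightarrow> 'a chart \<Rightarrow> complex \<Rightarrow> complex" where
  "transition c d = snd d \<circ> inv_into (fst c) (snd c)"

text \<open>The atlas need not be maximal. Connectedness and compactness are imposed separately.\<close>

locale riemann_surface =
  fixes X :: "'a topology" and A :: "'a chart set"
  assumes hausdorff: "Hausdorff_space X"
    and charts_cover: "(\<Union>c\<in>A. fst c) = topspace X"
    and chart_open: "c \<in> A \<Longrightarrow> openin X (fst c)"
    and chart_image_open: "c \<in> A \<Longrightarrow> open (chart_image c)"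
    and chart_homeomorphic: "c \<in> A \<Longrightarrow>
      homeomorphic_map (subtopology X (fst c)) (top_of_set (chart_image c)) (snd c)"
    and transition_holomorphic: "c \<in> A \<Longrightarrow> d \<in> A \<Longrightarrow>
      transition c d holomorphic_on snd c ` (fst c \<inter> fst d)"

definition has_genus :: "'a topology \<Rightarrow> nat \<Rightarrow> bool" where
  "has_genus X g \<longleftrightarrow> homology_group 1 X \<cong> free_Abelian_group {..<2 * g}"


text \<open>A complex-valued 1-form is given by its local expressions: \<open>\<omega> c z v\<close> is the value,
  in the chart \<open>c\<close> and at the coordinate \<open>z\<close>, on the tangent vector with coordinate \<open>v\<close>. It need only
  be real-linear in \<open>v\<close>, so that the conjugate of a form is again a form. Values for \<open>c\<close> outside the
  atlas or \<open>z\<close> outside the image of \<open>c\<close> carry no information.\<close>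

type_synonym 'a one_form = "'a chart \<Rightarrow> complex \<Rightarrow> complex \<Rightarrow> complex"

definition holomorphic_differential :: "'a chart set \<Rightarrow> 'a one_form \<Rightarrow> bool" where
  "holomorphic_differential A \<omega> \<longleftrightarrow>
     (\<forall>c\<in>A. \<exists>f. f holomorphic_on chart_image c \<and> (\<forall>z\<in>chart_image c. \<forall>v. \<omega> c z v = f z * v)) \<and>
     (\<forall>c\<in>A. \<forall>d\<in>A. \<forall>z \<in> snd c ` (fst c \<inter> fst d). \<forall>v.
        \<omega> c z v = \<omega> d (transition c d z) (deriv (transition c d) z * v))"

definition nonzero_form :: "'a chart set \<Rightarrow> 'a one_form \<Rightarrow> bool" where
  "nonzero_form A \<omega> \<longleftrightarrow> (\<exists>c\<in>A. \<exists>z\<in>chart_image c. \<exists>v. \<omega> c z v \<noteq> 0)"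

definition cnj_form :: "'a one_form \<Rightarrow> 'a one_form" where
  "cnj_form \<omega> = (\<lambda>c z v. cnj (\<omega> c z v))"


definition piecewise_C1_path :: "'a topology \<Rightarrow> 'a chart set \<Rightarrow> (real \<Rightarrow> 'a) \<Rightarrow> bool" where
  "piecewise_C1_path X A \<gamma> \<longleftrightarrow> pathin X \<gamma> \<and>
     (\<forall>c\<in>A. \<forall>r s. 0 \<le> r \<and> s \<le> 1 \<and> \<gamma> ` {r..s} \<subseteq> fst c \<longrightarrow>
        (snd c \<circ> \<gamma>) piecewise_C1_differentiable_on {r..s})"

definition chart_at :: "'a chart set \<Rightarrow> 'a \<Rightarrow> 'a chart" where
  "chart_at A p = (SOME c. c \<in> A \<and> p \<in> fst c)"

text \<open>The integral over \<open>{0..1}\<close> of the form evaluated on the velocity of the path. By the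
  transformation law of forms, the integrand does not depend on the charts chosen, except at the
  finitely many break points of the path.\<close>

definition line_integral :: "'a chart set \<Rightarrow> 'a one_form \<Rightarrow> (real \<Rightarrow> 'a) \<Rightarrow> complex" where
  "line_integral A \<omega> \<gamma> = integral {0..1}
     (\<lambda>t. let c = chart_at A (\<gamma> t) in
          \<omega> c (snd c (\<gamma> t)) (vector_derivative (snd c \<circ> \<gamma>) (at t within {0..1})))"

text \<open>A singular 1-simplex as a path from its vertex 0 to its vertex 1, so that its boundary is the
  end point minus the starting point.\<close>

definition simplex_path :: "((nat \<Rightarrow> real) \<Rightarrow> 'a) \<Rightarrow> real \<Rightarrow> 'a" where
  "simplex_path \<sigma> t = \<sigma> (\<lambda>i. if i = 0 then 1 - t else if i = 1 then t else 0)"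

definition path_simplex :: "(real \<Rightarrow> 'a) \<Rightarrow> (nat \<Rightarrow> real) \<Rightarrow> 'a" where
  "path_simplex \<gamma> = (\<lambda>x\<in>standard_simplex 1. \<gamma> (x 1))"

definition chain_integral :: "'a chart set \<Rightarrow> 'a one_form \<Rightarrow> 'a chain \<Rightarrow> complex" where
  "chain_integral A \<omega> c =
     (\<Sum>\<sigma>\<in>Poly_Mapping.keys c.
        of_int (Poly_Mapping.lookup c \<sigma>) * line_integral A \<omega> (simplex_path \<sigma>))"

text \<open>The elements of the homology group are sets of cycles. The integral of a closed form over a
  class is its integral over any representing cycle built from piecewise \<open>C\<^sup>1\<close> paths.\<close>

definition class_integral ::
    "'a topology \<Rightarrow> 'a chart set \<Rightarrow> 'a chain set \<Rightarrow> 'a one_form \<Rightarrow> complex" where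
  "class_integral X A h \<omega> =
     (THE I. \<exists>c\<in>h. (\<forall>\<sigma>\<in>Poly_Mapping.keys c. piecewise_C1_path X A (simplex_path \<sigma>)) \<and>
                   I = chain_integral A \<omega> c)"


text \<open>Closed curves are functions on the real line with period 1.\<close>

definition C1_loop :: "'a topology \<Rightarrow> 'a chart set \<Rightarrow> (real \<Rightarrow> 'a) \<Rightarrow> bool" where
  "C1_loop X A \<gamma> \<longleftrightarrow> continuous_map euclideanreal X \<gamma> \<and> (\<forall>t. \<gamma> (t + 1) = \<gamma> t) \<and>
     (\<forall>c\<in>A. (snd c \<circ> \<gamma>) C1_differentiable_on {t. \<gamma> t \<in> fst c})"

definition loop_class :: "'a topology \<Rightarrow> (real \<Rightarrow> 'a) \<Rightarrow> 'a chain set" where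
  "loop_class X \<gamma> = homologous_rel_set 1 X {} (frag_of (path_simplex \<gamma>))"

definition crossings :: "(real \<Rightarrow> 'a) \<Rightarrow> (real \<Rightarrow> 'a) \<Rightarrow> (real \<times> real) set" where
  "crossings \<gamma> \<delta> = {(s, t). s \<in> {0..<1} \<and> t \<in> {0..<1} \<and> \<gamma> s = \<delta> t}"

text \<open>The determinant of the pair of velocities \<open>(\<gamma>' s, \<delta>' t)\<close> in a chart around the crossing:
  for complex numbers \<open>v\<close>, \<open>w\<close> the determinant of \<open>(v, w)\<close> is \<open>Im (cnj v * w)\<close>. Its sign does not
  depend on the chart and is positive iff the pair is a positive basis of the tangent space for the
  orientation given by the complex structure.\<close>

definition crossing_det ::
    "'a chart set \<Rightarrow> (real \<Rightarrow> 'a) \<Rightarrow> (real \<Rightarrow> 'a) \<Rightarrow> real \<times> real \<Rightarrow> real" where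
  "crossing_det A \<gamma> \<delta> = (\<lambda>(s, t). let c = chart_at A (\<gamma> s) in
     Im (cnj (vector_derivative (snd c \<circ> \<gamma>) (at s)) * vector_derivative (snd c \<circ> \<delta>) (at t)))"

definition transversal ::
    "'a chart set \<Rightarrow> (real \<Rightarrow> 'a) \<Rightarrow> (real \<Rightarrow> 'a) \<Rightarrow> bool" where
  "transversal A \<gamma> \<delta> \<longleftrightarrow> finite (crossings \<gamma> \<delta>) \<and> (\<forall>p\<in>crossings \<gamma> \<delta>. crossing_det A \<gamma> \<delta> p \<noteq> 0)"

text \<open>The intersection product of two classes is the signed number of crossings of transversal
  closed curves representing them. On a connected surface such curves exist for any two classes,
  and the number is independent of their choice.\<close>

definition has_intersection_product ::
    "'a topology \<Rightarrow> 'a chart set \<Rightarrow> 'a chain set \<Rightarrow> 'a chain set \<Rightarrow> int \<Rightarrow> bool" where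
  "has_intersection_product X A h k n \<longleftrightarrow>
     (\<exists>\<gamma> \<delta>. C1_loop X A \<gamma> \<and> C1_loop X A \<delta> \<and> loop_class X \<gamma> = h \<and> loop_class X \<delta> = k \<and>
        transversal A \<gamma> \<delta> \<and>
        real_of_int n = (\<Sum>p\<in>crossings \<gamma> \<delta>. sgn (crossing_det A \<gamma> \<delta> p)))"


text \<open>A finite family, indexed by \<open>I\<close>, that is a basis of the (multiplicatively written) abelian
  group \<open>G\<close> as a module over the integers.\<close>

definition integer_basis :: "('h, 'm) monoid_scheme \<Rightarrow> 'i set \<Rightarrow> ('i \<Rightarrow> 'h) \<Rightarrow> bool" where
  "integer_basis G I e \<longleftrightarrow> finite I \<and> e \<in> I \<rightarrow> carrier G \<and>
     (\<forall>h\<in>carrier G. \<exists>!m::'i \<Rightarrow> int. m \<in> extensional I \<and>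
        h = finprod G (\<lambda>i. e i [^]\<^bsub>G\<^esub> m i) I)"

definition symplectic_basis ::
    "'a topology \<Rightarrow> 'a chart set \<Rightarrow> nat \<Rightarrow> (nat \<Rightarrow> 'a chain set) \<Rightarrow> (nat \<Rightarrow> 'a chain set) \<Rightarrow> bool" where
  "symplectic_basis X A g a b \<longleftrightarrow>
     integer_basis (homology_group 1 X) ({1..g} <+> {1..g}) (case_sum a b) \<and>
     (\<forall>j\<in>{1..g}. \<forall>k\<in>{1..g}.
        has_intersection_product X A (a j) (a k) 0 \<and>
        has_intersection_product X A (b j) (b k) 0 \<and>
        has_intersection_product X A (a j) (b k) (if j = k then 1 else 0))"

end

theory Submission
  imports Defs "HOL-Complex_Analysis.Complex_Analysis"
begin

text \<open>
  Every closed curve \<open>\<delta>\<close> has a dual closed form \<open>\<eta>\<close>, built without any two-dimensional topology. Cut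
  \<open>\<delta>\<close> into arcs inside coordinate discs; for an arc from \<open>p\<close> to \<open>q\<close> the form \<open>d (\<psi> log ((z - q) / (z - p)))\<close>,
  with \<open>\<psi>\<close> a bump function and the logarithm cut along the arc, extends across the interior of the arc,
  and its poles at \<open>p\<close> and \<open>q\<close> cancel against those of the neighbouring arcs. The Cauchy--Pompeiu formula
  shows that the surface integral of \<open>\<omega> \<and> \<eta>\<close> is a fixed multiple of the integral of \<open>\<omega>\<close> along \<open>\<delta>\<close>, for every closed
  \<open>\<omega>\<close>. The jump of the logarithm across the arc shows that the integral of \<open>\<eta>\<close> along a curve
  transversal to \<open>\<delta>\<close> is \<open>2 \<pi> i\<close> times the signed number of crossings.

  Since the wedge product is antisymmetric, the periods of the forms dual to the curves of a symplectic
  basis form the standard symplectic matrix. Subtracting a combination of these forms from \<open>\<omega>\<close> leaves a form without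
  periods, that is \<open>dh\<close>, and \<open>dh \<and> \<omega>'\<close> integrates to zero when \<open>\<omega>'\<close> is holomorphic or
  antiholomorphic. So the bilinear expression in the periods of \<open>\<omega>\<close> and \<open>\<omega>'\<close> is a positive multiple of
  the integral of \<open>\<omega> \<and> \<omega>'\<close>, which vanishes for two holomorphic forms, while \<open>i \<omega> \<and> cnj \<omega>\<close> is positive.
\<close>

section \<open>Primitives along maps of convex sets\<close>

text \<open>Two weaknesses of the data shape the proof. Homologies consist of merely continuous
  simplices, so integrals are taken through local primitives, which ask for no velocity. And each
  intersection product is witnessed by its own pair of closed curves, so nothing says at the outset
  that one representative of a class serves all products. Dual forms are therefore characterised by
  their pairing with every closed form: by antisymmetry, two forms dual to the same class have equal
  periods over every class that has a dual form itself, and the invariance of the intersection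
  number comes out as a by-product.

  The logarithm is chosen because, in the sense of distributions, the exterior derivative of the
  extended form sits at the two ends of the arc. The pairing with a closed form is then a difference
  of values of a primitive at these ends, without any tubular neighbourhood; the curve may pass
  through itself or pause. The price is a form that is singular at the junctions of the arcs, where
  residues have to cancel and values have to be repaired.\<close>

lemma diff_swap: "a - b = c - d \<longleftrightarrow> a - c = b - (d::'w::ab_group_add)"
  by (auto simp: algebra_simps)

text \<open>\<open>P x\<close> is the sum of \<open>D\<close> over a fine subdivision of the segment from a base point to \<open>x\<close>.\<close>

lemma convex_cocycle_trivial:
  fixes K :: "'v::real_normed_vector set" and D :: "'v \<Rightarrow> 'v \<Rightarrow> 'w::ab_group_add"
  assumes "convex K" "bounded K" "e > 0"
    and D: "\<And>x y z. \<lbrakk>x \<in> K; y \<in> K; z \<in> K; dist x y < e; dist y z < e; dist x z < e\<rbrakk>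
                 \<Longrightarrow> D x y + D y z = D x z"
  shows "\<exists>P. \<forall>x\<in>K. \<forall>y\<in>K. dist x y < e/3 \<longrightarrow> P y - P x = D x y"
proof (cases "K = {}")
  case True
  then show ?thesis by auto
next
  case False
  then obtain x0 where x0: "x0 \<in> K" by auto
  obtain B where B: "\<And>x. x \<in> K \<Longrightarrow> norm (x - x0) \<le> B" "B > 0"
  proof -
    obtain C where "\<And>x. x \<in> K \<Longrightarrow> norm x \<le> C" using \<open>bounded K\<close> by (auto simp: bounded_iff)
    then have "norm (x - x0) \<le> \<bar>C\<bar> + \<bar>C\<bar> + 1" if "x \<in> K" for x
      using norm_triangle_ineq4[of x x0] that x0 by (smt (verit))
    then show ?thesis using that[of "\<bar>C\<bar> + \<bar>C\<bar> + 1"] by auto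
  qed
  \<comment> \<open>Sides shorter than \<open>e/3\<close> keep the diagonals of the quadrilaterals
    below shorter than \<open>2 * e/3\<close>, within the range of the cocycle identity.\<close>
  obtain N :: nat where N: "N > 0" "B / N < e/3"
  proof -
    obtain N where "real N > 3 * B / e" using reals_Archimedean2 by blast
    moreover have "3 * B / e > 0" using B \<open>e > 0\<close> by simp
    moreover have "N > 0" using calculation by (auto intro: Nat.gr0I)
    ultimately have "N > 0" "B / N < e/3"
      using \<open>e>0\<close> B(2) by (auto simp: field_simps)
    then show ?thesis using that by blast
  qed
  define p where "p x k = x0 + (real k / N) *\<^sub>R (x - x0)" for x k
  have pK: "p x k \<in> K" if "x \<in> K" "k \<le> N" for x k
  proof -
    have "p x k = (1 - real k / N) *\<^sub>R x0 + (real k / N) *\<^sub>R x"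
      by (simp add: p_def algebra_simps)
    moreover have "real k / N \<le> 1" "real k / N \<ge> 0" using that N by (auto simp: field_simps)
    ultimately show ?thesis
      using convexD_alt[OF \<open>convex K\<close> x0 that(1), of "real k / N"] by simp
  qed
  have pp: "dist (p x k) (p x (Suc k)) < e/3" if "x \<in> K" for x k
  proof -
    have "p x (Suc k) - p x k = (1 / N) *\<^sub>R (x - x0)"
      by (simp add: p_def algebra_simps add_divide_distrib)
    then have "dist (p x k) (p x (Suc k)) = norm (x - x0) / N"
      by (metis dist_commute dist_norm norm_scaleR abs_of_nonneg of_nat_0_le_iff zero_le_divide_1_iff mult_1 times_divide_eq_left)
    also have "\<dots> \<le> B / N" using B that by (simp add: divide_right_mono)
    finally show ?thesis using N(2) by linarith
  qed
  have pq: "dist (p x k) (p y k) < e/3" if "dist x y < e/3" "k \<le> N" for x y k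
  proof -
    have "p x k - p y k = (real k / N) *\<^sub>R (x - y)" by (simp add: p_def algebra_simps)
    then have "dist (p x k) (p y k) = (real k / N) * dist x y" by (simp add: dist_norm)
    also have "\<dots> \<le> 1 * dist x y" by (rule mult_right_mono) (use that N in \<open>auto simp: field_simps\<close>)
    finally show ?thesis using that by simp
  qed
  have D0: "D x x = 0" if "x \<in> K" for x using D[of x x x] that \<open>e > 0\<close> by simp
  define P where "P x = (\<Sum>k<N. D (p x k) (p x (Suc k)))" for x
  have "P y - P x = D x y" if xy: "x \<in> K" "y \<in> K" "dist x y < e/3" for x y
  proof -
    \<comment> \<open>The four points span a thin quadrilateral. Its diagonal from
      \<open>p x k\<close> to \<open>p y (Suc k)\<close> cuts it into two triangles to which the
      cocycle identity applies; summed over \<open>k\<close>, the sides across the two segments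
      telescope.\<close>
    have "D (p y k) (p y (Suc k)) - D (p x k) (p x (Suc k)) =
          D (p x (Suc k)) (p y (Suc k)) - D (p x k) (p y k)" if "k < N" for k
    proof -
      have in_K: "p x k \<in> K" "p y k \<in> K" "p x (Suc k) \<in> K" "p y (Suc k) \<in> K"
        using pK xy that by auto
      note d = pp[OF xy(1), of k] pp[OF xy(2), of k] pq[OF xy(3), of k] pq[OF xy(3), of "Suc k"]
      have d': "dist (p x k) (p y (Suc k)) < e"
        using d that dist_triangle[of "p x k" "p y (Suc k)" "p y k"] \<open>e > 0\<close> by linarith
      have "D (p x k) (p y k) + D (p y k) (p y (Suc k)) = D (p x k) (p y (Suc k))"
        by (rule D) (use in_K d d' that \<open>e > 0\<close> in auto)
      moreover have "D (p x k) (p x (Suc k)) + D (p x (Suc k)) (p y (Suc k)) = D (p x k) (p y (Suc k))"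
        by (rule D) (use in_K d d' that \<open>e > 0\<close> in auto)
      ultimately show ?thesis by (simp add: algebra_simps)
    qed
    then have "P y - P x = (\<Sum>k<N. D (p x (Suc k)) (p y (Suc k)) - D (p x k) (p y k))"
      by (simp add: P_def sum_subtractf [symmetric])
    also have "\<dots> = D (p x N) (p y N) - D (p x 0) (p y 0)"
      by (rule sum_lessThan_telescope)
    also have "\<dots> = D x y" using N D0[OF x0] by (simp add: p_def)
    finally show ?thesis .
  qed
  then show ?thesis by blast
qed

section \<open>Charts as local coordinates\<close>

definition pt :: "'a chart \<Rightarrow> complex \<Rightarrow> 'a" where
  "pt c = inv_into (fst c) (snd c)"

context riemann_surface
begin

lemma chart_subset: "c \<in> A \<Longrightarrow> fst c \<subseteq> topspace X"
  using charts_cover by auto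

lemma chart_inj: "c \<in> A \<Longrightarrow> inj_on (snd c) (fst c)"
  using chart_homeomorphic[of c] chart_subset[of c]
  by (auto dest!: homeomorphic_imp_injective_map simp: Int_absorb1)

lemma pt_snd [simp]: "c \<in> A \<Longrightarrow> x \<in> fst c \<Longrightarrow> pt c (snd c x) = x"
  by (simp add: pt_def chart_inj)

lemma snd_pt [simp]: "z \<in> chart_image c \<Longrightarrow> snd c (pt c z) = z"
  by (simp add: pt_def chart_image_def f_inv_into_f)

lemma pt_in [simp]: "z \<in> chart_image c \<Longrightarrow> pt c z \<in> fst c"
  by (simp add: pt_def chart_image_def inv_into_into)

lemma snd_in [simp]: "x \<in> fst c \<Longrightarrow> snd c x \<in> chart_image c"
  by (simp add: chart_image_def)

lemma continuous_snd: "c \<in> A \<Longrightarrow> continuous_map (subtopology X (fst c)) euclidean (snd c)"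
  using homeomorphic_imp_continuous_map[OF chart_homeomorphic] continuous_map_into_fulltopology by blast

lemma continuous_pt: "c \<in> A \<Longrightarrow> continuous_map (top_of_set (chart_image c)) X (pt c)"
proof -
  assume c: "c \<in> A"
  obtain g where g: "homeomorphic_maps (subtopology X (fst c)) (top_of_set (chart_image c)) (snd c) g"
    using chart_homeomorphic[OF c] homeomorphic_map_maps by blast
  then have "continuous_map (top_of_set (chart_image c)) X g"
    by (auto simp: homeomorphic_maps_def continuous_map_in_subtopology)
  moreover have "g z = pt c z" if "z \<in> chart_image c" for z
  proof -
    have gz: "g z \<in> fst c" "snd c (g z) = z"
      using g that chart_subset[OF c] by (auto simp: homeomorphic_maps_def continuous_map_def)
    then show ?thesis using pt_snd[OF c gz(1)] by simp
  qed
  ultimately show "continuous_map (top_of_set (chart_image c)) X (pt c)"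
    using continuous_map_eq[of "top_of_set (chart_image c)" X g "pt c"] by simp
qed

lemma open_chart:
  assumes "c \<in> A" "openin X U"
  shows "open (snd c ` (U \<inter> fst c))"
proof -
  have "openin (subtopology X (fst c)) (U \<inter> fst c)"
    using assms by (simp add: openin_subtopology_Int)
  then have "openin (top_of_set (chart_image c)) (snd c ` (U \<inter> fst c))"
    using homeomorphic_imp_open_map[OF chart_homeomorphic[OF assms(1)]] by (simp add: open_map_def)
  then show ?thesis using chart_image_open[OF assms(1)] openin_open_eq by blast
qed

lemma open_preimage:
  assumes "c \<in> A" "open S"
  shows "openin X {x \<in> fst c. snd c x \<in> S}"
proof -
  have "openin (subtopology X (fst c)) {x \<in> topspace (subtopology X (fst c)). snd c x \<in> S}"
    using continuous_snd[OF assms(1)] assms(2) by (simp add: continuous_map_def)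
  also have "topspace (subtopology X (fst c)) = fst c" using chart_subset[OF assms(1)] by auto
  finally show ?thesis using chart_open[OF assms(1)] openin_trans_full by blast
qed

lemma point_chart: "x \<in> topspace X \<Longrightarrow> \<exists>c\<in>A. x \<in> fst c"
  using charts_cover by auto

lemma chart_at:
  assumes "x \<in> topspace X" shows "chart_at A x \<in> A" "x \<in> fst (chart_at A x)"
  unfolding chart_at_def atomize_conj using someI_ex[of "\<lambda>c. c \<in> A \<and> x \<in> fst c"] point_chart[OF assms]
  by blast

text \<open>Moves local questions on the surface to a disc in the plane, where convexity and
  connectedness are at hand.\<close>

lemma chart_ball:
  assumes "c \<in> A" "openin X U" "x \<in> U" "x \<in> fst c"
  obtains e where "e > 0" "ball (snd c x) e \<subseteq> snd c ` (U \<inter> fst c)"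
     "\<And>z. z \<in> ball (snd c x) e \<Longrightarrow> z \<in> chart_image c \<and> pt c z \<in> U"
proof -
  obtain e where e: "e > 0" "ball (snd c x) e \<subseteq> snd c ` (U \<inter> fst c)"
    using openE[OF open_chart[OF assms(1,2)], of "snd c x"] assms(3,4) by blast
  moreover have "z \<in> chart_image c \<and> pt c z \<in> U" if z: "z \<in> ball (snd c x) e" for z
  proof -
    obtain y where "y \<in> U" "y \<in> fst c" "z = snd c y" using subsetD[OF e(2) z] by (auto simp: image_iff)
    then show ?thesis using assms(1) by simp
  qed
  ultimately show ?thesis using that by blast
qed

lemma transition_eq: "transition c d z = snd d (pt c z)"
  by (simp add: transition_def pt_def)

lemma open_overlap: "c \<in> A \<Longrightarrow> d \<in> A \<Longrightarrow> open (snd c ` (fst c \<inter> fst d))"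
  using open_chart[of c "fst d"] chart_open by (simp add: Int_commute)

lemma transition_deriv:
  assumes "c \<in> A" "d \<in> A" "x \<in> fst c" "x \<in> fst d"
  shows "(transition c d has_field_derivative deriv (transition c d) (snd c x)) (at (snd c x))"
  using holomorphic_derivI[OF transition_holomorphic[OF assms(1,2)] open_overlap[OF assms(1,2)]] assms
  by blast

text \<open>The chain rule for a function that is only real differentiable: the transition
  contributes multiplication by its complex derivative, which is the transformation law of a
  one-form.\<close>

lemma has_derivative_change_chart:
  assumes "c \<in> A" "d \<in> A" "x \<in> fst c" "x \<in> fst d"
    and F: "((\<lambda>z. F (pt d z)) has_derivative f') (at (snd d x))"
  shows "((\<lambda>z. F (pt c z)) has_derivative (\<lambda>v. f' (deriv (transition c d) (snd c x) * v))) (at (snd c x))"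
proof -
  have "((\<lambda>z. F (pt d (transition c d z))) has_derivative (\<lambda>v. f' (deriv (transition c d) (snd c x) * v))) (at (snd c x))"
    using has_derivative_compose[OF transition_deriv[OF assms(1-4), unfolded has_field_derivative_def],
        of "\<lambda>z. F (pt d z)" f'] F
    by (simp add: transition_eq assms)
  then show ?thesis
  proof (rule has_derivative_transform_within_open)
    show "open (snd c ` (fst c \<inter> fst d))" using open_overlap assms by blast
    show "snd c x \<in> snd c ` (fst c \<inter> fst d)" using assms by blast
    show "F (pt d (transition c d y)) = F (pt c y)" if "y \<in> snd c ` (fst c \<inter> fst d)" for y
      using that assms by (auto simp: transition_eq)
  qed
qed

section \<open>Primitives of one-forms on open sets\<close>

text \<open>\<open>prim \<omega> U F\<close> says that \<open>\<omega> = dF\<close> on the open set \<open>U\<close>. As nothing but this is ever required, a closed form is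
  defined below as a continuous form with local primitives, and need not be differentiable.\<close>

definition prim :: "'a one_form \<Rightarrow> 'a set \<Rightarrow> ('a \<Rightarrow> complex) \<Rightarrow> bool" where
  "prim \<omega> U F \<longleftrightarrow> openin X U \<and>
     (\<forall>c\<in>A. \<forall>x\<in>U \<inter> fst c. ((\<lambda>z. F (pt c z)) has_derivative \<omega> c (snd c x)) (at (snd c x)))"

definition locally_exact :: "'a one_form \<Rightarrow> bool" where
  "locally_exact \<omega> \<longleftrightarrow> (\<forall>x\<in>topspace X. \<exists>U F. x \<in> U \<and> prim \<omega> U F)"

lemma primD:
  "prim \<omega> U F \<Longrightarrow> c \<in> A \<Longrightarrow> x \<in> U \<Longrightarrow> x \<in> fst c
    \<Longrightarrow> ((\<lambda>z. F (pt c z)) has_derivative \<omega> c (snd c x)) (at (snd c x))"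
  by (simp add: prim_def)

lemma primD':
  "prim \<omega> U F \<Longrightarrow> c \<in> A \<Longrightarrow> z \<in> chart_image c \<Longrightarrow> pt c z \<in> U
    \<Longrightarrow> ((\<lambda>z. F (pt c z)) has_derivative \<omega> c z) (at z)"
  using primD[of \<omega> U F c "pt c z"] by simp

text \<open>In one chart both primitives have the same derivative on a disc, so their difference is
  constant there.\<close>

lemma prim_locally_const:
  assumes "prim \<omega> U F" "prim \<omega> V G" "x \<in> U" "x \<in> V"
  shows "\<exists>W. openin X W \<and> x \<in> W \<and> (\<forall>y\<in>W. F y - G y = F x - G x)"
proof -
  have o: "openin X (U \<inter> V)" using assms by (auto simp: prim_def)
  have "x \<in> topspace X" using assms openin_subset by (auto simp: prim_def)
  then obtain c where c: "c \<in> A" "x \<in> fst c" using point_chart by blast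
  obtain e where e: "e > 0" "\<And>z. z \<in> ball (snd c x) e \<Longrightarrow> z \<in> chart_image c \<and> pt c z \<in> U \<inter> V"
    using chart_ball[OF c(1) o _ c(2)] assms(3,4) by (metis IntI)
  define W where "W = {y \<in> fst c. snd c y \<in> ball (snd c x) e}"
  have 1: "((\<lambda>z. F (pt c z) - G (pt c z)) has_derivative (\<lambda>h. 0)) (at z)" if "z \<in> ball (snd c x) e" for z
  proof -
    have "((\<lambda>z. F (pt c z)) has_derivative \<omega> c z) (at z)"  "((\<lambda>z. G (pt c z)) has_derivative \<omega> c z) (at z)"
      using primD'[OF assms(1) c(1)] primD'[OF assms(2) c(1)] e(2)[OF that] by blast+
    from has_derivative_diff[OF this] show ?thesis by simp
  qed
  have "F y - G y = F x - G x" if "y \<in> W" for y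
    using has_derivative_zero_unique_connected[of "ball (snd c x) e" "\<lambda>z. F (pt c z) - G (pt c z)" "snd c y" "snd c x"]
      1 that e(1) c by (simp add: W_def)
  moreover have "openin X W" unfolding W_def by (rule open_preimage[OF c(1)]) simp
  moreover have "x \<in> W" using c e by (simp add: W_def)
  ultimately show ?thesis by blast
qed

section \<open>Primitives along continuous maps\<close>

text \<open>A primitive of the pullback of \<open>\<omega>\<close> along a merely continuous map \<open>\<gamma>\<close>; for \<open>K\<close> a triangle this shows
  that integrals over boundaries vanish.\<close>

definition pathprim :: "'a one_form \<Rightarrow> 'v::metric_space set \<Rightarrow> ('v \<Rightarrow> 'a) \<Rightarrow> ('v \<Rightarrow> complex) \<Rightarrow> bool" where
  "pathprim \<omega> K \<gamma> P \<longleftrightarrow> continuous_map (top_of_set K) X \<gamma> \<and> (\<forall>x\<in>K. \<forall>U F. prim \<omega> U F \<and> \<gamma> x \<in> U \<longrightarrow>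
     (\<exists>e>0. \<forall>y\<in>K. dist y x < e \<longrightarrow> P y - P x = F (\<gamma> y) - F (\<gamma> x)))"

lemma continuous_map_nbhd:
  fixes K :: "'v::metric_space set"
  assumes "continuous_map (top_of_set K) X \<gamma>" "openin X U" "x \<in> K" "\<gamma> x \<in> U"
  shows "\<exists>e>0. \<forall>y\<in>K. dist y x < e \<longrightarrow> \<gamma> y \<in> U"
proof -
  have "openin (top_of_set K) {y \<in> K. \<gamma> y \<in> U}"
    using assms(1,2) by (simp add: continuous_map_def)
  then show ?thesis
    unfolding openin_euclidean_subtopology_iff using assms(3,4) by blast
qed

lemma pathprimD:
  "pathprim \<omega> K \<gamma> P \<Longrightarrow> x \<in> K \<Longrightarrow> prim \<omega> U F \<Longrightarrow> \<gamma> x \<in> U \<Longrightarrow>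
     \<exists>e>0. \<forall>y\<in>K. dist y x < e \<longrightarrow> P y - P x = F (\<gamma> y) - F (\<gamma> x)"
  unfolding pathprim_def by simp

text \<open>The definition quantifies over all local primitives at a point; one suffices, because
  any two of them differ by a constant near the point.\<close>

lemma pathprimI:
  assumes "continuous_map (top_of_set K) X \<gamma>"
    and "\<And>x. x \<in> K \<Longrightarrow> \<exists>U F e. prim \<omega> U F \<and> \<gamma> x \<in> U \<and> e > 0 \<and>
        (\<forall>y\<in>K. dist y x < e \<longrightarrow> P y - P x = F (\<gamma> y) - F (\<gamma> x))"
  shows "pathprim \<omega> K \<gamma> P"
  unfolding pathprim_def
proof (intro conjI ballI allI impI assms(1))
  fix x V G assume x: "x \<in> K" and V: "prim \<omega> V G \<and> \<gamma> x \<in> V"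
  obtain U F e where U: "prim \<omega> U F" "\<gamma> x \<in> U" "e > 0"
        "\<And>y. y \<in> K \<Longrightarrow> dist y x < e \<Longrightarrow> P y - P x = F (\<gamma> y) - F (\<gamma> x)"
    using assms(2)[OF x] by blast
  obtain W where W: "openin X W" "\<gamma> x \<in> W" "\<And>y. y \<in> W \<Longrightarrow> F y - G y = F (\<gamma> x) - G (\<gamma> x)"
    using prim_locally_const[of \<omega> U F V G "\<gamma> x"] U V by blast
  obtain e' where e': "e' > 0" "\<And>y. y \<in> K \<Longrightarrow> dist y x < e' \<Longrightarrow> \<gamma> y \<in> W"
    using continuous_map_nbhd[OF assms(1) W(1) x W(2)] by blast
  have "P y - P x = G (\<gamma> y) - G (\<gamma> x)" if "y \<in> K" "dist y x < min e e'" for y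
  proof -
    have "F (\<gamma> y) - G (\<gamma> y) = F (\<gamma> x) - G (\<gamma> x)" using W(3) e'(2) that by auto
    moreover have "P y - P x = F (\<gamma> y) - F (\<gamma> x)" using U(4)[of y] that by simp
    ultimately show ?thesis by (metis diff_swap)
  qed
  then show "\<exists>e>0. \<forall>y\<in>K. dist y x < e \<longrightarrow> P y - P x = G (\<gamma> y) - G (\<gamma> x)"
    using U(3) e'(1) by (intro exI[of _ "min e e'"]) auto
qed

text \<open>The increments \<open>D x y\<close> of local primitives over short distances satisfy the
  cocycle identity, and on a bounded convex set such a cocycle is a coboundary. It is applied to
  intervals, to the triangle and to coordinate discs.\<close>

lemma pathprim_exists:
  fixes K :: "'v::real_normed_vector set"
  assumes "locally_exact \<omega>" "compact K" "convex K" and cont: "continuous_map (top_of_set K) X \<gamma>"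
  obtains P where "pathprim \<omega> K \<gamma> P"
proof -
  have top: "\<gamma> x \<in> topspace X" if "x \<in> K" for x
    using cont that by (auto simp: continuous_map_def)
  \<comment> \<open>The cover whose Lebesgue number \<open>e\<close> gives every ball of radius
    \<open>e\<close> around a point of \<open>K\<close> a single local primitive.\<close>
  define \<G> where "\<G> = {G. open G \<and> (\<exists>U F. prim \<omega> U F \<and> \<gamma> ` (K \<inter> G) \<subseteq> U)}"
  obtain e where e: "e > 0" "\<And>x. x \<in> K \<Longrightarrow> \<exists>G \<in> \<G>. ball x e \<subseteq> G"
  proof (rule Heine_Borel_lemma[OF \<open>compact K\<close>, of \<G>])
    show "K \<subseteq> \<Union>\<G>"
    proof
      fix x assume x: "x \<in> K"
      obtain U F where U: "\<gamma> x \<in> U" "prim \<omega> U F" using assms(1) top[OF x] by (auto simp: locally_exact_def)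
      then have oU: "openin X U" by (simp add: prim_def)
      obtain d where d: "d > 0" "\<forall>y\<in>K. dist y x < d \<longrightarrow> \<gamma> y \<in> U"
        using continuous_map_nbhd[OF cont oU x U(1)] by auto
      have "\<gamma> ` (K \<inter> ball x d) \<subseteq> U" using d(2) by (auto simp: dist_commute)
      then have "ball x d \<in> \<G>" "x \<in> ball x d" using U(2) d(1) by (auto simp: \<G>_def)
      then show "x \<in> \<Union>\<G>" by blast
    qed
  qed (auto simp: \<G>_def)
  have "\<forall>x\<in>K. \<exists>UF. prim \<omega> (fst UF) (snd UF) \<and> \<gamma> ` (K \<inter> ball x e) \<subseteq> fst UF"
  proof
    fix x assume "x \<in> K"
    then obtain G where G: "G \<in> \<G>" "ball x e \<subseteq> G" using e(2)[of x] by auto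
    then obtain U F where U: "prim \<omega> U F" "\<gamma> ` (K \<inter> G) \<subseteq> U" unfolding \<G>_def by auto
    have "\<gamma> ` (K \<inter> ball x e) \<subseteq> U" using U(2) G(2) by auto
    then show "\<exists>UF. prim \<omega> (fst UF) (snd UF) \<and> \<gamma> ` (K \<inter> ball x e) \<subseteq> fst UF"
      using U(1) by (intro exI[of _ "(U, F)"]) simp
  qed
  from bchoice[OF this] obtain UF where UF0:
    "\<forall>x\<in>K. prim \<omega> (fst (UF x)) (snd (UF x)) \<and> \<gamma> ` (K \<inter> ball x e) \<subseteq> fst (UF x)" by blast
  define U F where "U x = fst (UF x)" and "F x = snd (UF x)" for x
  have UF: "\<And>x. x \<in> K \<Longrightarrow> prim \<omega> (U x) (F x)" "\<And>x. x \<in> K \<Longrightarrow> \<gamma> ` (K \<inter> ball x e) \<subseteq> U x"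
    using UF0 by (auto simp: U_def F_def)
  define D where "D x y = F x (\<gamma> y) - F x (\<gamma> x)" for x y
  have coc: "D x y + D y z = D x z"
    if xyz: "x \<in> K" "y \<in> K" "z \<in> K" "dist x y < e" "dist y z < e" "dist x z < e" for x y z
  proof -
    \<comment> \<open>The overlap of the two domains of primitives may be disconnected, but the part
      of \<open>K\<close> in both balls is convex; there the difference of the two primitives is
      constant.\<close>
    let ?S = "K \<inter> ball x e \<inter> ball y e"
    have "F x (\<gamma> z) - F y (\<gamma> z) = F x (\<gamma> y) - F y (\<gamma> y)"
    proof (rule connected_local_const[where A = ?S and f = "\<lambda>w. F x (\<gamma> w) - F y (\<gamma> w)"])
      show "connected ?S" by (intro convex_connected convex_Int convex_ball \<open>convex K\<close>)
      show "\<forall>a\<in>?S. \<forall>\<^sub>F b in at a within ?S. F x (\<gamma> a) - F y (\<gamma> a) = F x (\<gamma> b) - F y (\<gamma> b)"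
      proof
        fix a assume a: "a \<in> ?S"
        have "\<gamma> a \<in> U x" "\<gamma> a \<in> U y" using UF(2)[OF xyz(1)] UF(2)[OF xyz(2)] a by auto
        obtain W where W: "openin X W" "\<gamma> a \<in> W" "\<forall>w\<in>W. F x w - F y w = F x (\<gamma> a) - F y (\<gamma> a)"
          using prim_locally_const[OF UF(1)[OF xyz(1)] UF(1)[OF xyz(2)] \<open>\<gamma> a \<in> U x\<close> \<open>\<gamma> a \<in> U y\<close>] by auto
        have "a \<in> K" using a by simp
        then obtain d where d: "d > 0" "\<forall>w\<in>K. dist w a < d \<longrightarrow> \<gamma> w \<in> W"
          using continuous_map_nbhd[OF cont W(1) _ W(2)] by auto
        have "F x (\<gamma> a) - F y (\<gamma> a) = F x (\<gamma> b) - F y (\<gamma> b)" if "b \<in> ?S" "dist b a < d" for b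
          using d(2) W(3) that by simp
        then show "\<forall>\<^sub>F b in at a within ?S. F x (\<gamma> a) - F y (\<gamma> a) = F x (\<gamma> b) - F y (\<gamma> b)"
          unfolding eventually_at using d(1) by (intro exI[of _ d]) simp
      qed
    qed (use xyz e in \<open>auto simp: dist_commute\<close>)
    then have "F y (\<gamma> z) - F y (\<gamma> y) = F x (\<gamma> z) - F x (\<gamma> y)" by (metis diff_swap)
    then show "D x y + D y z = D x z" by (simp add: D_def)
  qed
  have "\<exists>P. \<forall>x\<in>K. \<forall>y\<in>K. dist x y < e/3 \<longrightarrow> P y - P x = D x y"
    by (rule convex_cocycle_trivial[OF \<open>convex K\<close> compact_imp_bounded[OF \<open>compact K\<close>] e(1)]) (rule coc)
  then obtain P where P: "\<And>x y. \<lbrakk>x \<in> K; y \<in> K; dist x y < e/3\<rbrakk> \<Longrightarrow> P y - P x = D x y"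
    by metis
  have "pathprim \<omega> K \<gamma> P"
  proof (rule pathprimI[OF cont])
    fix x assume x: "x \<in> K"
    have "\<gamma> x \<in> U x" using UF(2)[OF x] x e(1) by force
    moreover have "\<forall>y\<in>K. dist y x < e/3 \<longrightarrow> P y - P x = F x (\<gamma> y) - F x (\<gamma> x)"
      using P[OF x] by (auto simp: D_def dist_commute)
    ultimately show "\<exists>U F e. prim \<omega> U F \<and> \<gamma> x \<in> U \<and> e > 0 \<and>
        (\<forall>y\<in>K. dist y x < e \<longrightarrow> P y - P x = F (\<gamma> y) - F (\<gamma> x))"
      using UF(1)[OF x] e(1) by (intro exI[of _ "U x"] exI[of _ "F x"] exI[of _ "e/3"]) auto
  qed
  then show ?thesis using that by blast
qed

lemma pathprim_unique:
  fixes K :: "'v::real_normed_vector set"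
  assumes "locally_exact \<omega>" "connected K" "pathprim \<omega> K \<gamma> P" "pathprim \<omega> K \<gamma> Q" "x \<in> K" "y \<in> K"
  shows "P y - P x = Q y - Q x"
proof -
  have "P y - Q y = P x - Q x"
  proof (rule connected_local_const[where A = K and f = "\<lambda>w. P w - Q w"])
    show "\<forall>a\<in>K. \<forall>\<^sub>F b in at a within K. P a - Q a = P b - Q b"
    proof
      fix a assume a: "a \<in> K"
      then have "\<gamma> a \<in> topspace X" using assms(3) by (auto simp: pathprim_def continuous_map_def)
      then obtain U F where U: "\<gamma> a \<in> U" "prim \<omega> U F" using assms(1) by (auto simp: locally_exact_def)
      obtain d where d: "d > 0" "\<forall>y\<in>K. dist y a < d \<longrightarrow> P y - P a = F (\<gamma> y) - F (\<gamma> a)"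
        using pathprimD[OF assms(3) a U(2,1)] by auto
      obtain d' where d': "d' > 0" "\<forall>y\<in>K. dist y a < d' \<longrightarrow> Q y - Q a = F (\<gamma> y) - F (\<gamma> a)"
        using pathprimD[OF assms(4) a U(2,1)] by auto
      have "P a - Q a = P b - Q b" if "b \<in> K" "dist b a < min d d'" for b
      proof -
        have "P b - P a = Q b - Q a" using d(2) d'(2) that by simp
        then show ?thesis by (metis diff_swap)
      qed
      then show "\<forall>\<^sub>F b in at a within K. P a - Q a = P b - Q b"
        unfolding eventually_at using d(1) d'(1) by (intro exI[of _ "min d d'"]) auto
    qed
  qed (use assms in auto)
  then show ?thesis by (metis diff_swap)
qed

lemma pathprim_compose:
  assumes "pathprim \<omega> K \<gamma> P" "continuous_on L h" "h ` L \<subseteq> K"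
  shows "pathprim \<omega> L (\<lambda>t. \<gamma> (h t)) (\<lambda>t. P (h t))"
  unfolding pathprim_def
proof (intro conjI ballI allI impI)
  show "continuous_map (top_of_set L) X (\<lambda>t. \<gamma> (h t))"
    using continuous_map_compose[of "top_of_set L" "top_of_set K" h X \<gamma>] assms
    by (auto simp: pathprim_def o_def continuous_map_in_subtopology)
  fix x U F assume x: "x \<in> L" and U: "prim \<omega> U F \<and> \<gamma> (h x) \<in> U"
  have "h x \<in> K" using x assms(3) by auto
  then obtain e where e: "e > 0" "\<forall>y\<in>K. dist y (h x) < e \<longrightarrow> P y - P (h x) = F (\<gamma> y) - F (\<gamma> (h x))"
    using pathprimD[OF assms(1)] U by metis
  obtain d where d: "d > 0" "\<forall>y\<in>L. dist y x < d \<longrightarrow> dist (h y) (h x) < e"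
    using assms(2) x e(1) unfolding continuous_on_iff by metis
  have "P (h y) - P (h x) = F (\<gamma> (h y)) - F (\<gamma> (h x))" if "y \<in> L" "dist y x < d" for y
    using e(2) d(2) that assms(3) by auto
  then show "\<exists>e>0. \<forall>y\<in>L. dist y x < e \<longrightarrow> P (h y) - P (h x) = F (\<gamma> (h y)) - F (\<gamma> (h x))"
    using d(1) by (intro exI[of _ d]) auto
qed

lemma pathprim_cong:
  assumes "pathprim \<omega> K \<gamma> P" "\<And>x. x \<in> K \<Longrightarrow> \<delta> x = \<gamma> x"
  shows "pathprim \<omega> K \<delta> P"
proof -
  have "continuous_map (top_of_set K) X \<delta>"
    using assms by (auto simp: pathprim_def intro: continuous_map_eq[of _ _ \<gamma>])
  then show ?thesis using assms by (simp add: pathprim_def)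
qed

lemma has_vector_derivative_change:
  assumes c: "c \<in> A" "\<gamma> t \<in> fst c" and t: "t \<in> S"
    and cont: "continuous_map (top_of_set S) X \<gamma>"
    and w: "((snd c \<circ> \<gamma>) has_vector_derivative w) (at t within S)"
    and F: "((\<lambda>z. F (pt c z)) has_derivative f') (at (snd c (\<gamma> t)))"
  shows "((\<lambda>s. F (\<gamma> s)) has_vector_derivative f' w) (at t within S)"
proof -
  have "((\<lambda>s. F (pt c ((snd c \<circ> \<gamma>) s))) has_derivative (\<lambda>h. f' (h *\<^sub>R w))) (at t within S)"
    using has_derivative_compose[OF w[unfolded has_vector_derivative_def]] F by auto
  then have 1: "((\<lambda>s. F (pt c ((snd c \<circ> \<gamma>) s))) has_vector_derivative f' w) (at t within S)"
    using linear_cmul[OF has_derivative_linear[OF F]] by (simp add: has_vector_derivative_def)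
  obtain e where e: "e > 0" "\<forall>y\<in>S. dist y t < e \<longrightarrow> \<gamma> y \<in> fst c"
    using continuous_map_nbhd[OF cont chart_open[OF c(1)] t c(2)] by auto
  show ?thesis
    by (rule has_vector_derivative_transform_within[OF 1 e(1) t]) (use e(2) c in \<open>auto simp: dist_commute\<close>)
qed

lemma velocity_change_chart:
  assumes "c \<in> A" "d \<in> A" "\<gamma> t \<in> fst c" "\<gamma> t \<in> fst d" "t \<in> S"
    and "continuous_map (top_of_set S) X \<gamma>"
    and "((snd c \<circ> \<gamma>) has_vector_derivative w) (at t within S)"
  shows "((snd d \<circ> \<gamma>) has_vector_derivative deriv (transition c d) (snd c (\<gamma> t)) * w) (at t within S)"
proof -
  have "((\<lambda>z. snd d (pt c z)) has_derivative (\<lambda>v. deriv (transition c d) (snd c (\<gamma> t)) * v)) (at (snd c (\<gamma> t)))"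
    using transition_deriv[OF assms(1-4)] unfolding has_field_derivative_def transition_eq[abs_def] by simp
  from has_vector_derivative_change[OF assms(1,3,5,6,7) this] show ?thesis by (simp add: o_def)
qed

text \<open>Links primitives along a curve with the integrand of \<open>line_integral\<close>:
  wherever the curve has a velocity, the chain rule differentiates the local primitive.\<close>

lemma pathprim_has_vector_derivative:
  assumes "locally_exact \<omega>" "pathprim \<omega> S \<gamma> P" "c \<in> A" "\<gamma> t \<in> fst c" "t \<in> S"
    and w: "((snd c \<circ> \<gamma>) has_vector_derivative w) (at t within S)"
  shows "(P has_vector_derivative \<omega> c (snd c (\<gamma> t)) w) (at t within S)"
proof -
  have cont: "continuous_map (top_of_set S) X \<gamma>" using assms by (simp add: pathprim_def)
  have "\<gamma> t \<in> topspace X" using chart_subset[OF assms(3)] assms(4) by blast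
  then obtain U F where U: "\<gamma> t \<in> U" "prim \<omega> U F"
    using assms(1) unfolding locally_exact_def by metis
  obtain e where e: "e > 0" "\<forall>y\<in>S. dist y t < e \<longrightarrow> P y - P t = F (\<gamma> y) - F (\<gamma> t)"
    using pathprimD[OF assms(2,5) U(2,1)] by auto
  have "((\<lambda>s. F (\<gamma> s)) has_vector_derivative \<omega> c (snd c (\<gamma> t)) w) (at t within S)"
    by (rule has_vector_derivative_change[OF assms(3,4,5) cont w]) (use U assms in \<open>auto simp: prim_def\<close>)
  then have "((\<lambda>s. F (\<gamma> s) + (P t - F (\<gamma> t))) has_vector_derivative \<omega> c (snd c (\<gamma> t)) w) (at t within S)"
    by (rule has_vector_derivative_add_const[THEN iffD2])
  then show ?thesis
    by (rule has_vector_derivative_transform_within[OF _ e(1) assms(5)])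
       (use e(2) in \<open>force simp: dist_commute algebra_simps\<close>)
qed

lemma prim_continuous:
  assumes "prim \<omega> U F" shows "continuous_map (subtopology X U) euclidean F"
proof -
  have U: "openin X U" using assms by (simp add: prim_def)
  have "\<exists>V. openin X V \<and> x \<in> V \<and> V \<subseteq> {x \<in> U. F x \<in> T}" if T: "open T" and xU: "x \<in> U" and FT: "F x \<in> T" for T x
  proof -
    have "x \<in> topspace X" using openin_subset[OF U] xU by blast
    then obtain c where c: "c \<in> A" "x \<in> fst c" using point_chart by blast
    obtain e where e: "e > 0" "\<And>z. z \<in> ball (snd c x) e \<Longrightarrow> z \<in> chart_image c \<and> pt c z \<in> U"
      using chart_ball[OF c(1) U xU c(2)] by metis
    have "continuous (at (snd c x)) (\<lambda>z. F (pt c z))"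
      using has_derivative_continuous[OF primD[OF assms c(1) xU c(2)]] .
    moreover have "F (pt c (snd c x)) \<in> T" using FT c by simp
    ultimately have "\<forall>\<^sub>F z in nhds (snd c x). F (pt c z) \<in> T"
      using \<open>open T\<close> topological_tendstoD[of "\<lambda>z. F (pt c z)" "F (pt c (snd c x))" "nhds (snd c x)" T]
      tendsto_at_iff_tendsto_nhds[of "\<lambda>z. F (pt c z)" "snd c x"]
      unfolding isCont_def by simp
    then obtain d where d: "d > 0" "\<And>z. dist z (snd c x) < d \<Longrightarrow> F (pt c z) \<in> T"
      unfolding eventually_nhds_metric by metis
    let ?V = "{y \<in> fst c. snd c y \<in> ball (snd c x) (min d e)}"
    have "openin X ?V" by (rule open_preimage[OF c(1)]) simp
    moreover have "x \<in> ?V" using c d e by simp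
    moreover have "?V \<subseteq> {x \<in> U. F x \<in> T}"
    proof
      fix y assume y: "y \<in> ?V"
      then have "y \<in> fst c" by simp
      then have "pt c (snd c y) = y" using c by simp
      then show "y \<in> {x \<in> U. F x \<in> T}" using d(2)[of "snd c y"] e(2)[of "snd c y"] y by (auto simp: dist_commute)
    qed
    ultimately show ?thesis by blast
  qed
  then have "openin X {x \<in> U. F x \<in> T}" if "open T" for T
    unfolding openin_subopen[of X "{x \<in> U. F x \<in> T}"] using that by simp
  then show ?thesis
    using U openin_subset[OF U] by (auto simp: continuous_map_def openin_open_subtopology Int_absorb1)
qed

text \<open>Bridges the break points of a curve, where the primitive may fail to have a derivative,
  in the fundamental theorem of calculus.\<close>

lemma pathprim_continuous:
  assumes "locally_exact \<omega>" "pathprim \<omega> S \<gamma> P"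
  shows "continuous_on S P"
  unfolding continuous_on_eq_continuous_within
proof
  fix t assume t: "t \<in> S"
  have cont: "continuous_map (top_of_set S) X \<gamma>" using assms by (simp add: pathprim_def)
  then have "\<gamma> t \<in> topspace X" using t by (auto simp: continuous_map_def)
  then obtain U F where U: "\<gamma> t \<in> U" "prim \<omega> U F" using assms(1) by (auto simp: locally_exact_def)
  then obtain e where e: "e > 0" "\<forall>y\<in>S. dist y t < e \<longrightarrow> P y - P t = F (\<gamma> y) - F (\<gamma> t)"
    using pathprimD[OF assms(2) t] by metis
  show "continuous (at t within S) P"
    unfolding continuous_within_eps_delta
  proof (intro allI impI)
    fix r :: real assume r: "r > 0"
    have "openin (subtopology X U) {x \<in> topspace (subtopology X U). F x \<in> ball (F (\<gamma> t)) r}"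
      using openin_continuous_map_preimage[OF prim_continuous[OF U(2)], of "ball (F (\<gamma> t)) r"] by simp
    then have "openin X {x \<in> topspace (subtopology X U). F x \<in> ball (F (\<gamma> t)) r}"
      using U(2) openin_trans_full unfolding prim_def by blast
    moreover have "\<gamma> t \<in> {x \<in> topspace (subtopology X U). F x \<in> ball (F (\<gamma> t)) r}"
      using U(1) r \<open>\<gamma> t \<in> topspace X\<close> by simp
    ultimately have "\<exists>d>0. \<forall>y\<in>S. dist y t < d \<longrightarrow> \<gamma> y \<in> {x \<in> topspace (subtopology X U). F x \<in> ball (F (\<gamma> t)) r}"
      by (rule continuous_map_nbhd[OF cont _ t])
    then obtain d where d: "d > 0" "\<forall>y\<in>S. dist y t < d \<longrightarrow> F (\<gamma> y) \<in> ball (F (\<gamma> t)) r" by auto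
    have "dist (P y) (P t) < r" if "y \<in> S" "dist y t < min d e" for y
    proof -
      have "P y - P t = F (\<gamma> y) - F (\<gamma> t)" "dist (F (\<gamma> t)) (F (\<gamma> y)) < r" using d(2) e(2) that by auto
      then show ?thesis by (simp add: dist_norm norm_minus_commute)
    qed
    then show "\<exists>d>0. \<forall>x'\<in>S. dist x' t < d \<longrightarrow> dist (P x') (P t) < r"
      using d(1) e(1) by (intro exI[of _ "min d e"]) auto
  qed
qed

end

section \<open>Periods over singular chains\<close>

text \<open>The extension of \<open>f\<close> to a homomorphism on the free abelian group of
  chains.\<close>

definition lin :: "('b \<Rightarrow> complex) \<Rightarrow> ('b \<Rightarrow>\<^sub>0 int) \<Rightarrow> complex" where
  "lin f c = (\<Sum>\<sigma>\<in>Poly_Mapping.keys c. of_int (Poly_Mapping.lookup c \<sigma>) * f \<sigma>)"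

lemma lin_superset:
  assumes "finite S" "Poly_Mapping.keys c \<subseteq> S"
  shows "lin f c = (\<Sum>\<sigma>\<in>S. of_int (Poly_Mapping.lookup c \<sigma>) * f \<sigma>)"
  unfolding lin_def by (rule sum.mono_neutral_left) (use assms in \<open>auto simp: in_keys_iff\<close>)

lemma lin_add: "lin f (a + b) = lin f a + lin f b"
proof -
  let ?S = "Poly_Mapping.keys a \<union> Poly_Mapping.keys b"
  have "lin f (a + b) = (\<Sum>\<sigma>\<in>?S. of_int (Poly_Mapping.lookup (a + b) \<sigma>) * f \<sigma>)"
    using Poly_Mapping.keys_add[of a b] by (intro lin_superset) auto
  also have "\<dots> = lin f a + lin f b"
    by (simp add: lin_superset[of ?S] lookup_add sum.distrib algebra_simps)
  finally show ?thesis .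
qed

lemma lin_frag_of [simp]: "lin f (frag_of a) = f a"
  by (simp add: lin_def)

lemma lin_0 [simp]: "lin f 0 = 0"
  by (simp add: lin_def)

lemma lin_minus: "lin f (- a) = - lin f a"
  using lin_add[of f a "- a"] by (simp add: add_eq_0_iff)

lemma lin_diff: "lin f (a - b) = lin f a - lin f b"
  using lin_add[of f a "- b"] by (simp add: lin_minus)

lemma lin_cmul: "lin f (frag_cmul k a) = of_int k * lin f a"
proof -
  have "lin f (frag_cmul k a) = (\<Sum>\<sigma>\<in>Poly_Mapping.keys a. of_int (Poly_Mapping.lookup (frag_cmul k a) \<sigma>) * f \<sigma>)"
    by (intro lin_superset) (auto simp: keys_cmul)
  then show ?thesis by (simp add: lin_def sum_distrib_left mult.assoc)
qed

lemma lin_sum: "lin f (sum g I) = (\<Sum>i\<in>I. lin f (g i))"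
  by (induction I rule: infinite_finite_induct) (auto simp: lin_add)

lemma lin_frag_extend: "lin f (frag_extend g c) = lin (\<lambda>\<sigma>. lin f (g \<sigma>)) c"
  by (simp add: frag_extend_def lin_sum lin_cmul) (simp add: lin_def)

lemma lin_eq_0: "(\<And>\<sigma>. \<sigma> \<in> Poly_Mapping.keys c \<Longrightarrow> f \<sigma> = 0) \<Longrightarrow> lin f c = 0"
  by (simp add: lin_def)

text \<open>Primitives exist on convex subsets of normed spaces, whereas standard simplices live in
  a function space with the product topology. The triangle is a planar model of the standard
  2-simplex.\<close>

definition triangle :: "(real \<times> real) set" where
  "triangle = {p. 0 \<le> fst p \<and> 0 \<le> snd p \<and> fst p + snd p \<le> 1}"

definition triangle_map :: "real \<times> real \<Rightarrow> nat \<Rightarrow> real" where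
  "triangle_map p = (\<lambda>i. if i = 0 then 1 - fst p - snd p else if i = 1 then fst p else if i = 2 then snd p else 0)"

lemma compact_triangle: "compact triangle"
proof -
  have "closed triangle" unfolding triangle_def
    by (intro closed_Collect_conj closed_Collect_le continuous_intros)
  moreover have "triangle \<subseteq> cbox (0,0) (1,1)" by (auto simp: triangle_def cbox_Pair_eq)
  ultimately show ?thesis using compact_eq_bounded_closed bounded_subset bounded_cbox by blast
qed

lemma convex_triangle: "convex triangle"
proof -
  have "fst x * u + fst y * v + (snd x * u + snd y * v) \<le> 1"
    if "fst x + snd x \<le> 1" "fst y + snd y \<le> 1" "0 \<le> u" "0 \<le> v" "u + v = 1"
    for x y :: "real \<times> real" and u v :: real
    using convex_bound_le[OF that] by (simp add: algebra_simps)
  then show ?thesis by (auto simp: convex_def triangle_def algebra_simps)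
qed

lemma triangle_map_in: "p \<in> triangle \<Longrightarrow> triangle_map p \<in> standard_simplex 2"
  by (auto simp: triangle_def triangle_map_def standard_simplex_def numeral_2_eq_2)

lemma continuous_triangle_map:
  "continuous_map (top_of_set triangle) (subtopology (powertop_real UNIV) (standard_simplex 2)) triangle_map"
  unfolding continuous_map_in_subtopology continuous_map_componentwise_UNIV
proof (intro conjI allI)
  show "continuous_map (top_of_set triangle) euclideanreal (\<lambda>x. triangle_map x k)" for k
    by (cases "k = 0"; cases "k = 1"; cases "k = 2") (auto simp: triangle_map_def intro!: continuous_intros)
qed (auto simp: triangle_map_in)

text \<open>Face \<open>k\<close> lies opposite vertex \<open>k\<close> and runs from the lower to
  the higher of the two remaining vertices, which are (0, 0), (1, 0) and (0, 1) in the planar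
  model.\<close>

lemma simplex_path_face:
  assumes "t \<in> {0..1}"
  shows "simplex_path (singular_face 2 0 f) t = f (triangle_map (1 - t, t))"
    "simplex_path (singular_face 2 1 f) t = f (triangle_map (0, t))"
    "simplex_path (singular_face 2 2 f) t = f (triangle_map (t, 0))"
proof -
  have 1: "(\<lambda>i. if i = 0 then 1 - t else if i = 1 then t else 0) \<in> standard_simplex (Suc 0)"
    using assms by (auto simp: standard_simplex_def)
  have "simplical_face 0 (\<lambda>i. if i = 0 then 1 - t else if i = 1 then t else 0) = triangle_map (1 - t, t)"
    "simplical_face 1 (\<lambda>i. if i = 0 then 1 - t else if i = 1 then t else 0) = triangle_map (0, t)"
    "simplical_face 2 (\<lambda>i. if i = 0 then 1 - t else if i = 1 then t else 0) = triangle_map (t, 0)"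
    by (auto simp: simplical_face_def triangle_map_def fun_eq_iff)
  then show "simplex_path (singular_face 2 0 f) t = f (triangle_map (1 - t, t))"
    "simplex_path (singular_face 2 1 f) t = f (triangle_map (0, t))"
    "simplex_path (singular_face 2 2 f) t = f (triangle_map (t, 0))"
    using 1 unfolding simplex_path_def singular_face_def by simp_all
qed

lemma simplex_path_path_simplex:
  "t \<in> {0..1} \<Longrightarrow> simplex_path (path_simplex \<gamma>) t = \<gamma> t"
  by (auto simp: simplex_path_def path_simplex_def standard_simplex_def)

context riemann_surface
begin

text \<open>The integral of a form along a merely continuous path. Edges of the simplices that
  realise a homology need not have a velocity, so \<open>line_integral\<close> is of no use for
  them.\<close>

definition pint :: "'a one_form \<Rightarrow> (real \<Rightarrow> 'a) \<Rightarrow> complex" where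
  "pint \<omega> \<gamma> = (let P = (SOME P. pathprim \<omega> {0..1} \<gamma> P) in P 1 - P 0)"

lemma pint_eq:
  assumes "locally_exact \<omega>" "pathprim \<omega> {0..1} \<gamma> P"
  shows "pint \<omega> \<gamma> = P 1 - P 0"
proof -
  have "pathprim \<omega> {0..1} \<gamma> (SOME P. pathprim \<omega> {0..1} \<gamma> P)"
    by (rule someI[of "pathprim \<omega> {0..1} \<gamma>", OF assms(2)])
  from pathprim_unique[OF assms(1) _ this assms(2), of 0 1] show ?thesis
    by (simp add: pint_def Let_def)
qed

definition cint :: "'a one_form \<Rightarrow> 'a chain \<Rightarrow> complex" where
  "cint \<omega> c = lin (\<lambda>\<sigma>. pint \<omega> (simplex_path \<sigma>)) c"

text \<open>One primitive on the whole triangle serves all three edges, and the alternating sum of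
  its increments cancels at the vertices.\<close>

lemma cint_boundary:
  assumes "locally_exact \<omega>" "singular_chain 2 X d"
  shows "cint \<omega> (chain_boundary 2 d) = 0"
proof -
  have "(\<Sum>k\<le>2. (-1) ^ k * pint \<omega> (simplex_path (singular_face 2 k f))) = 0"
    if "f \<in> Poly_Mapping.keys d" for f
  proof -
    have f: "singular_simplex 2 X f" using assms(2) that by (auto simp: singular_chain_def)
    have cont: "continuous_map (top_of_set triangle) X (\<lambda>p. f (triangle_map p))"
      using continuous_map_compose[OF continuous_triangle_map] f by (auto simp: singular_simplex_def o_def)
    obtain P where P: "pathprim \<omega> triangle (\<lambda>p. f (triangle_map p)) P"
      using pathprim_exists[OF assms(1) compact_triangle convex_triangle cont] by metis
    have edge: "pint \<omega> (simplex_path (singular_face 2 k f)) = P (e 1) - P (e 0)"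
      if "continuous_on {0..1} e" "e ` {0..1} \<subseteq> triangle"
         "\<And>t. t \<in> {0..1} \<Longrightarrow> simplex_path (singular_face 2 k f) t = f (triangle_map (e t))" for k and e
      by (rule pint_eq[OF assms(1)]) (rule pathprim_cong[OF pathprim_compose[OF P that(1,2)] that(3)])
    have e: "continuous_on {0..1} (\<lambda>t::real. (1 - t, t))" "(\<lambda>t::real. (1 - t, t)) ` {0..1} \<subseteq> triangle"
      "continuous_on {0..1} (\<lambda>t::real. (0::real, t))" "(\<lambda>t::real. (0, t)) ` {0..1} \<subseteq> triangle"
      "continuous_on {0..1} (\<lambda>t::real. (t, 0::real))" "(\<lambda>t::real. (t, 0)) ` {0..1} \<subseteq> triangle"
      by (auto simp: triangle_def intro!: continuous_intros)
    have "pint \<omega> (simplex_path (singular_face 2 0 f)) = P (0, 1) - P (1, 0)"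
      using edge[OF e(1,2) simplex_path_face(1)] by simp
    moreover have "pint \<omega> (simplex_path (singular_face 2 1 f)) = P (0, 1) - P (0, 0)"
      using edge[OF e(3,4) simplex_path_face(2)] by simp
    moreover have "pint \<omega> (simplex_path (singular_face 2 2 f)) = P (1, 0) - P (0, 0)"
      using edge[OF e(5,6) simplex_path_face(3)] by simp
    ultimately show ?thesis by (simp add: numeral_2_eq_2)
  qed
  then show ?thesis
    unfolding cint_def chain_boundary_def by (simp add: lin_frag_extend lin_sum lin_cmul lin_eq_0)
qed

lemma cint_homologous:
  assumes "locally_exact \<omega>" "homologous_rel 1 X {} c c'"
  shows "cint \<omega> c = cint \<omega> c'"
proof -
  obtain d where "singular_chain 2 X d" "chain_boundary 2 d = c - c'"
    using assms(2) by (auto simp: homologous_rel_def singular_boundary numeral_2_eq_2)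
  then have "cint \<omega> (c - c') = 0" using cint_boundary[OF assms(1)] by metis
  then show ?thesis by (simp add: cint_def lin_diff)
qed

text \<open>Off finitely many parameters the primitive differentiates to the integrand, so the
  fundamental theorem of calculus applies.\<close>

lemma line_integral_eq_pint:
  assumes le: "locally_exact \<omega>" and C1: "piecewise_C1_path X A \<gamma>"
  shows "line_integral A \<omega> \<gamma> = pint \<omega> \<gamma>"
proof -
  have cont: "continuous_map (top_of_set {0..1}) X \<gamma>"
    using C1 by (simp add: piecewise_C1_path_def pathin_def)
  obtain P where P: "pathprim \<omega> {0..1} \<gamma> P"
    using pathprim_exists[OF le _ _ cont] by auto
  \<comment> \<open>\<open>piecewise_C1_path\<close> speaks only of subintervals that stay in one
    chart, so at first break points are finite only near each parameter; an infinite
    \<open>Bad\<close> would accumulate somewhere in the compact interval.\<close>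
  define Bad where "Bad = {t \<in> {0..1}. \<not> (\<exists>c w. c \<in> A \<and> \<gamma> t \<in> fst c \<and>
      ((snd c \<circ> \<gamma>) has_vector_derivative w) (at t within {0..1}))}"
  have "\<exists>e>0. finite (Bad \<inter> ball t e)" if t: "t \<in> {0..1}" for t
  proof -
    have "\<gamma> t \<in> topspace X" using cont t by (auto simp: continuous_map_def)
    then obtain c where c: "c \<in> A" "\<gamma> t \<in> fst c" using point_chart by metis
    obtain e where e: "e > 0" "\<forall>s\<in>{0..1}. dist s t < e \<longrightarrow> \<gamma> s \<in> fst c"
      using continuous_map_nbhd[OF cont chart_open[OF c(1)] t c(2)] by auto
    define r s where "r = max 0 (t - e/2)" and "s = min 1 (t + e/2)"
    have sub: "\<gamma> ` {r..s} \<subseteq> fst c" using e by (auto simp: r_def s_def dist_real_def)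
    then have "(snd c \<circ> \<gamma>) piecewise_C1_differentiable_on {r..s}"
      using C1 c by (auto simp: piecewise_C1_path_def r_def s_def)
    then obtain S where S: "finite S" "(snd c \<circ> \<gamma>) C1_differentiable_on ({r..s} - S)"
      by (auto simp: piecewise_C1_differentiable_on_def)
    have "Bad \<inter> ball t (e/2) \<subseteq> S"
    proof
      fix x assume x: "x \<in> Bad \<inter> ball t (e/2)"
      then have "x \<in> {0..1}" "\<bar>t - x\<bar> < e/2" by (simp_all add: Bad_def dist_real_def)
      moreover from this(2) have "t - e/2 \<le> x" "x \<le> t + e/2" by linarith+
      ultimately have xrs: "x \<in> {0..1}" "x \<in> {r..s}" unfolding r_def s_def by auto
      show "x \<in> S"
      proof (rule ccontr)
        assume "x \<notin> S"
        then obtain w where "((snd c \<circ> \<gamma>) has_vector_derivative w) (at x)"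
          using S(2) xrs unfolding C1_differentiable_on_def by blast
        then have "((snd c \<circ> \<gamma>) has_vector_derivative w) (at x within {0..1})"
          by (rule has_vector_derivative_at_within)
        moreover have "\<gamma> x \<in> fst c" using sub xrs by auto
        ultimately show False using x c(1) by (auto simp: Bad_def)
      qed
    qed
    then show ?thesis using S(1) e(1) finite_subset by (intro exI[of _ "e/2"]) auto
  qed
  then have "finite Bad"
  proof -
    assume loc: "\<And>t. t \<in> {0..1} \<Longrightarrow> \<exists>e>0. finite (Bad \<inter> ball t e)"
    show "finite Bad"
    proof (rule ccontr)
      assume "infinite Bad"
      then obtain t where t: "t \<in> {0..1}" "t islimpt Bad"
        using compact_eq_Bolzano_Weierstrass[of "{0..1::real}"] by (auto simp: Bad_def)
      then show False using loc[OF t(1)] unfolding islimpt_eq_infinite_ball by blast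
    qed
  qed
  let ?f = "\<lambda>t. let c = chart_at A (\<gamma> t) in
          \<omega> c (snd c (\<gamma> t)) (vector_derivative (snd c \<circ> \<gamma>) (at t within {0..1}))"
  have "(?f has_integral (P 1 - P 0)) {0..1}"
  proof (rule fundamental_theorem_of_calculus_interior_strong[OF \<open>finite Bad\<close>])
    fix t assume t: "t \<in> {0<..<1::real} - Bad"
    then obtain c w where c: "c \<in> A" "\<gamma> t \<in> fst c" "((snd c \<circ> \<gamma>) has_vector_derivative w) (at t within {0..1})"
      by (auto simp: Bad_def)
    have t01: "t \<in> {0..1}" using t by simp
    \<comment> \<open>The integrand uses the chart picked by \<open>chart_at\<close>; the existence
      of a velocity carries over to it from the chart \<open>c\<close>.\<close>
    define d where "d = chart_at A (\<gamma> t)"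
    have d: "d \<in> A" "\<gamma> t \<in> fst d" using chart_at[of "\<gamma> t"] chart_subset[OF c(1)] c(2) by (auto simp: d_def)
    obtain w' where w': "((snd d \<circ> \<gamma>) has_vector_derivative w') (at t within {0..1})"
      using velocity_change_chart[OF c(1) d(1) c(2) d(2) t01 cont c(3)] by auto
    have "(P has_vector_derivative \<omega> d (snd d (\<gamma> t)) w') (at t within {0..1})"
      by (rule pathprim_has_vector_derivative[OF le P d t01 w'])
    moreover have "vector_derivative (snd d \<circ> \<gamma>) (at t within {0..1}) = w'"
      by (rule vector_derivative_within_closed_interval[OF _ t01 w']) simp
    moreover have "at t within {0..1} = at t" using t by (intro at_within_interior) auto
    ultimately show "(P has_vector_derivative ?f t) (at t)"
      by (simp add: d_def[symmetric] Let_def)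
  qed (use pathprim_continuous[OF le P] in auto)
  then show ?thesis unfolding line_integral_def pint_eq[OF le P] by (rule integral_unique)
qed

text \<open>Justifies the definite description in \<open>class_integral\<close>: the integral over a
  chain is a homology invariant, so all representatives made of piecewise smooth paths give one
  value.\<close>

lemma class_integral_eq:
  assumes le: "locally_exact \<omega>" and h: "h = homologous_rel_set 1 X {} c"
    and ex: "c' \<in> h" "\<And>\<sigma>. \<sigma> \<in> Poly_Mapping.keys c' \<Longrightarrow> piecewise_C1_path X A (simplex_path \<sigma>)"
  shows "class_integral X A h \<omega> = cint \<omega> c"
proof -
  have *: "chain_integral A \<omega> c'' = cint \<omega> c"
    if "c'' \<in> h" "\<And>\<sigma>. \<sigma> \<in> Poly_Mapping.keys c'' \<Longrightarrow> piecewise_C1_path X A (simplex_path \<sigma>)" for c''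
  proof -
    have "chain_integral A \<omega> c'' = cint \<omega> c''"
      unfolding chain_integral_def cint_def lin_def
      by (rule sum.cong) (use that(2) line_integral_eq_pint[OF le] in auto)
    then show ?thesis using cint_homologous[OF le, of c c''] that(1) h by auto
  qed
  show ?thesis unfolding class_integral_def
    by (rule the_equality) (use * ex in \<open>metis+\<close>)
qed

end

section \<open>Forms with vanishing periods are exact\<close>

context riemann_surface
begin

lemma pathprim_within:
  assumes "prim \<omega> U F" "continuous_map (top_of_set K) X \<gamma>" "\<And>x. x \<in> K \<Longrightarrow> \<gamma> x \<in> U"
  shows "pathprim \<omega> K \<gamma> (\<lambda>t. F (\<gamma> t))"
  by (rule pathprimI[OF assms(2)]) (use assms in \<open>auto intro!: exI[of _ U] exI[of _ F] exI[of _ 1]\<close>)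

text \<open>The classes on all of whose cycles the integral vanishes form a subgroup of the homology
  group. It contains a basis, hence everything.\<close>

lemma cint_cycle_zero:
  fixes e :: "'i \<Rightarrow> 'a chain set"
  assumes le: "locally_exact \<omega>" and basis: "integer_basis (homology_group 1 X) I e"
    and zero: "\<And>i c. i \<in> I \<Longrightarrow> c \<in> e i \<Longrightarrow> cint \<omega> c = 0"
    and z: "singular_relcycle 1 X {} z"
  shows "cint \<omega> z = 0"
proof -
  define G where "G = homology_group 1 X"
  have G1: "G = homology_group (int 1) X" by (simp add: G_def)
  interpret comm_group G unfolding G_def by (rule abelian_relative_homology_group)
  define K where "K = {h \<in> carrier G. \<forall>c\<in>h. cint \<omega> c = 0}"
  have K: "subgroup K G"
  proof
    show "K \<subseteq> carrier G" by (auto simp: K_def)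
    have mult: "x \<otimes>\<^bsub>G\<^esub> y = (\<Union>r\<in>x. \<Union>s\<in>y. {r + s})" for x y
      unfolding G1 mult_relative_homology_group by simp
    show "x \<otimes>\<^bsub>G\<^esub> y \<in> K" if "x \<in> K" "y \<in> K" for x y
    proof -
      have "x \<otimes>\<^bsub>G\<^esub> y \<in> carrier G" using that by (auto simp: K_def)
      moreover have "\<forall>c\<in>x \<otimes>\<^bsub>G\<^esub> y. cint \<omega> c = 0"
        using that unfolding mult K_def cint_def by (auto simp: lin_add)
      ultimately show ?thesis by (simp add: K_def)
    qed
    have "cint \<omega> c = 0" if "singular_relboundary 1 X {} c" for c
      using cint_homologous[OF le, of c 0] that by (simp add: homologous_rel_def cint_def)
    then show "\<one>\<^bsub>G\<^esub> \<in> K"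
    proof -
      have "\<one>\<^bsub>G\<^esub> = singular_relboundary_set 1 X {}" unfolding G1 by (rule one_relative_homology_group)
      then show ?thesis using one_closed \<open>\<And>c. singular_relboundary 1 X {} c \<Longrightarrow> cint \<omega> c = 0\<close> unfolding K_def by blast
    qed
    show "inv\<^bsub>G\<^esub> x \<in> K" if "x \<in> K" for x
    proof -
      have x: "x \<in> carrier G" using that by (auto simp: K_def)
      then have "inv\<^bsub>G\<^esub> x = uminus ` x" unfolding G1 by (rule inv_relative_homology_group)
      moreover have "inv\<^bsub>G\<^esub> x \<in> carrier G" using x by simp
      ultimately show ?thesis using that unfolding K_def cint_def by (auto simp: lin_minus)
    qed
  qed
  have fin: "finite I" and e: "\<And>i. i \<in> I \<Longrightarrow> e i \<in> carrier G"
    using basis by (auto simp: integer_basis_def G_def)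
  have eK: "e i [^]\<^bsub>G\<^esub> (k::int) \<in> K" if "i \<in> I" for i k
    by (rule subgroup_int_pow_closed[OF K]) (use zero[OF that] e[OF that] in \<open>simp add: K_def\<close>)
  have "finprod G (\<lambda>i. e i [^]\<^bsub>G\<^esub> (m i::int)) J \<in> K" if "finite J" "J \<subseteq> I" for m J
    using that
  proof (induction rule: finite_induct)
    case empty
    then show ?case using subgroup.one_closed[OF K] by simp
  next
    case (insert j J)
    have "finprod G (\<lambda>i. e i [^]\<^bsub>G\<^esub> m i) (insert j J) = e j [^]\<^bsub>G\<^esub> m j \<otimes>\<^bsub>G\<^esub> finprod G (\<lambda>i. e i [^]\<^bsub>G\<^esub> m i) J"
      by (rule finprod_insert) (use insert e in auto)
    then show ?case using insert eK subgroup.m_closed[OF K] by auto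
  qed
  from this[OF fin] have fK: "finprod G (\<lambda>i. e i [^]\<^bsub>G\<^esub> (m i::int)) I \<in> K" for m by simp
  have "homologous_rel_set 1 X {} z \<in> carrier G"
    unfolding G1 carrier_relative_homology_group by (rule imageI) (rule CollectI, rule z)
  moreover have "\<forall>h\<in>carrier G. \<exists>!m::'i \<Rightarrow> int. m \<in> extensional I \<and> h = finprod G (\<lambda>i. e i [^]\<^bsub>G\<^esub> m i) I"
    using basis unfolding integer_basis_def G_def by (elim conjE)
  ultimately have "\<exists>!m::'i \<Rightarrow> int. m \<in> extensional I \<and> homologous_rel_set 1 X {} z = finprod G (\<lambda>i. e i [^]\<^bsub>G\<^esub> m i) I"
    by (rule bspec[rotated])
  then obtain m :: "'i \<Rightarrow> int" where "homologous_rel_set 1 X {} z = finprod G (\<lambda>i. e i [^]\<^bsub>G\<^esub> m i) I"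
    by (elim ex1E conjE)
  then have "homologous_rel_set 1 X {} z \<in> K" using fK by simp
  then show ?thesis by (auto simp: K_def)
qed

section \<open>Construction of a global primitive\<close>

lemma path_connected_X:
  assumes "connected_space X"
  shows "path_connected_space X"
proof -
  have "locally_path_connected_space X"
    unfolding locally_path_connected_space_def neighbourhood_base_of
  proof (intro allI impI)
    fix W x assume W: "openin X W \<and> x \<in> W"
    then have "x \<in> topspace X" using openin_subset by blast
    then obtain c where c: "c \<in> A" "x \<in> fst c" using point_chart by metis
    obtain e where e: "e > 0" "\<And>z. z \<in> ball (snd c x) e \<Longrightarrow> z \<in> chart_image c \<and> pt c z \<in> W"
      using chart_ball[OF c(1) _ _ c(2), of W] W by metis
    let ?V = "pt c ` ball (snd c x) e"
    have "ball (snd c x) e \<subseteq> chart_image c" using e(2) by blast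
    then have "path_connectedin (top_of_set (chart_image c)) (ball (snd c x) e)"
      by (simp add: path_connectedin_subtopology convex_imp_path_connected)
    then have "path_connectedin X ?V"
      by (rule path_connectedin_continuous_map_image[OF continuous_pt[OF c(1)]])
    moreover have "?V = {y \<in> fst c. snd c y \<in> ball (snd c x) e}"
    proof
      show "?V \<subseteq> {y \<in> fst c. snd c y \<in> ball (snd c x) e}" using e(2) by auto
      show "{y \<in> fst c. snd c y \<in> ball (snd c x) e} \<subseteq> ?V"
        using c(1) by (auto intro!: image_eqI[where x = "snd c _"])
    qed
    then have "openin X ?V" using open_preimage[OF c(1), of "ball (snd c x) e"] by simp
    moreover have "x \<in> ?V" using c e(1) by (auto intro!: image_eqI[where x = "snd c x"])
    moreover have "?V \<subseteq> W" using e(2) by auto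
    ultimately show "\<exists>U V. openin X U \<and> path_connectedin X V \<and> x \<in> U \<and> U \<subseteq> V \<and> V \<subseteq> W" by blast
  qed
  then show ?thesis using assms path_connected_eq_connected_space by blast
qed

lemma singular_simplex_path:
  assumes "pathin X g" shows "singular_simplex 1 X (path_simplex g)"
proof -
  have "continuous_map (subtopology (powertop_real UNIV) (standard_simplex 1)) (top_of_set {0..1}) (\<lambda>x. x 1)"
    by (auto simp: continuous_map_in_subtopology standard_simplex_def
        intro!: continuous_map_from_subtopology continuous_map_product_projection)
  from continuous_map_compose[OF this, of X g]
  have "continuous_map (subtopology (powertop_real UNIV) (standard_simplex 1)) X (g \<circ> (\<lambda>x. x 1))"
    using assms by (simp add: pathin_def)
  then have "continuous_map (subtopology (powertop_real UNIV) (standard_simplex 1)) X (path_simplex g)"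
    by (rule continuous_map_eq) (simp add: path_simplex_def)
  then show ?thesis by (simp add: singular_simplex_def path_simplex_def)
qed

definition vertex :: "'a \<Rightarrow> (nat \<Rightarrow> real) \<Rightarrow> 'a" where
  "vertex x = (\<lambda>_\<in>standard_simplex 0. x)"

lemma chain_boundary_path:
  "chain_boundary 1 (frag_of (path_simplex g)) = frag_of (vertex (g 1)) - frag_of (vertex (g 0))"
proof -
  \<comment> \<open>The face opposite vertex 0 is vertex 1, at which the coordinate with index 1
    equals 1: the end point of the path.\<close>
  have "singular_face 1 0 (path_simplex g) = vertex (g 1)"
  proof
    fix x
    have "simplical_face 0 x \<in> standard_simplex 1 \<and> simplical_face 0 x 1 = 1" if "x \<in> standard_simplex 0"
      using that unfolding standard_simplex_def by (auto simp: simplical_face_def)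
    then show "singular_face 1 0 (path_simplex g) x = vertex (g 1) x"
      by (simp add: singular_face_def path_simplex_def vertex_def restrict_def)
  qed
  moreover have "singular_face 1 1 (path_simplex g) = vertex (g 0)"
  proof
    fix x
    have "simplical_face 1 x \<in> standard_simplex 1 \<and> simplical_face 1 x 1 = 0" if "x \<in> standard_simplex 0"
      using that unfolding standard_simplex_def by (auto simp: simplical_face_def)
    then show "singular_face 1 1 (path_simplex g) x = vertex (g 0) x"
      by (simp add: singular_face_def path_simplex_def vertex_def restrict_def)
  qed
  ultimately show ?thesis by (simp add: chain_boundary_def)
qed

lemma pint_path_simplex:
  assumes "locally_exact \<omega>" "pathprim \<omega> {0..1} g P"
  shows "cint \<omega> (frag_of (path_simplex g)) = P 1 - P 0"
  unfolding cint_def lin_frag_of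
  by (rule pint_eq[OF assms(1)]) (rule pathprim_cong[OF assms(2)], rule simplex_path_path_simplex)

text \<open>Integration from a base point along arbitrarily chosen paths. Two choices are compared
  through cycles with vanishing integral, so no homotopy of paths is involved.\<close>

lemma global_primitive:
  assumes le: "locally_exact \<omega>" and conn: "connected_space X"
    and zero: "\<And>z. singular_relcycle 1 X {} z \<Longrightarrow> cint \<omega> z = 0"
  shows "\<exists>h. prim \<omega> (topspace X) h"
proof (cases "topspace X = {}")
  case True
  have "prim \<omega> {} (\<lambda>_. 0)" by (simp add: prim_def)
  then show ?thesis using True by metis
next
  case False
  then obtain x0 where x0: "x0 \<in> topspace X" by (metis ex_in_conv)
  have "\<forall>x\<in>topspace X. \<exists>g. pathin X g \<and> g 0 = x0 \<and> g 1 = x"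
    using path_connected_X[OF conn] x0 by (simp add: path_connected_space_def)
  then obtain g where g: "\<And>x. x \<in> topspace X \<Longrightarrow> pathin X (g x) \<and> g x 0 = x0 \<and> g x 1 = x" by metis
  define h where "h x = cint \<omega> (frag_of (path_simplex (g x)))" for x
  have seg: "h y - h x = cint \<omega> (frag_of (path_simplex s))"
    if "x \<in> topspace X" "y \<in> topspace X" "pathin X s" "s 0 = x" "s 1 = y" for x y s
  proof -
    \<comment> \<open>The chosen path to \<open>x\<close>, then \<open>s\<close>, minus the chosen
      path to \<open>y\<close>: a cycle of three simplices, in which the coefficient -1 replaces the
      reversal of a path.\<close>
    let ?z = "frag_of (path_simplex (g x)) + frag_of (path_simplex s) - frag_of (path_simplex (g y))"
    have "singular_chain 1 X ?z"
      using singular_simplex_path g that by (intro singular_chain_add singular_chain_diff) (auto simp: singular_chain_of)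
    moreover have "chain_boundary 1 ?z = 0"
      using g that by (simp add: chain_boundary_add chain_boundary_diff chain_boundary_path del: One_nat_def)
    ultimately have "cint \<omega> ?z = 0" using zero by (simp add: singular_cycle)
    then show ?thesis by (simp add: cint_def lin_add lin_diff h_def diff_eq_eq add.commute)
  qed
  have loc: "\<exists>e>0. \<forall>z\<in>ball (snd c x) e. z \<in> chart_image c \<and> pt c z \<in> U \<and> h (pt c z) - h x = F (pt c z) - F x"
    if c: "c \<in> A" "x \<in> fst c" and U: "prim \<omega> U F" "x \<in> U" for c x U F
  proof -
    have oU: "openin X U" using U by (simp add: prim_def)
    have x: "x \<in> topspace X" using chart_subset[OF c(1)] c(2) by blast
    obtain e where e: "e > 0" "\<And>z. z \<in> ball (snd c x) e \<Longrightarrow> z \<in> chart_image c \<and> pt c z \<in> U"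
      using chart_ball[OF c(1) oU U(2) c(2)] by metis
    have "h (pt c z) - h x = F (pt c z) - F x" if z: "z \<in> ball (snd c x) e" for z
    proof -
      define s where "s t = pt c ((1 - t) *\<^sub>R snd c x + t *\<^sub>R z)" for t :: real
      have inb: "(1 - t) *\<^sub>R snd c x + t *\<^sub>R z \<in> ball (snd c x) e" if "t \<in> {0..1}" for t
        using that z e(1) convexD_alt[OF convex_ball, of "snd c x" "snd c x" e z t] by simp
      have "continuous_map (top_of_set {0..1}) (top_of_set (chart_image c)) (\<lambda>t. (1 - t) *\<^sub>R snd c x + t *\<^sub>R z)"
        using inb e(2) by (auto simp: continuous_map_in_subtopology intro!: continuous_intros)
      from continuous_map_compose[OF this continuous_pt[OF c(1)]]
      have s: "continuous_map (top_of_set {0..1}) X s" unfolding s_def[abs_def] o_def .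
      have "pt c z \<in> topspace X" using e(2)[OF z] oU openin_subset by blast
      moreover have "s 0 = x" "s 1 = pt c z" using c by (simp_all add: s_def)
      ultimately have "h (pt c z) - h x = cint \<omega> (frag_of (path_simplex s))"
        using s x by (intro seg) (auto simp: pathin_def)
      also have "\<dots> = F (s 1) - F (s 0)"
        by (rule pint_path_simplex[OF le pathprim_within[OF U(1) s]]) (use inb e(2) in \<open>simp add: s_def\<close>)
      finally show ?thesis using \<open>s 0 = x\<close> \<open>s 1 = pt c z\<close> by simp
    qed
    then show ?thesis using e by blast
  qed
  have "prim \<omega> (topspace X) h"
    unfolding prim_def
  proof (intro conjI ballI openin_topspace)
    fix c x assume c: "c \<in> A" and "x \<in> topspace X \<inter> fst c"
    then have x: "x \<in> topspace X" "x \<in> fst c" by auto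
    then obtain U F where U: "prim \<omega> U F" "x \<in> U" using le unfolding locally_exact_def by metis
    obtain e where e: "e > 0" "\<forall>z\<in>ball (snd c x) e. z \<in> chart_image c \<and> pt c z \<in> U \<and> h (pt c z) - h x = F (pt c z) - F x"
      using loc[OF c x(2) U] by metis
    have "((\<lambda>z. F (pt c z) + (h x - F x)) has_derivative \<omega> c (snd c x)) (at (snd c x))"
      using has_derivative_add_const[OF primD[OF U(1) c U(2) x(2)]] .
    then show "((\<lambda>z. h (pt c z)) has_derivative \<omega> c (snd c x)) (at (snd c x))"
    proof (rule has_derivative_transform_within_open)
      show "open (ball (snd c x) e)" "snd c x \<in> ball (snd c x) e" using e(1) by auto
      show "F (pt c z) + (h x - F x) = h (pt c z)" if z: "z \<in> ball (snd c x) e" for z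
      proof -
        have "h (pt c z) - h x = F (pt c z) - F x" using e(2) z by blast
        then show ?thesis by (simp add: algebra_simps)
      qed
    qed
  qed
  then show ?thesis by blast
qed

end

section \<open>Compactly supported functions of class \<open>C\<^sup>1\<close> on the plane\<close>

text \<open>Differentiability over the reals, with the derivative as explicit data: the forms below
  are such derivatives, and bump functions are not holomorphic.\<close>

definition c1on :: "complex set \<Rightarrow> (complex \<Rightarrow> complex) \<Rightarrow> (complex \<Rightarrow> complex \<Rightarrow> complex) \<Rightarrow> bool" where
  "c1on S f f' \<longleftrightarrow> open S \<and> (\<forall>z\<in>S. (f has_derivative f' z) (at z)) \<and> (\<forall>v. continuous_on S (\<lambda>z. f' z v))"

lemma c1on_has_derivative: "c1on S f f' \<Longrightarrow> z \<in> S \<Longrightarrow> (f has_derivative f' z) (at z)"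
  by (simp add: c1on_def)

lemma c1on_continuous_deriv: "c1on S f f' \<Longrightarrow> continuous_on S (\<lambda>z. f' z v)"
  by (simp add: c1on_def)

lemma c1on_continuous: "c1on S f f' \<Longrightarrow> continuous_on S f"
  unfolding c1on_def by (meson continuous_at_imp_continuous_on has_derivative_continuous)

lemma c1on_subset: "c1on S f f' \<Longrightarrow> open T \<Longrightarrow> T \<subseteq> S \<Longrightarrow> c1on T f f'"
  by (auto simp: c1on_def intro: continuous_on_subset)

lemma c1on_mult:
  assumes f: "c1on S f f'" and g: "c1on S g g'"
  shows "c1on S (\<lambda>z. f z * g z) (\<lambda>z v. f z * g' z v + f' z v * g z)"
proof -
  have "((\<lambda>z. f z * g z) has_derivative (\<lambda>v. f z * g' z v + f' z v * g z)) (at z)" if "z \<in> S" for z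
    by (rule has_derivative_mult[OF c1on_has_derivative[OF f that] c1on_has_derivative[OF g that]])
  moreover have "continuous_on S (\<lambda>z. f z * g' z v + f' z v * g z)" for v
    by (intro continuous_intros c1on_continuous[OF f] c1on_continuous[OF g]
        c1on_continuous_deriv[OF f] c1on_continuous_deriv[OF g])
  ultimately show ?thesis using f by (simp add: c1on_def)
qed

lemma c1on_holomorphic:
  assumes "f holomorphic_on S" "open S"
  shows "c1on S f (\<lambda>z v. deriv f z * v)"
  unfolding c1on_def
proof (intro conjI ballI allI assms(2))
  show "(f has_derivative (\<lambda>v. deriv f z * v)) (at z)" if "z \<in> S" for z
    using holomorphic_derivI[OF assms that] by (simp add: has_field_derivative_def)
  show "continuous_on S (\<lambda>z. deriv f z * v)" for v
    by (intro continuous_intros holomorphic_on_imp_continuous_on holomorphic_deriv assms)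
qed

text \<open>\<open>S\<close> and the complement of \<open>K\<close> are open and cover the plane. On
  their overlap \<open>f\<close> is zero and so is its derivative, hence the two pieces fit
  together.\<close>

lemma c1on_extend_zero:
  assumes f: "c1on S f f'" and K: "closed K" "K \<subseteq> S" and z: "\<And>z. z \<in> S - K \<Longrightarrow> f z = 0"
  shows "c1on UNIV (\<lambda>z. if z \<in> S then f z else 0) (\<lambda>z v. if z \<in> S then f' z v else 0)"
proof -
  let ?f = "\<lambda>z. if z \<in> S then f z else 0"
  have oS: "open S" using f by (simp add: c1on_def)
  have f'0: "f' z v = 0" if "z \<in> S - K" for z v
  proof -
    have "((\<lambda>_. 0) has_derivative f' z) (at z)"
      by (rule has_derivative_transform_within_open[OF c1on_has_derivative[OF f], of z "S - K"])
         (use that z oS K in \<open>auto simp: open_Diff\<close>)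
    moreover have "((\<lambda>_. 0) has_derivative (\<lambda>_. 0)) (at z)" by simp
    ultimately have "f' z = (\<lambda>_. 0)" by (rule has_derivative_unique)
    then show ?thesis by simp
  qed
  have "(?f has_derivative (\<lambda>v. if z \<in> S then f' z v else 0)) (at z)" for z
  proof (cases "z \<in> S")
    case True
    have "(?f has_derivative f' z) (at z)"
      by (rule has_derivative_transform_within_open[OF c1on_has_derivative[OF f True] oS True]) simp
    then show ?thesis using True by simp
  next
    case False
    have "(?f has_derivative (\<lambda>_. 0)) (at z)"
      by (rule has_derivative_transform_within_open[of "\<lambda>_. 0" _ _ _ "- K"])
         (use K False z in auto)
    then show ?thesis using False by simp
  qed
  moreover have "continuous_on UNIV (\<lambda>z. if z \<in> S then f' z v else 0)" for v
  proof -
    have "continuous_on (S \<union> - K) (\<lambda>z. if z \<in> S then f' z v else 0)"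
    proof (rule continuous_on_open_Un[OF oS])
      show "open (- K)" using K(1) by (simp add: open_Compl)
      show "continuous_on S (\<lambda>z. if z \<in> S then f' z v else 0)"
        using c1on_continuous_deriv[OF f] by (rule continuous_on_eq) simp
      show "continuous_on (- K) (\<lambda>z. if z \<in> S then f' z v else 0)"
        by (rule continuous_on_eq[of _ "\<lambda>_. 0"]) (use f'0 in auto)
    qed
    moreover have "S \<union> - K = UNIV" using K(2) by blast
    ultimately show ?thesis by simp
  qed
  ultimately show ?thesis by (simp add: c1on_def)
qed

lemma integrable_continuous_compact_support:
  fixes f :: "complex \<Rightarrow> complex"
  assumes "continuous_on UNIV f" "\<And>z. z \<notin> cball 0 R \<Longrightarrow> f z = 0"
  shows "integrable lborel f"
proof -
  have "integrable lborel (\<lambda>z. indicator (cball 0 R) z *\<^sub>R f z)"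
    by (rule borel_integrable_compact) (use assms(1) in \<open>auto intro: continuous_on_subset\<close>)
  also have "(\<lambda>z. indicator (cball 0 R) z *\<^sub>R f z) = f"
    using assms(2) by (auto simp: indicator_def)
  finally show ?thesis .
qed

lemma c1on_deriv_zero:
  assumes w: "c1on UNIV w w'" and supp: "\<And>z. z \<notin> cball 0 R \<Longrightarrow> w z = 0" and z: "z \<notin> cball 0 R"
  shows "w' z v = 0"
proof -
  have "((\<lambda>_. 0) has_derivative w' z) (at z)"
    by (rule has_derivative_transform_within_open[OF c1on_has_derivative[OF w UNIV_I], of "- cball 0 R"])
       (use z supp in auto)
  moreover have "((\<lambda>_. 0) has_derivative (\<lambda>_. 0)) (at z)" by simp
  ultimately have "w' z = (\<lambda>_. 0)" by (rule has_derivative_unique)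
  then show ?thesis by simp
qed

lemma real_linear_bound:
  assumes "linear (L :: complex \<Rightarrow> complex)"
  shows "norm (L u) \<le> (norm (L 1) + norm (L \<i>)) * norm u"
proof -
  have "u = Re u *\<^sub>R 1 + Im u *\<^sub>R \<i>" by (simp add: complex_eq_iff)
  then have "L u = Re u *\<^sub>R L 1 + Im u *\<^sub>R L \<i>"
    using assms by (metis linear_add linear_cmul)
  also have "norm \<dots> \<le> \<bar>Re u\<bar> * norm (L 1) + \<bar>Im u\<bar> * norm (L \<i>)"
    by (metis norm_triangle_ineq norm_scaleR)
  also have "\<dots> \<le> norm u * norm (L 1) + norm u * norm (L \<i>)"
    by (intro add_mono mult_right_mono abs_Re_le_cmod abs_Im_le_cmod) auto
  finally show ?thesis by (simp add: algebra_simps)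
qed

text \<open>Difference quotients integrate to zero by translation invariance of Lebesgue measure,
  and they converge dominatedly to the directional derivative. It is the form in which Stokes'
  theorem in the plane is used.\<close>

lemma integral_derivative_zero:
  assumes w: "c1on UNIV w w'" and supp: "\<And>z. z \<notin> cball 0 R \<Longrightarrow> w z = 0"
  shows "integrable lborel (\<lambda>z. w' z v)" "integral\<^sup>L lborel (\<lambda>z. w' z v) = 0"
proof -
  have supp': "w' z u = 0" if "z \<notin> cball 0 R" for z u
    by (rule c1on_deriv_zero[OF w supp that])
  show int': "integrable lborel (\<lambda>z. w' z v)"
    by (rule integrable_continuous_compact_support[OF c1on_continuous_deriv[OF w] supp'])
  show "integral\<^sup>L lborel (\<lambda>z. w' z v) = 0"
  proof (cases "v = 0")
    case True
    have "w' z 0 = 0" for z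
      using linear_0[OF has_derivative_linear[OF c1on_has_derivative[OF w]]] by simp
    then show ?thesis using True by simp
  next
    case False
    have intw: "integrable lborel w"
      by (rule integrable_continuous_compact_support[OF c1on_continuous[OF w] supp])
    have meas[measurable]: "w \<in> borel_measurable borel"
      by (rule borel_measurable_continuous_onI[OF c1on_continuous[OF w]])
    have "continuous_on (cball 0 R) (\<lambda>z. norm (w' z 1) + norm (w' z \<i>))"
      using c1on_continuous_deriv[OF w] by (intro continuous_intros) (auto intro: continuous_on_subset)
    then have "bounded ((\<lambda>z. norm (w' z 1) + norm (w' z \<i>)) ` cball 0 R)"
      by (intro compact_imp_bounded compact_continuous_image) auto
    then obtain B0 where B0: "\<And>z. z \<in> cball 0 R \<Longrightarrow> norm (w' z 1) + norm (w' z \<i>) \<le> B0"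
      unfolding bounded_iff by fastforce
    define B where "B = max 0 B0"
    have "norm (w' z 1) + norm (w' z \<i>) \<le> B" for z
      using B0[of z] supp'[of z] by (cases "z \<in> cball 0 R") (auto simp: B_def)
    then have "norm (w' z u) \<le> B * norm u" for z u
      using real_linear_bound[OF has_derivative_linear[OF c1on_has_derivative[OF w]], of z u]
      by (meson UNIV_I mult_right_mono norm_ge_zero order_trans)
    then have onorm: "onorm (w' z) \<le> B" for z by (intro onorm_bound) (auto simp: B_def)
    \<comment> \<open>A global Lipschitz constant bounds all difference quotients
      simultaneously.\<close>
    have lip: "norm (w x - w y) \<le> B * norm (x - y)" for x y
      by (rule differentiable_bound[of UNIV w w']) (use onorm c1on_has_derivative[OF w] in auto)
    define s where "s n z = real (Suc n) *\<^sub>R (w ((1 / real (Suc n)) *\<^sub>R v + z) - w z)" for n z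
    have shift: "integrable lborel (\<lambda>z. w (c + z))" "integral\<^sup>L lborel (\<lambda>z. w (c + z)) = integral\<^sup>L lborel w" for c
    proof -
      have m: "(+) c \<in> lborel \<rightarrow>\<^sub>M borel" by simp
      show "integrable lborel (\<lambda>z. w (c + z))"
        using integrable_distr_eq[OF m meas] intw by (simp add: lborel_distr_plus)
      show "integral\<^sup>L lborel (\<lambda>z. w (c + z)) = integral\<^sup>L lborel w"
        using integral_distr[OF m meas] by (simp add: lborel_distr_plus)
    qed
    have s0: "integral\<^sup>L lborel (s n) = 0" for n
      unfolding s_def using shift intw by (simp add: Bochner_Integration.integral_diff)
    \<comment> \<open>Shifts by at most \<open>norm v\<close> keep the supports of all quotients
      inside the ball of radius \<open>R + norm v\<close>, on which the dominating function is
      constant.\<close>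
    have "(\<lambda>n. integral\<^sup>L lborel (s n)) \<longlonglongrightarrow> integral\<^sup>L lborel (\<lambda>z. w' z v)"
    proof (rule integral_dominated_convergence[where w = "\<lambda>z. indicator (cball 0 (R + norm v)) z *\<^sub>R (B * norm v)"])
      show "(\<lambda>z. w' z v) \<in> borel_measurable lborel" using int' by auto
      show "s n \<in> borel_measurable lborel" for n unfolding s_def by measurable
      show "integrable lborel (\<lambda>z::complex. indicator (cball 0 (R + norm v)) z *\<^sub>R (B * norm v))"
        by (rule borel_integrable_compact) auto
      show "AE z in lborel. norm (s n z) \<le> indicator (cball 0 (R + norm v)) z *\<^sub>R (B * norm v)" for n
      proof (rule AE_I2)
        fix z
        show "norm (s n z) \<le> indicator (cball 0 (R + norm v)) z *\<^sub>R (B * norm v)"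
        proof (cases "z \<in> cball 0 (R + norm v)")
          case True
          have "norm (w ((1 / real (Suc n)) *\<^sub>R v + z) - w z) \<le> B * norm ((1 / real (Suc n)) *\<^sub>R v)"
            using lip[of "(1 / real (Suc n)) *\<^sub>R v + z" z] by (simp only: add_diff_cancel_right')
          then have "norm (s n z) \<le> real (Suc n) * (B * norm ((1 / real (Suc n)) *\<^sub>R v))"
            unfolding s_def norm_scaleR abs_of_nat by (intro mult_left_mono) auto
          also have "\<dots> = B * norm v" by simp
          finally show ?thesis using True by simp
        next
          case out: False
          have "norm ((1 / real (Suc n)) *\<^sub>R v) \<le> norm v" by (simp add: divide_le_eq algebra_simps)
          then have "norm z - norm v \<le> norm ((1 / real (Suc n)) *\<^sub>R v + z)"
            using norm_diff_ineq[of z "(1 / real (Suc n)) *\<^sub>R v"] by (simp add: add.commute)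
          then have "(1 / real (Suc n)) *\<^sub>R v + z \<notin> cball 0 R" "z \<notin> cball 0 R"
            using out norm_ge_zero[of v] unfolding mem_cball dist_0_norm by linarith+
          then have "s n z = 0" using supp by (simp add: s_def)
          then show ?thesis using out by simp
        qed
      qed
      show "AE z in lborel. (\<lambda>n. s n z) \<longlonglongrightarrow> w' z v"
      proof (rule AE_I2)
        fix z
        have lin: "linear (w' z)" using has_derivative_linear[OF c1on_has_derivative[OF w]] by simp
        let ?h = "\<lambda>n. (1 / real (Suc n)) *\<^sub>R v"
        have "filterlim (\<lambda>n. ?h n + z) (at z) sequentially"
        proof (rule filterlim_atI)
          have "(\<lambda>n. ?h n) \<longlonglongrightarrow> 0 *\<^sub>R v" by (intro tendsto_scaleR tendsto_const LIMSEQ_Suc lim_1_over_n)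
          from tendsto_add[OF this tendsto_const[of z]] show "(\<lambda>n. ?h n + z) \<longlonglongrightarrow> z" by simp
          show "\<forall>\<^sub>F n in sequentially. ?h n + z \<noteq> z" using False by (simp del: of_nat_Suc)
        qed
        moreover have "((\<lambda>y. (w y - w z - w' z (y - z)) /\<^sub>R norm (y - z)) \<longlongrightarrow> 0) (at z)"
          using c1on_has_derivative[OF w, of z] by (simp add: has_derivative_at_within)
        ultimately have "(\<lambda>n. (w (?h n + z) - w z - w' z (?h n + z - z)) /\<^sub>R norm (?h n + z - z)) \<longlonglongrightarrow> 0"
          by (rule filterlim_compose[rotated])
        from tendsto_scaleR[OF tendsto_const[of "norm v"] this]
        have "(\<lambda>n. norm v *\<^sub>R ((w (?h n + z) - w z - w' z (?h n + z - z)) /\<^sub>R norm (?h n + z - z))) \<longlonglongrightarrow> 0" by simp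
        moreover have "norm v *\<^sub>R ((w (?h n + z) - w z - w' z (?h n + z - z)) /\<^sub>R norm (?h n + z - z)) = s n z - w' z v" for n
        proof -
          have 1: "w' z (?h n) = (1 / real (Suc n)) *\<^sub>R w' z v" by (rule linear_cmul[OF lin])
          have "norm v *\<^sub>R ((w (?h n + z) - w z - w' z (?h n + z - z)) /\<^sub>R norm (?h n + z - z))
            = real (Suc n) *\<^sub>R (w (?h n + z) - w z - w' z (?h n))"
            using False by (simp add: algebra_simps del: of_nat_Suc)
          also have "\<dots> = s n z - real (Suc n) *\<^sub>R w' z (?h n)" by (simp add: s_def scaleR_diff_right del: of_nat_Suc)
          also have "real (Suc n) *\<^sub>R w' z (?h n) = w' z v" by (simp add: 1 del: of_nat_Suc)
          finally show ?thesis .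
        qed
        ultimately have "(\<lambda>n. s n z - w' z v) \<longlonglongrightarrow> 0" by simp
        then show "(\<lambda>n. s n z) \<longlonglongrightarrow> w' z v" by (rule LIM_zero_cancel)
      qed
    qed
    then show ?thesis by (simp add: s0 LIMSEQ_const_iff)
  qed
qed

text \<open>Presents the measure of the plane as a product, so that Tonelli's theorem applies to
  real and imaginary parts. Both measures agree on boxes.\<close>

lemma lborel_complex: "(lborel :: complex measure) = distr (lborel \<Otimes>\<^sub>M lborel) borel (\<lambda>p. Complex (fst p) (snd p))"
proof (rule lborel_eqI)
  have m: "(\<lambda>p. Complex (fst p) (snd p)) \<in> (lborel \<Otimes>\<^sub>M lborel) \<rightarrow>\<^sub>M borel"
  proof -
    have "continuous_on UNIV (\<lambda>p::real\<times>real. Complex (fst p) (snd p))"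
      unfolding complex_eq by (intro continuous_intros)
    then have "(\<lambda>p::real\<times>real. Complex (fst p) (snd p)) \<in> borel \<rightarrow>\<^sub>M borel"
      by (rule borel_measurable_continuous_onI)
    then show ?thesis by (simp add: lborel_prod)
  qed
  fix l u :: complex assume le: "\<And>b. b \<in> Basis \<Longrightarrow> l \<bullet> b \<le> u \<bullet> b"
  have le': "Re l \<le> Re u" "Im l \<le> Im u" using le[of 1] le[of \<i>] by (auto simp: Basis_complex_def)
  have "(\<lambda>p. Complex (fst p) (snd p)) -` box l u \<inter> space (lborel \<Otimes>\<^sub>M lborel) = box (Re l) (Re u) \<times> box (Im l) (Im u)"
    by (auto simp: box_def Basis_complex_def space_pair_measure)
  then have "emeasure (distr (lborel \<Otimes>\<^sub>M lborel) borel (\<lambda>p. Complex (fst p) (snd p))) (box l u)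
     = emeasure (lborel \<Otimes>\<^sub>M lborel) (box (Re l) (Re u) \<times> box (Im l) (Im u))"
    by (simp add: emeasure_distr[OF m])
  also have "\<dots> = emeasure lborel (box (Re l) (Re u)) * emeasure lborel (box (Im l) (Im u))"
    by (rule lborel.emeasure_pair_measure_Times) auto
  also have "\<dots> = ennreal (\<Prod>b\<in>Basis. (u - l) \<bullet> b)"
    using le' by (simp add: Basis_complex_def ennreal_mult)
  finally show "emeasure (distr (lborel \<Otimes>\<^sub>M lborel) borel (\<lambda>p. Complex (fst p) (snd p))) (box l u) = ennreal (\<Prod>b\<in>Basis. (u - l) \<bullet> b)" .
qed simp

lemma nn_integral_complex_product:
  assumes [measurable]: "f \<in> borel_measurable borel" "g \<in> borel_measurable borel"
  shows "(\<integral>\<^sup>+z. f (Re z) * g (Im z) \<partial>lborel) = (\<integral>\<^sup>+x. f x \<partial>lborel) * (\<integral>\<^sup>+y. g y \<partial>lborel)"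
proof -
  have m: "(\<lambda>p. Complex (fst p) (snd p)) \<in> (lborel \<Otimes>\<^sub>M lborel) \<rightarrow>\<^sub>M borel"
  proof -
    have "continuous_on UNIV (\<lambda>p::real\<times>real. Complex (fst p) (snd p))"
      unfolding complex_eq by (intro continuous_intros)
    then have "(\<lambda>p::real\<times>real. Complex (fst p) (snd p)) \<in> borel \<rightarrow>\<^sub>M borel"
      by (rule borel_measurable_continuous_onI)
    then show ?thesis by (simp add: lborel_prod)
  qed
  have ReIm[measurable]: "Re \<in> borel_measurable borel" "Im \<in> borel_measurable borel"
    by (auto intro!: borel_measurable_continuous_onI continuous_intros)
  have "(\<integral>\<^sup>+z. f (Re z) * g (Im z) \<partial>lborel) = (\<integral>\<^sup>+p. f (fst p) * g (snd p) \<partial>(lborel \<Otimes>\<^sub>M lborel))"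
    by (subst lborel_complex, subst nn_integral_distr[OF m]) auto
  also have "\<dots> = (\<integral>\<^sup>+x. (\<integral>\<^sup>+y. f x * g y \<partial>lborel) \<partial>lborel)"
    by (subst lborel.nn_integral_fst[symmetric]) auto
  also have "\<dots> = (\<integral>\<^sup>+x. f x \<partial>lborel) * (\<integral>\<^sup>+y. g y \<partial>lborel)"
    by (simp add: nn_integral_cmult nn_integral_multc)
  finally show ?thesis .
qed

lemma nn_integral_inverse_one_plus_square: "(\<integral>\<^sup>+(x::real). ennreal (1 / (1 + x\<^sup>2)) \<partial>lborel) < \<infinity>"
proof -
  have d: "(arctan has_real_derivative 1 / (1 + x\<^sup>2)) (at x)" for x
    using DERIV_arctan[of x] by (simp add: inverse_eq_divide)
  have "(\<integral>\<^sup>+x. ennreal (1 / (1 + x\<^sup>2)) * indicator {-real n..real n} x \<partial>lborel) = arctan (real n) - arctan (- real n)" for n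
    by (rule nn_integral_FTC_Icc) (use d in \<open>auto intro: has_field_derivative_at_within\<close>)
  moreover have "arctan (real n) - arctan (- real n) \<le> pi" for n
    using arctan_bounded[of "real n"] by (simp add: arctan_minus)
  ultimately have bd: "(\<integral>\<^sup>+x. ennreal (1 / (1 + x\<^sup>2)) * indicator {-real n..real n} x \<partial>lborel) \<le> ennreal pi" for n
    by (simp add: ennreal_leI)
  have "(\<integral>\<^sup>+(x::real). ennreal (1 / (1 + x\<^sup>2)) \<partial>lborel) = (\<integral>\<^sup>+x. (SUP n. ennreal (1 / (1 + x\<^sup>2)) * indicator {-real n..real n} x) \<partial>lborel)"
  proof (rule nn_integral_cong)
    fix x :: real
    obtain n where n: "real n \<ge> \<bar>x\<bar>" using real_arch_simple by blast
    show "ennreal (1 / (1 + x\<^sup>2)) = (SUP n. ennreal (1 / (1 + x\<^sup>2)) * indicator {-real n..real n} x)"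
    proof (rule antisym)
      have "ennreal (1 / (1 + x\<^sup>2)) = ennreal (1 / (1 + x\<^sup>2)) * indicator {-real n..real n} x"
        using n by (auto simp: indicator_def)
      also have "\<dots> \<le> (SUP n. ennreal (1 / (1 + x\<^sup>2)) * indicator {-real n..real n} x)" by (rule SUP_upper) simp
      finally show "ennreal (1 / (1 + x\<^sup>2)) \<le> (SUP n. ennreal (1 / (1 + x\<^sup>2)) * indicator {-real n..real n} x)" .
    qed (auto intro!: SUP_least simp: indicator_def)
  qed
  also have "\<dots> = (SUP n. (\<integral>\<^sup>+x. ennreal (1 / (1 + x\<^sup>2)) * indicator {-real n..real n} x \<partial>lborel))"
    by (rule nn_integral_monotone_convergence_SUP) (auto simp: incseq_def le_fun_def indicator_def)
  also have "\<dots> \<le> ennreal pi" by (rule SUP_least) (rule bd)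
  finally show ?thesis by (simp add: le_less_trans)
qed

lemma nn_integral_inverse_sqrt: "(\<integral>\<^sup>+(x::real). ennreal (\<bar>x\<bar> powr (-1/2)) * indicator {-R..R} x \<partial>lborel) < \<infinity>"
proof (cases "R \<ge> 0")
  case True
  let ?f = "\<lambda>x::real. \<bar>x\<bar> powr (-1/2)"
  have 1: "((\<lambda>x. x powr (-1/2)) has_integral (R powr (-1/2 + 1) / (-1/2 + 1))) {0..R}"
    using has_integral_powr_from_0[of "-1/2" R] True by simp
  have 2: "(?f has_integral (R powr (-1/2 + 1) / (-1/2 + 1))) {0..R}"
    by (rule has_integral_eq[OF _ 1]) auto
  have "((\<lambda>x. ?f (- x)) has_integral (R powr (-1/2 + 1) / (-1/2 + 1))) {-R..-0}"
    by (rule has_integral_reflect_lemma_real[OF 2])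
  then have 3: "(?f has_integral (R powr (-1/2 + 1) / (-1/2 + 1))) {-R..0}" by simp
  obtain I where "(?f has_integral I) {-R..R}"
    using has_integral_combine[OF _ _ 3 2] True by auto
  then have I: "((\<lambda>x. if x \<in> {-R..R} then ?f x else 0) has_integral I) UNIV"
    by (rule has_integral_restrict_UNIV[THEN iffD2])
  have "(\<integral>\<^sup>+x. ennreal (if x \<in> {-R..R} then ?f x else 0) \<partial>lborel) = ennreal I"
    by (rule nn_integral_has_integral_lborel[OF _ _ I]) auto
  moreover have "ennreal (if x \<in> {-R..R} then ?f x else 0) = ennreal (?f x) * indicator {-R..R} x" for x
    by (auto simp: indicator_def)
  ultimately show ?thesis by simp
next
  case False
  then have "{-R..R} = {}" by auto
  then show ?thesis by simp
qed

text \<open>Since \<open>sqrt (\<bar>Re z\<bar> * \<bar>Im z\<bar>) \<le> norm z\<close>, the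
  singularity is dominated by a product of two integrable functions of one variable; this takes the
  place of polar coordinates.\<close>

lemma integrable_inverse_norm:
  "integrable lborel (\<lambda>z::complex. indicator (cball 0 R) z *\<^sub>R (1 / norm z))"
proof (rule integrableI_bounded)
  have [measurable]: "cball (0::complex) R \<in> sets borel" by simp
  show "(\<lambda>z::complex. indicator (cball 0 R) z *\<^sub>R (1 / norm z)) \<in> borel_measurable lborel" by measurable
  let ?g = "\<lambda>x::real. ennreal (\<bar>x\<bar> powr (-1/2)) * indicator {-R..R} x"
  \<comment> \<open>On the axes the dominating product is 0, because
    \<open>0 powr (-1/2) = 0\<close>, and the estimate fails; they form a null set.\<close>
  have null: "AE z::complex in lborel. Re z \<noteq> 0 \<and> Im z \<noteq> 0"
  proof -
    have "negligible {z::complex. 1 \<bullet> z = 0}" "negligible {z::complex. \<i> \<bullet> z = 0}"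
      by (rule negligible_hyperplane; simp)+
    then have "negligible ({z::complex. 1 \<bullet> z = 0} \<union> {z. \<i> \<bullet> z = 0})" by (rule negligible_Un)
    moreover have "{z::complex. 1 \<bullet> z = 0} \<union> {z. \<i> \<bullet> z = 0} = {z. Re z = 0 \<or> Im z = 0}"
      by (auto simp: inner_complex_def)
    ultimately have neg: "negligible {z. Re z = 0 \<or> Im z = 0}" by metis
    have "{z::complex. Re z = 0 \<or> Im z = 0} \<in> null_sets lborel"
    proof -
      have "closed {z::complex. Re z = 0 \<or> Im z = 0}"
        by (intro closed_Collect_disj closed_Collect_eq continuous_intros)
      then show ?thesis using neg by (simp add: negligible_iff_null_sets null_sets_completion_iff borel_closed)
    qed
    then have "AE z in lborel. z \<notin> {z::complex. Re z = 0 \<or> Im z = 0}" by (rule AE_not_in)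
    then show ?thesis by auto
  qed
  have "(\<integral>\<^sup>+z. norm (indicator (cball 0 R) z *\<^sub>R (1 / norm (z::complex))) \<partial>lborel) \<le> (\<integral>\<^sup>+z. ?g (Re z) * ?g (Im z) \<partial>lborel)"
  proof (rule nn_integral_mono_AE, rule AE_mp[OF null], rule AE_I2, rule impI)
    fix z :: complex assume nz: "Re z \<noteq> 0 \<and> Im z \<noteq> 0"
    show "ennreal (norm (indicator (cball 0 R) z *\<^sub>R (1 / norm z))) \<le> ?g (Re z) * ?g (Im z)"
    proof (cases "z \<in> cball 0 R")
      case True
      have "\<bar>Re z\<bar> \<le> R" "\<bar>Im z\<bar> \<le> R" using True abs_Re_le_cmod[of z] abs_Im_le_cmod[of z] by auto
      then have ind: "indicator {-R..R} (Re z) = (1::ennreal)" "indicator {-R..R} (Im z) = (1::ennreal)"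
        by (auto simp: indicator_def)
      have "sqrt (\<bar>Re z\<bar> * \<bar>Im z\<bar>) \<le> norm z"
      proof -
        have "\<bar>Re z\<bar> * \<bar>Im z\<bar> \<le> norm z * norm z"
          by (intro mult_mono abs_Re_le_cmod abs_Im_le_cmod) auto
        then show ?thesis using real_sqrt_le_mono by fastforce
      qed
      moreover have "sqrt (\<bar>Re z\<bar> * \<bar>Im z\<bar>) > 0" using nz by simp
      ultimately have "1 / norm z \<le> 1 / sqrt (\<bar>Re z\<bar> * \<bar>Im z\<bar>)" by (intro frac_le) auto
      also have "\<dots> = \<bar>Re z\<bar> powr (-1/2) * \<bar>Im z\<bar> powr (-1/2)"
        using nz by (simp add: powr_minus_divide powr_half_sqrt real_sqrt_mult)
      finally show ?thesis using True ind by (simp add: ennreal_mult[symmetric] ennreal_leI)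
    qed simp
  qed
  also have "\<dots> = (\<integral>\<^sup>+x. ?g x \<partial>lborel) * (\<integral>\<^sup>+x. ?g x \<partial>lborel)"
    by (rule nn_integral_complex_product) auto
  also have "\<dots> < \<infinity>" using nn_integral_inverse_sqrt[of R] by (simp add: ennreal_mult_less_top)
  finally show "(\<integral>\<^sup>+z. norm (indicator (cball 0 R) z *\<^sub>R (1 / norm (z::complex))) \<partial>lborel) < \<infinity>" .
qed

text \<open>Dominated by the product of the functions \<open>1 / (1 + x\<^sup>2)\<close> of the two
  coordinates, which have finite integral.\<close>

lemma integrable_pompeiu_kernel: "integrable lborel (\<lambda>z::complex. 1 / (1 + (norm z)\<^sup>2)\<^sup>2)"
proof (rule integrableI_bounded)
  show "(\<lambda>z::complex. 1 / (1 + (norm z)\<^sup>2)\<^sup>2) \<in> borel_measurable lborel" by simp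
  let ?g = "\<lambda>x::real. ennreal (1 / (1 + x\<^sup>2))"
  have "(\<integral>\<^sup>+z. norm (1 / (1 + (norm (z::complex))\<^sup>2)\<^sup>2) \<partial>lborel) \<le> (\<integral>\<^sup>+z. ?g (Re z) * ?g (Im z) \<partial>lborel)"
  proof (rule nn_integral_mono)
    fix z :: complex
    have "(1 + (Re z)\<^sup>2) * (1 + (Im z)\<^sup>2) \<le> (1 + (norm z)\<^sup>2) * (1 + (norm z)\<^sup>2)"
      unfolding cmod_power2 by (intro mult_mono) auto
    then have "1 / (1 + (norm z)\<^sup>2)\<^sup>2 \<le> 1 / ((1 + (Re z)\<^sup>2) * (1 + (Im z)\<^sup>2))"
      unfolding power2_eq_square[of "1 + (norm z)\<^sup>2"]
      by (intro divide_left_mono mult_pos_pos add_pos_nonneg) auto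
    then show "ennreal (norm (1 / (1 + (norm z)\<^sup>2)\<^sup>2)) \<le> ?g (Re z) * ?g (Im z)"
      by (simp add: ennreal_mult[symmetric] ennreal_leI)
  qed
  also have "\<dots> = (\<integral>\<^sup>+x. ?g x \<partial>lborel) * (\<integral>\<^sup>+x. ?g x \<partial>lborel)"
    by (rule nn_integral_complex_product) auto
  also have "\<dots> < \<infinity>" using nn_integral_inverse_one_plus_square by (simp add: ennreal_mult_less_top)
  finally show "(\<integral>\<^sup>+z. norm (1 / (1 + (norm (z::complex))\<^sup>2)\<^sup>2) \<partial>lborel) < \<infinity>" .
qed

section \<open>The Cauchy--Pompeiu formula\<close>

text \<open>The value is \<open>\<pi>\<close>, but only its sign matters.\<close>

definition kappa :: real where
  "kappa = integral\<^sup>L lborel (\<lambda>z::complex. 1 / (1 + (norm z)\<^sup>2)\<^sup>2)"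

text \<open>The integrand is positive everywhere, so a vanishing integral would make the whole plane
  a null set.\<close>

lemma kappa_pos: "kappa > 0"
proof -
  have nn: "0 \<le> 1 / (1 + (norm z)\<^sup>2)\<^sup>2" for z :: complex by simp
  have "kappa \<noteq> 0"
  proof
    assume "kappa = 0"
    then have "AE z::complex in lborel. 1 / (1 + (norm z)\<^sup>2)\<^sup>2 = 0"
      unfolding kappa_def using integral_nonneg_eq_0_iff_AE[OF integrable_pompeiu_kernel] nn by simp
    moreover have "1 / (1 + (norm z)\<^sup>2)\<^sup>2 \<noteq> 0" for z :: complex
      using add_pos_nonneg[of 1 "(norm z)\<^sup>2"] by simp
    ultimately have "AE z::complex in lborel. False" by simp
    then have "ae_filter (lborel :: complex measure) = bot" by (simp add: trivial_limit_def)
    then have "emeasure lborel (UNIV :: complex set) = 0" by (simp add: ae_filter_eq_bot_iff)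
    then show False by simp
  qed
  moreover have "kappa \<ge> 0" unfolding kappa_def using nn by (intro Bochner_Integration.integral_nonneg)
  ultimately show ?thesis by simp
qed

lemma lborel_shift:
  fixes f :: "complex \<Rightarrow> 'b::{banach, second_countable_topology}"
  assumes [measurable]: "f \<in> borel_measurable borel"
  shows "integrable lborel (\<lambda>z. f (c + z)) \<longleftrightarrow> integrable lborel f"
    "integral\<^sup>L lborel (\<lambda>z. f (c + z)) = integral\<^sup>L lborel f"
proof -
  have m: "(+) c \<in> lborel \<rightarrow>\<^sub>M borel" by simp
  show "integrable lborel (\<lambda>z. f (c + z)) \<longleftrightarrow> integrable lborel f"
    using integrable_distr_eq[OF m assms] by (simp add: lborel_distr_plus)
  show "integral\<^sup>L lborel (\<lambda>z. f (c + z)) = integral\<^sup>L lborel f"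
    using integral_distr[OF m assms] by (simp add: lborel_distr_plus)
qed

lemma lborel_scale:
  fixes f :: "complex \<Rightarrow> complex"
  assumes f[measurable]: "f \<in> borel_measurable borel" and e: "e > 0"
  shows "integral\<^sup>L lborel f = integral\<^sup>L lborel (\<lambda>u. e\<^sup>2 *\<^sub>R f (a + e *\<^sub>R u))"
proof -
  have m: "(\<lambda>x. a + e *\<^sub>R x) \<in> lborel \<rightarrow>\<^sub>M borel" by simp
  have "integral\<^sup>L lborel f = integral\<^sup>L (density (distr lborel borel (\<lambda>x. a + e *\<^sub>R x)) (\<lambda>_. ennreal (\<bar>e\<bar> ^ 2))) f"
    using lborel_affine[of e a] e by simp
  also have "\<dots> = integral\<^sup>L (distr lborel borel (\<lambda>x. a + e *\<^sub>R x)) (\<lambda>x. (\<bar>e\<bar> ^ 2) *\<^sub>R f x)"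
    by (rule integral_density) auto
  also have "\<dots> = integral\<^sup>L lborel (\<lambda>u. (\<bar>e\<bar> ^ 2) *\<^sub>R f (a + e *\<^sub>R u))"
    by (rule integral_distr[OF m]) auto
  finally show ?thesis using e by simp
qed

lemma integrable_inverse_norm_at:
  "integrable lborel (\<lambda>z::complex. indicator (cball a R) z *\<^sub>R (1 / norm (z - a)))"
proof -
  have "integrable lborel (\<lambda>z::complex. indicator (cball 0 R) (-a + z) *\<^sub>R (1 / norm (-a + z)))"
    by (subst lborel_shift(1)) (use integrable_inverse_norm in auto)
  moreover have "indicator (cball 0 R) (z - a) = (indicator (cball a R) z :: real)" for z
    by (auto simp: indicator_def dist_norm norm_minus_commute)
  ultimately show ?thesis by simp
qed

text \<open>A smooth regularisation of \<open>1 / (z - a)\<close>: with \<open>u = z - a\<close> it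
  is \<open>cnj u / ((norm u)\<^sup>2 + e\<^sup>2)\<close>. It is dominated by the kernel itself and
  takes the value 0 at \<open>a\<close>.\<close>

definition reg_kernel :: "real \<Rightarrow> complex \<Rightarrow> complex \<Rightarrow> complex" where
  "reg_kernel e a z = cnj (z - a) / ((z - a) * cnj (z - a) + of_real (e\<^sup>2))"

lemma reg_kernel_denom:
  "(z - a) * cnj (z - a) + of_real (e\<^sup>2) = of_real ((norm (z - a))\<^sup>2 + e\<^sup>2)"
  by (simp only: complex_norm_square of_real_add)

lemma reg_kernel_denom_nz: "e > 0 \<Longrightarrow> (z - a) * cnj (z - a) + of_real (e\<^sup>2) \<noteq> 0"
proof -
  assume "e > 0"
  then have "(norm (z - a))\<^sup>2 + e\<^sup>2 > 0" by (intro add_nonneg_pos) auto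
  then show ?thesis unfolding reg_kernel_denom of_real_eq_0_iff by linarith
qed

definition reg_kernel_deriv :: "real \<Rightarrow> complex \<Rightarrow> complex \<Rightarrow> complex \<Rightarrow> complex" where
  "reg_kernel_deriv e a z v = (let u = z - a; c = cnj u; D = u * c + of_real (e\<^sup>2) in
     (cnj v * D - c * (v * c + u * cnj v)) / D\<^sup>2)"

lemma c1on_reg_kernel:
  assumes "e > 0" shows "c1on UNIV (reg_kernel e a) (reg_kernel_deriv e a)"
proof -
  have cn: "((\<lambda>z. cnj (z - a)) has_derivative cnj) (at z)" for z
  proof -
    have "((\<lambda>z. z - a) has_derivative (\<lambda>v. v)) (at z)" by (auto intro!: derivative_eq_intros)
    from bounded_linear.has_derivative[OF bounded_linear_cnj this] show ?thesis by simp
  qed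
  have "(reg_kernel e a has_derivative reg_kernel_deriv e a z) (at z)" for z
  proof -
    let ?D = "\<lambda>z. (z - a) * cnj (z - a) + of_real (e\<^sup>2)"
    have D: "(?D has_derivative (\<lambda>v. v * cnj (z - a) + (z - a) * cnj v)) (at z)"
      using cn by (auto intro!: derivative_eq_intros simp: algebra_simps)
    have nz: "?D z \<noteq> 0" by (rule reg_kernel_denom_nz[OF assms])
    have "((\<lambda>z. cnj (z - a) / ?D z) has_derivative
        (\<lambda>h. (cnj h * ?D z - cnj (z - a) * (h * cnj (z - a) + (z - a) * cnj h)) / (?D z * ?D z))) (at z)"
      by (rule has_derivative_divide'[OF cn D nz])
    then show ?thesis unfolding reg_kernel_def[abs_def] reg_kernel_deriv_def[abs_def] Let_def power2_eq_square[of "_ + _"] .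
  qed
  moreover have "continuous_on UNIV (\<lambda>z. reg_kernel_deriv e a z v)" for v
    unfolding reg_kernel_deriv_def Let_def using reg_kernel_denom_nz[OF assms]
    by (intro continuous_intros) auto
  ultimately show ?thesis by (simp add: c1on_def)
qed

text \<open>For a real-linear \<open>L\<close> the combination \<open>\<i> * L 1 - L \<i>\<close>
  kills the complex-linear part; it is \<open>2 * \<i>\<close> times the derivative with respect to
  \<open>cnj z\<close>. What it leaves of the regularised kernel concentrates at \<open>a\<close> as
  \<open>e\<close> tends to 0.\<close>

lemma reg_kernel_dbar:
  "\<i> * reg_kernel_deriv e a z 1 - reg_kernel_deriv e a z \<i>
    = 2 * \<i> * of_real (e\<^sup>2) / ((z - a) * cnj (z - a) + of_real (e\<^sup>2))\<^sup>2"
proof -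
  define u c D where "u = z - a" and "c = cnj u" and "D = u * c + of_real (e\<^sup>2)"
  have "\<i> * reg_kernel_deriv e a z 1 - reg_kernel_deriv e a z \<i>
     = (\<i> * (D - c * (c + u)) - (- \<i> * D - c * (\<i> * c - \<i> * u))) / D\<^sup>2"
    unfolding reg_kernel_deriv_def Let_def u_def[symmetric] c_def[symmetric] D_def[symmetric]
    by (simp add: divide_inverse algebra_simps)
  also have "\<i> * (D - c * (c + u)) - (- \<i> * D - c * (\<i> * c - \<i> * u)) = 2 * \<i> * (D - u * c)"
    by (simp add: algebra_simps)
  also have "D - u * c = of_real (e\<^sup>2)" by (simp add: D_def)
  finally show ?thesis by (simp add: u_def c_def D_def)
qed

lemma norm_reg_kernel_le: "norm (reg_kernel e a z) \<le> 1 / norm (z - a)"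
proof (cases "z = a")
  case False
  have "norm (reg_kernel e a z) = norm (z - a) / ((norm (z - a))\<^sup>2 + e\<^sup>2)"
    unfolding reg_kernel_def reg_kernel_denom norm_divide norm_of_real by (simp only: complex_mod_cnj) simp
  also have "\<dots> \<le> norm (z - a) / (norm (z - a))\<^sup>2"
    using False by (intro divide_left_mono) (auto intro!: mult_pos_pos add_pos_nonneg)
  also have "\<dots> = 1 / norm (z - a)" by (simp add: power2_eq_square)
  finally show ?thesis .
qed (simp add: reg_kernel_def)

text \<open>The derivative of \<open>G\<close> times the regularised kernel integrates to zero. By
  the product rule it consists of a term that converges to the integral of the dbar-derivative of
  \<open>G\<close> against \<open>1 / (z - a)\<close>, and of a concentrating term that converges to
  a multiple of \<open>G a\<close>.\<close>

lemma pompeiu: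
  assumes G: "c1on UNIV G G'" and supp: "\<And>z. z \<notin> cball 0 R \<Longrightarrow> G z = 0"
  shows "integrable lborel (\<lambda>z. (\<i> * G' z 1 - G' z \<i>) / (z - a))" (is ?I)
    and "integral\<^sup>L lborel (\<lambda>z. (\<i> * G' z 1 - G' z \<i>) / (z - a)) = - 2 * \<i> * of_real kappa * G a" (is ?E)
proof -
  define g where "g z = \<i> * G' z 1 - G' z \<i>" for z
  have G'0: "G' z v = 0" if "z \<notin> cball 0 R" for z v by (rule c1on_deriv_zero[OF G supp that])
  have contg: "continuous_on UNIV g" unfolding g_def
    by (intro continuous_intros c1on_continuous_deriv[OF G])
  have contG: "continuous_on UNIV G" by (rule c1on_continuous[OF G])
  note [measurable] = borel_measurable_continuous_onI[OF contg] borel_measurable_continuous_onI[OF contG]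
  have "bounded (g ` cball 0 R)" "bounded (G ` cball 0 R)"
    by (intro compact_imp_bounded compact_continuous_image continuous_on_subset[OF contg] continuous_on_subset[OF contG] compact_cball subset_UNIV)+
  then obtain C M where C0: "\<And>z. z \<in> cball 0 R \<Longrightarrow> norm (g z) \<le> C" and M0: "\<And>z. z \<in> cball 0 R \<Longrightarrow> norm (G z) \<le> M"
    unfolding bounded_iff by fastforce
  have g0: "g z = 0" if "z \<notin> cball 0 R" for z using G'0[OF that] by (simp add: g_def)
  have C: "norm (g z) \<le> \<bar>C\<bar>" for z using C0[of z] g0[of z] by (cases "z \<in> cball 0 R") auto
  have M: "norm (G z) \<le> \<bar>M\<bar>" for z using M0[of z] supp[of z] by (cases "z \<in> cball 0 R") auto
  \<comment> \<open>One integrable bound for all regularisations: the ball around \<open>a\<close>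
    contains \<open>cball 0 R\<close>, outside of which \<open>g\<close> vanishes.\<close>
  define bd where "bd z = \<bar>C\<bar> * (indicator (cball a (R + norm a)) z *\<^sub>R (1 / norm (z - a)))" for z
  have intbd: "integrable lborel bd" unfolding bd_def
    by (intro integrable_mult_right integrable_inverse_norm_at)
  have gbd: "norm (g z) * (1 / norm (z - a)) \<le> bd z" for z
  proof (cases "z \<in> cball 0 R")
    case True
    then have "z \<in> cball a (R + norm a)" using norm_triangle_ineq4[of a z] by (simp add: dist_norm)
    moreover have "norm (g z) * (1 / norm (z - a)) \<le> \<bar>C\<bar> * (1 / norm (z - a))"
      by (rule mult_right_mono[OF C]) simp
    ultimately show ?thesis by (simp add: bd_def)
  next
    case False then show ?thesis using g0 by (simp add: bd_def)
  qed
  show ?I unfolding g_def[symmetric]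
  proof (rule Bochner_Integration.integrable_bound[OF intbd])
    show "(\<lambda>z. g z / (z - a)) \<in> borel_measurable lborel" by measurable
    show "AE z in lborel. norm (g z / (z - a)) \<le> norm (bd z)"
      using gbd by (auto intro!: AE_I2 order_trans[OF _ abs_ge_self] simp: norm_divide)
  qed
  define e where "e n = 1 / real (Suc n)" for n
  have e: "e n > 0" for n by (simp add: e_def)
  have e0: "e \<longlonglongrightarrow> 0" unfolding e_def by (rule LIMSEQ_Suc[OF lim_1_over_n])
  define D where "D n z = (z - a) * cnj (z - a) + of_real ((e n)\<^sup>2)" for n z
  \<comment> \<open>Obtained from the vanishing integrals of the derivatives in the directions 1 and
    \<open>\<i>\<close>, combined so that only the dbar-derivatives of the two factors
    survive.\<close>
  have ident: "integral\<^sup>L lborel (\<lambda>z. reg_kernel (e n) a z * g z) = - 2 * \<i> * integral\<^sup>L lborel (\<lambda>z. G z * of_real ((e n)\<^sup>2) / (D n z)\<^sup>2)" for n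
  proof -
    have K: "c1on UNIV (reg_kernel (e n) a) (reg_kernel_deriv (e n) a)" by (rule c1on_reg_kernel[OF e])
    note W = c1on_mult[OF G K]
    have s: "G z * reg_kernel (e n) a z = 0" if "z \<notin> cball 0 R" for z using supp[OF that] by simp
    let ?W' = "\<lambda>z v. G z * reg_kernel_deriv (e n) a z v + G' z v * reg_kernel (e n) a z"
    note z = integral_derivative_zero[OF W s]
    have "0 = \<i> * integral\<^sup>L lborel (\<lambda>z. ?W' z 1) - integral\<^sup>L lborel (\<lambda>z. ?W' z \<i>)" using z(2) by simp
    also have "\<dots> = integral\<^sup>L lborel (\<lambda>z. \<i> * ?W' z 1 - ?W' z \<i>)"
      using z(1) by simp
    also have "(\<lambda>z. \<i> * ?W' z 1 - ?W' z \<i>) = (\<lambda>z. reg_kernel (e n) a z * g z + 2 * \<i> * (G z * of_real ((e n)\<^sup>2) / (D n z)\<^sup>2))"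
    proof
      fix z
      have "\<i> * ?W' z 1 - ?W' z \<i> = reg_kernel (e n) a z * g z + G z * (\<i> * reg_kernel_deriv (e n) a z 1 - reg_kernel_deriv (e n) a z \<i>)"
        by (simp add: g_def algebra_simps)
      then show "\<i> * ?W' z 1 - ?W' z \<i> = reg_kernel (e n) a z * g z + 2 * \<i> * (G z * of_real ((e n)\<^sup>2) / (D n z)\<^sup>2)"
        unfolding reg_kernel_dbar D_def by simp
    qed
    also have "integral\<^sup>L lborel \<dots> = integral\<^sup>L lborel (\<lambda>z. reg_kernel (e n) a z * g z) + 2 * \<i> * integral\<^sup>L lborel (\<lambda>z. G z * of_real ((e n)\<^sup>2) / (D n z)\<^sup>2)"
    proof -
      have i1: "integrable lborel (\<lambda>z. reg_kernel (e n) a z * g z)"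
        by (rule integrable_continuous_compact_support[of _ R])
           (auto intro!: continuous_intros contg c1on_continuous[OF K] simp: g0)
      have i2: "integrable lborel (\<lambda>z. G z * of_real ((e n)\<^sup>2) / (D n z)\<^sup>2)"
        unfolding D_def by (rule integrable_continuous_compact_support[of _ R])
           (use reg_kernel_denom_nz[OF e] supp in \<open>auto intro!: continuous_intros contG\<close>)
      show ?thesis
        using Bochner_Integration.integral_add[OF i1 integrable_mult_right[OF i2, of "2 * \<i>"]]
        by (simp only: integral_mult_right_zero)
    qed
    finally show ?thesis by (simp add: add_eq_0_iff algebra_simps)
  qed
  have lim1: "(\<lambda>n. integral\<^sup>L lborel (\<lambda>z. reg_kernel (e n) a z * g z)) \<longlonglongrightarrow> integral\<^sup>L lborel (\<lambda>z. g z / (z - a))"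
  proof (rule integral_dominated_convergence[OF _ _ intbd])
    show "(\<lambda>z. g z / (z - a)) \<in> borel_measurable lborel" by measurable
    have "(\<lambda>z. reg_kernel (e n) a z * g z) \<in> borel_measurable borel" for n
      by (intro borel_measurable_continuous_onI continuous_intros contg c1on_continuous[OF c1on_reg_kernel[OF e]])
    then show "(\<lambda>z. reg_kernel (e n) a z * g z) \<in> borel_measurable lborel" for n by simp
    show "AE z in lborel. norm (reg_kernel (e n) a z * g z) \<le> bd z" for n
    proof (rule AE_I2)
      fix z
      have "norm (reg_kernel (e n) a z * g z) \<le> (1 / norm (z - a)) * norm (g z)"
        unfolding norm_mult by (rule mult_right_mono[OF norm_reg_kernel_le]) simp
      then show "norm (reg_kernel (e n) a z * g z) \<le> bd z" using gbd[of z] by (simp add: mult.commute)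
    qed
    show "AE z in lborel. (\<lambda>n. reg_kernel (e n) a z * g z) \<longlonglongrightarrow> g z / (z - a)"
    proof (rule AE_I2)
      fix z
      show "(\<lambda>n. reg_kernel (e n) a z * g z) \<longlonglongrightarrow> g z / (z - a)"
      proof (cases "z = a")
        case False
        have "(\<lambda>n. cnj (z - a) / ((z - a) * cnj (z - a) + of_real ((e n)\<^sup>2))) \<longlonglongrightarrow> cnj (z - a) / ((z - a) * cnj (z - a) + of_real (0\<^sup>2))"
          using False by (intro tendsto_intros e0) auto
        also have "cnj (z - a) / ((z - a) * cnj (z - a) + of_real (0\<^sup>2)) = 1 / (z - a)"
          using False by (simp add: divide_simps)
        finally have "(\<lambda>n. reg_kernel (e n) a z) \<longlonglongrightarrow> 1 / (z - a)" by (simp add: reg_kernel_def)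
        from tendsto_mult[OF this tendsto_const[of "g z"]] show ?thesis by simp
      qed (simp add: reg_kernel_def)
    qed
  qed
  \<comment> \<open>The substitution \<open>z = a + e n *\<^sub>R u\<close> turns the concentrating
    factor into the fixed density of \<open>kappa\<close> and moves the dependence on
    \<open>n\<close> into the argument of \<open>G\<close>.\<close>
  have scaled: "integral\<^sup>L lborel (\<lambda>z. G z * of_real ((e n)\<^sup>2) / (D n z)\<^sup>2)
      = integral\<^sup>L lborel (\<lambda>u. G (a + e n *\<^sub>R u) * of_real (1 / (1 + (norm u)\<^sup>2)\<^sup>2))" for n
  proof -
    have "(\<lambda>z. G z * of_real ((e n)\<^sup>2) / (D n z)\<^sup>2) \<in> borel_measurable borel"
      unfolding D_def using reg_kernel_denom_nz[OF e] by (intro borel_measurable_continuous_onI continuous_intros contG) auto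
    from lborel_scale[OF this e[of n], of a]
    have "integral\<^sup>L lborel (\<lambda>z. G z * of_real ((e n)\<^sup>2) / (D n z)\<^sup>2)
      = integral\<^sup>L lborel (\<lambda>u. (e n)\<^sup>2 *\<^sub>R (G (a + e n *\<^sub>R u) * of_real ((e n)\<^sup>2) / (D n (a + e n *\<^sub>R u))\<^sup>2))" .
    moreover have "(e n)\<^sup>2 *\<^sub>R (G (a + e n *\<^sub>R u) * of_real ((e n)\<^sup>2) / (D n (a + e n *\<^sub>R u))\<^sup>2)
        = G (a + e n *\<^sub>R u) * of_real (1 / (1 + (norm u)\<^sup>2)\<^sup>2)" for u
    proof -
      define E N where "E = complex_of_real ((e n)\<^sup>2)" and "N = complex_of_real (1 + (norm u)\<^sup>2)"
      have D: "D n (a + e n *\<^sub>R u) = E * N"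
        unfolding D_def reg_kernel_denom E_def N_def of_real_mult[symmetric] of_real_eq_iff
        using e[of n] by (simp add: power_mult_distrib algebra_simps)
      have "E \<noteq> 0" using e[of n] by (simp add: E_def)
      then have "E * (G (a + e n *\<^sub>R u) * E / (E * N)\<^sup>2) = G (a + e n *\<^sub>R u) * (1 / N\<^sup>2)"
        by (simp add: power2_eq_square)
      then show ?thesis unfolding D by (simp add: scaleR_conv_of_real E_def N_def)
    qed
    ultimately show ?thesis by (simp only:)
  qed
  have lim2: "(\<lambda>n. integral\<^sup>L lborel (\<lambda>u. G (a + e n *\<^sub>R u) * of_real (1 / (1 + (norm u)\<^sup>2)\<^sup>2)))
      \<longlonglongrightarrow> integral\<^sup>L lborel (\<lambda>u::complex. G a * of_real (1 / (1 + (norm u)\<^sup>2)\<^sup>2))"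
  proof (rule integral_dominated_convergence[where w = "\<lambda>u. \<bar>M\<bar> * (1 / (1 + (norm u)\<^sup>2)\<^sup>2)"])
    show "integrable lborel (\<lambda>u::complex. \<bar>M\<bar> * (1 / (1 + (norm u)\<^sup>2)\<^sup>2))"
      by (intro integrable_mult_right integrable_pompeiu_kernel)
    show "(\<lambda>u::complex. G a * of_real (1 / (1 + (norm u)\<^sup>2)\<^sup>2)) \<in> borel_measurable lborel" by measurable
    show "(\<lambda>u. G (a + e n *\<^sub>R u) * of_real (1 / (1 + (norm u)\<^sup>2)\<^sup>2)) \<in> borel_measurable lborel" for n
      by measurable
    show "AE u in lborel. norm (G (a + e n *\<^sub>R u) * of_real (1 / (1 + (norm u)\<^sup>2)\<^sup>2)) \<le> \<bar>M\<bar> * (1 / (1 + (norm u)\<^sup>2)\<^sup>2)" for n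
      unfolding norm_mult norm_of_real by (intro AE_I2 mult_mono M) auto
    show "AE u in lborel. (\<lambda>n. G (a + e n *\<^sub>R u) * of_real (1 / (1 + (norm u)\<^sup>2)\<^sup>2)) \<longlonglongrightarrow> G a * of_real (1 / (1 + (norm u)\<^sup>2)\<^sup>2)"
    proof (rule AE_I2)
      fix u
      have "(\<lambda>n. a + e n *\<^sub>R u) \<longlonglongrightarrow> a + 0 *\<^sub>R u" by (intro tendsto_intros e0)
      then have "(\<lambda>n. a + e n *\<^sub>R u) \<longlonglongrightarrow> a" by simp
      then have "(\<lambda>n. G (a + e n *\<^sub>R u)) \<longlonglongrightarrow> G a"
        using continuous_on_tendsto_compose[OF contG] by simp
      then show "(\<lambda>n. G (a + e n *\<^sub>R u) * of_real (1 / (1 + (norm u)\<^sup>2)\<^sup>2)) \<longlonglongrightarrow> G a * of_real (1 / (1 + (norm u)\<^sup>2)\<^sup>2)"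
        by (rule tendsto_mult[OF _ tendsto_const])
    qed
  qed
  have "integral\<^sup>L lborel (\<lambda>u. G a * of_real (1 / (1 + (norm (u::complex))\<^sup>2)\<^sup>2)) = G a * of_real kappa"
    by (simp only: integral_mult_right_zero integral_complex_of_real kappa_def)
  then have "(\<lambda>n. - 2 * \<i> * integral\<^sup>L lborel (\<lambda>z. G z * of_real ((e n)\<^sup>2) / (D n z)\<^sup>2)) \<longlonglongrightarrow> - 2 * \<i> * (G a * of_real kappa)"
    unfolding scaled using lim2 by (intro tendsto_intros) simp
  then have "integral\<^sup>L lborel (\<lambda>z. g z / (z - a)) = - 2 * \<i> * (G a * of_real kappa)"
    using lim1 unfolding ident by (rule LIMSEQ_unique[rotated])
  then show ?E by (simp add: g_def)
qed

section \<open>The dual form of an arc in the plane\<close>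

lemma max_power_deriv:
  "((\<lambda>x::real. (max 0 x) ^ Suc (Suc n)) has_real_derivative real (Suc (Suc n)) * (max 0 x) ^ Suc n) (at x)"
proof -
  consider "x > 0" | "x < 0" | "x = 0" by linarith
  then show ?thesis
  proof cases
    case 1
    have "((\<lambda>x. x ^ Suc (Suc n)) has_real_derivative real (Suc (Suc n)) * x ^ Suc n) (at x)"
      using DERIV_pow[of "Suc (Suc n)" x] by simp
    then have "((\<lambda>x. (max 0 x) ^ Suc (Suc n)) has_real_derivative real (Suc (Suc n)) * x ^ Suc n) (at x)"
      by (rule has_field_derivative_transform_within_open[of _ _ _ "{0<..}"]) (use 1 in auto)
    then show ?thesis using 1 by simp
  next
    case 2
    have "((\<lambda>x. (max 0 x) ^ Suc (Suc n)) has_real_derivative 0) (at x)"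
      by (rule has_field_derivative_transform_within_open[of "\<lambda>_. 0" _ _ "{..<0}"]) (use 2 in auto)
    then show ?thesis using 2 by simp
  next
    case 3
    have "((\<lambda>h::real. ((max 0 (0 + h)) ^ Suc (Suc n) - (max 0 0) ^ Suc (Suc n)) / h) \<longlongrightarrow> 0) (at 0)"
    proof (rule Lim_null_comparison)
      have "norm ((max 0 (0 + h) ^ Suc (Suc n) - max 0 0 ^ Suc (Suc n)) / h) \<le> \<bar>h\<bar> ^ Suc n" for h :: real
        by (cases "h > 0") (auto simp: max_def intro!: mult_nonpos_nonneg zero_le_power)
      then show "\<forall>\<^sub>F h in at 0. norm ((max 0 (0 + h) ^ Suc (Suc n) - max 0 0 ^ Suc (Suc n)) / h) \<le> \<bar>h\<bar> ^ Suc n"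
        for h :: real by simp
      have "((\<lambda>h::real. \<bar>h\<bar> ^ Suc n) \<longlongrightarrow> \<bar>0\<bar> ^ Suc n) (at 0)" by (intro tendsto_intros)
      then show "((\<lambda>h::real. \<bar>h\<bar> ^ Suc n) \<longlongrightarrow> 0) (at 0)" by simp
    qed
    then show ?thesis using 3 by (simp add: has_field_derivative_iff)
  qed
qed

text \<open>A quotient \<open>Bf / (Af + Bf)\<close> of cubic truncated powers, with
  \<open>Af\<close> zero left of \<open>a\<close> and \<open>Bf\<close> zero right of
  \<open>b\<close>, so that the denominator never vanishes. Cubes leave a continuous second
  derivative: the first derivative of the bump becomes a coefficient of a function that must be of
  class C1.\<close>

lemma smoothstep:
  assumes ab: "a < (b::real)"
  shows "\<exists>s s1 s2::real \<Rightarrow> real. (\<forall>x. (s has_real_derivative s1 x) (at x)) \<and>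
    (\<forall>x. (s1 has_real_derivative s2 x) (at x)) \<and> continuous_on UNIV s2 \<and>
    (\<forall>x. 0 \<le> s x \<and> s x \<le> 1) \<and> (\<forall>x\<le>a. s x = 1 \<and> s1 x = 0) \<and> (\<forall>x\<ge>b. s x = 0 \<and> s1 x = 0)"
proof -
  define M1 M2 M3 where "M1 x = max 0 (x::real)" and "M2 x = (max 0 (x::real)) ^ 2" and "M3 x = (max 0 (x::real)) ^ 3" for x
  have M3: "(M3 has_real_derivative 3 * M2 x) (at x)" for x
    using max_power_deriv[of 1 x] by (simp add: M3_def[abs_def] M2_def numeral_3_eq_3 numeral_2_eq_2)
  have M2: "(M2 has_real_derivative 2 * M1 x) (at x)" for x
    using max_power_deriv[of 0 x] by (simp add: M2_def[abs_def] M1_def numeral_2_eq_2)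
  have cM: "continuous_on UNIV (\<lambda>x. M1 (f x))" "continuous_on UNIV (\<lambda>x. M2 (f x))" "continuous_on UNIV (\<lambda>x. M3 (f x))"
    if "continuous_on UNIV f" for f
    unfolding M1_def M2_def M3_def by (intro continuous_intros that)+
  define Af A1 A2 where "Af x = M3 (x - a)" and "A1 x = 3 * M2 (x - a)" and "A2 x = 6 * M1 (x - a)" for x
  define Bf B1 B2 where "Bf x = M3 (b - x)" and "B1 x = - 3 * M2 (b - x)" and "B2 x = 6 * M1 (b - x)" for x
  have lin: "((\<lambda>x. x - a) has_real_derivative 1) (at x)" "((\<lambda>x. b - x) has_real_derivative - 1) (at x)" for x
    by (auto intro!: derivative_eq_intros)
  have dA: "(Af has_real_derivative A1 x) (at x)" "(A1 has_real_derivative A2 x) (at x)" for x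
    using DERIV_chain2[OF M3 lin(1), of x] DERIV_cmult[OF DERIV_chain2[OF M2 lin(1)], of 3 x]
    unfolding Af_def[abs_def] A1_def[abs_def] A2_def by simp_all
  have dB: "(Bf has_real_derivative B1 x) (at x)" "(B1 has_real_derivative B2 x) (at x)" for x
    using DERIV_chain2[OF M3 lin(2), of x] DERIV_cmult[OF DERIV_chain2[OF M2 lin(2)], of "-3" x]
    unfolding Bf_def[abs_def] B1_def[abs_def] B2_def by simp_all
  have A0: "Af x = 0" "A1 x = 0" if "x \<le> a" for x using that by (auto simp: Af_def A1_def M3_def M2_def)
  have B0: "Bf x = 0" "B1 x = 0" if "x \<ge> b" for x using that by (auto simp: Bf_def B1_def M3_def M2_def)
  have nn: "Af x \<ge> 0" "Bf x \<ge> 0" for x by (auto simp: Af_def Bf_def M3_def)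
  have pos: "Af x + Bf x > 0" for x
  proof (cases "x > a")
    case True then have "Af x > 0" by (simp add: Af_def M3_def)
    then show ?thesis using nn[of x] by linarith
  next
    case False then have "Bf x > 0" using ab by (simp add: Bf_def M3_def)
    then show ?thesis using nn[of x] by linarith
  qed
  then have nz: "Af x + Bf x \<noteq> 0" for x by (metis less_irrefl)
  define s s1 s2 where "s x = Bf x / (Af x + Bf x)"
    and "s1 x = (B1 x * Af x - Bf x * A1 x) / (Af x + Bf x) ^ 2"
    and "s2 x = ((B2 x * Af x - Bf x * A2 x) * (Af x + Bf x) ^ 2
        - (B1 x * Af x - Bf x * A1 x) * (2 * (Af x + Bf x) * (A1 x + B1 x))) / ((Af x + Bf x) ^ 2 * (Af x + Bf x) ^ 2)" for x
  have "(s has_real_derivative s1 x) (at x)" for x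
  proof -
    have "(s has_real_derivative (B1 x * (Af x + Bf x) - Bf x * (A1 x + B1 x)) / ((Af x + Bf x) * (Af x + Bf x))) (at x)"
      unfolding s_def[abs_def] by (rule DERIV_divide[OF dB(1) DERIV_add[OF dA(1) dB(1)] nz])
    then show ?thesis by (simp add: s1_def power2_eq_square algebra_simps)
  qed
  moreover have "(s1 has_real_derivative s2 x) (at x)" for x
  proof -
    have n: "((\<lambda>x. B1 x * Af x - Bf x * A1 x) has_real_derivative B2 x * Af x - Bf x * A2 x) (at x)"
      by (rule derivative_eq_intros dA dB refl)+ (simp add: algebra_simps)
    have d: "((\<lambda>x. (Af x + Bf x) ^ 2) has_real_derivative 2 * (Af x + Bf x) * (A1 x + B1 x)) (at x)"
      by (rule derivative_eq_intros dA dB refl)+ (simp add: algebra_simps)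
    show ?thesis unfolding s1_def[abs_def] s2_def
      by (rule DERIV_divide[OF n d]) (use nz in simp)
  qed
  moreover have "continuous_on UNIV s2"
    unfolding s2_def Af_def Bf_def A1_def B1_def A2_def B2_def
    using nz unfolding Af_def Bf_def by (intro continuous_intros cM) auto
  moreover have "0 \<le> s x \<and> s x \<le> 1" for x using nn[of x] pos[of x] by (simp add: s_def divide_le_eq)
  moreover have "s x = 1 \<and> s1 x = 0" if "x \<le> a" for x using A0[OF that] nz[of x] by (simp add: s_def s1_def)
  moreover have "s x = 0 \<and> s1 x = 0" if "x \<ge> b" for x using B0[OF that] by (simp add: s_def s1_def)
  ultimately show ?thesis by blast
qed

text \<open>\<open>\<psi>1\<close> and \<open>\<psi>2\<close> are the first and second derivatives.
  The symmetry of \<open>\<psi>2\<close> says that d\<psi> is closed; it makes the second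
  derivatives cancel in \<open>local_dual_pairing\<close>.\<close>

definition bump :: "complex \<Rightarrow> real \<Rightarrow> real \<Rightarrow> (complex \<Rightarrow> complex) \<Rightarrow> (complex \<Rightarrow> complex \<Rightarrow> complex) \<Rightarrow>
    (complex \<Rightarrow> complex \<Rightarrow> complex \<Rightarrow> complex) \<Rightarrow> bool" where
  "bump z0 r1 r2 \<psi> \<psi>1 \<psi>2 \<longleftrightarrow> c1on UNIV \<psi> \<psi>1 \<and> (\<forall>v. c1on UNIV (\<lambda>z. \<psi>1 z v) (\<lambda>z w. \<psi>2 z v w)) \<and>
     (\<forall>z v w. \<psi>2 z v w = \<psi>2 z w v) \<and> (\<forall>z. \<exists>t. \<psi> z = of_real t \<and> 0 \<le> t \<and> t \<le> 1) \<and>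
     (\<forall>z. dist z0 z \<le> r1 \<longrightarrow> \<psi> z = 1 \<and> (\<forall>v. \<psi>1 z v = 0)) \<and>
     (\<forall>z. r2 \<le> dist z0 z \<longrightarrow> \<psi> z = 0 \<and> (\<forall>v. \<psi>1 z v = 0))"

lemma bump_exists:
  assumes "0 < r1" "r1 < r2" shows "\<exists>\<psi> \<psi>1 \<psi>2. bump z0 r1 r2 \<psi> \<psi>1 \<psi>2"
proof -
  have "r1\<^sup>2 < r2\<^sup>2" using assms by (intro power_strict_mono) auto
  then obtain s s1 s2 :: "real \<Rightarrow> real" where s: "\<And>x. (s has_real_derivative s1 x) (at x)"
    "\<And>x. (s1 has_real_derivative s2 x) (at x)" "continuous_on UNIV s2"
    "\<And>x. 0 \<le> s x \<and> s x \<le> 1" "\<And>x. x \<le> r1\<^sup>2 \<Longrightarrow> s x = 1 \<and> s1 x = 0" "\<And>x. x \<ge> r2\<^sup>2 \<Longrightarrow> s x = 0 \<and> s1 x = 0"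
    using smoothstep by metis
  \<comment> \<open>The squared distance, since it is smooth also at the centre; the radii therefore
    enter squared.\<close>
  define N where "N z = (z - z0) \<bullet> (z - z0)" for z :: complex
  define \<psi> :: "complex \<Rightarrow> complex" where "\<psi> z = of_real (s (N z))" for z
  define \<psi>1 :: "complex \<Rightarrow> complex \<Rightarrow> complex" where "\<psi>1 z v = of_real (s1 (N z) * (2 * ((z - z0) \<bullet> v)))" for z v
  define \<psi>2 :: "complex \<Rightarrow> complex \<Rightarrow> complex \<Rightarrow> complex" where
    "\<psi>2 z v w = of_real (s2 (N z) * (2 * ((z - z0) \<bullet> w)) * (2 * ((z - z0) \<bullet> v)) + s1 (N z) * (2 * (w \<bullet> v)))" for z v w
  have dN: "(N has_derivative (\<lambda>v. 2 * ((z - z0) \<bullet> v))) (at z)" for z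
    unfolding N_def[abs_def] by (auto intro!: derivative_eq_intros simp: inner_commute)
  have cN: "continuous_on UNIV N" unfolding N_def by (intro continuous_intros)
  have d0: "((\<lambda>z. s (N z)) has_derivative (\<lambda>v. s1 (N z) * (2 * ((z - z0) \<bullet> v)))) (at z)" for z
    using has_derivative_compose[OF dN s(1)[unfolded has_field_derivative_def]] .
  have d1: "((\<lambda>z. s1 (N z)) has_derivative (\<lambda>v. s2 (N z) * (2 * ((z - z0) \<bullet> v)))) (at z)" for z
    using has_derivative_compose[OF dN s(2)[unfolded has_field_derivative_def]] .
  have cs1: "continuous_on UNIV s1" using s(2) by (meson DERIV_continuous_on has_field_derivative_at_within)
  have c1: "continuous_on UNIV (\<lambda>z. s1 (N z))" "continuous_on UNIV (\<lambda>z. s2 (N z))"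
    using continuous_on_compose2[OF cs1 cN] continuous_on_compose2[OF s(3) cN] by auto
  have "c1on UNIV \<psi> \<psi>1"
    unfolding c1on_def \<psi>_def[abs_def] \<psi>1_def[abs_def]
    using has_derivative_of_real[OF d0] by (auto intro!: continuous_intros c1)
  moreover have "c1on UNIV (\<lambda>z. \<psi>1 z v) (\<lambda>z w. \<psi>2 z v w)" for v
  proof -
    have "((\<lambda>z. s1 (N z) * (2 * ((z - z0) \<bullet> v))) has_derivative
        (\<lambda>w. s2 (N z) * (2 * ((z - z0) \<bullet> w)) * (2 * ((z - z0) \<bullet> v)) + s1 (N z) * (2 * (w \<bullet> v)))) (at z)" for z
      by (rule derivative_eq_intros d1 refl)+ (simp add: algebra_simps)
    from has_derivative_of_real[OF this] show ?thesis
      unfolding c1on_def \<psi>1_def[abs_def] \<psi>2_def[abs_def] by (auto intro!: continuous_intros c1)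
  qed
  moreover have "\<psi>2 z v w = \<psi>2 z w v" for z v w by (simp add: \<psi>2_def inner_commute algebra_simps)
  moreover have "\<exists>t. \<psi> z = of_real t \<and> 0 \<le> t \<and> t \<le> 1" for z using s(4) by (auto simp: \<psi>_def)
  moreover have NN: "N z = (dist z0 z)\<^sup>2" for z by (simp add: N_def dist_norm norm_minus_commute[of z0] power2_norm_eq_inner)
  moreover have "\<psi> z = 1 \<and> (\<forall>v. \<psi>1 z v = 0)" if "dist z0 z \<le> r1" for z
  proof -
    have "N z \<le> r1\<^sup>2" unfolding NN using that by (intro power_mono) auto
    then show ?thesis using s(5) by (simp add: \<psi>_def \<psi>1_def)
  qed
  moreover have "\<psi> z = 0 \<and> (\<forall>v. \<psi>1 z v = 0)" if "r2 \<le> dist z0 z" for z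
  proof -
    have "N z \<ge> r2\<^sup>2" unfolding NN using that assms by (intro power_mono) auto
    then show ?thesis using s(6) by (simp add: \<psi>_def \<psi>1_def)
  qed
  ultimately have "bump z0 r1 r2 \<psi> \<psi>1 \<psi>2" unfolding bump_def by blast
  then show ?thesis by blast
qed

text \<open>Up to a constant this is the branch of \<open>log ((z - q) / (z - p))\<close> cut along an arc \<open>\<alpha>\<close> from \<open>p\<close> to \<open>q\<close>;
  \<open>arc_pole\<close> is its derivative.\<close>

definition arc_log :: "(real \<Rightarrow> complex) \<Rightarrow> complex \<Rightarrow> complex" where
  "arc_log \<alpha> z = contour_integral \<alpha> (\<lambda>\<zeta>. 1 / (\<zeta> - z))"

definition arc_pole :: "(real \<Rightarrow> complex) \<Rightarrow> complex \<Rightarrow> complex" where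
  "arc_pole \<alpha> z = 1 / (z - pathfinish \<alpha>) - 1 / (z - pathstart \<alpha>)"

lemma C1_valid_path: "\<alpha> C1_differentiable_on {0..1} \<Longrightarrow> valid_path \<alpha>"
  by (simp add: valid_path_def C1_differentiable_imp_piecewise)

text \<open>Differentiation under the integral leaves the integrand
  \<open>1 / (u - z)\<^sup>2\<close>, which has the primitive \<open>- 1 / (u - z)\<close> along the
  arc and so sees only the two ends.\<close>

lemma arc_log_deriv:
  assumes \<alpha>: "\<alpha> C1_differentiable_on {0..1}" and z: "z \<notin> path_image \<alpha>"
  shows "(arc_log \<alpha> has_field_derivative arc_pole \<alpha> z) (at z)"
proof -
  note v = C1_valid_path[OF \<alpha>]
  have "continuous_on {0..1} (\<lambda>t. vector_derivative \<alpha> (at t))"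
    using \<alpha> by (simp add: C1_differentiable_on_eq)
  then have "bounded ((\<lambda>t. vector_derivative \<alpha> (at t)) ` {0..1})"
    by (intro compact_imp_bounded compact_continuous_image) auto
  then obtain B where "\<forall>x\<in>(\<lambda>t. vector_derivative \<alpha> (at t)) ` {0..1}. norm x \<le> B"
    unfolding bounded_iff by blast
  then have B: "\<And>t. t \<in> {0..1} \<Longrightarrow> norm (vector_derivative \<alpha> (at t)) \<le> B" by blast
  have int: "((\<lambda>u. 1 / (u - w) ^ 1) has_contour_integral arc_log \<alpha> w) \<alpha>" if "w \<in> UNIV - path_image \<alpha>" for w
    using contour_integrable_inversediff[OF v, of w] that unfolding arc_log_def
    by (simp add: has_contour_integral_integral)
  have "(arc_log \<alpha> has_field_derivative of_nat 1 * contour_integral \<alpha> (\<lambda>u. 1 / (u - z) ^ Suc 1)) (at z)"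
    by (rule Cauchy_next_derivative(2)[where S = UNIV and f' = "\<lambda>_. 1" and k = 1, OF _ B int _ _ v]) (use z in auto)
  moreover have "((\<lambda>u. 1 / (u - z) ^ Suc 1) has_contour_integral (- 1 / (pathfinish \<alpha> - z) - (- 1 / (pathstart \<alpha> - z)))) \<alpha>"
  proof (rule contour_integral_primitive[where S = "path_image \<alpha>", OF _ v])
    fix u assume "u \<in> path_image \<alpha>"
    then have "u - z \<noteq> 0" using z by auto
    then show "((\<lambda>u. - 1 / (u - z)) has_field_derivative 1 / (u - z) ^ Suc 1) (at u within path_image \<alpha>)"
      by (auto intro!: derivative_eq_intros simp: power2_eq_square)
  qed auto
  then have "contour_integral \<alpha> (\<lambda>u. 1 / (u - z) ^ Suc 1) = - 1 / (pathfinish \<alpha> - z) - (- 1 / (pathstart \<alpha> - z))"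
    by (rule contour_integral_unique)
  moreover have "- 1 / (pathfinish \<alpha> - z) - (- 1 / (pathstart \<alpha> - z)) = arc_pole \<alpha> z"
  proof -
    have "- 1 / (w - z) = 1 / (z - w)" for w
      using minus_divide_divide[of 1 "z - w"] by (simp only: minus_diff_eq)
    then show ?thesis by (simp only: arc_pole_def)
  qed
  ultimately show ?thesis by simp
qed

lemma c1on_arc_log:
  assumes \<alpha>: "\<alpha> C1_differentiable_on {0..1}"
  shows "c1on (- path_image \<alpha>) (arc_log \<alpha>) (\<lambda>z v. arc_pole \<alpha> z * v)"
  unfolding c1on_def
proof (intro conjI ballI allI)
  show "open (- path_image \<alpha>)" using closed_valid_path_image[OF C1_valid_path[OF \<alpha>]] by (simp add: open_Compl)
  show "(arc_log \<alpha> has_derivative (\<lambda>v. arc_pole \<alpha> z * v)) (at z)" if "z \<in> - path_image \<alpha>" for z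
    using arc_log_deriv[OF \<alpha>, of z] that by (simp add: has_field_derivative_def)
  show "continuous_on (- path_image \<alpha>) (\<lambda>z. arc_pole \<alpha> z * v)" for v
    unfolding arc_pole_def by (intro continuous_intros) auto
qed

text \<open>Off the arc this is the derivative of \<open>\<psi> z * arc_log \<alpha> z\<close>. The
  expanded form makes sense on the interior of the arc too: there the discontinuous factor
  \<open>arc_log\<close> meets \<open>\<psi>1 = 0\<close>.\<close>

definition arc_form :: "(complex \<Rightarrow> complex) \<Rightarrow> (complex \<Rightarrow> complex \<Rightarrow> complex) \<Rightarrow> (real \<Rightarrow> complex) \<Rightarrow> complex \<Rightarrow> complex \<Rightarrow> complex" where
  "arc_form \<psi> \<psi>1 \<alpha> z v = \<psi> z * arc_pole \<alpha> z * v + arc_log \<alpha> z * \<psi>1 z v"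

text \<open>Adding and subtracting the term \<open>G * arc_pole\<close> wedge d\<psi> splits the
  integrand in two: \<open>arc_pole\<close> times the dbar-derivative of \<open>G * \<psi>\<close>,
  which the Pompeiu formula evaluates at both ends, and the exterior derivative of
  \<open>G * arc_log\<close> times d\<psi>, which integrates to zero.\<close>

lemma local_dual_pairing:
  assumes r: "0 < r1" "r1 < r2" "r2 < r" and bump: "bump z0 r1 r2 \<psi> \<psi>1 \<psi>2"
    and G: "c1on (ball z0 r) G G'" and \<alpha>: "\<alpha> C1_differentiable_on {0..1}" and im: "path_image \<alpha> \<subseteq> ball z0 r1"
  defines "I \<equiv> \<lambda>z. if z \<in> ball z0 r then G' z 1 * arc_form \<psi> \<psi>1 \<alpha> z \<i> - G' z \<i> * arc_form \<psi> \<psi>1 \<alpha> z 1 else 0"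
  shows "integrable lborel I"
    and "integral\<^sup>L lborel I = - 2 * \<i> * of_real kappa * (G (pathfinish \<alpha>) - G (pathstart \<alpha>))"
proof -
  define B where "B = ball z0 r"
  have b: "c1on UNIV \<psi> \<psi>1" "\<And>v. c1on UNIV (\<lambda>z. \<psi>1 z v) (\<lambda>z w. \<psi>2 z v w)" "\<And>z v w. \<psi>2 z v w = \<psi>2 z w v"
    "\<And>z. dist z0 z \<le> r1 \<Longrightarrow> \<psi> z = 1" "\<And>z v. dist z0 z \<le> r1 \<Longrightarrow> \<psi>1 z v = 0"
    "\<And>z. r2 \<le> dist z0 z \<Longrightarrow> \<psi> z = 0" "\<And>z v. r2 \<le> dist z0 z \<Longrightarrow> \<psi>1 z v = 0"
    using bump unfolding bump_def by auto
  have oB: "open B" by (simp add: B_def)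
  define O' where "O' = B - path_image \<alpha>"
  have oO: "open O'" unfolding O'_def using oB closed_valid_path_image[OF C1_valid_path[OF \<alpha>]] by (rule open_Diff)
  define W where "W = (\<lambda>z. if z \<in> B then G z * \<psi> z else 0)"
  define W' where "W' = (\<lambda>z v. if z \<in> B then G z * \<psi>1 z v + G' z v * \<psi> z else 0)"
  have cW: "c1on UNIV W W'" unfolding W_def W'_def
    by (rule c1on_extend_zero[OF c1on_mult[OF _ c1on_subset[OF b(1)]], where K = "cball z0 r2"])
       (use G oB r b in \<open>auto simp: B_def not_le\<close>)
  define R where "R = norm z0 + r"
  have sub: "z \<in> cball 0 R" if "z \<in> B" for z
    using that norm_triangle_ineq2[of z z0] by (auto simp: B_def R_def dist_norm norm_minus_commute)
  have W0: "W z = 0" if "z \<notin> cball 0 R" for z using sub that by (auto simp: W_def)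
  have P: "integrable lborel (\<lambda>z. (\<i> * W' z 1 - W' z \<i>) / (z - a))"
    "integral\<^sup>L lborel (\<lambda>z. (\<i> * W' z 1 - W' z \<i>) / (z - a)) = - 2 * \<i> * of_real kappa * W a" for a
    by (rule pompeiu[OF cW W0], assumption)+
  \<comment> \<open>The factor \<open>\<psi>1\<close> confines these functions to the annulus
    between \<open>r1\<close> and \<open>r2\<close>, away from the arc, so the jump of the logarithm
    does not spoil smoothness.\<close>
  define V where "V v = (\<lambda>z. if z \<in> O' then G z * arc_log \<alpha> z * \<psi>1 z v else 0)" for v
  define V' where "V' v = (\<lambda>z u. if z \<in> O' then (G z * arc_log \<alpha> z) * \<psi>2 z v u +
      (G z * (arc_pole \<alpha> z * u) + G' z u * arc_log \<alpha> z) * \<psi>1 z v else 0)" for v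
  have cV: "c1on UNIV (V v) (V' v)" for v
    unfolding V_def V'_def
  proof (rule c1on_extend_zero[of O' _ _ "cball z0 r2 - ball z0 r1"])
    show "c1on O' (\<lambda>z. G z * arc_log \<alpha> z * \<psi>1 z v) (\<lambda>z u. (G z * arc_log \<alpha> z) * \<psi>2 z v u +
      (G z * (arc_pole \<alpha> z * u) + G' z u * arc_log \<alpha> z) * \<psi>1 z v)"
      by (intro c1on_mult c1on_subset[OF b(2) oO] c1on_subset[OF G oO] c1on_subset[OF c1on_arc_log[OF \<alpha>] oO])
         (auto simp: O'_def B_def)
    show "closed (cball z0 r2 - ball z0 r1)" by (intro closed_Diff) auto
    show "cball z0 r2 - ball z0 r1 \<subseteq> O'" using im r by (auto simp: O'_def B_def)
    show "G z * arc_log \<alpha> z * \<psi>1 z v = 0" if "z \<in> O' - (cball z0 r2 - ball z0 r1)" for z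
      using that b(5)[of z v] b(7)[of z v] by (cases "dist z0 z \<le> r1") auto
  qed
  have V0: "V v z = 0" if "z \<notin> cball 0 R" for z v using sub that by (auto simp: V_def O'_def)
  have ZV: "integrable lborel (\<lambda>z. V' v z u)" "integral\<^sup>L lborel (\<lambda>z. V' v z u) = 0" for v u
    by (rule integral_derivative_zero[OF cV V0], assumption)+
  let ?f = "\<lambda>z. (\<i> * W' z 1 - W' z \<i>) / (z - pathfinish \<alpha>) - (\<i> * W' z 1 - W' z \<i>) / (z - pathstart \<alpha>)"
  let ?g = "\<lambda>z. V' \<i> z 1 - V' 1 z \<i>"
  have I: "I = (\<lambda>z. ?f z + ?g z)"
  proof
    fix z
    have f: "?f z = arc_pole \<alpha> z * (\<i> * W' z 1 - W' z \<i>)" by (simp add: arc_pole_def divide_inverse algebra_simps)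
    show "I z = ?f z + ?g z"
    proof (cases "z \<in> B")
      case False
      then show ?thesis by (simp add: I_def W'_def V'_def O'_def B_def)
    next
      case True
      show ?thesis
      proof (cases "z \<in> O'")
        case O: True
        have "?g z = (G z * arc_pole \<alpha> z + G' z 1 * arc_log \<alpha> z) * \<psi>1 z \<i> - (G z * (arc_pole \<alpha> z * \<i>) + G' z \<i> * arc_log \<alpha> z) * \<psi>1 z 1"
          using O b(3)[of z 1 \<i>] by (simp add: V'_def)
        then show ?thesis unfolding f using True by (simp add: I_def W'_def B_def arc_form_def algebra_simps)
      next
        case O: False
        then have "z \<in> path_image \<alpha>" using True by (simp add: O'_def)
        then have d: "dist z0 z \<le> r1" using im by auto
        have "?g z = 0" using O by (simp add: V'_def)
        then show ?thesis unfolding f using True b(4)[OF d] b(5)[OF d]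
          by (simp add: I_def W'_def B_def arc_form_def algebra_simps)
      qed
    qed
  qed
  have intf: "integrable lborel ?f" and intg: "integrable lborel ?g" using P(1) ZV(1) by auto
  show "integrable lborel I" unfolding I using intf intg by simp
  have "integral\<^sup>L lborel ?f = - 2 * \<i> * of_real kappa * W (pathfinish \<alpha>) - (- 2 * \<i> * of_real kappa * W (pathstart \<alpha>))"
    by (subst Bochner_Integration.integral_diff[OF P(1) P(1)]) (simp only: P(2))
  moreover have "integral\<^sup>L lborel ?g = 0"
    by (subst Bochner_Integration.integral_diff[OF ZV(1) ZV(1)]) (simp add: ZV(2))
  moreover have "W z = G z" if "z \<in> path_image \<alpha>" for z
  proof -
    have "dist z0 z < r1" using im that by auto
    then show ?thesis using r b(4)[of z] by (simp add: W_def B_def)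
  qed
  then have "W (pathfinish \<alpha>) = G (pathfinish \<alpha>)" "W (pathstart \<alpha>) = G (pathstart \<alpha>)" by auto
  ultimately have "integral\<^sup>L lborel ?f + integral\<^sup>L lborel ?g = - 2 * \<i> * of_real kappa * (G (pathfinish \<alpha>) - G (pathstart \<alpha>))"
    by (simp add: algebra_simps)
  then show "integral\<^sup>L lborel I = - 2 * \<i> * of_real kappa * (G (pathfinish \<alpha>) - G (pathstart \<alpha>))"
    unfolding I using Bochner_Integration.integral_add[OF intf intg] by simp
qed

section \<open>Forms and densities on a surface\<close>

text \<open>The identification of the plane with \<open>real^2\<close>, in which the change of
  variables formula is phrased through determinants of matrices.\<close>

definition jv :: "complex \<Rightarrow> real^2" where "jv z = vector [Re z, Im z]"
definition vj :: "real^2 \<Rightarrow> complex" where "vj x = Complex (vec_nth x 1) (vec_nth x 2)"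

lemma vj_jv [simp]: "vj (jv z) = z" by (simp add: vj_def jv_def)
lemma jv_vj [simp]: "jv (vj x) = x" by (simp add: vj_def jv_def vec_eq_iff forall_2)
lemma jv_nth [simp]: "vec_nth (jv z) 1 = Re z" "vec_nth (jv z) 2 = Im z" by (simp_all add: jv_def)

lemma linear_jv: "linear jv" by (rule linearI) (simp_all add: vec_eq_iff forall_2)
lemma linear_vj: "linear vj" by (rule linearI) (simp_all add: vj_def complex_eq_iff)
lemma bl_jv: "bounded_linear jv" using linear_jv by (simp add: linear_conv_bounded_linear)
lemma bl_vj: "bounded_linear vj" using linear_vj by (simp add: linear_conv_bounded_linear)

lemma jv_measurable [measurable]: "jv \<in> borel \<rightarrow>\<^sub>M borel"
  by (rule borel_measurable_continuous_onI[OF linear_continuous_on[OF bl_jv]])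
lemma vj_measurable [measurable]: "vj \<in> borel \<rightarrow>\<^sub>M borel"
  by (rule borel_measurable_continuous_onI[OF linear_continuous_on[OF bl_vj]])

lemma jv_image: "jv ` E = vj -` E"
proof
  show "jv ` E \<subseteq> vj -` E" by auto
  show "vj -` E \<subseteq> jv ` E" by (metis imageI jv_vj subsetI vimage_eq)
qed

lemma lborel_jv: "(lborel :: (real^2) measure) = distr lborel borel jv"
proof (rule lborel_eqI)
  fix l u :: "real^2" assume le: "\<And>b. b \<in> Basis \<Longrightarrow> l \<bullet> b \<le> u \<bullet> b"
  have le': "vec_nth l i \<le> vec_nth u i" for i
    using le[of "axis i 1"] by (simp add: inner_axis axis_in_Basis_iff)
  have "jv -` box l u = box (vj l) (vj u)"
    by (auto simp: set_eq_iff mem_box_cart forall_2 in_box_complex_iff vj_def)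
  then have "emeasure (distr lborel borel jv) (box l u) = emeasure lborel (box (vj l) (vj u))"
    by (simp add: emeasure_distr)
  also have "\<dots> = ennreal ((vec_nth u 1 - vec_nth l 1) * (vec_nth u 2 - vec_nth l 2))"
    using le'[of 1] le'[of 2] by (simp add: emeasure_lborel_box_eq Basis_complex_def vj_def)
  also have "(vec_nth u 1 - vec_nth l 1) * (vec_nth u 2 - vec_nth l 2) = measure lborel (cbox l u)"
    using le' by (subst content_cbox_cart) (auto simp: interval_eq_empty_cart not_less UNIV_2)
  also have "\<dots> = (\<Prod>b\<in>Basis. (u - l) \<bullet> b)"
    using le by (subst content_cbox) (auto simp: inner_diff_left)
  finally show "emeasure (distr lborel borel jv) (box l u) = ennreal (\<Prod>b\<in>Basis. (u - l) \<bullet> b)" .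
qed simp

text \<open>Passes between Lebesgue integrals over the complex plane and gauge integrals over
  \<open>real^2\<close>. Borel measurability makes the completion of the measure harmless.\<close>

lemma integrable_jv_bridge:
  fixes f :: "complex \<Rightarrow> complex"
  assumes F: "(\<lambda>z. indicator E z *\<^sub>R f z) \<in> borel_measurable borel"
  shows "(\<lambda>x. jv (f (vj x))) absolutely_integrable_on jv ` E \<longleftrightarrow> set_integrable lborel E f"
    and "set_integrable lborel E f \<Longrightarrow> integral (jv ` E) (\<lambda>x. jv (f (vj x))) = jv (set_lebesgue_integral lborel E f)"
proof -
  let ?F = "\<lambda>z. indicator E z *\<^sub>R f z"
  note [measurable] = F
  have eq: "(\<lambda>x. indicator (jv ` E) x *\<^sub>R jv (f (vj x))) = (\<lambda>x. jv (?F (vj x)))"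
    by (auto simp: jv_image indicator_def linear_0[OF linear_jv])
  have m: "(\<lambda>x. jv (?F (vj x))) \<in> borel_measurable lborel" by measurable
  have m': "(\<lambda>x. jv (?F (vj x))) \<in> borel_measurable borel" by measurable
  have j: "jv \<in> lborel \<rightarrow>\<^sub>M borel" by measurable
  have iff2: "integrable lborel (\<lambda>z. jv (?F z)) \<longleftrightarrow> integrable lborel ?F"
    using integrable_bounded_linear[OF bl_jv, of lborel ?F]
      integrable_bounded_linear[OF bl_vj, of lborel "\<lambda>z. jv (?F z)"] by auto
  have iff1: "integrable lborel (\<lambda>x. jv (?F (vj x))) \<longleftrightarrow> integrable lborel (\<lambda>z. jv (?F z))"
    by (subst lborel_jv, subst integrable_distr_eq[OF j m']) simp
  have int1: "integral\<^sup>L lborel (\<lambda>x. jv (?F (vj x))) = integral\<^sup>L lborel (\<lambda>z. jv (?F z))"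
    by (subst lborel_jv, subst integral_distr[OF j m']) simp
  have "(\<lambda>x. jv (f (vj x))) absolutely_integrable_on jv ` E \<longleftrightarrow> integrable lebesgue (\<lambda>x. jv (?F (vj x)))"
    unfolding set_integrable_def eq ..
  also have "\<dots> \<longleftrightarrow> integrable lborel (\<lambda>x. jv (?F (vj x)))"
    by (rule integrable_completion[OF m])
  finally show *: "(\<lambda>x. jv (f (vj x))) absolutely_integrable_on jv ` E \<longleftrightarrow> set_integrable lborel E f"
    using iff1 iff2 unfolding set_integrable_def by simp
  show "integral (jv ` E) (\<lambda>x. jv (f (vj x))) = jv (set_lebesgue_integral lborel E f)" if "set_integrable lborel E f"
  proof -
    have a: "(\<lambda>x. jv (f (vj x))) absolutely_integrable_on jv ` E" using * that by simp
    have "integral (jv ` E) (\<lambda>x. jv (f (vj x))) = set_lebesgue_integral lebesgue (jv ` E) (\<lambda>x. jv (f (vj x)))"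
      using set_lebesgue_integral_eq_integral(2)[OF a] by simp
    also have "\<dots> = integral\<^sup>L lebesgue (\<lambda>x. jv (?F (vj x)))"
      unfolding set_lebesgue_integral_def eq ..
    also have "\<dots> = integral\<^sup>L lborel (\<lambda>x. jv (?F (vj x)))" by (rule integral_completion[OF m])
    also have "\<dots> = jv (integral\<^sup>L lborel ?F)"
      unfolding int1 using that unfolding set_integrable_def by (rule integral_bounded_linear[OF bl_jv])
    finally show ?thesis by (simp add: set_lebesgue_integral_def)
  qed
qed

text \<open>The real derivative of a holomorphic map is multiplication by a complex number, whose
  determinant is the square of its modulus.\<close>

lemma change_of_variables_holomorphic:
  fixes f \<tau> :: "complex \<Rightarrow> complex"
  assumes S: "open S" and \<tau>: "\<tau> holomorphic_on S" "inj_on \<tau> S"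
    and m1: "(\<lambda>w. indicator (\<tau> ` S) w *\<^sub>R f w) \<in> borel_measurable borel"
    and m2: "(\<lambda>z. indicator S z *\<^sub>R (of_real ((norm (deriv \<tau> z))\<^sup>2) * f (\<tau> z))) \<in> borel_measurable borel"
  shows "set_integrable lborel S (\<lambda>z. of_real ((norm (deriv \<tau> z))\<^sup>2) * f (\<tau> z)) \<longleftrightarrow> set_integrable lborel (\<tau> ` S) f" (is "?A \<longleftrightarrow> ?B")
    and "set_integrable lborel (\<tau> ` S) f \<Longrightarrow>
       set_lebesgue_integral lborel S (\<lambda>z. of_real ((norm (deriv \<tau> z))\<^sup>2) * f (\<tau> z)) = set_lebesgue_integral lborel (\<tau> ` S) f"
proof -
  let ?h = "\<lambda>z. of_real ((norm (deriv \<tau> z))\<^sup>2) * f (\<tau> z)"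
  define g where "g x = jv (\<tau> (vj x))" for x
  define g' where "g' x = (\<lambda>v. jv (deriv \<tau> (vj x) * vj v))" for x
  have oS: "open (jv ` S)" unfolding jv_image
    using S by (rule open_vimage) (rule linear_continuous_on[OF bl_vj])
  have Sm: "jv ` S \<in> sets lebesgue" using oS by auto
  have der: "(g has_derivative g' x) (at x within jv ` S)" if "x \<in> jv ` S" for x
  proof -
    have "vj x \<in> S" using that by auto
    then have "(\<tau> has_derivative (\<lambda>v. deriv \<tau> (vj x) * v)) (at (vj x))"
      using holomorphic_derivI[OF \<tau>(1) S] by (simp add: has_field_derivative_def)
    from bounded_linear.has_derivative[OF bl_jv has_derivative_compose[OF bounded_linear_imp_has_derivative[OF bl_vj] this]]
    show ?thesis unfolding g_def[abs_def] g'_def by (simp add: has_derivative_at_withinI)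
  qed
  have inj: "inj_on g (jv ` S)"
  proof (rule inj_onI)
    fix x y assume xy: "x \<in> jv ` S" "y \<in> jv ` S" "g x = g y"
    then have "\<tau> (vj x) = \<tau> (vj y)" unfolding g_def by (metis vj_jv)
    moreover have "vj x \<in> S" "vj y \<in> S" using xy by auto
    ultimately have "vj x = vj y" using \<tau>(2) by (simp add: inj_on_eq_iff)
    then show "x = y" by (metis jv_vj)
  qed
  have det: "\<bar>det (matrix (g' x))\<bar> = (norm (deriv \<tau> (vj x)))\<^sup>2" for x
  proof -
    have "vj (axis 1 1) = 1" "vj (axis 2 1) = \<i>" by (simp_all add: vj_def axis_def complex_eq_iff)
    then have "det (matrix (g' x)) = (Re (deriv \<tau> (vj x)))\<^sup>2 + (Im (deriv \<tau> (vj x)))\<^sup>2"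
      by (simp add: det_2 matrix_def g'_def power2_eq_square)
    then show ?thesis by (simp add: cmod_power2)
  qed
  have im: "g ` jv ` S = jv ` \<tau> ` S" by (auto simp: g_def image_iff)
  have eq: "\<bar>det (matrix (g' x))\<bar> *\<^sub>R jv (f (vj (g x))) = jv (?h (vj x))" for x
    unfolding det g_def vj_jv
    using linear_cmul[OF linear_jv, of "(norm (deriv \<tau> (vj x)))\<^sup>2" "f (\<tau> (vj x))"] by (simp add: scaleR_conv_of_real)
  have CV: "(\<lambda>x. jv (?h (vj x))) absolutely_integrable_on jv ` S \<and> integral (jv ` S) (\<lambda>x. jv (?h (vj x))) = b \<longleftrightarrow>
     (\<lambda>x. jv (f (vj x))) absolutely_integrable_on jv ` \<tau> ` S \<and> integral (jv ` \<tau> ` S) (\<lambda>x. jv (f (vj x))) = b" for b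
    using has_absolute_integral_change_of_variables[OF Sm der inj, of "\<lambda>x. jv (f (vj x))" b] unfolding eq im .
  show iff: "?A \<longleftrightarrow> ?B"
  proof -
    have "(\<lambda>x. jv (?h (vj x))) absolutely_integrable_on jv ` S \<longleftrightarrow> (\<lambda>x. jv (f (vj x))) absolutely_integrable_on jv ` \<tau> ` S"
      using CV by blast
    then show ?thesis using integrable_jv_bridge(1)[OF m1] integrable_jv_bridge(1)[OF m2] by (simp only:)
  qed
  show "set_lebesgue_integral lborel S ?h = set_lebesgue_integral lborel (\<tau> ` S) f" if B: ?B
  proof -
    have A: ?A using iff B by simp
    have "(\<lambda>x. jv (f (vj x))) absolutely_integrable_on jv ` \<tau> ` S" using integrable_jv_bridge(1)[OF m1] B by simp
    then have "integral (jv ` S) (\<lambda>x. jv (?h (vj x))) = integral (jv ` \<tau> ` S) (\<lambda>x. jv (f (vj x)))"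
      using CV by blast
    then have "jv (set_lebesgue_integral lborel S ?h) = jv (set_lebesgue_integral lborel (\<tau> ` S) f)"
      using integrable_jv_bridge(2)[OF m1 B] integrable_jv_bridge(2)[OF m2 A] by simp
    then show ?thesis by (metis vj_jv)
  qed
qed

section \<open>One-forms, two-forms and extension by zero\<close>

context riemann_surface
begin

definition covariant :: "'a one_form \<Rightarrow> bool" where
  "covariant \<omega> \<longleftrightarrow> (\<forall>c\<in>A. \<forall>d\<in>A. \<forall>x\<in>fst c \<inter> fst d. \<forall>v.
     \<omega> c (snd c x) v = \<omega> d (snd d x) (deriv (transition c d) (snd c x) * v))"

definition is_form :: "'a one_form \<Rightarrow> bool" where
  "is_form \<omega> \<longleftrightarrow> covariant \<omega> \<and> (\<forall>c\<in>A. \<forall>z\<in>chart_image c. linear (\<omega> c z))"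

definition continuous_form :: "'a one_form \<Rightarrow> bool" where
  "continuous_form \<omega> \<longleftrightarrow> (\<forall>c\<in>A. \<forall>v. continuous_on (chart_image c) (\<lambda>z. \<omega> c z v))"

definition closed_form :: "'a one_form \<Rightarrow> bool" where
  "closed_form \<omega> \<longleftrightarrow> locally_exact \<omega> \<and> continuous_form \<omega>"

lemma covariantD:
  assumes "covariant \<omega>" "c \<in> A" "d \<in> A" "x \<in> fst c" "x \<in> fst d"
  shows "\<omega> c (snd c x) v = \<omega> d (snd d x) (deriv (transition c d) (snd c x) * v)"
  by (rule assms(1)[unfolded covariant_def, rule_format, OF assms(2,3) IntI[OF assms(4,5)]])

lemma is_formI:
  assumes "\<And>c d x v. c \<in> A \<Longrightarrow> d \<in> A \<Longrightarrow> x \<in> fst c \<Longrightarrow> x \<in> fst d \<Longrightarrow>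
      \<omega> c (snd c x) v = \<omega> d (snd d x) (deriv (transition c d) (snd c x) * v)"
    and "\<And>c z. c \<in> A \<Longrightarrow> z \<in> chart_image c \<Longrightarrow> linear (\<omega> c z)"
  shows "is_form \<omega>"
  unfolding is_form_def covariant_def using assms(2) by (intro conjI ballI allI) (erule IntE, rule assms(1))

lemma is_formD:
  assumes "is_form \<omega>"
  shows "covariant \<omega>" "c \<in> A \<Longrightarrow> z \<in> chart_image c \<Longrightarrow> linear (\<omega> c z)"
  using assms unfolding is_form_def by blast+

text \<open>In two charts the form is the derivative of the same primitive, so uniqueness of
  derivatives yields both the transformation law and linearity.\<close>

lemma locally_exact_is_form:
  assumes "locally_exact \<omega>" shows "is_form \<omega>"
proof -
  have pr: "\<exists>U F. x \<in> U \<and> prim \<omega> U F" if "c \<in> A" "x \<in> fst c" for c x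
    using assms chart_subset[OF that(1)] that(2) unfolding locally_exact_def by blast
  have "\<omega> c (snd c x) v = \<omega> d (snd d x) (deriv (transition c d) (snd c x) * v)"
    if cd: "c \<in> A" "d \<in> A" "x \<in> fst c" "x \<in> fst d" for c d x v
  proof -
    obtain U F where U: "x \<in> U" "prim \<omega> U F" using pr[OF cd(1,3)] by metis
    from has_derivative_unique[OF primD[OF U(2) cd(1) U(1) cd(3)]
        has_derivative_change_chart[OF cd primD[OF U(2) cd(2) U(1) cd(4)]]]
    show ?thesis by metis
  qed
  moreover have "linear (\<omega> c z)" if c: "c \<in> A" and z: "z \<in> chart_image c" for c z
  proof -
    obtain U F where U: "pt c z \<in> U" "prim \<omega> U F" using pr[OF c pt_in[OF z]] by metis
    from has_derivative_linear[OF primD'[OF U(2) c z U(1)]] show ?thesis .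
  qed
  ultimately show ?thesis by (rule is_formI)
qed

text \<open>The coefficient of dx wedge dy: the value of the 2-form on the pair of tangent vectors
  with coordinates 1 and \<open>\<i>\<close>.\<close>

definition wedge :: "'a one_form \<Rightarrow> 'a one_form \<Rightarrow> 'a chart \<Rightarrow> complex \<Rightarrow> complex" where
  "wedge \<omega> \<eta> c z = \<omega> c z 1 * \<eta> c z \<i> - \<omega> c z \<i> * \<eta> c z 1"

text \<open>The transformation law of the coefficient of a 2-form; the factor is the Jacobian
  determinant of a holomorphic transition and is positive.\<close>

definition density :: "('a chart \<Rightarrow> complex \<Rightarrow> complex) \<Rightarrow> bool" where
  "density \<Theta> \<longleftrightarrow> (\<forall>c\<in>A. \<forall>d\<in>A. \<forall>x\<in>fst c \<inter> fst d.
     \<Theta> c (snd c x) = of_real ((norm (deriv (transition c d) (snd c x)))\<^sup>2) * \<Theta> d (snd d x))"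

definition measurable_density :: "('a chart \<Rightarrow> complex \<Rightarrow> complex) \<Rightarrow> bool" where
  "measurable_density \<Theta> \<longleftrightarrow> (\<forall>c\<in>A. (\<lambda>z. indicator (chart_image c) z *\<^sub>R \<Theta> c z) \<in> borel_measurable borel)"

lemma linear_complex_expand:
  assumes "linear (L :: complex \<Rightarrow> complex)"
  shows "L a = of_real (Re a) * L 1 + of_real (Im a) * L \<i>"
proof -
  have "a = Re a *\<^sub>R 1 + Im a *\<^sub>R \<i>" by (simp add: complex_eq_iff)
  then have "L a = Re a *\<^sub>R L 1 + Im a *\<^sub>R L \<i>"
    using assms by (metis linear_add linear_cmul)
  then show ?thesis by (simp add: scaleR_conv_of_real)
qed

text \<open>Pulling back a real 2-form along multiplication by \<open>a\<close> multiplies it by the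
  determinant of that map, the square of \<open>norm a\<close>.\<close>

lemma linear_wedge_scale:
  assumes "linear (L :: complex \<Rightarrow> complex)" "linear (M :: complex \<Rightarrow> complex)"
  shows "L (a * 1) * M (a * \<i>) - L (a * \<i>) * M (a * 1) = of_real ((norm a)\<^sup>2) * (L 1 * M \<i> - L \<i> * M 1)"
proof -
  note e = linear_complex_expand[OF assms(1)] linear_complex_expand[OF assms(2)]
  have "(norm a)\<^sup>2 = Re a * Re a + Im a * Im a"
    using cmod_power2[of a] by (simp add: power2_eq_square)
  then have "of_real ((norm a)\<^sup>2) = (of_real (Re a) * of_real (Re a) + of_real (Im a) * of_real (Im a) :: complex)"
    by (simp only: of_real_add of_real_mult)
  moreover have "Re (a * \<i>) = - Im a" "Im (a * \<i>) = Re a" by auto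
  ultimately show ?thesis
    unfolding e[of a] e[of "a * \<i>"] mult_1_right by (simp add: algebra_simps)
qed

lemma density_wedge:
  assumes "is_form \<omega>" "is_form \<eta>" shows "density (wedge \<omega> \<eta>)"
  unfolding density_def
proof (intro ballI)
  fix c d x assume cd: "c \<in> A" "d \<in> A" "x \<in> fst c \<inter> fst d"
  then have x: "x \<in> fst c" "x \<in> fst d" by auto
  have lin: "linear (\<omega> d (snd d x))" "linear (\<eta> d (snd d x))"
    by (rule is_formD(2)[OF assms(1) cd(2) snd_in[OF x(2)]], rule is_formD(2)[OF assms(2) cd(2) snd_in[OF x(2)]])
  have cov: "covariant \<omega>" "covariant \<eta>" by (rule is_formD(1)[OF assms(1)], rule is_formD(1)[OF assms(2)])
  show "wedge \<omega> \<eta> c (snd c x) = of_real ((norm (deriv (transition c d) (snd c x)))\<^sup>2) * wedge \<omega> \<eta> d (snd d x)"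
    unfolding wedge_def covariantD[OF cov(1) cd(1,2) x] covariantD[OF cov(2) cd(1,2) x]
    by (rule linear_wedge_scale[OF lin])
qed

lemma overlap_integral:
  assumes c: "c \<in> A" and d: "d \<in> A" and \<Theta>: "density \<Theta>" "measurable_density \<Theta>"
  shows "set_integrable lborel (snd c ` (fst c \<inter> fst d)) (\<Theta> c) \<longleftrightarrow> set_integrable lborel (snd d ` (fst c \<inter> fst d)) (\<Theta> d)"
    and "set_integrable lborel (snd d ` (fst c \<inter> fst d)) (\<Theta> d) \<Longrightarrow>
      set_lebesgue_integral lborel (snd c ` (fst c \<inter> fst d)) (\<Theta> c) = set_lebesgue_integral lborel (snd d ` (fst c \<inter> fst d)) (\<Theta> d)"
proof -
  let ?S = "snd c ` (fst c \<inter> fst d)" and ?\<tau> = "transition c d"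
  have oS: "open ?S" by (rule open_overlap[OF c d])
  have im: "?\<tau> ` ?S = snd d ` (fst c \<inter> fst d)"
    unfolding image_image using c by (intro image_cong) (auto simp: transition_eq)
  have oT: "open (snd d ` (fst c \<inter> fst d))" using open_overlap[OF d c] by (simp add: Int_commute)
  have inj: "inj_on ?\<tau> ?S"
  proof (rule inj_onI)
    fix z w assume zw: "z \<in> ?S" "w \<in> ?S" "?\<tau> z = ?\<tau> w"
    then obtain x y where xy: "x \<in> fst c \<inter> fst d" "z = snd c x" "y \<in> fst c \<inter> fst d" "w = snd c y" by auto
    then have "snd d x = snd d y" using zw(3) c by (simp add: transition_eq)
    then have "x = y" using xy chart_inj[OF d] by (auto simp: inj_on_def)
    then show "z = w" using xy by simp
  qed
  have eq: "of_real ((norm (deriv ?\<tau> z))\<^sup>2) * \<Theta> d (?\<tau> z) = \<Theta> c z" if zS: "z \<in> ?S" for z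
  proof -
    obtain x where x: "x \<in> fst c \<inter> fst d" "z = snd c x" using zS by blast
    then have "?\<tau> z = snd d x" using c by (simp add: transition_eq)
    then show ?thesis using \<Theta>(1) c d x unfolding density_def by metis
  qed
  have meas: "(\<lambda>z. indicator S z *\<^sub>R \<Theta> e z) \<in> borel_measurable borel" if "e \<in> A" "open S" "S \<subseteq> chart_image e" for e S
  proof -
    have [measurable]: "S \<in> sets borel" using that by simp
    have [measurable]: "(\<lambda>z. indicator (chart_image e) z *\<^sub>R \<Theta> e z) \<in> borel_measurable borel"
      using \<Theta>(2) that(1) by (simp add: measurable_density_def)
    have "(\<lambda>z. indicator S z *\<^sub>R (indicator (chart_image e) z *\<^sub>R \<Theta> e z)) \<in> borel_measurable borel" by measurable
    also have "(\<lambda>z. indicator S z *\<^sub>R (indicator (chart_image e) z *\<^sub>R \<Theta> e z)) = (\<lambda>z. indicator S z *\<^sub>R \<Theta> e z)"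
      using that(3) by (auto simp: fun_eq_iff indicator_def)
    finally show ?thesis .
  qed
  have m1: "(\<lambda>w. indicator (?\<tau> ` ?S) w *\<^sub>R \<Theta> d w) \<in> borel_measurable borel"
    unfolding im by (rule meas[OF d oT]) (auto simp: chart_image_def)
  have "(\<lambda>z. indicator ?S z *\<^sub>R \<Theta> c z) \<in> borel_measurable borel"
    by (rule meas[OF c oS]) (auto simp: chart_image_def)
  also have eqi: "(\<lambda>z. indicator ?S z *\<^sub>R \<Theta> c z) = (\<lambda>z. indicator ?S z *\<^sub>R (of_real ((norm (deriv ?\<tau> z))\<^sup>2) * \<Theta> d (?\<tau> z)))"
    using eq by (auto simp: fun_eq_iff indicator_def simp del: of_real_power)
  finally have m2: "(\<lambda>z. indicator ?S z *\<^sub>R (of_real ((norm (deriv ?\<tau> z))\<^sup>2) * \<Theta> d (?\<tau> z))) \<in> borel_measurable borel" .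
  note cv = change_of_variables_holomorphic[OF oS transition_holomorphic[OF c d] inj m1 m2]
  show "set_integrable lborel ?S (\<Theta> c) \<longleftrightarrow> set_integrable lborel (snd d ` (fst c \<inter> fst d)) (\<Theta> d)"
    using cv(1) unfolding set_integrable_def eqi im .
  show "set_lebesgue_integral lborel ?S (\<Theta> c) = set_lebesgue_integral lborel (snd d ` (fst c \<inter> fst d)) (\<Theta> d)"
    if "set_integrable lborel (snd d ` (fst c \<inter> fst d)) (\<Theta> d)"
    using cv(2) that unfolding set_lebesgue_integral_def eqi im by simp
qed

text \<open>The extension by zero of a form given in the single chart \<open>c0\<close>.\<close>

definition ext :: "'a chart \<Rightarrow> (complex \<Rightarrow> complex \<Rightarrow> complex) \<Rightarrow> 'a one_form" where
  "ext c0 e = (\<lambda>c z v. if pt c z \<in> fst c0 then e (snd c0 (pt c z)) (deriv (transition c c0) z * v) else 0)"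

definition ext0 :: "'a chart \<Rightarrow> (complex \<Rightarrow> complex) \<Rightarrow> 'a \<Rightarrow> complex" where
  "ext0 c0 p x = (if x \<in> fst c0 then p (snd c0 x) else 0)"

lemma ext_snd: "c \<in> A \<Longrightarrow> x \<in> fst c \<Longrightarrow> ext c0 e c (snd c x) v =
   (if x \<in> fst c0 then e (snd c0 x) (deriv (transition c c0) (snd c x) * v) else 0)"
  by (simp add: ext_def)

lemma transition_chain:
  assumes c: "c \<in> A" "d \<in> A" "e \<in> A" and x: "x \<in> fst c" "x \<in> fst d" "x \<in> fst e"
  shows "deriv (transition c e) (snd c x) = deriv (transition d e) (snd d x) * deriv (transition c d) (snd c x)"
proof -
  have "((\<lambda>z. snd e (pt d z)) has_derivative (\<lambda>v. deriv (transition d e) (snd d x) * v)) (at (snd d x))"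
    using transition_deriv[OF c(2,3) x(2,3)] unfolding has_field_derivative_def transition_eq[abs_def] .
  from has_derivative_change_chart[OF c(1,2) x(1,2) this]
  have "((\<lambda>z. snd e (pt c z)) has_field_derivative deriv (transition d e) (snd d x) * deriv (transition c d) (snd c x)) (at (snd c x))"
    unfolding has_field_derivative_def by (rule has_derivative_eq_rhs) (simp add: fun_eq_iff mult.assoc)
  then show ?thesis using DERIV_imp_deriv unfolding transition_eq[abs_def] by blast
qed

lemma transition_self: "c \<in> A \<Longrightarrow> x \<in> fst c \<Longrightarrow> deriv (transition c c) (snd c x) = 1"
proof -
  assume c: "c \<in> A" "x \<in> fst c"
  have "(transition c c has_field_derivative 1) (at (snd c x))"
    by (rule has_field_derivative_transform_within_open[OF DERIV_ident chart_image_open[OF c(1)]])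
       (use c in \<open>auto simp: transition_eq\<close>)
  then show ?thesis by (rule DERIV_imp_deriv)
qed

lemma is_form_ext:
  assumes c0: "c0 \<in> A" and lin: "\<And>z. z \<in> chart_image c0 \<Longrightarrow> linear (e z)"
  shows "is_form (ext c0 e)"
proof -
  have "ext c0 e c (snd c x) v = ext c0 e d (snd d x) (deriv (transition c d) (snd c x) * v)"
    if cd: "c \<in> A" "d \<in> A" "x \<in> fst c" "x \<in> fst d" for c d x v
    using transition_chain[OF cd(1,2) c0 cd(3,4)] cd by (simp add: ext_snd mult.assoc)
  moreover have "linear (ext c0 e c z)" if c: "c \<in> A" and z: "z \<in> chart_image c" for c z
  proof (cases "pt c z \<in> fst c0")
    case True
    then have l: "linear (e (snd c0 (pt c z)))" using lin by simp
    have "linear (\<lambda>v. e (snd c0 (pt c z)) (deriv (transition c c0) z * v))"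
      using linear_compose[OF linear_times l] by (simp add: o_def)
    then show ?thesis using True by (simp add: ext_def)
  next
    case False
    then show ?thesis by (simp add: ext_def linear_zero)
  qed
  ultimately show ?thesis by (rule is_formI)
qed

text \<open>Here the Hausdorff property enters: compact sets are closed in the whole surface, so an
  object supported in one extends by zero without singularities at points outside the chart.\<close>

lemma closedin_chart_compact:
  assumes c: "c \<in> A" and K: "compact K" "K \<subseteq> chart_image c"
  shows "closedin X {x \<in> fst c. snd c x \<in> K}"
proof -
  have "compactin (top_of_set (chart_image c)) K" using K by (simp add: compactin_subtopology)
  then have "compactin X (pt c ` K)" by (rule image_compactin[OF _ continuous_pt[OF c]])
  then have "closedin X (pt c ` K)" by (rule compactin_imp_closedin[OF hausdorff])
  also have "pt c ` K = {x \<in> fst c. snd c x \<in> K}"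
  proof
    show "pt c ` K \<subseteq> {x \<in> fst c. snd c x \<in> K}" using K(2) by auto
    show "{x \<in> fst c. snd c x \<in> K} \<subseteq> pt c ` K" using c by (auto intro!: image_eqI[where x = "snd c _"])
  qed
  finally show ?thesis .
qed

text \<open>The extension evaluates \<open>e\<close> on a vector that moves with \<open>z\<close>.
  Expanding this vector in 1 and \<open>\<i>\<close> reduces the claim to continuity for fixed
  vectors.\<close>

lemma ext_continuous_at_chart:
  assumes c0: "c0 \<in> A" and c: "c \<in> A" and U: "openin X U" "U \<subseteq> fst c0"
    and lin: "\<And>z. z \<in> snd c0 ` U \<Longrightarrow> linear (e z)"
    and cont: "\<And>v. continuous_on (snd c0 ` U) (\<lambda>z. e z v)"
  shows "continuous_on (snd c ` (U \<inter> fst c)) (\<lambda>z. ext c0 e c z v)"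
proof -
  let ?S = "snd c ` (U \<inter> fst c)" and ?\<tau> = "transition c c0"
  have sub: "?S \<subseteq> snd c ` (fst c \<inter> fst c0)" using U by auto
  have c\<tau>: "continuous_on ?S ?\<tau>"
    by (rule continuous_on_subset[OF holomorphic_on_imp_continuous_on[OF transition_holomorphic[OF c c0]] sub])
  have cd: "continuous_on ?S (deriv ?\<tau>)"
    by (rule continuous_on_subset[OF holomorphic_on_imp_continuous_on[OF holomorphic_deriv[OF transition_holomorphic[OF c c0] open_overlap[OF c c0]]] sub])
  have im: "?\<tau> ` ?S \<subseteq> snd c0 ` U" using c by (auto simp: transition_eq)
  have e1: "continuous_on ?S (\<lambda>z. e (?\<tau> z) u)" for u
    by (rule continuous_on_compose2[OF cont c\<tau> im])
  have "continuous_on ?S (\<lambda>z. of_real (Re (deriv ?\<tau> z * v)) * e (?\<tau> z) 1 + of_real (Im (deriv ?\<tau> z * v)) * e (?\<tau> z) \<i>)"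
    by (intro continuous_intros cd e1)
  then show ?thesis
  proof (rule continuous_on_eq)
    fix z assume z: "z \<in> ?S"
    then have "pt c z \<in> fst c0" "?\<tau> z \<in> snd c0 ` U" using c U by (auto simp: transition_eq)
    then show "of_real (Re (deriv ?\<tau> z * v)) * e (?\<tau> z) 1 + of_real (Im (deriv ?\<tau> z * v)) * e (?\<tau> z) \<i> = ext c0 e c z v"
      using linear_complex_expand[OF lin, of "?\<tau> z" "deriv ?\<tau> z * v"] by (simp add: ext_def transition_eq)
  qed
qed

text \<open>The removed compact set \<open>B\<close> will be the arc along which a logarithm is cut,
  \<open>K\<close> the support of a bump function. \<open>W\<close> is covered by its part in the
  chart and by the open set \<open>V\<close>, on which the potential and the form both
  vanish.\<close>

lemma ext_prim_off:
  assumes c0: "c0 \<in> A" and B: "compact B" "B \<subseteq> chart_image c0" and p: "c1on (chart_image c0 - B) p p'"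
    and K: "compact K" "K \<subseteq> chart_image c0" and p0: "\<And>z. z \<in> chart_image c0 - B - K \<Longrightarrow> p z = 0"
  defines "W \<equiv> topspace X - {x \<in> fst c0. snd c0 x \<in> B}"
  shows "prim (ext c0 p') W (ext0 c0 p)"
    "\<And>c v. c \<in> A \<Longrightarrow> continuous_on (snd c ` (W \<inter> fst c)) (\<lambda>z. ext c0 p' c z v)"
proof -
  have oW: "openin X W" unfolding W_def using closedin_chart_compact[OF c0 B] by blast
  define V where "V = topspace X - {x \<in> fst c0. snd c0 x \<in> B \<union> K}"
  have oV: "openin X V" unfolding V_def
    using closedin_chart_compact[OF c0 compact_Un[OF B(1) K(1)]] B(2) K(2) by blast
  have V0: "ext0 c0 p y = 0" if "y \<in> V" for y
    using that p0 by (auto simp: ext0_def V_def)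
  let ?S = "chart_image c0 - B"
  have oS: "open ?S" using p by (simp add: c1on_def)
  have lin: "linear (p' z)" if "z \<in> ?S" for z
    using has_derivative_linear[OF c1on_has_derivative[OF p that]] .
  have p'0: "p' z v = 0" if z: "z \<in> ?S - K" for z v
  proof -
    have "((\<lambda>_. 0) has_derivative p' z) (at z)"
      by (rule has_derivative_transform_within_open[OF c1on_has_derivative[OF p], of z "?S - K"])
         (use z p0 oS compact_imp_closed[OF K(1)] in \<open>auto simp: open_Diff\<close>)
    moreover have "((\<lambda>_. 0) has_derivative (\<lambda>_. 0)) (at z)" by simp
    ultimately have "p' z = (\<lambda>_. 0)" by (rule has_derivative_unique)
    then show ?thesis by simp
  qed
  show pr: "prim (ext c0 p') W (ext0 c0 p)"
    unfolding prim_def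
  proof (intro conjI ballI oW)
    fix c x assume c: "c \<in> A" and "x \<in> W \<inter> fst c"
    then have x: "x \<in> W" "x \<in> topspace X" "x \<in> fst c" by (auto simp: W_def)
    show "((\<lambda>z. ext0 c0 p (pt c z)) has_derivative ext c0 p' c (snd c x)) (at (snd c x))"
    proof (cases "x \<in> fst c0")
      case True
      have mem: "snd c0 x \<in> ?S" using True x by (auto simp: W_def)
      have "((\<lambda>z. ext0 c0 p (pt c0 z)) has_derivative p' (snd c0 x)) (at (snd c0 x))"
        by (rule has_derivative_transform_within_open[OF c1on_has_derivative[OF p mem] oS mem])
           (auto simp: ext0_def)
      from has_derivative_change_chart[OF c c0 x(3) True this] True c x
      show ?thesis by (simp add: ext_def)
    next
      case False
      then have xV: "x \<in> V" using x by (simp add: V_def)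
      have "((\<lambda>z. ext0 c0 p (pt c z)) has_derivative (\<lambda>_. 0)) (at (snd c x))"
      proof (rule has_derivative_transform_within_open[of "\<lambda>_. 0"])
        show "open (snd c ` (V \<inter> fst c))" by (rule open_chart[OF c oV])
        show "snd c x \<in> snd c ` (V \<inter> fst c)" using xV x by blast
        show "0 = ext0 c0 p (pt c y)" if "y \<in> snd c ` (V \<inter> fst c)" for y
          using that c V0 by auto
      qed simp
      then show ?thesis using False c x by (simp add: ext_def)
    qed
  qed
  fix c v assume c: "c \<in> A"
  define U where "U = W \<inter> fst c0"
  have oU: "openin X U" unfolding U_def using oW chart_open[OF c0] by blast
  have U: "U \<subseteq> fst c0" "snd c0 ` U \<subseteq> ?S" by (auto simp: U_def W_def)
  have "continuous_on (snd c ` (U \<inter> fst c) \<union> snd c ` (V \<inter> fst c)) (\<lambda>z. ext c0 p' c z v)"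
  proof (rule continuous_on_open_Un)
    show "open (snd c ` (U \<inter> fst c))" "open (snd c ` (V \<inter> fst c))"
      by (rule open_chart[OF c oU], rule open_chart[OF c oV])
    show "continuous_on (snd c ` (U \<inter> fst c)) (\<lambda>z. ext c0 p' c z v)"
      by (rule ext_continuous_at_chart[OF c0 c oU U(1)])
         (use U(2) lin continuous_on_subset[OF c1on_continuous_deriv[OF p] U(2)] in auto)
    show "continuous_on (snd c ` (V \<inter> fst c)) (\<lambda>z. ext c0 p' c z v)"
    proof (rule continuous_on_eq[of _ "\<lambda>_. 0"])
      fix z assume "z \<in> snd c ` (V \<inter> fst c)"
      then obtain x where x: "x \<in> V" "x \<in> fst c" "z = snd c x" by auto
      then show "0 = ext c0 p' c z v" using c p'0[of "snd c0 x"] by (auto simp: ext_snd V_def)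
    qed simp
  qed
  moreover have "snd c ` (W \<inter> fst c) \<subseteq> snd c ` (U \<inter> fst c) \<union> snd c ` (V \<inter> fst c)"
    unfolding U_def V_def W_def by blast
  ultimately show "continuous_on (snd c ` (W \<inter> fst c)) (\<lambda>z. ext c0 p' c z v)"
    by (rule continuous_on_subset)
qed

lemma ext_prim:
  assumes c0: "c0 \<in> A" and p: "c1on (chart_image c0) p p'" and K: "compact K" "K \<subseteq> chart_image c0"
    and p0: "\<And>z. z \<in> chart_image c0 - K \<Longrightarrow> p z = 0"
  shows "prim (ext c0 p') (topspace X) (ext0 c0 p)" "continuous_form (ext c0 p')"
proof -
  have p1: "c1on (chart_image c0 - {}) p p'" using p by simp
  have p2: "p z = 0" if "z \<in> chart_image c0 - {} - K" for z using p0 that by simp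
  note e = ext_prim_off[OF c0 compact_empty empty_subsetI p1 K p2, simplified]
  show "prim (ext c0 p') (topspace X) (ext0 c0 p)" by (rule e(1))
  show "continuous_form (ext c0 p')"
    unfolding continuous_form_def
  proof (intro ballI allI)
    fix c v assume c: "c \<in> A"
    have "snd c ` (topspace X \<inter> fst c) = chart_image c"
      using chart_subset[OF c] by (auto simp: chart_image_def)
    then show "continuous_on (chart_image c) (\<lambda>z. ext c0 p' c z v)" using e(2)[OF c, of v] by simp
  qed
qed

end

section \<open>Partitions of unity and surface integrals\<close>

lemma integral_continuous_pos:
  fixes g :: "complex \<Rightarrow> real"
  assumes "integrable lborel g" "continuous_on UNIV g" "\<And>z. g z \<ge> 0" "g z0 > 0"
  shows "integral\<^sup>L lborel g > 0"
proof -
  have "integral\<^sup>L lborel g \<noteq> 0"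
  proof
    assume "integral\<^sup>L lborel g = 0"
    then have "AE z in lborel. g z = 0"
      using integral_nonneg_eq_0_iff_AE[OF assms(1)] assms(3) by simp
    then obtain N where N: "{z. g z \<noteq> 0} \<subseteq> N" "N \<in> null_sets lborel"
      by (auto elim!: AE_E simp: null_sets_def)
    have "N \<in> null_sets lebesgue" using null_sets_completionI[OF N(2)] .
    then have "negligible N" by (simp add: negligible_iff_null_sets)
    then have "negligible {z. g z > 0}" by (rule negligible_subset) (use N(1) in auto)
    moreover have "open {z. g z > 0}" by (intro open_Collect_less continuous_on_const assms(2))
    ultimately show False using open_not_negligible assms(4) by blast
  qed
  moreover have "integral\<^sup>L lborel g \<ge> 0" by (rule Bochner_Integration.integral_nonneg) (rule assms(3))
  ultimately show ?thesis by simp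
qed

lemma set_integrable_eq_outside:
  assumes "T \<subseteq> S" "\<forall>z \<in> S - T. f z = (0::complex)"
  shows "set_integrable lborel S f \<longleftrightarrow> set_integrable lborel T f"
    "set_lebesgue_integral lborel S f = set_lebesgue_integral lborel T f"
proof -
  have "(\<lambda>z. indicator S z *\<^sub>R f z) = (\<lambda>z. indicator T z *\<^sub>R f z)"
    using assms by (auto simp: fun_eq_iff indicator_def)
  then show "set_integrable lborel S f \<longleftrightarrow> set_integrable lborel T f"
    "set_lebesgue_integral lborel S f = set_lebesgue_integral lborel T f"
    unfolding set_integrable_def set_lebesgue_integral_def by simp_all
qed

context riemann_surface
begin

lemma prim_continuous_on:
  assumes "prim \<omega> (topspace X) F" "c \<in> A"
  shows "continuous_on (chart_image c) (\<lambda>z. F (pt c z))"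
proof (rule continuous_at_imp_continuous_on, rule ballI)
  fix z assume z: "z \<in> chart_image c"
  have "pt c z \<in> topspace X" using chart_subset[OF assms(2)] pt_in[OF z] by blast
  then show "isCont (\<lambda>z. F (pt c z)) z" using has_derivative_continuous[OF primD'[OF assms z]] by simp
qed

lemma prim_c1on:
  assumes "prim \<omega> (topspace X) F" "continuous_form \<omega>" "c \<in> A"
  shows "c1on (chart_image c) (\<lambda>z. F (pt c z)) (\<omega> c)"
  unfolding c1on_def
proof (intro conjI ballI allI chart_image_open[OF assms(3)])
  fix z assume z: "z \<in> chart_image c"
  have "pt c z \<in> topspace X" using chart_subset[OF assms(3)] pt_in[OF z] by blast
  then show "((\<lambda>z. F (pt c z)) has_derivative \<omega> c z) (at z)" using primD'[OF assms(1,3) z] by simp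
next
  show "continuous_on (chart_image c) (\<lambda>z. \<omega> c z v)" for v
    using assms(2,3) by (simp add: continuous_form_def)
qed

lemma prim_is_form: "prim \<omega> (topspace X) F \<Longrightarrow> is_form \<omega>"
  by (rule locally_exact_is_form) (auto simp: locally_exact_def)

lemma prim_deriv_zero:
  assumes pr: "prim \<omega> (topspace X) F" and V: "openin X V" "\<And>y. y \<in> V \<Longrightarrow> F y = a"
    and c: "c \<in> A" "x \<in> fst c" "x \<in> V"
  shows "\<omega> c (snd c x) v = 0"
proof -
  have x: "x \<in> topspace X" using chart_subset[OF c(1)] c(2) by blast
  have "((\<lambda>z. a) has_derivative \<omega> c (snd c x)) (at (snd c x))"
  proof (rule has_derivative_transform_within_open[OF primD[OF pr c(1) x c(2)] open_chart[OF c(1) V(1)]])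
    show "snd c x \<in> snd c ` (V \<inter> fst c)" using c by blast
    show "F (pt c y) = a" if "y \<in> snd c ` (V \<inter> fst c)" for y using that c(1) V(2) by auto
  qed
  moreover have "((\<lambda>_. a) has_derivative (\<lambda>_. 0)) (at (snd c x))" by simp
  ultimately have "\<omega> c (snd c x) = (\<lambda>_. 0)" by (rule has_derivative_unique)
  then show ?thesis by simp
qed

end

text \<open>The derivatives \<open>d\<rho>\<close> belong to the data because Stokes' theorem is
  proved by differentiating products \<open>\<rho> i x * h x\<close>. The indices are points, the
  centres of the coordinate discs.\<close>

locale surface_pou = riemann_surface X A for X :: "'a topology" and A +
  fixes I :: "'a set" and ch :: "'a \<Rightarrow> 'a chart" and \<rho> :: "'a \<Rightarrow> 'a \<Rightarrow> complex" and d\<rho> :: "'a \<Rightarrow> 'a one_form"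
    and K :: "'a \<Rightarrow> complex set"
  assumes finI: "finite I" and ch: "i \<in> I \<Longrightarrow> ch i \<in> A"
    and rho_prim: "i \<in> I \<Longrightarrow> prim (d\<rho> i) (topspace X) (\<rho> i)" and rho_cont: "i \<in> I \<Longrightarrow> continuous_form (d\<rho> i)"
    and rho_range: "i \<in> I \<Longrightarrow> x \<in> topspace X \<Longrightarrow> \<exists>t. \<rho> i x = of_real t \<and> 0 \<le> t \<and> t \<le> 1"
    and K: "i \<in> I \<Longrightarrow> compact (K i)" "i \<in> I \<Longrightarrow> K i \<subseteq> chart_image (ch i)"
    and rho_supp: "i \<in> I \<Longrightarrow> x \<in> topspace X \<Longrightarrow> x \<notin> fst (ch i) \<or> snd (ch i) x \<notin> K i \<Longrightarrow> \<rho> i x = 0"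
    and rho_sum: "x \<in> topspace X \<Longrightarrow> (\<Sum>i\<in>I. \<rho> i x) = 1"

text \<open>Finitely many of the small discs on which a bump equals 1 cover the compact surface; the
  bumps are divided by their sum.\<close>

lemma (in riemann_surface) pou_exists:
  assumes comp: "compact_space X"
  shows "\<exists>I ch \<rho> d\<rho> K. surface_pou X A I ch \<rho> d\<rho> K"
proof -
  define ch where "ch x = chart_at A x" for x
  have ch: "ch x \<in> A" "x \<in> fst (ch x)" if "x \<in> topspace X" for x using chart_at[OF that] by (auto simp: ch_def)
  have "\<exists>r \<psi> \<psi>1. r > 0 \<and> ball (snd (ch x) x) r \<subseteq> chart_image (ch x) \<and> (\<exists>\<psi>2. bump (snd (ch x) x) (r/3) (r/2) \<psi> \<psi>1 \<psi>2)"
    if x: "x \<in> topspace X" for x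
  proof -
    obtain r where r: "r > 0" "ball (snd (ch x) x) r \<subseteq> chart_image (ch x)"
      using openE[OF chart_image_open[OF ch(1)[OF x]] snd_in[OF ch(2)[OF x]]] by metis
    then have "\<exists>\<psi> \<psi>1 \<psi>2. bump (snd (ch x) x) (r/3) (r/2) \<psi> \<psi>1 \<psi>2" by (intro bump_exists) auto
    then show ?thesis using r by blast
  qed
  then obtain r \<psi> \<psi>1 where r: "\<And>x. x \<in> topspace X \<Longrightarrow> r x > 0"
      "\<And>x. x \<in> topspace X \<Longrightarrow> ball (snd (ch x) x) (r x) \<subseteq> chart_image (ch x)"
      "\<And>x. x \<in> topspace X \<Longrightarrow> \<exists>\<psi>2. bump (snd (ch x) x) (r x/3) (r x/2) (\<psi> x) (\<psi>1 x) \<psi>2" by metis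
  have bump: "c1on UNIV (\<psi> x) (\<psi>1 x)" "\<And>z. \<exists>t. \<psi> x z = of_real t \<and> 0 \<le> t \<and> t \<le> 1"
    "\<And>z. dist (snd (ch x) x) z \<le> r x/3 \<Longrightarrow> \<psi> x z = 1" "\<And>z. r x/2 \<le> dist (snd (ch x) x) z \<Longrightarrow> \<psi> x z = 0"
    if "x \<in> topspace X" for x using r(3)[OF that] unfolding bump_def by auto
  define K where "K x = cball (snd (ch x) x) (r x / 2)" for x
  have K: "compact (K x)" "K x \<subseteq> chart_image (ch x)" if "x \<in> topspace X" for x
    using r(1,2)[OF that] by (auto simp: K_def subset_iff)
  define b db where "b x = ext0 (ch x) (\<psi> x)" and "db x = ext (ch x) (\<psi>1 x)" for x
  have \<psi>0: "\<psi> x z = 0" if "x \<in> topspace X" "z \<notin> K x" for x z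
    using bump(4)[OF that(1), of z] that(2) by (simp add: K_def)
  have b: "prim (db x) (topspace X) (b x)" "continuous_form (db x)" if x: "x \<in> topspace X" for x
    unfolding b_def db_def
    by (rule ext_prim[OF ch(1)[OF x] c1on_subset[OF bump(1)[OF x] chart_image_open[OF ch(1)[OF x]]] K[OF x]]; use \<psi>0[OF x] in simp)+
  have b_range: "\<exists>t. b x y = of_real t \<and> 0 \<le> t \<and> t \<le> 1" if "x \<in> topspace X" for x y
    using bump(2)[OF that] by (auto simp: b_def ext0_def intro: exI[of _ 0])
  define U where "U x = {y \<in> fst (ch x). snd (ch x) y \<in> ball (snd (ch x) x) (r x / 3)}" for x
  have "openin X (U x)" if x: "x \<in> topspace X" for x
    unfolding U_def by (rule open_preimage[OF ch(1)[OF x]]) simp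
  then have "\<forall>V\<in>U ` topspace X. openin X V" by blast
  moreover have "topspace X \<subseteq> \<Union>(U ` topspace X)" using ch r(1) by (force simp: U_def)
  ultimately have "\<exists>\<F>. finite \<F> \<and> \<F> \<subseteq> U ` topspace X \<and> topspace X \<subseteq> \<Union>\<F>"
    using comp unfolding compact_space_alt by blast
  then obtain I where I: "finite I" "I \<subseteq> topspace X" "topspace X \<subseteq> \<Union>(U ` I)"
    using finite_subset_image by (metis (no_types, lifting))
  define S dS where "S y = (\<Sum>i\<in>I. b i y)" and "dS c z v = (\<Sum>i\<in>I. db i c z v)" for y c z v
  \<comment> \<open>Every point lies in a disc where one of the bumps equals 1 and no bump is
    negative, so the denominator is at least 1.\<close>
  have S1: "\<exists>s. S y = of_real s \<and> s \<ge> 1" if y: "y \<in> topspace X" for y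
  proof -
    have "\<forall>i\<in>I. \<exists>t. b i y = of_real t \<and> 0 \<le> t" using b_range I(2) by blast
    then obtain t where t: "\<And>i. i \<in> I \<Longrightarrow> b i y = of_real (t i) \<and> 0 \<le> t i" by metis
    obtain j where j: "j \<in> I" "y \<in> U j" using I(3) y by blast
    then have "b j y = 1" using bump(3)[of j "snd (ch j) y"] I(2) by (auto simp: U_def b_def ext0_def)
    then have "t j = 1" using t[OF j(1)] by simp
    then have "1 \<le> (\<Sum>i\<in>I. t i)" using member_le_sum[of j I t] j(1) t I(1) by auto
    moreover have "S y = of_real (\<Sum>i\<in>I. t i)" using t by (simp add: S_def)
    ultimately show ?thesis by blast
  qed
  then have Snz: "S y \<noteq> 0" if "y \<in> topspace X" for y using that by fastforce
  have S: "prim dS (topspace X) S"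
    unfolding prim_def S_def[abs_def] dS_def
    by (intro conjI ballI openin_topspace has_derivative_sum primD[OF b(1)]) (use I(2) in auto)
  have Sc: "continuous_form dS"
    using b(2) I(2) unfolding continuous_form_def dS_def by (auto intro!: continuous_intros)
  define \<rho> d\<rho> where "\<rho> i y = b i y / S y"
    and "d\<rho> i c z v = (db i c z v * S (pt c z) - b i (pt c z) * dS c z v) / (S (pt c z) * S (pt c z))" for i y c z v
  have top: "pt c z \<in> topspace X" if "c \<in> A" "z \<in> chart_image c" for c z
    using chart_subset[OF that(1)] pt_in[OF that(2)] by blast
  have "surface_pou X A I ch \<rho> d\<rho> K"
  proof
    show "finite I" by fact
    fix i assume i: "i \<in> I"
    then have it: "i \<in> topspace X" using I by auto
    show "ch i \<in> A" by (rule ch(1)[OF it])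
    show "prim (d\<rho> i) (topspace X) (\<rho> i)"
      unfolding prim_def
    proof (intro conjI ballI openin_topspace)
      fix c x assume c: "c \<in> A" and x: "x \<in> topspace X \<inter> fst c"
      then have p: "pt c (snd c x) = x" by simp
      have "((\<lambda>z. b i (pt c z) / S (pt c z)) has_derivative (\<lambda>h. (db i c (snd c x) h * S (pt c (snd c x)) - b i (pt c (snd c x)) * dS c (snd c x) h) / (S (pt c (snd c x)) * S (pt c (snd c x))))) (at (snd c x))"
        by (rule has_derivative_divide'[OF primD[OF b(1)[OF it] c] primD[OF S c]]) (use x p Snz in auto)
      then show "((\<lambda>z. \<rho> i (pt c z)) has_derivative d\<rho> i c (snd c x)) (at (snd c x))"
        unfolding \<rho>_def d\<rho>_def .
    qed
    show "continuous_form (d\<rho> i)"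
      unfolding continuous_form_def d\<rho>_def
    proof (intro ballI allI)
      fix c v assume c: "c \<in> A"
      have "continuous_on (chart_image c) (\<lambda>z. db i c z v)" "continuous_on (chart_image c) (\<lambda>z. dS c z v)"
        using b(2)[OF it] Sc c by (auto simp: continuous_form_def)
      then show "continuous_on (chart_image c) (\<lambda>z. (db i c z v * S (pt c z) - b i (pt c z) * dS c z v) / (S (pt c z) * S (pt c z)))"
        using Snz top[OF c] prim_continuous_on[OF b(1)[OF it] c] prim_continuous_on[OF S c]
        by (intro continuous_intros) auto
    qed
    show "compact (K i)" "K i \<subseteq> chart_image (ch i)" by (rule K[OF it])+
    fix x assume x: "x \<in> topspace X"
    show "\<exists>t. \<rho> i x = of_real t \<and> 0 \<le> t \<and> t \<le> 1"
    proof -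
      obtain s t where s: "S x = of_real s" "s \<ge> 1" "b i x = of_real t" "0 \<le> t" "t \<le> 1"
        using S1[OF x] b_range[OF it, of x] by blast
      have "\<rho> i x = of_real (t / s)" using s by (simp add: \<rho>_def)
      moreover have "0 \<le> t / s" "t / s \<le> 1" using s by (auto simp: divide_le_eq)
      ultimately show ?thesis by blast
    qed
    show "\<rho> i x = 0" if "x \<notin> fst (ch i) \<or> snd (ch i) x \<notin> K i"
      using that \<psi>0[OF it] by (auto simp: \<rho>_def b_def ext0_def)
  next
    fix x assume x: "x \<in> topspace X"
    show "(\<Sum>i\<in>I. \<rho> i x) = 1" using Snz[OF x] by (simp add: \<rho>_def sum_divide_distrib[symmetric] S_def)
  qed
  then show ?thesis by blast
qed

section \<open>Surface integrals\<close>

context surface_pou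
begin

definition Sintegrable :: "('a chart \<Rightarrow> complex \<Rightarrow> complex) \<Rightarrow> bool" where
  "Sintegrable \<Theta> \<longleftrightarrow> (\<forall>i\<in>I. set_integrable lborel (chart_image (ch i)) (\<lambda>z. \<rho> i (pt (ch i) z) * \<Theta> (ch i) z))"

definition Sint :: "('a chart \<Rightarrow> complex \<Rightarrow> complex) \<Rightarrow> complex" where
  "Sint \<Theta> = (\<Sum>i\<in>I. set_lebesgue_integral lborel (chart_image (ch i)) (\<lambda>z. \<rho> i (pt (ch i) z) * \<Theta> (ch i) z))"

lemma pt_top: "c \<in> A \<Longrightarrow> z \<in> chart_image c \<Longrightarrow> pt c z \<in> topspace X"
  using chart_subset pt_in by blast

lemma rho_continuous: "i \<in> I \<Longrightarrow> c \<in> A \<Longrightarrow> continuous_on (chart_image c) (\<lambda>z. \<rho> i (pt c z))"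
  by (rule prim_continuous_on[OF rho_prim])

lemma rho_zero:
  "i \<in> I \<Longrightarrow> d \<in> A \<Longrightarrow> z \<in> chart_image d \<Longrightarrow> pt d z \<notin> fst (ch i) \<Longrightarrow> \<rho> i (pt d z) = 0"
  using rho_supp pt_top by blast

lemma rho_zero_K:
  assumes "i \<in> I" "z \<in> chart_image (ch i)" "z \<notin> K i" shows "\<rho> i (pt (ch i) z) = 0"
proof (rule rho_supp[OF assms(1) pt_top[OF ch[OF assms(1)] assms(2)]], rule disjI2)
  show "snd (ch i) (pt (ch i) z) \<notin> K i" unfolding snd_pt[OF assms(2)] by (rule assms(3))
qed

lemma rho_deriv_supp:
  assumes i: "i \<in> I" and c: "c \<in> A" "x \<in> fst c" and out: "x \<notin> fst (ch i) \<or> snd (ch i) x \<notin> K i"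
  shows "d\<rho> i c (snd c x) v = 0"
proof -
  let ?C = "{x \<in> fst (ch i). snd (ch i) x \<in> K i}"
  have "openin X (topspace X - ?C)" using closedin_chart_compact[OF ch[OF i] K[OF i]] by blast
  moreover have "x \<in> topspace X - ?C" using out chart_subset[OF c(1)] c(2) by auto
  ultimately show ?thesis
    using prim_deriv_zero[OF rho_prim[OF i], of "topspace X - ?C" 0 c x v] rho_supp[OF i] c by auto
qed

lemma sum_drho:
  assumes c: "c \<in> A" "x \<in> fst c" shows "(\<Sum>i\<in>I. d\<rho> i c (snd c x) v) = 0"
proof -
  have "prim (\<lambda>c z v. \<Sum>i\<in>I. d\<rho> i c z v) (topspace X) (\<lambda>y. \<Sum>i\<in>I. \<rho> i y)"
    unfolding prim_def
    by (intro conjI ballI openin_topspace has_derivative_sum primD[OF rho_prim]) auto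
  from prim_deriv_zero[OF this openin_topspace, of 1 c x v] rho_sum c chart_subset[OF c(1)] show ?thesis by auto
qed

lemma measurable_density_continuous:
  assumes "\<And>c. c \<in> A \<Longrightarrow> continuous_on (chart_image c) (\<Theta> c)"
  shows "measurable_density \<Theta>"
  unfolding measurable_density_def
  using assms by (auto intro!: borel_measurable_continuous_on_indicator chart_image_open borel_open)

lemma Sintegrable_continuous:
  assumes "\<And>c. c \<in> A \<Longrightarrow> continuous_on (chart_image c) (\<Theta> c)"
  shows "Sintegrable \<Theta>"
  unfolding Sintegrable_def
proof
  fix i assume i: "i \<in> I"
  let ?f = "\<lambda>z. \<rho> i (pt (ch i) z) * \<Theta> (ch i) z"
  have "continuous_on (chart_image (ch i)) ?f"
    by (intro continuous_intros rho_continuous[OF i ch[OF i]] assms ch[OF i])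
  then have "set_integrable lborel (K i) ?f"
    unfolding set_integrable_def using K[OF i] by (intro borel_integrable_compact) (auto intro: continuous_on_subset)
  moreover have "\<forall>z \<in> chart_image (ch i) - K i. ?f z = 0"
  proof
    fix z assume "z \<in> chart_image (ch i) - K i"
    then have "\<rho> i (pt (ch i) z) = 0" using rho_zero_K[OF i, of z] by blast
    then show "?f z = 0" by (simp only: mult_zero_left)
  qed
  ultimately show "set_integrable lborel (chart_image (ch i)) ?f"
    using set_integrable_eq_outside(1)[OF K(2)[OF i], of ?f] by metis
qed

lemma Sint_sum:
  assumes "finite J" "\<And>j. j \<in> J \<Longrightarrow> Sintegrable (\<Theta> j)"
  shows "Sint (\<lambda>c z. \<Sum>j\<in>J. \<Theta> j c z) = (\<Sum>j\<in>J. Sint (\<Theta> j))"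
proof -
  have "set_lebesgue_integral lborel (chart_image (ch i)) (\<lambda>z. \<rho> i (pt (ch i) z) * (\<Sum>j\<in>J. \<Theta> j (ch i) z))
      = (\<Sum>j\<in>J. set_lebesgue_integral lborel (chart_image (ch i)) (\<lambda>z. \<rho> i (pt (ch i) z) * \<Theta> j (ch i) z))" if i: "i \<in> I" for i
    unfolding set_lebesgue_integral_def sum_distrib_left scaleR_sum_right
    by (rule Bochner_Integration.integral_sum) (use assms i in \<open>auto simp: Sintegrable_def set_integrable_def\<close>)
  then have "Sint (\<lambda>c z. \<Sum>j\<in>J. \<Theta> j c z) = (\<Sum>i\<in>I. \<Sum>j\<in>J. set_lebesgue_integral lborel (chart_image (ch i)) (\<lambda>z. \<rho> i (pt (ch i) z) * \<Theta> j (ch i) z))"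
    by (simp add: Sint_def)
  also have "\<dots> = (\<Sum>j\<in>J. Sint (\<Theta> j))" unfolding Sint_def by (rule sum.swap)
  finally show ?thesis .
qed

lemma Sint_cmult: "Sint (\<lambda>c z. a * \<Theta> c z) = a * Sint \<Theta>"
proof -
  have "(\<lambda>z. \<rho> i (pt (ch i) z) * (a * \<Theta> (ch i) z)) = (\<lambda>z. a * (\<rho> i (pt (ch i) z) * \<Theta> (ch i) z))" for i
    by (simp add: algebra_simps)
  then show ?thesis unfolding Sint_def by (simp add: sum_distrib_left)
qed

lemma Sintegrable_cmult: "Sintegrable \<Theta> \<Longrightarrow> Sintegrable (\<lambda>c z. a * \<Theta> c z)"
proof -
  assume "Sintegrable \<Theta>"
  then have "set_integrable lborel (chart_image (ch i)) (\<lambda>z. a * (\<rho> i (pt (ch i) z) * \<Theta> (ch i) z))" if "i \<in> I" for i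
    using that by (auto simp: Sintegrable_def)
  then show ?thesis unfolding Sintegrable_def by (simp add: mult.left_commute)
qed

text \<open>Meant for the junctions of arcs: there the sum of the arc forms carries no information,
  so it agrees with the dual form only off a finite set in each chart.\<close>

lemma Sint_cong_finite:
  assumes "measurable_density \<Theta>" "measurable_density \<Theta>'"
    and "\<And>c. c \<in> A \<Longrightarrow> \<exists>N. finite N \<and> (\<forall>z\<in>chart_image c - N. \<Theta> c z = \<Theta>' c z)"
  shows "Sint \<Theta> = Sint \<Theta>'"
  unfolding Sint_def
proof (rule sum.cong[OF refl])
  fix i assume i: "i \<in> I"
  let ?S = "chart_image (ch i)"
  obtain N where N: "finite N" "\<And>z. z \<in> ?S - N \<Longrightarrow> \<Theta> (ch i) z = \<Theta>' (ch i) z" using assms(3)[OF ch[OF i]] by blast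
  have mr: "(\<lambda>z. indicator ?S z *\<^sub>R \<rho> i (pt (ch i) z)) \<in> borel_measurable borel"
    by (rule borel_measurable_continuous_on_indicator[OF borel_open[OF chart_image_open[OF ch[OF i]]] rho_continuous[OF i ch[OF i]]])
  have m: "(\<lambda>z. indicator ?S z *\<^sub>R (\<rho> i (pt (ch i) z) * \<Theta> (ch i) z)) \<in> borel_measurable lborel" if "measurable_density \<Theta>" for \<Theta>
  proof -
    have "(\<lambda>z. (indicator ?S z *\<^sub>R \<rho> i (pt (ch i) z)) * (indicator ?S z *\<^sub>R \<Theta> (ch i) z)) \<in> borel_measurable borel"
      using that ch[OF i] by (intro borel_measurable_times mr) (simp add: measurable_density_def)
    also have "(\<lambda>z. (indicator ?S z *\<^sub>R \<rho> i (pt (ch i) z)) * (indicator ?S z *\<^sub>R \<Theta> (ch i) z)) = (\<lambda>z. indicator ?S z *\<^sub>R (\<rho> i (pt (ch i) z) * \<Theta> (ch i) z))"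
      by (auto simp: fun_eq_iff indicator_def)
    finally show ?thesis by simp
  qed
  show "set_lebesgue_integral lborel ?S (\<lambda>z. \<rho> i (pt (ch i) z) * \<Theta> (ch i) z) = set_lebesgue_integral lborel ?S (\<lambda>z. \<rho> i (pt (ch i) z) * \<Theta>' (ch i) z)"
    unfolding set_lebesgue_integral_def
  proof (rule integral_cong_AE[OF m[OF assms(1)] m[OF assms(2)]])
    have "AE z in lborel. z \<notin> N" using N(1) by (intro AE_not_in finite_imp_null_set_lborel)
    then show "AE z in lborel. indicator ?S z *\<^sub>R (\<rho> i (pt (ch i) z) * \<Theta> (ch i) z) = indicator ?S z *\<^sub>R (\<rho> i (pt (ch i) z) * \<Theta>' (ch i) z)"
      by eventually_elim (use N(2) in \<open>auto simp: fun_eq_iff indicator_def\<close>)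
  qed
qed

text \<open>Each piece \<open>\<rho> i\<close> times \<Theta> is carried from its own chart to
  \<open>d\<close> by the change of variables on the overlap, outside of which it vanishes in either
  chart. In \<open>d\<close> the weights then add up to 1.\<close>

lemma Sint_local:
  assumes d: "d \<in> A" and \<Theta>: "density \<Theta>" "measurable_density \<Theta>"
    and supp: "\<And>c z. c \<in> A \<Longrightarrow> z \<in> chart_image c \<Longrightarrow> pt c z \<notin> fst d \<Longrightarrow> \<Theta> c z = 0"
    and int: "set_integrable lborel (chart_image d) (\<Theta> d)"
  shows "Sintegrable \<Theta>" "Sint \<Theta> = set_lebesgue_integral lborel (chart_image d) (\<Theta> d)"
proof -
  define \<Psi> where "\<Psi> i c z = \<rho> i (pt c z) * \<Theta> c z" for i c z
  have dens: "density (\<Psi> i)" if "i \<in> I" for i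
    unfolding density_def \<Psi>_def
  proof (intro ballI)
    fix c e x assume "c \<in> A" "e \<in> A" "x \<in> fst c \<inter> fst e"
    moreover from this have "\<Theta> c (snd c x) = of_real ((norm (deriv (transition c e) (snd c x)))\<^sup>2) * \<Theta> e (snd e x)"
      using \<Theta>(1) unfolding density_def by blast
    ultimately show "\<rho> i (pt c (snd c x)) * \<Theta> c (snd c x) = of_real ((norm (deriv (transition c e) (snd c x)))\<^sup>2) * (\<rho> i (pt e (snd e x)) * \<Theta> e (snd e x))"
      by (simp only: pt_snd Int_iff mult.left_commute)
  qed
  have meas: "measurable_density (\<Psi> i)" if i: "i \<in> I" for i
    unfolding measurable_density_def
  proof
    fix c assume c: "c \<in> A"
    have m1: "(\<lambda>z. indicator (chart_image c) z *\<^sub>R \<rho> i (pt c z)) \<in> borel_measurable borel"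
      by (rule borel_measurable_continuous_on_indicator[OF borel_open[OF chart_image_open[OF c]] rho_continuous[OF i c]])
    have m2: "(\<lambda>z. indicator (chart_image c) z *\<^sub>R \<Theta> c z) \<in> borel_measurable borel"
      using \<Theta>(2) c unfolding measurable_density_def by blast
    have "(\<lambda>z. (indicator (chart_image c) z *\<^sub>R \<rho> i (pt c z)) * (indicator (chart_image c) z *\<^sub>R \<Theta> c z)) \<in> borel_measurable borel"
      by (rule borel_measurable_times[OF m1 m2])
    also have "(\<lambda>z. (indicator (chart_image c) z *\<^sub>R \<rho> i (pt c z)) * (indicator (chart_image c) z *\<^sub>R \<Theta> c z)) = (\<lambda>z. indicator (chart_image c) z *\<^sub>R \<Psi> i c z)"
      by (auto simp: fun_eq_iff indicator_def \<Psi>_def)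
    finally show "(\<lambda>z. indicator (chart_image c) z *\<^sub>R \<Psi> i c z) \<in> borel_measurable borel" .
  qed
  have intD: "set_integrable lborel (chart_image d) (\<Psi> i d)" if i: "i \<in> I" for i
    unfolding set_integrable_def
  proof (rule Bochner_Integration.integrable_bound[OF int[unfolded set_integrable_def]])
    show "(\<lambda>z. indicator (chart_image d) z *\<^sub>R \<Psi> i d z) \<in> borel_measurable lborel"
      using meas[OF i] d by (simp add: measurable_density_def)
    show "AE z in lborel. norm (indicator (chart_image d) z *\<^sub>R \<Psi> i d z) \<le> norm (indicator (chart_image d) z *\<^sub>R \<Theta> d z)"
    proof (rule AE_I2)
      fix z
      show "norm (indicator (chart_image d) z *\<^sub>R \<Psi> i d z) \<le> norm (indicator (chart_image d) z *\<^sub>R \<Theta> d z)"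
      proof (cases "z \<in> chart_image d")
        case True
        then obtain t where "\<rho> i (pt d z) = of_real t" "0 \<le> t" "t \<le> 1" using rho_range[OF i pt_top[OF d]] by blast
        then show ?thesis using True by (simp add: \<Psi>_def norm_mult mult_left_le_one_le)
      qed simp
    qed
  qed
  have *: "set_integrable lborel (chart_image (ch i)) (\<Psi> i (ch i)) \<and>
      set_lebesgue_integral lborel (chart_image (ch i)) (\<Psi> i (ch i)) = set_lebesgue_integral lborel (chart_image d) (\<Psi> i d)" if i: "i \<in> I" for i
  proof -
    let ?S = "snd (ch i) ` (fst (ch i) \<inter> fst d)" and ?T = "snd d ` (fst (ch i) \<inter> fst d)"
    have ST: "?S \<subseteq> chart_image (ch i)" "?T \<subseteq> chart_image d" by (auto simp: chart_image_def)
    have S0: "\<forall>z \<in> chart_image (ch i) - ?S. \<Psi> i (ch i) z = 0"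
    proof
      fix z assume that: "z \<in> chart_image (ch i) - ?S"
      have "pt (ch i) z \<notin> fst d"
      proof
        assume "pt (ch i) z \<in> fst d"
        then have "snd (ch i) (pt (ch i) z) \<in> ?S" using that by (intro imageI) simp
        then show False using that by simp
      qed
      then have "\<Theta> (ch i) z = 0" using supp[OF ch[OF i], of z] that by blast
      then show "\<Psi> i (ch i) z = 0" by (simp add: \<Psi>_def)
    qed
    have T0: "\<forall>z \<in> chart_image d - ?T. \<Psi> i d z = 0"
    proof
      fix z assume that: "z \<in> chart_image d - ?T"
      have "pt d z \<notin> fst (ch i)"
      proof
        assume "pt d z \<in> fst (ch i)"
        then have "snd d (pt d z) \<in> ?T" using that by (intro imageI) simp
        then show False using that by simp
      qed
      then have "\<rho> i (pt d z) = 0" using rho_zero[OF i d, of z] that by blast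
      then show "\<Psi> i d z = 0" by (simp add: \<Psi>_def)
    qed
    note o = overlap_integral[OF ch[OF i] d dens[OF i] meas[OF i]]
    have T: "set_integrable lborel ?T (\<Psi> i d)"
      using set_integrable_eq_outside(1)[OF ST(2) T0] intD[OF i] by blast
    then show ?thesis
      using o set_integrable_eq_outside[OF ST(1) S0] set_integrable_eq_outside[OF ST(2) T0] by simp
  qed
  have \<Psi>_fun: "\<Psi> i c = (\<lambda>z. \<rho> i (pt c z) * \<Theta> c z)" for i c by (simp add: \<Psi>_def fun_eq_iff)
  show "Sintegrable \<Theta>" unfolding Sintegrable_def using *[unfolded \<Psi>_fun] by blast
  have "Sint \<Theta> = (\<Sum>i\<in>I. set_lebesgue_integral lborel (chart_image (ch i)) (\<Psi> i (ch i)))"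
    unfolding Sint_def \<Psi>_fun ..
  also have "\<dots> = (\<Sum>i\<in>I. set_lebesgue_integral lborel (chart_image d) (\<Psi> i d))" using * by simp
  also have "\<dots> = integral\<^sup>L lborel (\<lambda>z. \<Sum>i\<in>I. indicator (chart_image d) z *\<^sub>R \<Psi> i d z)"
    unfolding set_lebesgue_integral_def
    by (rule Bochner_Integration.integral_sum[symmetric]) (use intD in \<open>simp add: set_integrable_def\<close>)
  also have "(\<lambda>z. \<Sum>i\<in>I. indicator (chart_image d) z *\<^sub>R \<Psi> i d z) = (\<lambda>z. indicator (chart_image d) z *\<^sub>R \<Theta> d z)"
  proof
    fix z
    show "(\<Sum>i\<in>I. indicator (chart_image d) z *\<^sub>R \<Psi> i d z) = indicator (chart_image d) z *\<^sub>R \<Theta> d z"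
      using rho_sum[OF pt_top[OF d], of z]
      by (cases "z \<in> chart_image d") (simp_all add: \<Psi>_def sum_distrib_right[symmetric])
  qed
  finally show "Sint \<Theta> = set_lebesgue_integral lborel (chart_image d) (\<Theta> d)" by (simp add: set_lebesgue_integral_def)
qed

end

section \<open>Stokes for holomorphic forms\<close>

lemma set_lebesgue_integral_cnj:
  "set_lebesgue_integral M S (\<lambda>z. cnj (f z)) = cnj (set_lebesgue_integral M S f)"
proof -
  have "(\<lambda>z. indicator S z *\<^sub>R cnj (f z)) = (\<lambda>z. cnj (indicator S z *\<^sub>R f z))" by simp
  then show ?thesis unfolding set_lebesgue_integral_def by (simp only: Bochner_Integration.integral_cnj)
qed

context surface_pou
begin

lemma Sint_cong:
  assumes "\<And>c z. c \<in> A \<Longrightarrow> z \<in> chart_image c \<Longrightarrow> \<Theta> c z = \<Theta>' c z"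
  shows "Sint \<Theta> = Sint \<Theta>'"
  unfolding Sint_def set_lebesgue_integral_def
proof (rule sum.cong[OF refl])
  fix i assume i: "i \<in> I"
  have "(\<lambda>z. indicator (chart_image (ch i)) z *\<^sub>R (\<rho> i (pt (ch i) z) * \<Theta> (ch i) z))
      = (\<lambda>z. indicator (chart_image (ch i)) z *\<^sub>R (\<rho> i (pt (ch i) z) * \<Theta>' (ch i) z))"
    using assms[OF ch[OF i]] by (auto simp: fun_eq_iff indicator_def)
  then show "integral\<^sup>L lborel (\<lambda>z. indicator (chart_image (ch i)) z *\<^sub>R (\<rho> i (pt (ch i) z) * \<Theta> (ch i) z))
      = integral\<^sup>L lborel (\<lambda>z. indicator (chart_image (ch i)) z *\<^sub>R (\<rho> i (pt (ch i) z) * \<Theta>' (ch i) z))"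
    by simp
qed

lemma Sint_cnj: "Sint (\<lambda>c z. cnj (\<Theta> c z)) = cnj (Sint \<Theta>)"
proof -
  have "set_lebesgue_integral lborel (chart_image (ch i)) (\<lambda>z. \<rho> i (pt (ch i) z) * cnj (\<Theta> (ch i) z))
     = cnj (set_lebesgue_integral lborel (chart_image (ch i)) (\<lambda>z. \<rho> i (pt (ch i) z) * \<Theta> (ch i) z))" if i: "i \<in> I" for i
  proof -
    have "\<rho> i (pt (ch i) z) * cnj (\<Theta> (ch i) z) = cnj (\<rho> i (pt (ch i) z) * \<Theta> (ch i) z)" if z: "z \<in> chart_image (ch i)" for z
    proof -
      obtain t where "\<rho> i (pt (ch i) z) = of_real t" using rho_range[OF i pt_top[OF ch[OF i] z]] by blast
      then show ?thesis by simp
    qed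
    then have "(\<lambda>z. indicator (chart_image (ch i)) z *\<^sub>R (\<rho> i (pt (ch i) z) * cnj (\<Theta> (ch i) z)))
      = (\<lambda>z. indicator (chart_image (ch i)) z *\<^sub>R cnj (\<rho> i (pt (ch i) z) * \<Theta> (ch i) z))" by (auto simp: fun_eq_iff indicator_def)
    then show ?thesis unfolding set_lebesgue_integral_cnj[symmetric] unfolding set_lebesgue_integral_def by simp
  qed
  then show ?thesis by (simp add: Sint_def)
qed

lemma continuous_wedge:
  assumes "continuous_form \<omega>" "continuous_form \<eta>" "c \<in> A"
  shows "continuous_on (chart_image c) (wedge \<omega> \<eta> c)"
  unfolding wedge_def[abs_def] using assms by (auto simp: continuous_form_def intro!: continuous_intros)

text \<open>As the \<open>\<rho> i\<close> sum to 1 and the \<open>d\<rho> i\<close> to 0,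
  \<open>T\<close> is the sum of the differentials of \<open>\<rho> i\<close> times
  \<open>h\<close>, each supported in one chart. Wedged with a holomorphic form such a differential
  has vanishing integral by the planar case.\<close>

lemma stokes_holomorphic:
  assumes T: "prim T (topspace X) h" "continuous_form T" and \<omega>: "is_form \<omega>"
    and f: "\<And>c. c \<in> A \<Longrightarrow> f c holomorphic_on chart_image c"
    and \<omega>f: "\<And>c z v. c \<in> A \<Longrightarrow> z \<in> chart_image c \<Longrightarrow> \<omega> c z v = f c z * v"
  shows "Sint (wedge T \<omega>) = 0"
proof -
  define D where "D i c z v = \<rho> i (pt c z) * T c z v + d\<rho> i c z v * h (pt c z)" for i c z v
  have Dp: "prim (D i) (topspace X) (\<lambda>y. \<rho> i y * h y)" if i: "i \<in> I" for i
    unfolding prim_def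
  proof (intro conjI ballI openin_topspace)
    fix c x assume c: "c \<in> A" "x \<in> topspace X \<inter> fst c"
    then have x: "x \<in> topspace X" "x \<in> fst c" by auto
    from has_derivative_mult[OF primD[OF rho_prim[OF i] c(1) x] primD[OF T(1) c(1) x]]
    show "((\<lambda>z. \<rho> i (pt c z) * h (pt c z)) has_derivative D i c (snd c x)) (at (snd c x))"
      unfolding D_def .
  qed
  have Dc: "continuous_form (D i)" if i: "i \<in> I" for i
    unfolding continuous_form_def D_def
  proof (intro ballI allI)
    fix c v assume c: "c \<in> A"
    have "continuous_on (chart_image c) (\<lambda>z. T c z v)" "continuous_on (chart_image c) (\<lambda>z. d\<rho> i c z v)"
      using T(2) rho_cont[OF i] c by (auto simp: continuous_form_def)
    then show "continuous_on (chart_image c) (\<lambda>z. \<rho> i (pt c z) * T c z v + d\<rho> i c z v * h (pt c z))"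
      by (intro continuous_intros rho_continuous[OF i c] prim_continuous_on[OF T(1) c])
  qed
  have \<omega>c: "continuous_form \<omega>"
    unfolding continuous_form_def
  proof (intro ballI allI)
    fix c v assume c: "c \<in> A"
    have "continuous_on (chart_image c) (\<lambda>z. f c z * v)"
      by (intro continuous_intros holomorphic_on_imp_continuous_on f c)
    then show "continuous_on (chart_image c) (\<lambda>z. \<omega> c z v)"
      by (rule continuous_on_eq) (simp add: \<omega>f[OF c])
  qed
  have split: "wedge T \<omega> c z = (\<Sum>i\<in>I. wedge (D i) \<omega> c z)" if c: "c \<in> A" and z: "z \<in> chart_image c" for c z
  proof -
    have "(\<Sum>i\<in>I. D i c z v) = T c z v" for v
    proof -
      have "(\<Sum>i\<in>I. d\<rho> i c z v) = 0" using sum_drho[OF c pt_in[OF z], of v] z by simp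
      then show ?thesis using rho_sum[OF pt_top[OF c z]]
        by (simp add: D_def sum.distrib sum_distrib_right[symmetric])
    qed
    then show ?thesis
      by (simp add: wedge_def sum_subtractf sum_distrib_right[symmetric])
  qed
  have zero: "Sint (wedge (D i) \<omega>) = 0" if i: "i \<in> I" for i
  proof -
    let ?d = "ch i" and ?\<Theta> = "wedge (D i) \<omega>"
    have d: "?d \<in> A" by (rule ch[OF i])
    let ?S = "chart_image ?d"
    have dens: "density ?\<Theta>" by (rule density_wedge[OF prim_is_form[OF Dp[OF i]] \<omega>])
    have meas: "measurable_density ?\<Theta>" by (rule measurable_density_continuous[OF continuous_wedge[OF Dc[OF i] \<omega>c]])
    have D0: "D i c z v = 0" if c: "c \<in> A" and z: "z \<in> chart_image c" and out: "pt c z \<notin> fst ?d \<or> snd ?d (pt c z) \<notin> K i" for c z v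
    proof -
      have "d\<rho> i c (snd c (pt c z)) v = 0" by (rule rho_deriv_supp[OF i c pt_in[OF z] out])
      then show ?thesis using rho_supp[OF i pt_top[OF c z] out] z by (simp add: D_def)
    qed
    \<comment> \<open>Multiplying by the holomorphic coefficient before differentiating changes
      nothing, because its complex-linear derivative drops out of
      \<open>\<i> * W' z 1 - W' z \<i>\<close>.\<close>
    define W where "W z = f ?d z * (\<rho> i (pt ?d z) * h (pt ?d z))" for z
    define W' where "W' z v = f ?d z * D i ?d z v + deriv (f ?d) z * v * (\<rho> i (pt ?d z) * h (pt ?d z))" for z v
    have cW: "c1on ?S W W'"
      unfolding W_def[abs_def] W'_def[abs_def]
      by (rule c1on_mult[OF c1on_holomorphic[OF f[OF d] chart_image_open[OF d]] prim_c1on[OF Dp[OF i] Dc[OF i] d]])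
    have W0: "W z = 0" if "z \<in> ?S - K i" for z
      using rho_zero_K[OF i] that by (simp add: W_def)
    note E = c1on_extend_zero[OF cW compact_imp_closed[OF K(1)[OF i]] K(2)[OF i] W0]
    let ?W = "\<lambda>z. if z \<in> ?S then W z else 0" and ?W' = "\<lambda>z v. if z \<in> ?S then W' z v else 0"
    obtain R where R: "\<And>z. z \<in> K i \<Longrightarrow> norm z \<le> R"
      using compact_imp_bounded[OF K(1)[OF i]] unfolding bounded_iff by blast
    have WR: "?W z = 0" if "z \<notin> cball 0 R" for z
      using that R[of z] W0[of z] by auto
    have Z: "integrable lborel (\<lambda>z. ?W' z v)" "integral\<^sup>L lborel (\<lambda>z. ?W' z v) = 0" for v
    proof -
      have WR': "\<And>z. z \<notin> cball 0 R \<Longrightarrow> ?W z = 0" by (rule WR)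
      show "integrable lborel (\<lambda>z. ?W' z v)" using integral_derivative_zero(1)[where v = v, OF E, of R] WR' by blast
      show "integral\<^sup>L lborel (\<lambda>z. ?W' z v) = 0" using integral_derivative_zero(2)[where v = v, OF E, of R] WR' by blast
    qed
    have eq: "indicator ?S z *\<^sub>R ?\<Theta> ?d z = \<i> * ?W' z 1 - ?W' z \<i>" for z
      using \<omega>f[OF d] by (auto simp: fun_eq_iff indicator_def wedge_def W'_def algebra_simps)
    have "set_integrable lborel ?S (?\<Theta> ?d)" unfolding set_integrable_def eq
      using Z(1) by (intro Bochner_Integration.integrable_diff integrable_mult_right)
    moreover have "?\<Theta> c z = 0" if "c \<in> A" "z \<in> chart_image c" "pt c z \<notin> fst ?d" for c z
      using D0[OF that(1,2)] that(3) by (simp add: wedge_def)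
    ultimately have "Sint ?\<Theta> = set_lebesgue_integral lborel ?S (?\<Theta> ?d)"
      by (intro Sint_local(2)[OF d dens meas])
    also have "\<dots> = \<i> * integral\<^sup>L lborel (\<lambda>z. ?W' z 1) - integral\<^sup>L lborel (\<lambda>z. ?W' z \<i>)"
      unfolding set_lebesgue_integral_def eq
      by (subst Bochner_Integration.integral_diff[OF integrable_mult_right[OF Z(1)] Z(1)]) (simp only: integral_mult_right_zero)
    also have "\<dots> = 0" unfolding Z(2) by simp
    finally show ?thesis .
  qed
  have "Sint (wedge T \<omega>) = Sint (\<lambda>c z. \<Sum>i\<in>I. wedge (D i) \<omega> c z)"
    by (rule Sint_cong) (rule split)
  also have "\<dots> = (\<Sum>i\<in>I. Sint (wedge (D i) \<omega>))"
    by (rule Sint_sum[OF finI Sintegrable_continuous[OF continuous_wedge[OF Dc \<omega>c]]])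
  also have "\<dots> = 0" using zero by simp
  finally show ?thesis .
qed

lemma prim_cnj:
  assumes "prim \<omega> U F" shows "prim (cnj_form \<omega>) U (\<lambda>y. cnj (F y))"
  unfolding prim_def
proof (intro conjI ballI)
  show "openin X U" using assms by (simp add: prim_def)
  fix c x assume c: "c \<in> A" "x \<in> U \<inter> fst c"
  then have x: "x \<in> U" "x \<in> fst c" by auto
  from bounded_linear.has_derivative[OF bounded_linear_cnj primD[OF assms c(1) x]]
  show "((\<lambda>z. cnj (F (pt c z))) has_derivative cnj_form \<omega> c (snd c x)) (at (snd c x))"
    unfolding cnj_form_def .
qed

lemma continuous_form_cnj: "continuous_form \<omega> \<Longrightarrow> continuous_form (cnj_form \<omega>)"
  unfolding continuous_form_def cnj_form_def by (auto intro!: continuous_on_cnj)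

text \<open>The holomorphic case applied to the conjugate of \<open>T\<close>.\<close>

lemma stokes_antiholomorphic:
  assumes T: "prim T (topspace X) h" "continuous_form T" and \<omega>: "is_form \<omega>"
    and f: "\<And>c. c \<in> A \<Longrightarrow> f c holomorphic_on chart_image c"
    and \<omega>f: "\<And>c z v. c \<in> A \<Longrightarrow> z \<in> chart_image c \<Longrightarrow> \<omega> c z v = f c z * v"
  shows "Sint (wedge T (cnj_form \<omega>)) = 0"
proof -
  have "wedge T (cnj_form \<omega>) = (\<lambda>c z. cnj (wedge (cnj_form T) \<omega> c z))"
    by (simp add: wedge_def cnj_form_def fun_eq_iff)
  then have "Sint (wedge T (cnj_form \<omega>)) = cnj (Sint (wedge (cnj_form T) \<omega>))" using Sint_cnj by simp
  also have "Sint (wedge (cnj_form T) \<omega>) = 0"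
    by (rule stokes_holomorphic[OF prim_cnj[OF T(1)] continuous_form_cnj[OF T(2)] \<omega> f \<omega>f])
  finally show ?thesis by simp
qed

text \<open>For \<omega> = f dz the coefficient of \<open>\<i>\<close> times the wedge with the
  conjugate is \<open>2 * (norm f)\<^sup>2\<close>, so every chart contributes the integral of a
  continuous nonnegative function.\<close>

lemma Sint_positive:
  assumes \<omega>: "is_form \<omega>"
    and f: "\<And>c. c \<in> A \<Longrightarrow> f c holomorphic_on chart_image c"
    and \<omega>f: "\<And>c z v. c \<in> A \<Longrightarrow> z \<in> chart_image c \<Longrightarrow> \<omega> c z v = f c z * v"
    and nz: "nonzero_form A \<omega>"
  shows "\<exists>t>0. \<i> * Sint (wedge \<omega> (cnj_form \<omega>)) = of_real t"
proof -
  define g where "g i z = (if z \<in> chart_image (ch i) then Re (\<rho> i (pt (ch i) z)) * (2 * (norm (f (ch i) z))\<^sup>2) else 0)" for i z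
  have g_eq: "indicator (chart_image (ch i)) z *\<^sub>R (\<rho> i (pt (ch i) z) * (\<i> * wedge \<omega> (cnj_form \<omega>) (ch i) z)) = of_real (g i z)"
    if i: "i \<in> I" for i z
  proof (cases "z \<in> chart_image (ch i)")
    case True
    obtain t where t: "\<rho> i (pt (ch i) z) = of_real t" using rho_range[OF i pt_top[OF ch[OF i] True]] by blast
    have "\<i> * wedge \<omega> (cnj_form \<omega>) (ch i) z = of_real (2 * (norm (f (ch i) z))\<^sup>2)"
      using \<omega>f[OF ch[OF i] True] by (simp add: wedge_def cnj_form_def complex_norm_square del: of_real_power)
    then show ?thesis using True t by (simp add: g_def)
  qed (simp add: g_def)
  have g0: "g i z \<ge> 0" if i: "i \<in> I" for i z
    using rho_range[OF i pt_top[OF ch[OF i]], of z] by (auto simp: g_def)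
  have gK: "g i z = 0" if i: "i \<in> I" and z: "z \<notin> K i" for i z
    using rho_zero_K[OF i] z by (auto simp: g_def)
  have gc: "continuous_on UNIV (g i)" if i: "i \<in> I" for i
  proof -
    let ?S = "chart_image (ch i)"
    have "continuous_on (?S \<union> - K i) (g i)"
    proof (rule continuous_on_open_Un)
      show "open ?S" by (rule chart_image_open[OF ch[OF i]])
      show "open (- K i)" using compact_imp_closed[OF K(1)[OF i]] by (simp add: open_Compl)
      have "continuous_on ?S (\<lambda>z. Re (\<rho> i (pt (ch i) z)) * (2 * (norm (f (ch i) z))\<^sup>2))"
        by (intro continuous_intros rho_continuous[OF i ch[OF i]] holomorphic_on_imp_continuous_on f ch[OF i])
      then show "continuous_on ?S (g i)" by (rule continuous_on_eq) (simp add: g_def)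
      show "continuous_on (- K i) (g i)"
        by (rule continuous_on_eq[of _ "\<lambda>_. 0"]) (use gK[OF i] in auto)
    qed
    moreover have "?S \<union> - K i = UNIV" using K(2)[OF i] by blast
    ultimately show ?thesis by simp
  qed
  have gi: "integrable lborel (g i)" if i: "i \<in> I" for i
  proof -
    have "integrable lborel (\<lambda>z. indicator (K i) z *\<^sub>R g i z)"
      by (rule borel_integrable_compact[OF K(1)[OF i] continuous_on_subset[OF gc[OF i]]]) simp
    also have "(\<lambda>z. indicator (K i) z *\<^sub>R g i z) = g i" using gK[OF i] by (auto simp: fun_eq_iff indicator_def)
    finally show ?thesis .
  qed
  have "\<i> * Sint (wedge \<omega> (cnj_form \<omega>)) = Sint (\<lambda>c z. \<i> * wedge \<omega> (cnj_form \<omega>) c z)"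
    by (rule Sint_cmult[symmetric])
  also have "\<dots> = (\<Sum>i\<in>I. integral\<^sup>L lborel (\<lambda>z. of_real (g i z)))"
    unfolding Sint_def set_lebesgue_integral_def using g_eq by simp
  also have "\<dots> = of_real (\<Sum>i\<in>I. integral\<^sup>L lborel (g i))" by simp
  finally have eq: "\<i> * Sint (wedge \<omega> (cnj_form \<omega>)) = of_real (\<Sum>i\<in>I. integral\<^sup>L lborel (g i))" .
  obtain c z v where c: "c \<in> A" "z \<in> chart_image c" "\<omega> c z v \<noteq> 0" using nz by (auto simp: nonzero_form_def)
  define x where "x = pt c z"
  have x: "x \<in> topspace X" "x \<in> fst c" "snd c x = z" using c pt_top by (auto simp: x_def)
  \<comment> \<open>Some weight is nonzero at the point where \<omega> is, and covariance transports
    the nonvanishing of \<omega> to the chart of that weight.\<close>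
  have "\<exists>i\<in>I. \<rho> i x \<noteq> 0"
  proof (rule ccontr)
    assume "\<not> (\<exists>i\<in>I. \<rho> i x \<noteq> 0)"
    then have "(\<Sum>i\<in>I. \<rho> i x) = 0" by simp
    then show False using rho_sum[OF x(1)] by simp
  qed
  then obtain j where j: "j \<in> I" "\<rho> j x \<noteq> 0" by blast
  have xj: "x \<in> fst (ch j)" using rho_supp[OF j(1) x(1)] j(2) by blast
  have "\<omega> c (snd c x) v = \<omega> (ch j) (snd (ch j) x) (deriv (transition c (ch j)) (snd c x) * v)"
    by (rule covariantD[OF is_formD(1)[OF \<omega>] c(1) ch[OF j(1)] x(2) xj])
  then have "f (ch j) (snd (ch j) x) \<noteq> 0" using c(3) x(3) \<omega>f[OF ch[OF j(1)] snd_in[OF xj]] by auto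
  moreover have "Re (\<rho> j x) > 0"
    using rho_range[OF j(1) x(1)] j(2) by auto
  ultimately have "g j (snd (ch j) x) > 0" using xj ch[OF j(1)] by (simp add: g_def)
  then have "integral\<^sup>L lborel (g j) > 0"
    by (rule integral_continuous_pos[OF gi[OF j(1)] gc[OF j(1)] g0[OF j(1)]])
  moreover have "integral\<^sup>L lborel (g i) \<ge> 0" if "i \<in> I" for i
    by (rule Bochner_Integration.integral_nonneg) (rule g0[OF that])
  ultimately have "(\<Sum>i\<in>I. integral\<^sup>L lborel (g i)) > 0"
    using j(1) by (intro sum_pos2[OF finI])
  then show ?thesis using eq by blast
qed

end

section \<open>Jumps of the Cauchy integral across an arc\<close>

text \<open>Injectivity makes a zero of \<open>\<tau> z - a\<close> at \<open>z0\<close> simple, so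
  the logarithmic derivative has residue 1 there. Hence the residues of an arc form are the same in
  every chart and their cancellation can be checked in any of them.\<close>

lemma pole_split:
  assumes \<tau>: "\<tau> holomorphic_on ball z0 e" "inj_on \<tau> (ball z0 e)" "e > 0"
  shows "\<exists>e'. 0 < e' \<and> e' \<le> e \<and> (\<exists>g. g holomorphic_on ball z0 e' \<and>
     (\<forall>z\<in>ball z0 e' - {z0}. deriv \<tau> z / (\<tau> z - a) = g z + (if \<tau> z0 = a then 1 / (z - z0) else 0)))"
proof (cases "\<tau> z0 = a")
  case True
  define h where "h z = (if z = z0 then deriv \<tau> z0 else (\<tau> z - \<tau> z0) / (z - z0))" for z
  have h: "h holomorphic_on ball z0 e"
    unfolding h_def[abs_def] by (rule pole_lemma[OF \<tau>(1)]) (use \<tau>(3) in \<open>simp add: interior_open\<close>)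
  have h\<tau>: "\<tau> z - a = (z - z0) * h z" for z using True by (simp add: h_def)
  have hnz: "h z \<noteq> 0" if "z \<in> ball z0 e" for z
  proof (cases "z = z0")
    case True
    then show ?thesis using holomorphic_injective_imp_regular[OF \<tau>(1) open_ball \<tau>(2)] \<tau>(3) by (simp add: h_def)
  next
    case False
    then have "\<tau> z \<noteq> \<tau> z0" using \<tau>(2,3) that by (auto simp: inj_on_def)
    then show ?thesis using False by (simp add: h_def)
  qed
  have "deriv \<tau> z / (\<tau> z - a) = deriv h z / h z + 1 / (z - z0)" if z: "z \<in> ball z0 e - {z0}" for z
  proof -
    have dh: "(h has_field_derivative deriv h z) (at z)" using holomorphic_derivI[OF h open_ball] z by blast
    have "((\<lambda>z. (z - z0) * h z + a) has_field_derivative (h z + (z - z0) * deriv h z)) (at z)"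
      by (auto intro!: derivative_eq_intros dh)
    moreover have "(\<lambda>z. (z - z0) * h z + a) = \<tau>" using h\<tau> by (auto simp: fun_eq_iff algebra_simps)
    ultimately have "deriv \<tau> z = h z + (z - z0) * deriv h z" using DERIV_imp_deriv by metis
    then show ?thesis using h\<tau>[of z] hnz[of z] z by (simp add: add_divide_distrib)
  qed
  moreover have "(\<lambda>z. deriv h z / h z) holomorphic_on ball z0 e"
    using hnz by (intro holomorphic_intros h open_ball) auto
  ultimately show ?thesis using True \<tau>(3) by (intro exI[of _ e] conjI exI[of _ "\<lambda>z. deriv h z / h z"]) auto
next
  case False
  have "continuous_on (ball z0 e) \<tau>" by (rule holomorphic_on_imp_continuous_on[OF \<tau>(1)])
  then have "isCont \<tau> z0" using \<tau>(3) by (simp add: continuous_on_eq_continuous_at)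
  then obtain d where d: "d > 0" "\<And>z. dist z z0 < d \<Longrightarrow> \<tau> z \<noteq> a"
    using continuous_at_avoid[of z0 \<tau> a] False by (metis dist_commute)
  define e' where "e' = min d e"
  have sub: "ball z0 e' \<subseteq> ball z0 e" by (auto simp: e'_def)
  have "(\<lambda>z. deriv \<tau> z / (\<tau> z - a)) holomorphic_on ball z0 e'"
    using d(2) by (intro holomorphic_intros holomorphic_on_subset[OF \<tau>(1) sub] open_ball) (auto simp: e'_def dist_commute)
  then show ?thesis using False d(1) \<tau>(3)
    by (intro exI[of _ e'] conjI exI[of _ "\<lambda>z. deriv \<tau> z / (\<tau> z - a)"]) (auto simp: e'_def)
qed

text \<open>The contribution of a part of the arc to \<open>arc_log\<close>, which allows jumps to
  be localised at single parameters.\<close>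

definition arc_int :: "(real \<Rightarrow> complex) \<Rightarrow> real \<Rightarrow> real \<Rightarrow> complex \<Rightarrow> complex" where
  "arc_int \<alpha> a b z = integral {a..b} (\<lambda>t. vector_derivative \<alpha> (at t) / (\<alpha> t - z))"

lemma arc_log_eq_arc_int: "arc_log \<alpha> z = arc_int \<alpha> 0 1 z"
  by (simp add: arc_log_def arc_int_def contour_integral_integral)

lemma C1_path_facts:
  assumes "\<alpha> C1_differentiable_on {0..1}"
  shows "\<And>t. t \<in> {0..1} \<Longrightarrow> (\<alpha> has_vector_derivative vector_derivative \<alpha> (at t)) (at t)"
    and "continuous_on {0..1} (\<lambda>t. vector_derivative \<alpha> (at t))" and "continuous_on {0..1} \<alpha>"
proof -
  show d: "(\<alpha> has_vector_derivative vector_derivative \<alpha> (at t)) (at t)" if "t \<in> {0..1}" for t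
    using assms that by (auto simp: C1_differentiable_on_eq vector_derivative_works[symmetric])
  show "continuous_on {0..1} (\<lambda>t. vector_derivative \<alpha> (at t))" using assms by (simp add: C1_differentiable_on_eq)
  show "continuous_on {0..1} \<alpha>"
    by (rule continuous_at_imp_continuous_on) (use d has_vector_derivative_continuous in blast)
qed

lemma arc_int_combine:
  assumes \<alpha>: "\<alpha> C1_differentiable_on {0..1}" and "0 \<le> a" "a \<le> b" "b \<le> c" "c \<le> 1" and z: "z \<notin> \<alpha> ` {a..c}"
  shows "arc_int \<alpha> a c z = arc_int \<alpha> a b z + arc_int \<alpha> b c z"
proof -
  have sub: "{a..c} \<subseteq> {0..1}" using assms by auto
  have "continuous_on {a..c} (\<lambda>t. vector_derivative \<alpha> (at t) / (\<alpha> t - z))"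
    using z by (intro continuous_intros continuous_on_subset[OF C1_path_facts(2)[OF \<alpha>] sub]
        continuous_on_subset[OF C1_path_facts(3)[OF \<alpha>] sub]) auto
  then have "(\<lambda>t. vector_derivative \<alpha> (at t) / (\<alpha> t - z)) integrable_on {a..c}"
    by (rule integrable_continuous_interval)
  from Henstock_Kurzweil_Integration.integral_combine[OF assms(3,4) this] show ?thesis by (simp add: arc_int_def)
qed

lemma arc_int_continuous:
  assumes \<alpha>: "\<alpha> C1_differentiable_on {0..1}" and "0 \<le> a" "b \<le> 1" and x: "x \<notin> \<alpha> ` {a..b}"
  shows "isCont (arc_int \<alpha> a b) x"
proof -
  have sub: "{a..b} \<subseteq> {0..1}" using assms by auto
  have c: "continuous_on {a..b} (\<lambda>t. vector_derivative \<alpha> (at t))" "continuous_on {a..b} \<alpha>"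
    using C1_path_facts(2,3)[OF \<alpha>] sub continuous_on_subset by blast+
  have "compact (\<alpha> ` {a..b})" using c(2) by (rule compact_continuous_image) simp
  then have "open (- \<alpha> ` {a..b})" by (simp add: compact_imp_closed open_Compl)
  then obtain e where e: "e > 0" "cball x e \<subseteq> - \<alpha> ` {a..b}" using x open_contains_cball by blast
  have "continuous_on (cball x e \<times> cbox a b) (\<lambda>(z, t). vector_derivative \<alpha> (at t) / (\<alpha> t - z))"
    unfolding case_prod_unfold using e(2)
    by (intro continuous_intros continuous_on_compose2[OF c(1)] continuous_on_compose2[OF c(2)]) auto
  then have "continuous_on (cball x e) (\<lambda>z. integral (cbox a b) (\<lambda>t. vector_derivative \<alpha> (at t) / (\<alpha> t - z)))"
    by (rule integral_continuous_on_param)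
  then have "continuous_on (cball x e) (arc_int \<alpha> a b)" by (simp add: arc_int_def[abs_def])
  then have "continuous_on (ball x e) (arc_int \<alpha> a b)" using continuous_on_subset ball_subset_cball by blast
  then show ?thesis using e(1) by (simp add: continuous_on_eq_continuous_at)
qed

lemma vector_derivative_bound:
  fixes f :: "real \<Rightarrow> complex"
  assumes "(f has_vector_derivative v) (at t)" "\<eta> > 0"
  shows "\<exists>d>0. \<forall>s. \<bar>s - t\<bar> < d \<longrightarrow> norm (f s - f t - (s - t) *\<^sub>R v) \<le> \<eta> * \<bar>s - t\<bar>"
proof -
  have "\<exists>d>0. \<forall>y. norm (y - t) < d \<longrightarrow> norm (f y - f t - (y - t) *\<^sub>R v) \<le> \<eta> * norm (y - t)"
    using assms unfolding has_vector_derivative_def has_derivative_at_alt by blast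
  then show ?thesis by simp
qed

text \<open>Divided by \<open>a\<close>, the arc near \<open>t0\<close> lies in a narrow double cone around the real axis, while the
  point \<open>Z s\<close> lies in the upper half plane outside of the cone. Hence the branch of the logarithm that
  is cut along the positive imaginary axis can be used along the whole piece of the arc.\<close>

lemma arc_int_one_sided:
  assumes \<alpha>: "\<alpha> C1_differentiable_on {0..1}" and t0: "0 < t0" "t0 < 1"
    and a0: "a0 = vector_derivative \<alpha> (at t0)" "a0 = a \<or> a0 = - a" "a \<noteq> 0"
    and Z: "(Z has_vector_derivative v) (at 0)" "Z 0 = \<alpha> t0" and pos: "Im (v / a) > 0"
  shows "\<exists>h0>0. h0 \<le> t0 \<and> h0 \<le> 1 - t0 \<and> (\<forall>h. 0 < h \<and> h < h0 \<longrightarrow>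
     Re ((\<alpha> (t0 + h) - \<alpha> t0) / a0) > 0 \<and> Re ((\<alpha> (t0 - h) - \<alpha> t0) / a0) < 0 \<and>
     ((\<lambda>s. arc_int \<alpha> (t0 - h) (t0 + h) (Z s)) \<longlongrightarrow>
        Ln (\<i> * ((\<alpha> (t0 + h) - \<alpha> t0) / a)) - Ln (\<i> * ((\<alpha> (t0 - h) - \<alpha> t0) / a))) (at_right 0))"
proof -
  define V where "V = v / a"
  \<comment> \<open>The slope of the double cone. It bounds
    \<open>\<eta> * \<bar>Re (W s)\<bar>\<close> by half of \<open>s * Im V\<close>, so
    \<open>W s\<close> stays above the cone although it may deviate from \<open>s\<close> times
    \<open>V\<close> by a quarter of \<open>s * Im V\<close>. The summand \<open>Im V\<close> in the
    denominator covers \<open>Re V = 0\<close>.\<close>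
  define \<eta> where "\<eta> = Im V / (2 * (\<bar>Re V\<bar> + Im V))"
  define \<zeta> where "\<zeta> t = (\<alpha> t - \<alpha> t0) / a" for t
  have V: "Im V > 0" using pos by (simp add: V_def)
  have \<eta>: "\<eta> > 0" using V by (simp add: \<eta>_def add_nonneg_pos)
  \<comment> \<open>With relative error at most 1/2 the real part of \<open>\<zeta> t\<close> keeps
    at least half of \<open>\<bar>t - t0\<bar>\<close>; then
    \<open>2 * \<kappa> \<le> \<eta>\<close> makes the slope at most \<eta>.\<close>
  define \<kappa> where "\<kappa> = min (1/2) (\<eta> / 2)"
  have \<kappa>: "\<kappa> > 0" "\<kappa> \<le> 1/2" "2 * \<kappa> \<le> \<eta>" using \<eta> by (auto simp: \<kappa>_def)
  \<comment> \<open>The arc may run along \<open>a\<close> or against it: both signs are used, one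
    for each side from which \<open>Z\<close> approaches.\<close>
  define \<sigma> where "\<sigma> = (if a0 = a then 1 else - 1 :: real)"
  have \<sigma>: "a0 = of_real \<sigma> * a" "\<bar>\<sigma>\<bar> = 1" using a0 by (auto simp: \<sigma>_def)
  have \<kappa>a: "\<kappa> * norm a > 0" using \<kappa> a0 by simp
  have "(\<alpha> has_vector_derivative a0) (at t0)" unfolding a0(1) by (rule C1_path_facts(1)[OF \<alpha>]) (use t0 in auto)
  from vector_derivative_bound[OF this \<kappa>a] obtain d where d: "d > 0"
    "\<And>s. \<bar>s - t0\<bar> < d \<Longrightarrow> norm (\<alpha> s - \<alpha> t0 - (s - t0) *\<^sub>R a0) \<le> \<kappa> * norm a * \<bar>s - t0\<bar>" by blast
  have cone: "\<bar>Re (\<zeta> t) - \<sigma> * (t - t0)\<bar> \<le> \<kappa> * \<bar>t - t0\<bar>" "\<bar>Im (\<zeta> t)\<bar> \<le> \<kappa> * \<bar>t - t0\<bar>" if t: "\<bar>t - t0\<bar> < d" for t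
  proof -
    have "\<zeta> t - of_real (\<sigma> * (t - t0)) = (\<alpha> t - \<alpha> t0 - (t - t0) *\<^sub>R a0) / a"
      using a0(3) by (simp add: \<zeta>_def \<sigma>(1) scaleR_conv_of_real diff_divide_distrib)
    then have "norm (\<zeta> t - of_real (\<sigma> * (t - t0))) = norm (\<alpha> t - \<alpha> t0 - (t - t0) *\<^sub>R a0) / norm a"
      by (simp add: norm_divide)
    also have "\<dots> \<le> (\<kappa> * norm a * \<bar>t - t0\<bar>) / norm a" by (rule divide_right_mono[OF d(2)[OF t]]) simp
    also have "\<dots> = \<kappa> * \<bar>t - t0\<bar>" using a0(3) by simp
    finally have n: "norm (\<zeta> t - of_real (\<sigma> * (t - t0))) \<le> \<kappa> * \<bar>t - t0\<bar>" .
    show "\<bar>Re (\<zeta> t) - \<sigma> * (t - t0)\<bar> \<le> \<kappa> * \<bar>t - t0\<bar>"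
      using abs_Re_le_cmod[of "\<zeta> t - of_real (\<sigma> * (t - t0))"] n by simp
    show "\<bar>Im (\<zeta> t)\<bar> \<le> \<kappa> * \<bar>t - t0\<bar>"
      using abs_Im_le_cmod[of "\<zeta> t - of_real (\<sigma> * (t - t0))"] n by simp
  qed
  have slope: "\<bar>Im (\<zeta> t)\<bar> \<le> \<eta> * \<bar>Re (\<zeta> t)\<bar>" if t: "\<bar>t - t0\<bar> < d" for t
  proof -
    have "\<bar>t - t0\<bar> = \<bar>\<sigma> * (t - t0)\<bar>" using \<sigma>(2) by (simp add: abs_mult)
    moreover have "\<bar>\<sigma> * (t - t0)\<bar> \<le> \<bar>Re (\<zeta> t)\<bar> + \<kappa> * \<bar>t - t0\<bar>" using cone(1)[OF t] by linarith
    moreover have "\<kappa> * \<bar>t - t0\<bar> \<le> (1/2) * \<bar>t - t0\<bar>" using \<kappa> by (intro mult_right_mono) auto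
    ultimately have "\<bar>t - t0\<bar> \<le> \<bar>Re (\<zeta> t)\<bar> + (1/2) * \<bar>t - t0\<bar>" by (metis add_left_mono order_trans)
    moreover have "x \<le> 2 * y" if "x \<le> y + (1/2) * x" for x y :: real using that by simp
    ultimately have 1: "\<bar>t - t0\<bar> \<le> 2 * \<bar>Re (\<zeta> t)\<bar>" by blast
    have "\<bar>Im (\<zeta> t)\<bar> \<le> \<kappa> * (2 * \<bar>Re (\<zeta> t)\<bar>)"
      using cone(2)[OF t] mult_left_mono[OF 1, of \<kappa>] \<kappa> by linarith
    also have "\<dots> \<le> \<eta> * \<bar>Re (\<zeta> t)\<bar>" using mult_right_mono[OF \<kappa>(3), of "\<bar>Re (\<zeta> t)\<bar>"] by (simp add: algebra_simps)
    finally show ?thesis .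
  qed
  have re: "\<sigma> * Re (\<zeta> (t0 + h)) > 0" "\<sigma> * Re (\<zeta> (t0 - h)) < 0" if h: "0 < h" "h < d" for h
  proof -
    have k: "\<kappa> * h \<le> (1/2) * h" using \<kappa> h by (intro mult_right_mono) auto
    have c: "\<bar>Re (\<zeta> (t0 + h)) - \<sigma> * h\<bar> \<le> \<kappa> * h" "\<bar>Re (\<zeta> (t0 - h)) + \<sigma> * h\<bar> \<le> \<kappa> * h"
      using cone(1)[of "t0 + h"] cone(1)[of "t0 - h"] h by auto
    have "\<sigma> = 1 \<or> \<sigma> = - 1" by (simp add: \<sigma>_def)
    then show "\<sigma> * Re (\<zeta> (t0 + h)) > 0"
    proof
      assume s: "\<sigma> = 1" show ?thesis using c(1) k h(1) unfolding s by linarith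
    next
      assume s: "\<sigma> = - 1" show ?thesis using c(1) k h(1) unfolding s by linarith
    qed
    from \<open>\<sigma> = 1 \<or> \<sigma> = - 1\<close> show "\<sigma> * Re (\<zeta> (t0 - h)) < 0"
    proof
      assume s: "\<sigma> = 1" show ?thesis using c(2) k h(1) unfolding s by linarith
    next
      assume s: "\<sigma> = - 1" show ?thesis using c(2) k h(1) unfolding s by linarith
    qed
  qed
  define W where "W s = (Z s - Z 0) / a" for s
  have IVa: "Im V / 4 * norm a > 0" using V a0 by simp
  from vector_derivative_bound[OF Z(1) this] obtain d2 where d2: "d2 > 0"
    "\<And>s. \<bar>s - 0\<bar> < d2 \<Longrightarrow> norm (Z s - Z 0 - (s - 0) *\<^sub>R v) \<le> Im V / 4 * norm a * \<bar>s - 0\<bar>" by blast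
  have W: "\<eta> * \<bar>Re (W s)\<bar> < Im (W s)" if s: "0 < s" "s < d2" for s
  proof -
    have "W s - of_real s * V = (Z s - Z 0 - (s - 0) *\<^sub>R v) / a"
      by (simp add: W_def V_def scaleR_conv_of_real diff_divide_distrib)
    then have "norm (W s - of_real s * V) = norm (Z s - Z 0 - (s - 0) *\<^sub>R v) / norm a"
      by (simp add: norm_divide)
    also have "\<dots> \<le> (Im V / 4 * norm a * \<bar>s - 0\<bar>) / norm a" by (rule divide_right_mono[OF d2(2)]) (use s in auto)
    also have "\<dots> = Im V / 4 * s" using a0(3) s by simp
    finally have n: "norm (W s - of_real s * V) \<le> Im V / 4 * s" .
    have "\<bar>Re (W s) - s * Re V\<bar> \<le> Im V / 4 * s" using abs_Re_le_cmod[of "W s - of_real s * V"] n by simp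
    moreover have "\<bar>s * Re V\<bar> = s * \<bar>Re V\<bar>" using s by (simp add: abs_mult)
    ultimately have r: "\<bar>Re (W s)\<bar> \<le> s * \<bar>Re V\<bar> + Im V / 4 * s" by linarith
    have "Im V / 4 * s \<le> Im V * s" using V s by simp
    then have r': "\<bar>Re (W s)\<bar> \<le> s * (\<bar>Re V\<bar> + Im V)" using r by (simp add: algebra_simps)
    have "\<bar>Im (W s) - s * Im V\<bar> \<le> norm (W s - of_real s * V)" using abs_Im_le_cmod[of "W s - of_real s * V"] by simp
    then have i: "Im (W s) \<ge> s * Im V - Im V / 4 * s" using n by linarith
    have "\<eta> * \<bar>Re (W s)\<bar> \<le> \<eta> * (s * (\<bar>Re V\<bar> + Im V))" using r' \<eta> by simp
    also have "\<dots> = s * Im V / 2"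
    proof -
      have "\<bar>Re V\<bar> + Im V \<noteq> 0" using V by linarith
      then show ?thesis by (simp add: \<eta>_def divide_simps)
    qed
    also have "\<dots> < s * Im V - Im V / 4 * s" using V s by (simp add: field_simps)
    finally show ?thesis using i by linarith
  qed
  define h0 where "h0 = min d (min t0 (1 - t0))"
  have h0: "h0 > 0" "h0 \<le> t0" "h0 \<le> 1 - t0" "h0 \<le> d" using d t0 by (auto simp: h0_def)
  have "Re ((\<alpha> (t0 + h) - \<alpha> t0) / a0) > 0 \<and> Re ((\<alpha> (t0 - h) - \<alpha> t0) / a0) < 0 \<and>
     ((\<lambda>s. arc_int \<alpha> (t0 - h) (t0 + h) (Z s)) \<longlongrightarrow> Ln (\<i> * \<zeta> (t0 + h)) - Ln (\<i> * \<zeta> (t0 - h))) (at_right 0)"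
    if h: "0 < h" "h < h0" for h
  proof (intro conjI)
    have hd: "h < d" using h h0 by simp
    have "(\<alpha> t - \<alpha> t0) / a0 = of_real \<sigma> * \<zeta> t" for t
      using a0(2) by (cases "a0 = a") (auto simp: \<sigma>_def \<zeta>_def minus_divide_left)
    then show "Re ((\<alpha> (t0 + h) - \<alpha> t0) / a0) > 0" "Re ((\<alpha> (t0 - h) - \<alpha> t0) / a0) < 0"
      using re[OF h(1) hd] by simp_all
    have eq: "arc_int \<alpha> (t0 - h) (t0 + h) (Z s) = Ln (\<i> * (\<zeta> (t0 + h) - W s)) - Ln (\<i> * (\<zeta> (t0 - h) - W s))"
      if s: "0 < s" "s < d2" for s
    proof -
      \<comment> \<open>Multiplication by \<open>\<i>\<close> carries the positive imaginary axis to
        the cut of \<open>Ln\<close>. A difference \<open>\<zeta> t - W s\<close> on that axis would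
        put a point of the cone straight above, or at, \<open>W s\<close>.\<close>
      have cut: "\<i> * (\<zeta> t - W s) \<notin> \<real>\<^sub>\<le>\<^sub>0" if t: "t \<in> {t0 - h..t0 + h}" for t
      proof
        assume "\<i> * (\<zeta> t - W s) \<in> \<real>\<^sub>\<le>\<^sub>0"
        then have "Im (W s) \<le> Im (\<zeta> t)" "Re (\<zeta> t) = Re (W s)" by (auto simp: complex_nonpos_Reals_iff)
        moreover have "\<bar>t - t0\<bar> < d" using t hd by auto
        ultimately show False using slope[of t] W[OF s] by auto
      qed
      have "((\<lambda>t. vector_derivative \<alpha> (at t) / (\<alpha> t - Z s)) has_integral
          (Ln (\<i> * (\<zeta> (t0 + h) - W s)) - Ln (\<i> * (\<zeta> (t0 - h) - W s)))) {t0 - h..t0 + h}"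
      proof (rule fundamental_theorem_of_calculus)
        show "t0 - h \<le> t0 + h" using h by simp
        fix t assume t: "t \<in> {t0 - h..t0 + h}"
        have t01: "t \<in> {0..1}" using t h h0 by auto
        let ?u = "\<lambda>t. \<i> * (\<zeta> t - W s)"
        have ueq: "?u t = \<i> / a * (\<alpha> t - Z s)" for t
          using Z(2) by (simp add: \<zeta>_def W_def diff_divide_distrib[symmetric])
        have "((\<lambda>t. \<i> / a * (\<alpha> t - Z s)) has_vector_derivative (\<i> / a * vector_derivative \<alpha> (at t))) (at t)"
          by (rule derivative_eq_intros C1_path_facts(1)[OF \<alpha> t01] refl)+ simp
        then have u: "(?u has_vector_derivative (\<i> / a * vector_derivative \<alpha> (at t))) (at t)"
          unfolding ueq .
        have "((Ln \<circ> ?u) has_vector_derivative (\<i> / a * vector_derivative \<alpha> (at t)) * inverse (?u t)) (at t)"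
          by (rule field_vector_diff_chain_at[OF u has_field_derivative_Ln[OF cut[OF t]]])
        moreover have "(\<i> / a * vector_derivative \<alpha> (at t)) * inverse (?u t) = vector_derivative \<alpha> (at t) / (\<alpha> t - Z s)"
        proof -
          have "?u t \<noteq> 0" using cut[OF t] by auto
          then have "\<alpha> t - Z s \<noteq> 0" unfolding ueq by auto
          then show ?thesis unfolding ueq using a0(3) by (simp add: divide_simps)
        qed
        ultimately have "((\<lambda>t. Ln (?u t)) has_vector_derivative vector_derivative \<alpha> (at t) / (\<alpha> t - Z s)) (at t)"
          by (simp add: o_def)
        then show "((\<lambda>t. Ln (?u t)) has_vector_derivative vector_derivative \<alpha> (at t) / (\<alpha> t - Z s)) (at t within {t0 - h..t0 + h})"
          by (rule has_vector_derivative_at_within)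
      qed
      then show ?thesis unfolding arc_int_def by (rule integral_unique)
    qed
    have "isCont Z 0" by (rule has_vector_derivative_continuous[OF Z(1)])
    then have "(Z \<longlongrightarrow> Z 0) (at 0)" by (simp add: isCont_def)
    then have "(Z \<longlongrightarrow> Z 0) (at_right 0)" by (rule filterlim_mono) (auto simp: at_le)
    then have "((\<lambda>s. (Z s - Z 0) / a) \<longlongrightarrow> (Z 0 - Z 0) / a) (at_right 0)"
      by (intro tendsto_divide tendsto_diff tendsto_const a0(3))
    then have W0: "(W \<longlongrightarrow> 0) (at_right 0)" by (simp add: W_def[abs_def])
    have n: "\<i> * (\<zeta> (t0 + h) - 0) \<notin> \<real>\<^sub>\<le>\<^sub>0" "\<i> * (\<zeta> (t0 - h) - 0) \<notin> \<real>\<^sub>\<le>\<^sub>0"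
      using re[OF h(1) hd] by (auto simp: complex_nonpos_Reals_iff)
    have "((\<lambda>s. Ln (\<i> * (\<zeta> (t0 + h) - W s)) - Ln (\<i> * (\<zeta> (t0 - h) - W s))) \<longlongrightarrow>
        Ln (\<i> * (\<zeta> (t0 + h) - 0)) - Ln (\<i> * (\<zeta> (t0 - h) - 0))) (at_right 0)"
      by (intro tendsto_diff tendsto_Ln tendsto_mult tendsto_const W0 n)
    moreover have "\<forall>\<^sub>F s in at_right 0. Ln (\<i> * (\<zeta> (t0 + h) - W s)) - Ln (\<i> * (\<zeta> (t0 - h) - W s)) = arc_int \<alpha> (t0 - h) (t0 + h) (Z s)"
      unfolding eventually_at_right_field using eq d2(1) by (intro exI[of _ d2]) auto
    ultimately show "((\<lambda>s. arc_int \<alpha> (t0 - h) (t0 + h) (Z s)) \<longlongrightarrow> Ln (\<i> * \<zeta> (t0 + h)) - Ln (\<i> * \<zeta> (t0 - h))) (at_right 0)"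
      using Lim_transform_eventually by fastforce
  qed
  then show ?thesis using h0 unfolding \<zeta>_def by blast
qed

text \<open>Coming from the other side amounts to replacing \<open>a\<close> by \<open>-a\<close>.
  At each end of the small piece the two branches differ by \<open>\<i> * pi\<close>, with opposite
  signs because the ends lie on opposite sides in real part; together this is
  \<open>2 * pi * \<i>\<close> up to sign.\<close>

lemma arc_int_jump:
  assumes \<alpha>: "\<alpha> C1_differentiable_on {0..1}" and t0: "0 < t0" "t0 < 1"
    and Z: "(Z has_vector_derivative v) (at 0)" "Z 0 = \<alpha> t0"
    and det: "Im (cnj v * vector_derivative \<alpha> (at t0)) \<noteq> 0"
  shows "\<exists>h0>0. h0 \<le> t0 \<and> h0 \<le> 1 - t0 \<and> (\<forall>h. 0 < h \<and> h < h0 \<longrightarrow>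
     ((\<lambda>s. arc_int \<alpha> (t0 - h) (t0 + h) (Z s) - arc_int \<alpha> (t0 - h) (t0 + h) (Z (- s))) \<longlongrightarrow>
        - 2 * pi * \<i> * of_real (sgn (Im (cnj v * vector_derivative \<alpha> (at t0))))) (at_right 0))"
proof -
  define a where "a = vector_derivative \<alpha> (at t0)"
  have az: "a \<noteq> 0" using det by (auto simp: a_def)
  have Zm: "((\<lambda>s. Z (- s)) has_vector_derivative - v) (at 0)"
  proof -
    have "((Z \<circ> uminus) has_vector_derivative (- 1) *\<^sub>R v) (at 0)"
      by (rule vector_diff_chain_at) (use Z in \<open>auto intro!: derivative_eq_intros\<close>)
    then show ?thesis by (simp add: o_def)
  qed
  have Lnm: "Ln (\<i> * u) - Ln (- (\<i> * u)) = \<i> * pi" if "Re u > 0" for u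
    using Ln_minus[of "\<i> * u"] that by (auto simp: complex_eq_iff)
  have Lnm': "Ln (\<i> * u) - Ln (- (\<i> * u)) = - \<i> * pi" if "Re u < 0" for u
    using Ln_minus[of "\<i> * u"] that by (auto simp: complex_eq_iff)
  \<comment> \<open>The curve crosses from the right of \<open>a\<close> to its left. The other case
    follows by reversing the curve.\<close>
  have main: "\<exists>h0>0. h0 \<le> t0 \<and> h0 \<le> 1 - t0 \<and> (\<forall>h. 0 < h \<and> h < h0 \<longrightarrow>
     ((\<lambda>s. arc_int \<alpha> (t0 - h) (t0 + h) (Y s) - arc_int \<alpha> (t0 - h) (t0 + h) (Y (- s))) \<longlongrightarrow> 2 * pi * \<i>) (at_right 0))"
    if Y: "(Y has_vector_derivative w) (at 0)" "((\<lambda>s. Y (- s)) has_vector_derivative - w) (at 0)" "Y 0 = \<alpha> t0"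
      and pos: "Im (w / a) > 0" for Y w
  proof -
    have pos': "Im (- w / - a) > 0" using pos by simp
    have Y0: "Y (- 0) = \<alpha> t0" using Y(3) by simp
    obtain h1 where h1: "h1 > 0" "h1 \<le> t0" "h1 \<le> 1 - t0" "\<And>h. 0 < h \<and> h < h1 \<Longrightarrow>
     Re ((\<alpha> (t0 + h) - \<alpha> t0) / a) > 0 \<and> Re ((\<alpha> (t0 - h) - \<alpha> t0) / a) < 0 \<and>
     ((\<lambda>s. arc_int \<alpha> (t0 - h) (t0 + h) (Y s)) \<longlongrightarrow>
        Ln (\<i> * ((\<alpha> (t0 + h) - \<alpha> t0) / a)) - Ln (\<i> * ((\<alpha> (t0 - h) - \<alpha> t0) / a))) (at_right 0)"
      using arc_int_one_sided[OF \<alpha> t0 a_def _ az Y(1,3) pos] by blast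
    obtain h2 where h2: "h2 > 0" "\<And>h. 0 < h \<and> h < h2 \<Longrightarrow>
     ((\<lambda>s. arc_int \<alpha> (t0 - h) (t0 + h) (Y (- s))) \<longlongrightarrow>
        Ln (\<i> * ((\<alpha> (t0 + h) - \<alpha> t0) / - a)) - Ln (\<i> * ((\<alpha> (t0 - h) - \<alpha> t0) / - a))) (at_right 0)"
      using arc_int_one_sided[OF \<alpha> t0 a_def _ _ Y(2) Y0 pos'] az by auto
    have "((\<lambda>s. arc_int \<alpha> (t0 - h) (t0 + h) (Y s) - arc_int \<alpha> (t0 - h) (t0 + h) (Y (- s))) \<longlongrightarrow> 2 * pi * \<i>) (at_right 0)"
      if h: "0 < h" "h < min h1 h2" for h
    proof -
      define u1 u2 where "u1 = (\<alpha> (t0 + h) - \<alpha> t0) / a" and "u2 = (\<alpha> (t0 - h) - \<alpha> t0) / a"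
      have u: "Re u1 > 0" "Re u2 < 0" using h1(4)[of h] h by (auto simp: u1_def u2_def)
      have "((\<lambda>s. arc_int \<alpha> (t0 - h) (t0 + h) (Y s) - arc_int \<alpha> (t0 - h) (t0 + h) (Y (- s))) \<longlongrightarrow>
        (Ln (\<i> * u1) - Ln (\<i> * u2)) - (Ln (- (\<i> * u1)) - Ln (- (\<i> * u2)))) (at_right 0)"
        using tendsto_diff[OF conjunct2[OF conjunct2[OF h1(4)[of h]]] h2(2)[of h]] h by (simp add: u1_def u2_def)
      moreover have "(Ln (\<i> * u1) - Ln (\<i> * u2)) - (Ln (- (\<i> * u1)) - Ln (- (\<i> * u2)))
         = (Ln (\<i> * u1) - Ln (- (\<i> * u1))) - (Ln (\<i> * u2) - Ln (- (\<i> * u2)))" by simp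
      moreover have "\<dots> = 2 * pi * \<i>" unfolding Lnm[OF u(1)] Lnm'[OF u(2)] by simp
      ultimately show ?thesis by simp
    qed
    then show ?thesis using h1(1-3) h2(1) by (intro exI[of _ "min h1 h2"]) auto
  qed
  \<comment> \<open>Crossing to the left of \<open>a\<close> means that the pair of velocities is
    negatively oriented, whence the minus sign in the jump formula.\<close>
  have Imva: "Im (v / a) = - Im (cnj v * a) / (norm a)\<^sup>2"
    by (simp add: Im_divide cmod_power2 algebra_simps diff_divide_distrib)
  show ?thesis
  proof (cases "Im (cnj v * a) < 0")
    case True
    then have "Im (v / a) > 0" unfolding Imva using az by simp
    from main[OF Z(1) Zm Z(2) this] show ?thesis using True unfolding a_def[symmetric] by simp
  next
    case False
    then have D: "Im (cnj v * a) > 0" using det by (simp add: a_def)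
    have "Im (v / a) < 0" unfolding Imva using D az by (intro divide_neg_pos) simp_all
    then have p: "Im (- v / a) > 0" by simp
    have Z2: "((\<lambda>s. Z (- (- s))) has_vector_derivative - (- v)) (at 0)" using Z(1) by simp
    have Z3: "Z (- 0) = \<alpha> t0" using Z(2) by simp
    obtain h0 where h0: "h0 > 0" "h0 \<le> t0" "h0 \<le> 1 - t0" "\<And>h. 0 < h \<and> h < h0 \<Longrightarrow>
      ((\<lambda>s. arc_int \<alpha> (t0 - h) (t0 + h) (Z (- s)) - arc_int \<alpha> (t0 - h) (t0 + h) (Z (- (- s)))) \<longlongrightarrow> 2 * pi * \<i>) (at_right 0)"
      using main[OF Zm Z2 Z3 p] by blast
    have "((\<lambda>s. arc_int \<alpha> (t0 - h) (t0 + h) (Z s) - arc_int \<alpha> (t0 - h) (t0 + h) (Z (- s))) \<longlongrightarrow> - (2 * pi * \<i>)) (at_right 0)"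
      if "0 < h \<and> h < h0" for h
      using tendsto_minus[OF h0(4)[OF that]] by simp
    then show ?thesis using h0(1-3) D unfolding a_def[symmetric] by (intro exI[of _ h0]) simp
  qed
qed

text \<open>The arc may pass through \<open>Z 0\<close> several times. The induction splits off a
  small piece around the first passage: what precedes it is continuous at \<open>Z 0\<close>, what
  follows has one passage fewer.\<close>

lemma arc_int_jumps:
  assumes \<alpha>: "\<alpha> C1_differentiable_on {0..1}" and Z: "(Z has_vector_derivative v) (at 0)"
    and off: "\<forall>\<^sub>F s in at_right 0. Z s \<notin> \<alpha> ` {0..1} \<and> Z (- s) \<notin> \<alpha> ` {0..1}"
    and fin: "finite {t \<in> {0..1}. \<alpha> t = Z 0}"
    and det: "\<And>t. t \<in> {0..1} \<Longrightarrow> \<alpha> t = Z 0 \<Longrightarrow> Im (cnj v * vector_derivative \<alpha> (at t)) \<noteq> 0"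
    and ab: "0 \<le> a" "a \<le> b" "b \<le> 1" "\<alpha> a \<noteq> Z 0" "\<alpha> b \<noteq> Z 0"
  shows "((\<lambda>s. arc_int \<alpha> a b (Z s) - arc_int \<alpha> a b (Z (- s))) \<longlongrightarrow>
     (\<Sum>t | t \<in> {a..b} \<and> \<alpha> t = Z 0. - 2 * pi * \<i> * of_real (sgn (Im (cnj v * vector_derivative \<alpha> (at t)))))) (at_right 0)"
  using ab
proof (induction "card {t \<in> {a..b}. \<alpha> t = Z 0}" arbitrary: a rule: less_induct)
  case (less a)
  let ?T = "{t \<in> {a..b}. \<alpha> t = Z 0}"
  have finT: "finite ?T" by (rule finite_subset[OF _ fin]) (use less.prems in auto)
  have Z0: "(Z \<longlongrightarrow> Z 0) (at_right 0)" "((\<lambda>s. Z (- s)) \<longlongrightarrow> Z 0) (at_right 0)"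
  proof -
    have "isCont Z 0" by (rule has_vector_derivative_continuous[OF Z(1)])
    then have z: "(Z \<longlongrightarrow> Z 0) (at 0)" by (simp add: isCont_def)
    then show "(Z \<longlongrightarrow> Z 0) (at_right 0)" by (rule filterlim_mono) (auto simp: at_le)
    have "(Z \<longlongrightarrow> Z 0) (at_left 0)" by (rule filterlim_mono[OF z]) (auto simp: at_le)
    then show "((\<lambda>s. Z (- s)) \<longlongrightarrow> Z 0) (at_right 0)" by (simp add: filterlim_at_left_to_right)
  qed
  have noT: "((\<lambda>s. arc_int \<alpha> l r (Z s) - arc_int \<alpha> l r (Z (- s))) \<longlongrightarrow> 0) (at_right 0)"
    if "0 \<le> l" "r \<le> 1" "Z 0 \<notin> \<alpha> ` {l..r}" for l r
  proof -
    have c: "isCont (arc_int \<alpha> l r) (Z 0)" by (rule arc_int_continuous[OF \<alpha> that])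
    have "((\<lambda>s. arc_int \<alpha> l r (Z s) - arc_int \<alpha> l r (Z (- s))) \<longlongrightarrow> arc_int \<alpha> l r (Z 0) - arc_int \<alpha> l r (Z 0)) (at_right 0)"
      by (intro tendsto_diff isCont_tendsto_compose[OF c] Z0)
    then show ?thesis by simp
  qed
  show ?case
  proof (cases "?T = {}")
    case True
    have "Z 0 \<notin> \<alpha> ` {a..b}" using True by auto
    from noT[OF less.prems(1,3) this] show ?thesis unfolding True by simp
  next
    case False
    define t0 where "t0 = Min ?T"
    have t0: "t0 \<in> ?T" unfolding t0_def by (rule Min_in[OF finT False])
    have t0min: "t0 \<le> t" if "t \<in> ?T" for t unfolding t0_def by (rule Min_le[OF finT that])
    have t0ab: "a < t0" "t0 < b" using t0 less.prems by (auto simp: less_le)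
    have t01: "0 < t0" "t0 < 1" using t0ab less.prems by auto
    have Zt: "Z 0 = \<alpha> t0" using t0 by simp
    have d0: "Im (cnj v * vector_derivative \<alpha> (at t0)) \<noteq> 0" using det[of t0] t0 t01 by simp
    obtain h0 where h0: "h0 > 0" "\<And>h. 0 < h \<and> h < h0 \<Longrightarrow>
       ((\<lambda>s. arc_int \<alpha> (t0 - h) (t0 + h) (Z s) - arc_int \<alpha> (t0 - h) (t0 + h) (Z (- s))) \<longlongrightarrow>
        - 2 * pi * \<i> * of_real (sgn (Im (cnj v * vector_derivative \<alpha> (at t0))))) (at_right 0)"
      using arc_int_jump[OF \<alpha> t01 Z Zt d0] by blast
    obtain e where e: "e > 0" "\<And>t. t \<in> ?T - {t0} \<Longrightarrow> e \<le> \<bar>t - t0\<bar>"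
    proof -
      have "finite (?T - {t0})" using finT by simp
      then obtain e where "e > 0" "\<forall>t\<in>?T - {t0}. t \<noteq> t0 \<longrightarrow> e \<le> dist t0 t"
        using finite_set_avoid by blast
      then show ?thesis using that[of e] by (auto simp: dist_real_def abs_minus_commute)
    qed
    \<comment> \<open>Small enough for the jump formula at \<open>t0\<close>, for excluding all
      other passages from the piece, and for staying strictly between \<open>a\<close> and
      \<open>b\<close>.\<close>
    define h where "h = min (min (h0/2) (e/2)) (min ((t0 - a)/2) ((b - t0)/2))"
    have h: "0 < h" "h < h0" "h < e" "a < t0 - h" "t0 + h < b"
      using h0(1) e(1) t0ab by (auto simp: h_def min_def field_simps)
    let ?l = "t0 - h" and ?r = "t0 + h"
    let ?J = "\<lambda>t. - 2 * pi * \<i> * of_real (sgn (Im (cnj v * vector_derivative \<alpha> (at t))))"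
    let ?T' = "{t \<in> {?r..b}. \<alpha> t = Z 0}"
    have r_ne: "\<alpha> ?r \<noteq> Z 0"
    proof
      assume "\<alpha> ?r = Z 0"
      then have "?r \<in> ?T - {t0}" using h less.prems by auto
      from e(2)[OF this] h show False by simp
    qed
    have T': "?T = insert t0 ?T'" "t0 \<notin> ?T'"
    proof -
      have "t \<in> insert t0 ?T'" if t: "t \<in> ?T" for t
      proof (cases "t = t0")
        case False
        then have "e \<le> \<bar>t - t0\<bar>" "t0 \<le> t" using e(2)[of t] t0min[OF t] t by auto
        then have "t \<ge> ?r" using h by linarith
        then show ?thesis using t by simp
      qed simp
      then show "?T = insert t0 ?T'" using t0 h by auto
      show "t0 \<notin> ?T'" using h by simp
    qed
    have "finite ?T'" using finT T' by (metis finite_insert)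
    then have "card ?T' < card ?T" using T' by simp
    then have IH: "((\<lambda>s. arc_int \<alpha> ?r b (Z s) - arc_int \<alpha> ?r b (Z (- s))) \<longlongrightarrow> sum ?J ?T') (at_right 0)"
      by (rule less.hyps) (use h less.prems r_ne t01 in auto)
    have first: "((\<lambda>s. arc_int \<alpha> a ?l (Z s) - arc_int \<alpha> a ?l (Z (- s))) \<longlongrightarrow> 0) (at_right 0)"
    proof (rule noT)
      show "Z 0 \<notin> \<alpha> ` {a..?l}"
      proof
        assume "Z 0 \<in> \<alpha> ` {a..?l}"
        then obtain t where "t \<in> {a..?l}" "\<alpha> t = Z 0" by auto
        then show False using t0min[of t] h t0ab by auto
      qed
    qed (use h t0ab less.prems in auto)
    have mid: "((\<lambda>s. arc_int \<alpha> ?l ?r (Z s) - arc_int \<alpha> ?l ?r (Z (- s))) \<longlongrightarrow> ?J t0) (at_right 0)"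
      by (rule h0(2)) (use h in simp)
    have tot: "((\<lambda>s. (arc_int \<alpha> a ?l (Z s) - arc_int \<alpha> a ?l (Z (- s))) + (arc_int \<alpha> ?l ?r (Z s) - arc_int \<alpha> ?l ?r (Z (- s)))
        + (arc_int \<alpha> ?r b (Z s) - arc_int \<alpha> ?r b (Z (- s)))) \<longlongrightarrow> 0 + ?J t0 + sum ?J ?T') (at_right 0)"
      by (intro tendsto_add first mid IH)
    \<comment> \<open>Splitting needs an integrable integrand, hence a point off the arc;
      \<open>off\<close> provides it for all small \<open>s\<close>.\<close>
    have comb: "arc_int \<alpha> a b z = arc_int \<alpha> a ?l z + arc_int \<alpha> ?l ?r z + arc_int \<alpha> ?r b z" if z: "z \<notin> \<alpha> ` {0..1}" for z
    proof -
      have n: "z \<notin> \<alpha> ` {a..b}" "z \<notin> \<alpha> ` {?l..b}" using z less.prems h t0ab by force+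
      have "arc_int \<alpha> a b z = arc_int \<alpha> a ?l z + arc_int \<alpha> ?l b z"
        by (rule arc_int_combine[OF \<alpha>]) (use less.prems h t0ab n in auto)
      also have "arc_int \<alpha> ?l b z = arc_int \<alpha> ?l ?r z + arc_int \<alpha> ?r b z"
        by (rule arc_int_combine[OF \<alpha>]) (use less.prems h t0ab n in auto)
      finally show ?thesis by simp
    qed
    have "((\<lambda>s. arc_int \<alpha> a b (Z s) - arc_int \<alpha> a b (Z (- s))) \<longlongrightarrow> 0 + ?J t0 + sum ?J ?T') (at_right 0)"
      by (rule tendsto_cong[THEN iffD1, OF _ tot], rule eventually_mono[OF off]) (simp add: comb)
    moreover have "0 + ?J t0 + sum ?J ?T' = sum ?J ?T"
      unfolding T'(1) by (simp only: sum.insert[OF \<open>finite ?T'\<close> T'(2)] add_0_left)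
    ultimately show ?thesis by simp
  qed
qed

section \<open>The dual form of an arc on a surface\<close>

text \<open>The arc lies where \<psi> equals 1, the support of \<psi> ends before radius
  \<open>r\<close>, and the closed disc of radius \<open>r\<close> in the chart leaves room for a
  primitive of the closed form to be paired.\<close>

locale surface_arc = riemann_surface X A for X :: "'a topology" and A +
  fixes c :: "'a chart" and z0 :: complex and r1 r2 r :: real and \<psi> \<psi>1 \<psi>2 and \<alpha> :: "real \<Rightarrow> complex"
  assumes c: "c \<in> A" and r: "0 < r1" "r1 < r2" "r2 < r" and disc: "cball z0 r \<subseteq> chart_image c"
    and bump: "bump z0 r1 r2 \<psi> \<psi>1 \<psi>2"
    and \<alpha>: "\<alpha> C1_differentiable_on {0..1}" and im: "path_image \<alpha> \<subseteq> ball z0 r1"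
begin

lemma bumpD: "c1on UNIV \<psi> \<psi>1" "dist z0 z \<le> r1 \<Longrightarrow> \<psi> z = 1" "dist z0 z \<le> r1 \<Longrightarrow> \<psi>1 z v = 0"
  "r2 \<le> dist z0 z \<Longrightarrow> \<psi> z = 0" "r2 \<le> dist z0 z \<Longrightarrow> \<psi>1 z v = 0"
  using bump unfolding bump_def by auto

lemma path_compact: "compact (path_image \<alpha>)"
  using C1_valid_path[OF \<alpha>] valid_path_imp_path compact_path_image by blast

lemma path_sub: "path_image \<alpha> \<subseteq> chart_image c"
proof -
  have "ball z0 r1 \<subseteq> cball z0 r" using r by auto
  then show ?thesis using im disc by blast
qed

lemma ends_in: "pathstart \<alpha> \<in> path_image \<alpha>" "pathfinish \<alpha> \<in> path_image \<alpha>" by auto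

abbreviation form :: "complex \<Rightarrow> complex \<Rightarrow> complex" where "form \<equiv> arc_form \<psi> \<psi>1 \<alpha>"

lemma linear_form: "linear (form z)"
proof -
  have "linear (\<psi>1 z)" using has_derivative_linear[OF c1on_has_derivative[OF bumpD(1) UNIV_I]] .
  then have l: "\<psi>1 z (u + v) = \<psi>1 z u + \<psi>1 z v" "\<psi>1 z (a *\<^sub>R u) = a *\<^sub>R \<psi>1 z u" for u v a
    by (auto simp: linear_add linear_cmul)
  show ?thesis unfolding arc_form_def
    by (rule linearI) (simp_all add: l algebra_simps)
qed

lemma is_form: "is_form (ext c form)"
  by (rule is_form_ext[OF c linear_form])

definition off :: "'a set" where "off = topspace X - {x \<in> fst c. snd c x \<in> path_image \<alpha>}"

definition pot :: "'a \<Rightarrow> complex" where "pot = ext0 c (\<lambda>z. \<psi> z * arc_log \<alpha> z)"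

text \<open>Off the whole arc the branch of the logarithm is single-valued, so the form has a
  potential; its jump across the arc is what detects crossings.\<close>

lemma prim_off: "prim (ext c form) off pot"
  and continuous_off: "d \<in> A \<Longrightarrow> continuous_on (snd d ` (off \<inter> fst d)) (\<lambda>z. ext c form d z v)"
proof -
  let ?S = "chart_image c - path_image \<alpha>"
  have oS: "open ?S" by (rule open_Diff[OF chart_image_open[OF c] compact_imp_closed[OF path_compact]])
  have "c1on ?S (\<lambda>z. \<psi> z * arc_log \<alpha> z) (\<lambda>z v. \<psi> z * (arc_pole \<alpha> z * v) + \<psi>1 z v * arc_log \<alpha> z)"
    by (rule c1on_mult[OF c1on_subset[OF bumpD(1) oS subset_UNIV] c1on_subset[OF c1on_arc_log[OF \<alpha>] oS]]) auto
  also have "(\<lambda>z v. \<psi> z * (arc_pole \<alpha> z * v) + \<psi>1 z v * arc_log \<alpha> z) = form"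
    by (simp add: fun_eq_iff arc_form_def)
  finally have p: "c1on ?S (\<lambda>z. \<psi> z * arc_log \<alpha> z) form" .
  have K: "compact (cball z0 r2)" "cball z0 r2 \<subseteq> chart_image c" using disc r by auto
  have p0: "\<psi> z * arc_log \<alpha> z = 0" if "z \<in> ?S - cball z0 r2" for z using bumpD(4)[of z] that by simp
  show "prim (ext c form) off pot" unfolding off_def pot_def
    by (rule ext_prim_off(1)[OF c path_compact path_sub p K p0])
  show "continuous_on (snd d ` (off \<inter> fst d)) (\<lambda>z. ext c form d z v)" if "d \<in> A" unfolding off_def
    by (rule ext_prim_off(2)[OF c path_compact path_sub p K p0 that])
qed

lemma pot_off: "x \<notin> fst c \<Longrightarrow> pot x = 0" "x \<in> fst c \<Longrightarrow> pot x = \<psi> (snd c x) * arc_log \<alpha> (snd c x)"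
  by (simp_all add: pot_def ext0_def)

abbreviation start_pt :: 'a where "start_pt \<equiv> pt c (pathstart \<alpha>)"
abbreviation end_pt :: 'a where "end_pt \<equiv> pt c (pathfinish \<alpha>)"

lemma ends_in_chart: "start_pt \<in> fst c" "end_pt \<in> fst c" "snd c start_pt = pathstart \<alpha>" "snd c end_pt = pathfinish \<alpha>"
  using ends_in path_sub by auto

lemma ends_iff:
  assumes "x \<in> fst c" shows "start_pt = x \<longleftrightarrow> snd c x = pathstart \<alpha>" "end_pt = x \<longleftrightarrow> snd c x = pathfinish \<alpha>"
  using pt_snd[OF c assms] ends_in_chart by metis+

lemma form_near_arc: "z \<in> ball z0 r1 \<Longrightarrow> form z v = arc_pole \<alpha> z * v"
  by (simp add: arc_form_def bumpD(2,3))

text \<open>Near the arc \<psi> equals 1 and the form reduces to \<open>arc_pole\<close>, which does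
  not see the cut; only the two poles remain.\<close>

lemma continuous_off_ends:
  assumes d: "d \<in> A"
  shows "continuous_on (snd d ` (fst d - {start_pt, end_pt})) (\<lambda>z. ext c form d z v)"
proof -
  define U where "U = {x \<in> fst c. snd c x \<in> ball z0 r1 - {pathstart \<alpha>, pathfinish \<alpha>}}"
  have oU: "openin X U" unfolding U_def by (rule open_preimage[OF c]) (intro open_Diff open_ball finite_imp_closed; simp)
  have oo: "openin X off" using prim_off by (simp add: prim_def)
  have "continuous_on (snd d ` (off \<inter> fst d) \<union> snd d ` (U \<inter> fst d)) (\<lambda>z. ext c form d z v)"
  proof (rule continuous_on_open_Un[OF open_chart[OF d oo] open_chart[OF d oU] continuous_off[OF d]])
    show "continuous_on (snd d ` (U \<inter> fst d)) (\<lambda>z. ext c form d z v)"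
    proof (rule ext_continuous_at_chart[OF c d oU _ linear_form])
      have "continuous_on (snd c ` U) (\<lambda>z. arc_pole \<alpha> z * v)" for v
        unfolding arc_pole_def by (intro continuous_intros) (auto simp: U_def)
      then show "continuous_on (snd c ` U) (\<lambda>z. form z v)" for v
        by (rule continuous_on_eq) (auto simp: U_def form_near_arc)
    qed (auto simp: U_def)
  qed
  moreover have "snd d ` (fst d - {start_pt, end_pt}) \<subseteq> snd d ` (off \<inter> fst d) \<union> snd d ` (U \<inter> fst d)"
  proof
    fix z assume "z \<in> snd d ` (fst d - {start_pt, end_pt})"
    then obtain x where x: "x \<in> fst d" "x \<noteq> start_pt" "x \<noteq> end_pt" "z = snd d x" by auto
    have "x \<in> off \<or> x \<in> U"
    proof (cases "x \<in> fst c \<and> snd c x \<in> path_image \<alpha>")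
      case True
      then have "snd c x \<noteq> pathstart \<alpha>" "snd c x \<noteq> pathfinish \<alpha>" using x ends_iff[of x] by metis+
      then show ?thesis using True im by (auto simp: U_def)
    next
      case False
      then show ?thesis using chart_subset[OF d] x(1) by (auto simp: off_def)
    qed
    then show "z \<in> snd d ` (off \<inter> fst d) \<union> snd d ` (U \<inter> fst d)" using x by blast
  qed
  ultimately show ?thesis by (rule continuous_on_subset)
qed

text \<open>Near the arc the form is the pullback of \<open>arc_pole\<close> under the transition.
  By \<open>pole_split\<close> its principal part is a simple pole with residue 1 at the end and -1
  at the start, and the holomorphic rest has a primitive on a disc.\<close>

lemma local_structure:
  assumes d: "d \<in> A" and x: "x \<in> fst d"
  shows "\<exists>e>0. \<exists>H H'. ball (snd d x) e \<subseteq> chart_image d \<and> c1on (ball (snd d x) e) H H' \<and>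
    (\<forall>z\<in>ball (snd d x) e - {snd d x}. \<forall>v. ext c form d z v =
       H' z v + (of_bool (end_pt = x) - of_bool (start_pt = x)) / (z - snd d x) * v)"
proof (cases "x \<in> off")
  case True
  have oo: "openin X off" using prim_off by (simp add: prim_def)
  obtain e where e: "e > 0" "ball (snd d x) e \<subseteq> snd d ` (off \<inter> fst d)"
      "\<And>z. z \<in> ball (snd d x) e \<Longrightarrow> z \<in> chart_image d \<and> pt d z \<in> off"
    using chart_ball[OF d oo True x] by metis
  have "c1on (ball (snd d x) e) (\<lambda>z. pot (pt d z)) (ext c form d)"
    unfolding c1on_def
  proof (intro conjI ballI allI open_ball)
    show "((\<lambda>z. pot (pt d z)) has_derivative ext c form d z) (at z)" if "z \<in> ball (snd d x) e" for z
      using primD'[OF prim_off d] e(3)[OF that] by blast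
    show "continuous_on (ball (snd d x) e) (\<lambda>z. ext c form d z v)" for v
      by (rule continuous_on_subset[OF continuous_off[OF d] e(2)])
  qed
  moreover have "end_pt \<noteq> x" "start_pt \<noteq> x" using True ends_in_chart ends_in by (auto simp: off_def)
  moreover have "ball (snd d x) e \<subseteq> chart_image d" using e(3) by blast
  ultimately show ?thesis using e(1) by (intro exI[of _ e] conjI exI) auto
next
  case False
  then have xc: "x \<in> fst c" "snd c x \<in> path_image \<alpha>" using chart_subset[OF d] x by (auto simp: off_def)
  define U where "U = {y \<in> fst c. snd c y \<in> ball z0 r1}"
  have oU: "openin X U" unfolding U_def by (rule open_preimage[OF c]) simp
  have xU: "x \<in> U" using xc im by (auto simp: U_def)
  obtain e0 where e0: "e0 > 0" "ball (snd d x) e0 \<subseteq> snd d ` (U \<inter> fst d)"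
      "\<And>z. z \<in> ball (snd d x) e0 \<Longrightarrow> z \<in> chart_image d \<and> pt d z \<in> U"
    using chart_ball[OF d oU xU x] by metis
  let ?\<tau> = "transition d c" and ?z = "snd d x"
  have sub: "ball ?z e0 \<subseteq> snd d ` (fst d \<inter> fst c)" using e0(2) by (auto simp: U_def)
  have hol: "?\<tau> holomorphic_on ball ?z e0" by (rule holomorphic_on_subset[OF transition_holomorphic[OF d c] sub])
  have inj: "inj_on ?\<tau> (ball ?z e0)"
  proof (rule inj_onI)
    fix z w assume zw: "z \<in> ball ?z e0" "w \<in> ball ?z e0" "?\<tau> z = ?\<tau> w"
    have "pt d z = pt d w"
      using zw(3) e0(3)[OF zw(1)] e0(3)[OF zw(2)] chart_inj[OF c] by (auto simp: transition_eq U_def inj_on_def)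
    then show "z = w" using e0(3)[OF zw(1)] e0(3)[OF zw(2)] snd_pt by metis
  qed
  have \<tau>x: "?\<tau> ?z = snd c x" using d x by (simp add: transition_eq)
  obtain e1 g1 where g1: "0 < e1" "e1 \<le> e0" "g1 holomorphic_on ball ?z e1" "\<And>z. z \<in> ball ?z e1 - {?z} \<Longrightarrow>
     deriv ?\<tau> z / (?\<tau> z - pathfinish \<alpha>) = g1 z + (if ?\<tau> ?z = pathfinish \<alpha> then 1 / (z - ?z) else 0)"
    using pole_split[OF hol inj e0(1), of "pathfinish \<alpha>"] by blast
  obtain e2 g2 where g2: "0 < e2" "e2 \<le> e0" "g2 holomorphic_on ball ?z e2" "\<And>z. z \<in> ball ?z e2 - {?z} \<Longrightarrow>
     deriv ?\<tau> z / (?\<tau> z - pathstart \<alpha>) = g2 z + (if ?\<tau> ?z = pathstart \<alpha> then 1 / (z - ?z) else 0)"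
    using pole_split[OF hol inj e0(1), of "pathstart \<alpha>"] by blast
  define e where "e = min e1 e2"
  have e: "e > 0" "ball ?z e \<subseteq> ball ?z e1" "ball ?z e \<subseteq> ball ?z e2" "ball ?z e \<subseteq> ball ?z e0"
    using g1(1,2) g2(1,2) by (auto simp: e_def)
  have g: "(\<lambda>z. g1 z - g2 z) holomorphic_on ball ?z e"
    by (intro holomorphic_intros holomorphic_on_subset[OF g1(3) e(2)] holomorphic_on_subset[OF g2(3) e(3)])
  obtain H where H: "\<And>z. z \<in> ball ?z e \<Longrightarrow> (H has_field_derivative (g1 z - g2 z)) (at z)"
    using holomorphic_convex_primitive'[OF convex_ball open_ball g] at_within_open[OF _ open_ball] by metis
  have "c1on (ball ?z e) H (\<lambda>z v. (g1 z - g2 z) * v)"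
    unfolding c1on_def
  proof (intro conjI ballI allI open_ball)
    show "(H has_derivative (\<lambda>v. (g1 z - g2 z) * v)) (at z)" if "z \<in> ball ?z e" for z
      using H[OF that] by (simp add: has_field_derivative_def)
    show "continuous_on (ball ?z e) (\<lambda>z. (g1 z - g2 z) * v)" for v
      by (intro continuous_intros holomorphic_on_imp_continuous_on[OF g])
  qed
  moreover have "ext c form d z v = (g1 z - g2 z) * v + (of_bool (end_pt = x) - of_bool (start_pt = x)) / (z - ?z) * v"
    if z: "z \<in> ball ?z e - {?z}" for z v
  proof -
    have zU: "z \<in> chart_image d" "pt d z \<in> U" using e0(3) z e(4) by blast+
    have \<tau>z: "snd c (pt d z) = ?\<tau> z" by (simp add: transition_eq)
    have "ext c form d z v = arc_pole \<alpha> (?\<tau> z) * (deriv ?\<tau> z * v)"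
      using zU \<tau>z by (simp add: ext_def U_def form_near_arc)
    also have "\<dots> = (deriv ?\<tau> z / (?\<tau> z - pathfinish \<alpha>) - deriv ?\<tau> z / (?\<tau> z - pathstart \<alpha>)) * v"
      by (simp add: arc_pole_def divide_inverse algebra_simps)
    also have "\<dots> = (g1 z + (if ?\<tau> ?z = pathfinish \<alpha> then 1 / (z - ?z) else 0) - (g2 z + (if ?\<tau> ?z = pathstart \<alpha> then 1 / (z - ?z) else 0))) * v"
    proof -
      have zz: "z \<in> ball ?z e1 - {?z}" "z \<in> ball ?z e2 - {?z}" using z e(2,3) by blast+
      show ?thesis by (simp only: g1(4)[OF zz(1)] g2(4)[OF zz(2)])
    qed
    also have "(if ?\<tau> ?z = pathfinish \<alpha> then 1 / (z - ?z) else 0) = of_bool (end_pt = x) / (z - ?z)"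
      unfolding \<tau>x ends_iff[OF xc(1)] by simp
    also have "(if ?\<tau> ?z = pathstart \<alpha> then 1 / (z - ?z) else 0) = of_bool (start_pt = x) / (z - ?z)"
      unfolding \<tau>x ends_iff[OF xc(1)] by simp
    finally show ?thesis by (simp add: diff_divide_distrib algebra_simps)
  qed
  moreover have "ball ?z e \<subseteq> chart_image d" using e0(3) e(4) by blast
  ultimately show ?thesis using e(1) by blast
qed

lemma measurable_wedge:
  assumes "continuous_form \<omega>" shows "measurable_density (wedge \<omega> (ext c form))"
  unfolding measurable_density_def
proof
  fix d assume d: "d \<in> A"
  let ?N = "snd d ` (fst d \<inter> {start_pt, end_pt})" and ?S = "chart_image d"
  have fN: "finite ?N" by simp
  have oS: "open (?S - ?N)" by (intro open_Diff chart_image_open[OF d] finite_imp_closed fN)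
  have SN: "?S - ?N \<subseteq> snd d ` (fst d - {start_pt, end_pt})" by (auto simp: chart_image_def)
  have c1: "continuous_on (?S - ?N) (\<lambda>z. \<omega> d z v)" for v
    using assms d unfolding continuous_form_def by (blast intro: continuous_on_subset)
  have "continuous_on (?S - ?N) (wedge \<omega> (ext c form) d)"
    unfolding wedge_def[abs_def] by (intro continuous_intros c1 continuous_on_subset[OF continuous_off_ends[OF d] SN])
  then have m: "(\<lambda>z. indicator (?S - ?N) z *\<^sub>R wedge \<omega> (ext c form) d z) \<in> borel_measurable borel"
    by (rule borel_measurable_continuous_on_indicator[OF borel_open[OF oS]])
  show "(\<lambda>z. indicator ?S z *\<^sub>R wedge \<omega> (ext c form) d z) \<in> borel_measurable borel"
    by (rule measurable_discrete_difference[OF m, of ?N]) (use fN in \<open>auto simp: countable_finite indicator_def\<close>)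
qed

lemma wedge_supp: "pt d z \<notin> fst c \<Longrightarrow> wedge \<omega> (ext c form) d z = 0"
  by (simp add: wedge_def ext_def)

lemma wedge_integral:
  assumes \<omega>: "closed_form \<omega>" and P: "pathprim \<omega> (cball z0 r) (pt c) P"
  shows "set_integrable lborel (chart_image c) (wedge \<omega> (ext c form) c)"
    and "set_lebesgue_integral lborel (chart_image c) (wedge \<omega> (ext c form) c)
       = - 2 * \<i> * of_real kappa * (P (pathfinish \<alpha>) - P (pathstart \<alpha>))"
proof -
  have le: "locally_exact \<omega>" and cf: "continuous_form \<omega>" using \<omega> by (auto simp: closed_form_def)
  have sub: "ball z0 r \<subseteq> chart_image c" using disc ball_subset_cball by blast
  \<comment> \<open>A primitive of \<omega> along the inclusion of the disc is an ordinary C1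
    primitive in the coordinate.\<close>
  have G: "c1on (ball z0 r) P (\<omega> c)"
    unfolding c1on_def
  proof (intro conjI ballI allI open_ball)
    fix z assume z: "z \<in> ball z0 r"
    then have zc: "z \<in> chart_image c" "z \<in> cball z0 r" using sub by auto
    then have "pt c z \<in> topspace X" using chart_subset[OF c] pt_in by blast
    then obtain U F where U: "pt c z \<in> U" "prim \<omega> U F" using le unfolding locally_exact_def by metis
    obtain e where e: "e > 0" "\<forall>y\<in>cball z0 r. dist y z < e \<longrightarrow> P y - P z = F (pt c y) - F (pt c z)"
      using pathprimD[OF P zc(2) U(2,1)] by metis
    have "((\<lambda>y. F (pt c y) + (P z - F (pt c z))) has_derivative \<omega> c z) (at z)"
      by (rule has_derivative_add_const[OF primD'[OF U(2) c zc(1) U(1)]])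
    then show "(P has_derivative \<omega> c z) (at z)"
    proof (rule has_derivative_transform_within_open)
      show "open (ball z0 r \<inter> ball z e)" "z \<in> ball z0 r \<inter> ball z e" using z e(1) by auto
      show "F (pt c y) + (P z - F (pt c z)) = P y" if "y \<in> ball z0 r \<inter> ball z e" for y
      proof -
        have "P y - P z = F (pt c y) - F (pt c z)" using e(2) that by (auto simp: dist_commute)
        then show ?thesis by (simp add: algebra_simps)
      qed
    qed
  next
    show "continuous_on (ball z0 r) (\<lambda>z. \<omega> c z v)" for v
      using cf c sub unfolding continuous_form_def by (blast intro: continuous_on_subset)
  qed
  have eq: "indicator (chart_image c) z *\<^sub>R wedge \<omega> (ext c form) c z =
     (if z \<in> ball z0 r then \<omega> c z 1 * arc_form \<psi> \<psi>1 \<alpha> z \<i> - \<omega> c z \<i> * arc_form \<psi> \<psi>1 \<alpha> z 1 else 0)" for z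
  proof (cases "z \<in> chart_image c")
    case True
    have tr: "deriv (transition c c) z = 1" using transition_self[OF c pt_in[OF True]] True by simp
    have "wedge \<omega> (ext c form) c z = \<omega> c z 1 * form z \<i> - \<omega> c z \<i> * form z 1"
      using True by (simp add: wedge_def ext_def tr)
    moreover have "form z v = 0" if "z \<notin> ball z0 r" for v
      using that r bumpD(4,5)[of z] by (simp add: arc_form_def)
    ultimately show ?thesis using True by simp
  next
    case False
    then show ?thesis using sub by auto
  qed
  note L = local_dual_pairing[OF r bump G \<alpha> im]
  show "set_integrable lborel (chart_image c) (wedge \<omega> (ext c form) c)"
    unfolding set_integrable_def eq by (rule L(1))
  show "set_lebesgue_integral lborel (chart_image c) (wedge \<omega> (ext c form) c)
       = - 2 * \<i> * of_real kappa * (P (pathfinish \<alpha>) - P (pathstart \<alpha>))"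
    unfolding set_lebesgue_integral_def eq by (rule L(2))
qed

end

section \<open>Closed chains of arcs\<close>

lemma c1on_sum:
  assumes "finite J" "\<And>j. j \<in> J \<Longrightarrow> c1on S (f j) (f' j)" "open S"
  shows "c1on S (\<lambda>z. \<Sum>j\<in>J. f j z) (\<lambda>z v. \<Sum>j\<in>J. f' j z v)"
  unfolding c1on_def
proof (intro conjI ballI allI assms(3))
  show "((\<lambda>z. \<Sum>j\<in>J. f j z) has_derivative (\<lambda>v. \<Sum>j\<in>J. f' j z v)) (at z)" if "z \<in> S" for z
    by (rule has_derivative_sum) (rule c1on_has_derivative[OF assms(2) that])
  show "continuous_on S (\<lambda>z. \<Sum>j\<in>J. f' j z v)" for v
    by (rule continuous_on_sum) (rule c1on_continuous_deriv[OF assms(2)])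
qed

lemma continuous_eq_at_limit_point:
  fixes f g :: "complex \<Rightarrow> complex"
  assumes "continuous_on S f" "continuous_on S g" "open S" "a \<in> S" "\<And>z. z \<in> S - {a} \<Longrightarrow> f z = g z"
  shows "f a = g a"
proof -
  have "isCont f a" "isCont g a" using assms by (auto simp: continuous_on_eq_continuous_at)
  then have l: "(f \<longlongrightarrow> f a) (at a)" "(g \<longlongrightarrow> g a) (at a)" by (auto simp: isCont_def)
  have "\<forall>\<^sub>F z in at a. f z = g z"
    using eventually_at_in_open[OF assms(3,4)] by (rule eventually_mono) (rule assms(5))
  then have "(g \<longlongrightarrow> f a) (at a)" by (rule Lim_transform_eventually[OF l(1)])
  then show ?thesis using l(2) by (rule tendsto_unique[OF trivial_limit_at])
qed

text \<open>\<open>cyclic\<close> makes the residues of the arc forms cancel at every point.\<close>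

locale surface_arcs = surface_pou X A I ch \<rho> d\<rho> K for X :: "'a topology" and A I ch \<rho> d\<rho> K +
  fixes N :: nat and c :: "nat \<Rightarrow> 'a chart" and z0 :: "nat \<Rightarrow> complex" and r1 r2 r :: "nat \<Rightarrow> real"
    and \<psi> \<psi>1 \<psi>2 and \<alpha> :: "nat \<Rightarrow> real \<Rightarrow> complex"
  assumes arcs: "k < N \<Longrightarrow> surface_arc X A (c k) (z0 k) (r1 k) (r2 k) (r k) (\<psi> k) (\<psi>1 k) (\<psi>2 k) (\<alpha> k)"
    and cyclic: "(\<Sum>k<N. of_bool (pt (c k) (pathfinish (\<alpha> k)) = x)) = (\<Sum>k<N. of_bool (pt (c k) (pathstart (\<alpha> k)) = x) :: complex)"
begin

definition arc_ext :: "nat \<Rightarrow> 'a one_form" where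
  "arc_ext k = ext (c k) (arc_form (\<psi> k) (\<psi>1 k) (\<alpha> k))"

definition total :: "'a one_form" where
  "total d z v = (\<Sum>k<N. arc_ext k d z v)"

definition junctions :: "'a set" where
  "junctions = (\<Union>k<N. {pt (c k) (pathstart (\<alpha> k)), pt (c k) (pathfinish (\<alpha> k))})"

lemma finite_junctions: "finite junctions" by (simp add: junctions_def)

lemma arc_is_form: "k < N \<Longrightarrow> is_form (arc_ext k)"
  unfolding arc_ext_def by (rule surface_arc.is_form[OF arcs])

lemma total_covariant: "covariant total"
  unfolding covariant_def
proof (intro ballI allI)
  fix d e x v assume d: "d \<in> A" "e \<in> A" and x: "x \<in> fst d \<inter> fst e"
  then have xx: "x \<in> fst d" "x \<in> fst e" by auto
  show "total d (snd d x) v = total e (snd e x) (deriv (transition d e) (snd d x) * v)"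
    unfolding total_def
    by (intro sum.cong refl covariantD[OF is_formD(1)[OF arc_is_form] d xx]) simp
qed

text \<open>The principal parts of all arcs add up to zero by \<open>cyclic\<close>, so off the
  junctions the total is a C1 differential. At a junction the value of \<open>total\<close> is an
  artefact of division by zero and says nothing.\<close>

lemma local_primitive:
  assumes d: "d \<in> A" and x: "x \<in> fst d"
  shows "\<exists>e>0. \<exists>H H'. ball (snd d x) e \<subseteq> chart_image d \<and> c1on (ball (snd d x) e) H H' \<and>
    (\<forall>z\<in>ball (snd d x) e. pt d z \<in> junctions \<longrightarrow> z = snd d x) \<and>
    (\<forall>z\<in>ball (snd d x) e. pt d z \<notin> junctions \<longrightarrow> (\<forall>v. total d z v = H' z v))"
proof -
  let ?m = "\<lambda>k. of_bool (pt (c k) (pathfinish (\<alpha> k)) = x) - of_bool (pt (c k) (pathstart (\<alpha> k)) = x) :: complex"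
  let ?R = "\<lambda>k eH. fst eH > 0 \<and> ball (snd d x) (fst eH) \<subseteq> chart_image d \<and> c1on (ball (snd d x) (fst eH)) (fst (snd eH)) (snd (snd eH)) \<and>
    (\<forall>z\<in>ball (snd d x) (fst eH) - {snd d x}. \<forall>v. arc_ext k d z v = snd (snd eH) z v + ?m k / (z - snd d x) * v)"
  have "\<forall>k\<in>{..<N}. \<exists>eH. ?R k eH"
  proof
    fix k assume "k \<in> {..<N}"
    then have k: "k < N" by simp
    from surface_arc.local_structure[OF arcs[OF k] d x]
    obtain e H H' where "e > 0" "ball (snd d x) e \<subseteq> chart_image d" "c1on (ball (snd d x) e) H H'"
      "\<forall>z\<in>ball (snd d x) e - {snd d x}. \<forall>v. arc_ext k d z v = H' z v + ?m k / (z - snd d x) * v"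
      unfolding arc_ext_def by blast
    then show "\<exists>eH. ?R k eH" by (intro exI[of _ "(e, H, H')"]) simp
  qed
  from bchoice[OF this] obtain eH where eH': "\<forall>k\<in>{..<N}. ?R k (eH k)" ..
  then have eH: "?R k (eH k)" if "k < N" for k using that by blast
  define E H H' where "E k = fst (eH k)" and "H k = fst (snd (eH k))" and "H' k = snd (snd (eH k))" for k
  have L: "E k > 0" "c1on (ball (snd d x) (E k)) (H k) (H' k)"
    "\<And>z v. z \<in> ball (snd d x) (E k) - {snd d x} \<Longrightarrow> arc_ext k d z v = H' k z v + ?m k / (z - snd d x) * v" if "k < N" for k
    using eH[OF that] by (auto simp: E_def H_def H'_def)
  have top: "junctions \<subseteq> topspace X"
  proof
    fix y assume "y \<in> junctions"
    then obtain k where k: "k < N" "y = pt (c k) (pathstart (\<alpha> k)) \<or> y = pt (c k) (pathfinish (\<alpha> k))"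
      by (auto simp: junctions_def)
    have "y \<in> fst (c k)" using surface_arc.ends_in_chart(1,2)[OF arcs[OF k(1)]] k(2) by auto
    then show "y \<in> topspace X" using chart_subset[OF surface_arc.c[OF arcs[OF k(1)]]] by blast
  qed
  \<comment> \<open>Removing the other junctions makes \<open>x\<close> the only possible junction
    in the disc.\<close>
  have "closedin X (junctions - {x})"
    using Hausdorff_imp_t1_space[OF hausdorff] finite_junctions top unfolding t1_space_closedin_finite by blast
  then have oV: "openin X (topspace X - (junctions - {x}))" by blast
  have xV: "x \<in> topspace X - (junctions - {x})" using chart_subset[OF d] x by blast
  obtain e0 where e0: "e0 > 0" "\<And>z. z \<in> ball (snd d x) e0 \<Longrightarrow> z \<in> chart_image d \<and> pt d z \<in> topspace X - (junctions - {x})"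
    using chart_ball[OF d oV xV x] by metis
  define e where "e = Min (insert e0 (E ` {..<N}))"
  have e: "e > 0" using e0(1) L(1) by (simp add: e_def)
  have e_le: "e \<le> e0" "k < N \<Longrightarrow> e \<le> E k" for k by (auto simp: e_def)
  have sub: "ball (snd d x) e \<subseteq> ball (snd d x) e0" "k < N \<Longrightarrow> ball (snd d x) e \<subseteq> ball (snd d x) (E k)" for k
    using e_le by (auto intro!: subset_ball)
  define Hs Hs' where "Hs z = (\<Sum>k<N. H k z)" and "Hs' z v = (\<Sum>k<N. H' k z v)" for z v
  have c1: "c1on (ball (snd d x) e) Hs Hs'"
    unfolding Hs_def[abs_def] Hs'_def[abs_def]
    by (rule c1on_sum) (use c1on_subset[OF L(2) open_ball sub(2)] in auto)
  have punct: "total d z v = Hs' z v" if z: "z \<in> ball (snd d x) e - {snd d x}" for z v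
  proof -
    have zk: "z \<in> ball (snd d x) (E k) - {snd d x}" if "k < N" for k using sub(2)[OF that] z by blast
    have "total d z v = (\<Sum>k<N. H' k z v + ?m k / (z - snd d x) * v)"
      unfolding total_def by (intro sum.cong refl L(3) zk) simp_all
    also have "\<dots> = Hs' z v + (\<Sum>k<N. ?m k) / (z - snd d x) * v"
      by (simp add: sum.distrib Hs'_def sum_distrib_right sum_divide_distrib)
    also have "(\<Sum>k<N. ?m k) = 0" using cyclic[of x] by (simp only: sum_subtractf) simp
    finally show ?thesis by simp
  qed
  have Q: "z = snd d x" if "z \<in> ball (snd d x) e" "pt d z \<in> junctions" for z
  proof -
    have "z \<in> chart_image d" "pt d z = x" using e0(2)[of z] sub(1) that by auto
    then show ?thesis using snd_pt by metis
  qed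
  have full: "total d z v = Hs' z v" if z: "z \<in> ball (snd d x) e" "pt d z \<notin> junctions" for z v
  proof (cases "z = snd d x")
    \<comment> \<open>At the centre itself the pole expansion says nothing; but if it is no
      junction, both sides are continuous there and agree by passing to the limit.\<close>
    case True
    then have xJ: "x \<notin> junctions" using z d x by simp
    have sub': "ball (snd d x) e \<subseteq> snd d ` (fst d - junctions)"
    proof
      fix w assume w: "w \<in> ball (snd d x) e"
      then have wc: "w \<in> chart_image d" using e0(2) sub(1) by blast
      have "pt d w \<notin> junctions" using Q[OF w] xJ d x by auto
      then show "w \<in> snd d ` (fst d - junctions)" using wc by (auto intro!: image_eqI[where x = "pt d w"])
    qed
    have "continuous_on (ball (snd d x) e) (\<lambda>z. total d z v)"
      unfolding total_def
    proof (rule continuous_on_sum)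
      fix k assume "k \<in> {..<N}"
      then have k: "k < N" by simp
      have "ball (snd d x) e \<subseteq> snd d ` (fst d - {pt (c k) (pathstart (\<alpha> k)), pt (c k) (pathfinish (\<alpha> k))})"
        using sub' k unfolding junctions_def by blast
      then show "continuous_on (ball (snd d x) e) (\<lambda>z. arc_ext k d z v)"
        unfolding arc_ext_def by (rule continuous_on_subset[OF surface_arc.continuous_off_ends[OF arcs[OF k] d]])
    qed
    from continuous_eq_at_limit_point[OF this c1on_continuous_deriv[OF c1] open_ball, of "snd d x" v] punct e True
    show ?thesis by simp
  next
    case False
    then show ?thesis using punct z by simp
  qed
  have "ball (snd d x) e \<subseteq> chart_image d" using e0(2) sub(1) by blast
  then show ?thesis using e c1 Q full by blast
qed

text \<open>The singularities are removable: at the finitely many junctions the values of the total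
  are replaced by those of the local C1 differentials.\<close>

lemma dual_form_exists:
  "\<exists>\<eta>. closed_form \<eta> \<and> (\<forall>d\<in>A. \<forall>x\<in>fst d - junctions. \<forall>v. \<eta> d (snd d x) v = total d (snd d x) v)"
proof -
  define D where "D y = chart_at A y" for y
  have D: "D y \<in> A" "y \<in> fst (D y)" if "y \<in> topspace X" for y using chart_at[OF that] by (auto simp: D_def)
  have "\<forall>y\<in>topspace X. \<exists>eH. fst eH > 0 \<and> ball (snd (D y) y) (fst eH) \<subseteq> chart_image (D y) \<and>
     c1on (ball (snd (D y) y) (fst eH)) (fst (snd eH)) (snd (snd eH)) \<and>
    (\<forall>z\<in>ball (snd (D y) y) (fst eH). pt (D y) z \<in> junctions \<longrightarrow> z = snd (D y) y) \<and>
    (\<forall>z\<in>ball (snd (D y) y) (fst eH). pt (D y) z \<notin> junctions \<longrightarrow> (\<forall>v. total (D y) z v = snd (snd eH) z v))"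
  proof
    fix y assume "y \<in> topspace X"
    from local_primitive[OF D[OF this]] obtain e H H' where
      "e > 0" "ball (snd (D y) y) e \<subseteq> chart_image (D y)" "c1on (ball (snd (D y) y) e) H H'"
      "\<forall>z\<in>ball (snd (D y) y) e. pt (D y) z \<in> junctions \<longrightarrow> z = snd (D y) y"
      "\<forall>z\<in>ball (snd (D y) y) e. pt (D y) z \<notin> junctions \<longrightarrow> (\<forall>v. total (D y) z v = H' z v)" by blast
    then show "\<exists>eH. fst eH > 0 \<and> ball (snd (D y) y) (fst eH) \<subseteq> chart_image (D y) \<and>
     c1on (ball (snd (D y) y) (fst eH)) (fst (snd eH)) (snd (snd eH)) \<and>
    (\<forall>z\<in>ball (snd (D y) y) (fst eH). pt (D y) z \<in> junctions \<longrightarrow> z = snd (D y) y) \<and>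
    (\<forall>z\<in>ball (snd (D y) y) (fst eH). pt (D y) z \<notin> junctions \<longrightarrow> (\<forall>v. total (D y) z v = snd (snd eH) z v))"
      by (intro exI[of _ "(e, H, H')"]) simp
  qed
  from bchoice[OF this] obtain eH where eH: "\<And>y. y \<in> topspace X \<Longrightarrow> fst (eH y) > 0 \<and> ball (snd (D y) y) (fst (eH y)) \<subseteq> chart_image (D y) \<and>
     c1on (ball (snd (D y) y) (fst (eH y))) (fst (snd (eH y))) (snd (snd (eH y))) \<and>
    (\<forall>z\<in>ball (snd (D y) y) (fst (eH y)). pt (D y) z \<in> junctions \<longrightarrow> z = snd (D y) y) \<and>
    (\<forall>z\<in>ball (snd (D y) y) (fst (eH y)). pt (D y) z \<notin> junctions \<longrightarrow> (\<forall>v. total (D y) z v = snd (snd (eH y)) z v))"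
    by blast
  define E H H' where "E y = fst (eH y)" and "H y = fst (snd (eH y))" and "H' y = snd (snd (eH y))" for y
  define U where "U y = {x \<in> fst (D y). snd (D y) x \<in> ball (snd (D y) y) (E y)}" for y
  have L: "E y > 0" "c1on (ball (snd (D y) y) (E y)) (H y) (H' y)"
    "\<And>x. x \<in> U y \<Longrightarrow> x \<in> junctions \<Longrightarrow> x = y"
    "\<And>x v. x \<in> U y \<Longrightarrow> x \<notin> junctions \<Longrightarrow> total (D y) (snd (D y) x) v = H' y (snd (D y) x) v" if y: "y \<in> topspace X" for y
  proof -
    show "E y > 0" "c1on (ball (snd (D y) y) (E y)) (H y) (H' y)" using eH[OF y] by (auto simp: E_def H_def H'_def)
    fix x v assume x: "x \<in> U y"
    then have p: "pt (D y) (snd (D y) x) = x" "snd (D y) x \<in> ball (snd (D y) y) (E y)" using D[OF y] by (auto simp: U_def)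
    show "x = y" if "x \<in> junctions"
    proof -
      have "snd (D y) x = snd (D y) y" using eH[OF y] p that unfolding E_def by metis
      then have "pt (D y) (snd (D y) y) = x" using p(1) by simp
      then show ?thesis using D[OF y] by simp
    qed
    show "total (D y) (snd (D y) x) v = H' y (snd (D y) x) v" if "x \<notin> junctions"
      using eH[OF y] p that unfolding E_def H'_def by metis
  qed
  have oU: "openin X (U y)" "y \<in> U y" "U y \<subseteq> fst (D y)" if y: "y \<in> topspace X" for y
    unfolding U_def using open_preimage[OF D(1)[OF y] open_ball] D(2)[OF y] L(1)[OF y] by auto
  \<comment> \<open>At a junction the differential constructed at that very point is used,
    transported to the requested chart. As \<open>U y\<close> contains no junction except possibly
    \<open>y\<close>, the definition agrees on all of \<open>U y\<close> with the differential built
    at \<open>y\<close>.\<close>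
  define \<eta> where "\<eta> d z v = (if pt d z \<in> junctions then ext (D (pt d z)) (H' (pt d z)) d z v else total d z v)" for d z v
  have \<eta>: "\<eta> d (snd d x) v = ext (D y) (H' y) d (snd d x) v" if y: "y \<in> topspace X" and x: "x \<in> U y" and d: "d \<in> A" "x \<in> fst d" for y x d v
  proof (cases "x \<in> junctions")
    case True
    then have "x = y" by (rule L(3)[OF y x])
    then show ?thesis using True d by (simp add: \<eta>_def)
  next
    case False
    have xD: "x \<in> fst (D y)" using x oU(3)[OF y] by blast
    have "\<eta> d (snd d x) v = total d (snd d x) v" using False d by (simp add: \<eta>_def)
    also have "\<dots> = total (D y) (snd (D y) x) (deriv (transition d (D y)) (snd d x) * v)"
      by (rule covariantD[OF total_covariant d(1) D(1)[OF y] d(2) xD])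
    also have "\<dots> = H' y (snd (D y) x) (deriv (transition d (D y)) (snd d x) * v)"
      by (rule L(4)[OF y x False])
    finally show ?thesis using xD d by (simp add: ext_snd)
  qed
  have pr: "prim \<eta> (U y) (\<lambda>x. H y (snd (D y) x))" if y: "y \<in> topspace X" for y
    unfolding prim_def
  proof (intro conjI ballI oU(1)[OF y])
    fix d x assume d: "d \<in> A" and "x \<in> U y \<inter> fst d"
    then have x: "x \<in> U y" "x \<in> fst d" by auto
    have xD: "x \<in> fst (D y)" "snd (D y) x \<in> ball (snd (D y) y) (E y)" using x by (auto simp: U_def)
    have sub: "ball (snd (D y) y) (E y) \<subseteq> chart_image (D y)" using eH[OF y] by (simp add: E_def)
    have "((\<lambda>z. H y (snd (D y) (pt (D y) z))) has_derivative H' y (snd (D y) x)) (at (snd (D y) x))"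
      by (rule has_derivative_transform_within_open[OF c1on_has_derivative[OF L(2)[OF y] xD(2)] open_ball xD(2)])
         (use sub in auto)
    from has_derivative_change_chart[OF d D(1)[OF y] x(2) xD(1) this]
    have "((\<lambda>z. H y (snd (D y) (pt d z))) has_derivative ext (D y) (H' y) d (snd d x)) (at (snd d x))"
      by (rule has_derivative_eq_rhs) (use xD x d in \<open>simp add: ext_snd fun_eq_iff\<close>)
    moreover have "ext (D y) (H' y) d (snd d x) = \<eta> d (snd d x)" using \<eta>[OF y x(1) d x(2)] by (simp add: fun_eq_iff)
    ultimately show "((\<lambda>z. H y (snd (D y) (pt d z))) has_derivative \<eta> d (snd d x)) (at (snd d x))" by simp
  qed
  then have "locally_exact \<eta>" using oU(2) unfolding locally_exact_def by blast
  moreover have "continuous_form \<eta>"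
    unfolding continuous_form_def
  proof (intro ballI allI)
    fix d v assume d: "d \<in> A"
    show "continuous_on (chart_image d) (\<lambda>z. \<eta> d z v)"
    proof (rule continuous_at_imp_continuous_on, rule ballI)
      fix z assume z: "z \<in> chart_image d"
      define y where "y = pt d z"
      have y: "y \<in> topspace X" "y \<in> fst d" "snd d y = z" using pt_top[OF d z] z by (auto simp: y_def)
      let ?S = "snd d ` (U y \<inter> fst d)"
      have oS: "open ?S" by (rule open_chart[OF d oU(1)[OF y(1)]])
      have im: "snd (D y) ` U y \<subseteq> ball (snd (D y) y) (E y)" by (auto simp: U_def)
      have "continuous_on ?S (\<lambda>z. ext (D y) (H' y) d z v)"
      proof (rule ext_continuous_at_chart[OF D(1)[OF y(1)] d oU(1,3)[OF y(1)]])
        show "linear (H' y w)" if "w \<in> snd (D y) ` U y" for w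
          using has_derivative_linear[OF c1on_has_derivative[OF L(2)[OF y(1)]]] im that by blast
        show "continuous_on (snd (D y) ` U y) (\<lambda>z. H' y z v)" for v
          by (rule continuous_on_subset[OF c1on_continuous_deriv[OF L(2)[OF y(1)]] im])
      qed
      then have "continuous_on ?S (\<lambda>z. \<eta> d z v)"
        by (rule continuous_on_eq) (use \<eta>[OF y(1) _ d] in auto)
      then show "isCont (\<lambda>z. \<eta> d z v) z"
        using oS oU(2)[OF y(1)] y(2,3) by (auto simp: continuous_on_eq_continuous_at)
    qed
  qed
  moreover have "\<eta> d (snd d x) v = total d (snd d x) v" if "d \<in> A" "x \<in> fst d - junctions" for d x v
    using that by (simp add: \<eta>_def)
  ultimately show ?thesis unfolding closed_form_def by blast
qed

text \<open>Arc by arc the pairing is a difference of values of a primitive of \<omega> at the two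
  ends. The primitives \<open>P k\<close> belong to different discs and are matched only later,
  along the closed curve.\<close>

lemma dual_pairing:
  assumes \<eta>: "closed_form \<eta>" "\<And>d x v. d \<in> A \<Longrightarrow> x \<in> fst d - junctions \<Longrightarrow> \<eta> d (snd d x) v = total d (snd d x) v"
    and \<omega>: "closed_form \<omega>" and P: "\<And>k. k < N \<Longrightarrow> pathprim \<omega> (cball (z0 k) (r k)) (pt (c k)) (P k)"
  shows "Sint (wedge \<omega> \<eta>) = - 2 * \<i> * of_real kappa * (\<Sum>k<N. P k (pathfinish (\<alpha> k)) - P k (pathstart (\<alpha> k)))"
proof -
  have cont: "continuous_form \<omega>" "continuous_form \<eta>" and form: "is_form \<omega>"
    using \<omega> \<eta>(1) locally_exact_is_form by (auto simp: closed_form_def)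
  let ?\<Theta> = "\<lambda>k. wedge \<omega> (arc_ext k)"
  have meas: "measurable_density (?\<Theta> k)" if "k < N" for k
    unfolding arc_ext_def by (rule surface_arc.measurable_wedge[OF arcs[OF that] cont(1)])
  have Sk: "Sintegrable (?\<Theta> k)" "Sint (?\<Theta> k) = - 2 * \<i> * of_real kappa * (P k (pathfinish (\<alpha> k)) - P k (pathstart (\<alpha> k)))"
    if k: "k < N" for k
  proof -
    note ar = arcs[OF k]
    have i: "set_integrable lborel (chart_image (c k)) (?\<Theta> k (c k))"
      unfolding arc_ext_def by (rule surface_arc.wedge_integral(1)[OF ar \<omega> P[OF k]])
    have s: "?\<Theta> k d z = 0" if "d \<in> A" "z \<in> chart_image d" "pt d z \<notin> fst (c k)" for d z
      unfolding arc_ext_def by (rule surface_arc.wedge_supp[OF ar that(3)])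
    note l = Sint_local[OF surface_arc.c[OF ar] density_wedge[OF form arc_is_form[OF k]] meas[OF k] s i]
    show "Sintegrable (?\<Theta> k)" by (rule l(1))
    show "Sint (?\<Theta> k) = - 2 * \<i> * of_real kappa * (P k (pathfinish (\<alpha> k)) - P k (pathstart (\<alpha> k)))"
      using l(2) surface_arc.wedge_integral(2)[OF ar \<omega> P[OF k]] unfolding arc_ext_def by simp
  qed
  have "Sint (wedge \<omega> \<eta>) = Sint (\<lambda>d z. \<Sum>k<N. ?\<Theta> k d z)"
  proof (rule Sint_cong_finite)
    show "measurable_density (wedge \<omega> \<eta>)" by (rule measurable_density_continuous[OF continuous_wedge[OF cont]])
    show "measurable_density (\<lambda>d z. \<Sum>k<N. ?\<Theta> k d z)"
      unfolding measurable_density_def scaleR_sum_right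
    proof
      fix d assume "d \<in> A"
      then have "(\<lambda>z. indicator (chart_image d) z *\<^sub>R ?\<Theta> k d z) \<in> borel_measurable borel" if "k \<in> {..<N}" for k
        using meas[of k] that unfolding measurable_density_def by blast
      then show "(\<lambda>z. \<Sum>k<N. indicator (chart_image d) z *\<^sub>R ?\<Theta> k d z) \<in> borel_measurable borel"
        by (rule borel_measurable_sum)
    qed
    fix d assume d: "d \<in> A"
    have "wedge \<omega> \<eta> d z = (\<Sum>k<N. ?\<Theta> k d z)" if z: "z \<in> chart_image d - snd d ` (junctions \<inter> fst d)" for z
    proof -
      have x: "pt d z \<in> fst d - junctions"
      proof -
        have "pt d z \<notin> junctions"
        proof
          assume "pt d z \<in> junctions"
          then have "snd d (pt d z) \<in> snd d ` (junctions \<inter> fst d)" using z by (intro imageI) simp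
          then show False using z by simp
        qed
        then show ?thesis using z by simp
      qed
      have "\<eta> d z v = (\<Sum>k<N. arc_ext k d z v)" for v using \<eta>(2)[OF d x, of v] z by (simp add: total_def)
      then show ?thesis by (simp add: wedge_def sum_distrib_left sum_subtractf)
    qed
    then show "\<exists>N'. finite N' \<and> (\<forall>z\<in>chart_image d - N'. wedge \<omega> \<eta> d z = (\<Sum>k<N. ?\<Theta> k d z))"
      using finite_junctions by (intro exI[of _ "snd d ` (junctions \<inter> fst d)"]) auto
  qed
  also have "\<dots> = (\<Sum>k<N. Sint (?\<Theta> k))" by (rule Sint_sum) (use Sk in auto)
  also have "\<dots> = (\<Sum>k<N. - 2 * \<i> * of_real kappa * (P k (pathfinish (\<alpha> k)) - P k (pathstart (\<alpha> k))))"
    using Sk by simp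
  finally show ?thesis by (simp add: sum_distrib_left)
qed

text \<open>A potential of the dual form off all arcs, which jumps across them.\<close>

definition potential :: "'a \<Rightarrow> complex" where
  "potential x = (\<Sum>k<N. surface_arc.pot (c k) (\<psi> k) (\<alpha> k) x)"

definition off_arcs :: "'a set" where
  "off_arcs = {x \<in> topspace X. \<forall>k<N. x \<in> surface_arc.off X (c k) (\<alpha> k)}"

lemma prim_potential:
  assumes \<eta>: "\<And>d x v. d \<in> A \<Longrightarrow> x \<in> fst d - junctions \<Longrightarrow> \<eta> d (snd d x) v = total d (snd d x) v"
  shows "prim \<eta> off_arcs potential"
proof -
  have oo: "openin X (surface_arc.off X (c k) (\<alpha> k))" if "k < N" for k
    using surface_arc.prim_off[OF arcs[OF that]] by (simp add: prim_def)
  have "openin X off_arcs"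
  proof (cases "N = 0")
    case True
    have "off_arcs = topspace X" unfolding off_arcs_def using True by auto
    then show ?thesis by simp
  next
    case False
    have "openin X (\<Inter>k\<in>{..<N}. surface_arc.off X (c k) (\<alpha> k))"
      by (rule openin_Inter) (use False oo in auto)
    moreover have "(\<Inter>k\<in>{..<N}. surface_arc.off X (c k) (\<alpha> k)) = off_arcs"
      using False oo openin_subset unfolding off_arcs_def by blast
    ultimately show ?thesis by simp
  qed
  moreover have "((\<lambda>z. potential (pt d z)) has_derivative \<eta> d (snd d x)) (at (snd d x))"
    if d: "d \<in> A" and x: "x \<in> off_arcs" "x \<in> fst d" for d x
  proof -
    have "((\<lambda>z. potential (pt d z)) has_derivative (\<lambda>v. \<Sum>k<N. arc_ext k d (snd d x) v)) (at (snd d x))"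
      unfolding potential_def
    proof (rule has_derivative_sum)
      fix k assume "k \<in> {..<N}"
      then have k: "k < N" by simp
      then have "x \<in> surface_arc.off X (c k) (\<alpha> k)" using x(1) by (simp add: off_arcs_def)
      from primD[OF surface_arc.prim_off[OF arcs[OF k]] d this x(2)]
      show "((\<lambda>z. surface_arc.pot (c k) (\<psi> k) (\<alpha> k) (pt d z)) has_derivative arc_ext k d (snd d x)) (at (snd d x))"
        unfolding arc_ext_def .
    qed
    moreover have "x \<notin> junctions"
    proof
      assume "x \<in> junctions"
      then obtain k where k: "k < N" "x = pt (c k) (pathstart (\<alpha> k)) \<or> x = pt (c k) (pathfinish (\<alpha> k))"
        by (auto simp: junctions_def)
      note ar = arcs[OF k(1)]
      have "x \<in> fst (c k) \<and> snd (c k) x \<in> path_image (\<alpha> k)"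
        using k(2) surface_arc.ends_in_chart[OF ar] by auto
      then have "x \<notin> surface_arc.off X (c k) (\<alpha> k)" unfolding surface_arc.off_def[OF ar] by simp
      then show False using x(1) k(1) by (simp add: off_arcs_def)
    qed
    then have "\<eta> d (snd d x) = (\<lambda>v. \<Sum>k<N. arc_ext k d (snd d x) v)"
      using \<eta>[OF d, of x] x(2) by (simp add: fun_eq_iff total_def)
    ultimately show ?thesis by simp
  qed
  ultimately show ?thesis by (auto simp: prim_def)
qed

end

section \<open>Closed curves\<close>

lemma locally_constant_interval:
  fixes f :: "real \<Rightarrow> complex"
  assumes "l \<le> u" and loc: "\<And>s. s \<in> {l..u} \<Longrightarrow> \<exists>e>0. \<forall>y\<in>{l..u}. dist y s < e \<longrightarrow> f y = f s"
  shows "f u = f l"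
proof (rule connected_local_const[of "{l..u}" u l f])
  show "\<forall>s\<in>{l..u}. \<forall>\<^sub>F y in at s within {l..u}. f s = f y"
  proof
    fix s assume "s \<in> {l..u}"
    then obtain e where e: "e > 0" "\<forall>y\<in>{l..u}. dist y s < e \<longrightarrow> f y = f s" using loc by metis
    then show "\<forall>\<^sub>F y in at s within {l..u}. f s = f y"
      unfolding eventually_at by (intro exI[of _ e]) auto
  qed
qed (use assms in auto)

text \<open>A function that is locally constant off finitely many points changes only by its jumps
  there, whatever its values at these points. The induction removes the last point.\<close>

lemma jump_sum:
  fixes f :: "real \<Rightarrow> complex"
  assumes "finite S" "S \<subseteq> {a<..<b}" "a \<le> b"
    and "\<And>s. s \<in> {a..b} - S \<Longrightarrow> \<exists>e>0. \<forall>y\<in>{a..b}. dist y s < e \<longrightarrow> f y = f s"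
    and "\<And>s. s \<in> S \<Longrightarrow> ((\<lambda>h. f (s + h) - f (s - h)) \<longlongrightarrow> j s) (at_right 0)"
  shows "f b - f a = sum j S"
  using assms
proof (induction S arbitrary: b rule: finite_linorder_max_induct)
  case empty
  have "f b = f a" by (rule locally_constant_interval) (use empty in auto)
  then show ?case by simp
next
  case (insert s S)
  \<comment> \<open>A point between the last jump and whatever precedes it; inserting
    \<open>a\<close> covers the case of no earlier jump.\<close>
  define m where "m = (Max (insert a S) + s) / 2"
  have asb: "a < s" "s < b" using insert.prems(1) by auto
  have "Max (insert a S) < s" using insert.hyps asb by (subst Max_less_iff) auto
  then have m: "Max (insert a S) < m" "m < s" by (auto simp: m_def)
  then have mS: "a < m" "\<And>t. t \<in> S \<Longrightarrow> t < m" using insert.hyps(1) by (auto simp: Max_less_iff)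
  have aS: "\<And>t. t \<in> S \<Longrightarrow> a < t" using insert.prems(1) by auto
  have const: "f y = f x" if xy: "a \<le> x" "x \<le> y" "y \<le> b" "{x..y} \<inter> insert s S = {}" for x y
  proof (rule locally_constant_interval[OF xy(2)])
    fix t assume t: "t \<in> {x..y}"
    then have "t \<in> {a..b} - insert s S" using xy by auto
    then obtain e where e: "e > 0" "\<forall>y\<in>{a..b}. dist y t < e \<longrightarrow> f y = f t" using insert.prems(3) by metis
    then show "\<exists>e>0. \<forall>z\<in>{x..y}. dist z t < e \<longrightarrow> f z = f t" using xy by (intro exI[of _ e]) auto
  qed
  have IH: "f m - f a = sum j S"
  proof (rule insert.IH)
    show "S \<subseteq> {a<..<m}" using mS aS by auto
    show "a \<le> m" using mS by simp
    show "((\<lambda>h. f (t + h) - f (t - h)) \<longlongrightarrow> j t) (at_right 0)" if "t \<in> S" for t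
      using insert.prems(4) that by simp
    fix t assume t: "t \<in> {a..m} - S"
    then have "t \<in> {a..b} - insert s S" using m asb by auto
    then obtain e where e: "e > 0" "\<forall>y\<in>{a..b}. dist y t < e \<longrightarrow> f y = f t" using insert.prems(3) by metis
    have "{a..m} \<subseteq> {a..b}" using m asb by auto
    then show "\<exists>e>0. \<forall>y\<in>{a..m}. dist y t < e \<longrightarrow> f y = f t" using e by (intro exI[of _ e]) auto
  qed
  have "\<forall>\<^sub>F h in at_right 0. f (s + h) - f (s - h) = f b - f m"
    unfolding eventually_at_right_field
  proof (intro exI[of _ "min (b - s) (s - m)"] conjI allI impI)
    show "0 < min (b - s) (s - m)" using asb m by simp
    fix h assume h: "0 < h" "h < min (b - s) (s - m)"
    have "{s + h..b} \<inter> insert s S = {}"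
    proof (rule equals0I)
      fix t assume "t \<in> {s + h..b} \<inter> insert s S"
      then show False using insert.hyps(2) h by fastforce
    qed
    then have "f b = f (s + h)" using const[of "s + h" b] h asb by simp
    moreover have "{m..s - h} \<inter> insert s S = {}"
    proof (rule equals0I)
      fix t assume "t \<in> {m..s - h} \<inter> insert s S"
      then show False using mS(2)[of t] h by force
    qed
    then have "f (s - h) = f m" using const[of m "s - h"] h asb mS(1) by simp
    ultimately show "f (s + h) - f (s - h) = f b - f m" by simp
  qed
  then have "((\<lambda>h. f (s + h) - f (s - h)) \<longlongrightarrow> f b - f m) (at_right 0)" by (rule tendsto_eventually)
  moreover have "((\<lambda>h. f (s + h) - f (s - h)) \<longlongrightarrow> j s) (at_right 0)" using insert.prems(4) by simp
  ultimately have "f b - f m = j s" by (rule tendsto_unique[OF trivial_limit_at_right_real])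
  moreover have "s \<notin> S" using insert.hyps(2) by auto
  ultimately show ?case using IH insert.hyps(1) by (simp add: algebra_simps)
qed

section \<open>Functions of period 1\<close>

lemma periodic_int:
  fixes g :: "real \<Rightarrow> 'b" assumes per: "\<And>t. g (t + 1) = g t"
  shows "g (t + of_int n) = g t"
proof (induction n rule: int_induct[of _ 0])
  case base show ?case by simp
next
  case (step1 i) then show ?case using per[of "t + of_int i"] by (simp add: add.assoc)
next
  case (step2 i) then show ?case using per[of "t + of_int (i - 1)"] by simp
qed

lemma periodic_Ints:
  fixes g :: "real \<Rightarrow> 'b" assumes "\<And>t. g (t + 1) = g t" "s - t \<in> \<int>" shows "g s = g t"
proof -
  obtain n where "s - t = of_int n" using assms(2) by (auto elim: Ints_cases)
  then have "s = t + of_int n" by simp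
  then show ?thesis using periodic_int[of g, OF assms(1)] by simp
qed

lemma periodic_frac:
  fixes g :: "real \<Rightarrow> 'b" assumes "\<And>t. g (t + 1) = g t" shows "g (frac t) = g t"
proof -
  have "frac t - t \<in> \<int>" by (simp add: frac_def)
  then show ?thesis by (rule periodic_Ints[of g, OF assms])
qed

lemma vector_derivative_periodic:
  fixes g :: "real \<Rightarrow> 'b::real_normed_vector" assumes per: "\<And>t. g (t + 1) = g t"
  shows "vector_derivative g (at (t + 1)) = vector_derivative g (at t)"
proof -
  have shift: "((\<lambda>x. h (x + a)) has_vector_derivative D) (at t)" if "(h has_vector_derivative D) (at (t + a))"
    for h :: "real \<Rightarrow> 'b" and D t a
    by (rule vector_diff_chain_at[of "\<lambda>x. x + a" 1 t h D, unfolded o_def, simplified])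
       (use that in \<open>auto intro!: derivative_eq_intros\<close>)
  \<comment> \<open>An equivalence for every \<open>D\<close> gives equal values of
    \<open>vector_derivative\<close> also where the derivative does not exist.\<close>
  have "(g has_vector_derivative D) (at (t + 1)) \<longleftrightarrow> (g has_vector_derivative D) (at t)" for D
  proof -
    have m: "g (x - 1) = g x" for x using per[of "x - 1"] by simp
    show ?thesis using shift[of g D t 1] shift[of g D "t + 1" "-1"] by (auto simp: per m)
  qed
  then show ?thesis unfolding vector_derivative_def by simp
qed

text \<open>\<open>b + frac (x - b)\<close> is the representative of \<open>x\<close> modulo 1 in
  the window that starts at \<open>b\<close>. Together with \<open>frac\<close> it gives the
  bijections that move sums over crossings from one window to another.\<close>

lemma frac_window:
  fixes b :: real
  shows "b + frac (x - b) \<in> {b..<b + 1}" "(b + frac (x - b)) - x \<in> \<int>"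
    and "x \<in> {b..<b + 1} \<Longrightarrow> b + frac (frac x - b) = x"
    and "x \<in> {0..<1} \<Longrightarrow> frac (b + frac (x - b)) = x"
proof -
  show "b + frac (x - b) \<in> {b..<b + 1}" using frac_lt_1[of "x - b"] by simp
  show "(b + frac (x - b)) - x \<in> \<int>" by (simp add: frac_def)
  show "b + frac (frac x - b) = x" if "x \<in> {b..<b + 1}"
  proof -
    have "frac (frac x - b) = x - b" unfolding frac_unique_iff using that by (auto simp: frac_def)
    then show ?thesis by simp
  qed
  show "frac (b + frac (x - b)) = x" if "x \<in> {0..<1}"
    unfolding frac_unique_iff using that by (auto simp: frac_def)
qed

lemma finite_frac_preimage:
  fixes F :: "real set" assumes "finite F" shows "finite {t \<in> {l..u}. frac t \<in> F}"
proof (rule finite_subset)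
  show "{t \<in> {l..u}. frac t \<in> F} \<subseteq> (\<lambda>(x, n). x + of_int n) ` (F \<times> {\<lfloor>l\<rfloor>..\<lfloor>u\<rfloor>})"
  proof
    fix t assume t: "t \<in> {t \<in> {l..u}. frac t \<in> F}"
    then have "(frac t, \<lfloor>t\<rfloor>) \<in> F \<times> {\<lfloor>l\<rfloor>..\<lfloor>u\<rfloor>}" by (auto intro: floor_mono)
    moreover have "t = (\<lambda>(x, n). x + of_int n) (frac t, \<lfloor>t\<rfloor>)" by (simp add: frac_def)
    ultimately show "t \<in> (\<lambda>(x, n). x + of_int n) ` (F \<times> {\<lfloor>l\<rfloor>..\<lfloor>u\<rfloor>})" by (rule rev_image_eqI)
  qed
qed (use assms in simp)

section \<open>Periods and crossing signs of closed curves\<close>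

context riemann_surface
begin

lemma C1_loopD:
  assumes "C1_loop X A \<delta>"
  shows "continuous_map euclideanreal X \<delta>" "\<delta> (t + 1) = \<delta> t" "\<delta> t \<in> topspace X"
    and "continuous_map (top_of_set S) X \<delta>"
    and "c \<in> A \<Longrightarrow> (snd c \<circ> \<delta>) C1_differentiable_on {t. \<delta> t \<in> fst c}"
    and "c \<in> A \<Longrightarrow> \<delta> t \<in> fst c \<Longrightarrow> ((snd c \<circ> \<delta>) has_vector_derivative vector_derivative (snd c \<circ> \<delta>) (at t)) (at t)"
proof -
  show cm: "continuous_map euclideanreal X \<delta>" "\<delta> (t + 1) = \<delta> t"
    and d: "c \<in> A \<Longrightarrow> (snd c \<circ> \<delta>) C1_differentiable_on {t. \<delta> t \<in> fst c}"
    using assms unfolding C1_loop_def by auto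
  show "\<delta> t \<in> topspace X" using cm(1) by (auto simp: continuous_map_def)
  show "continuous_map (top_of_set S) X \<delta>" using cm(1) by (rule continuous_map_from_subtopology)
  show "((snd c \<circ> \<delta>) has_vector_derivative vector_derivative (snd c \<circ> \<delta>) (at t)) (at t)" if "c \<in> A" "\<delta> t \<in> fst c"
    using d[OF that(1)] that(2) unfolding C1_differentiable_on_eq by (auto simp: vector_derivative_works)
qed

text \<open>The shift of a primitive by one period is a primitive along the same curve, so the
  increment over a period does not depend on where the period starts.\<close>

lemma loop_period:
  assumes le: "locally_exact \<omega>" and \<delta>: "C1_loop X A \<delta>" and P: "pathprim \<omega> {a..a + 1} \<delta> P"
  shows "P (a + 1) - P a = cint \<omega> (frag_of (path_simplex \<delta>))"
proof -
  define l u where "l = min 0 a" and "u = max 1 (a + 1)"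
  obtain Q where Q: "pathprim \<omega> {l..u} \<delta> Q"
    using pathprim_exists[OF le compact_Icc convex_real_interval(5) C1_loopD(4)[OF \<delta>]] by metis
  have sub: "{a..a+1} \<subseteq> {l..u}" "{0..1} \<subseteq> {l..u}" "{l..u-1} \<subseteq> {l..u}" "(\<lambda>t. t + 1) ` {l..u-1} \<subseteq> {l..u}"
    by (auto simp: l_def u_def)
  have restr: "pathprim \<omega> L \<delta> Q" if "L \<subseteq> {l..u}" for L
    using pathprim_compose[OF Q continuous_on_id, of L] that by simp
  have "pathprim \<omega> {l..u-1} (\<lambda>t. \<delta> (t + 1)) (\<lambda>t. Q (t + 1))"
    by (rule pathprim_compose[OF Q _ sub(4)]) (intro continuous_intros)
  then have "pathprim \<omega> {l..u-1} \<delta> (\<lambda>t. Q (t + 1))"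
    by (rule pathprim_cong) (simp add: C1_loopD(2)[OF \<delta>])
  from pathprim_unique[OF le _ this restr[OF sub(3)], of 0 a]
  have "Q (a + 1) - Q (0 + 1) = Q a - Q 0" by (simp add: l_def u_def)
  then have "Q (a + 1) - Q a = Q 1 - Q 0" by (simp add: algebra_simps)
  moreover have "P (a + 1) - P a = Q (a + 1) - Q a"
    by (rule pathprim_unique[OF le _ P restr[OF sub(1)]]) auto
  ultimately show ?thesis using pint_path_simplex[OF le restr[OF sub(2)]] by simp
qed

lemma loop_piecewise_C1:
  assumes \<delta>: "C1_loop X A \<delta>" shows "piecewise_C1_path X A (simplex_path (path_simplex \<delta>))"
  unfolding piecewise_C1_path_def
proof (intro conjI ballI allI impI)
  let ?p = "simplex_path (path_simplex \<delta>)"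
  have eq: "?p t = \<delta> t" if "t \<in> {0..1}" for t by (rule simplex_path_path_simplex[OF that])
  show "pathin X ?p" unfolding pathin_def
    by (rule continuous_map_eq[OF C1_loopD(4)[OF \<delta>]]) (simp add: eq)
  fix c r s assume c: "c \<in> A" and "0 \<le> r \<and> s \<le> 1 \<and> ?p ` {r..s} \<subseteq> fst c"
  then have rs: "0 \<le> r" "s \<le> 1" "\<And>t. t \<in> {r..s} \<Longrightarrow> \<delta> t \<in> fst c" using eq by force+
  have d: "(snd c \<circ> \<delta>) C1_differentiable_on {r..s}"
    by (rule C1_differentiable_on_subset[OF C1_loopD(5)[OF \<delta> c]]) (use rs(3) in auto)
  have co: "continuous_on {r..s} (snd c \<circ> \<delta>)" by (rule C1_differentiable_imp_continuous_on[OF d])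
  obtain D where D: "\<And>t. t \<in> {r..s} \<Longrightarrow> ((snd c \<circ> \<delta>) has_vector_derivative D t) (at t)" "continuous_on {r..s} D"
    using d unfolding C1_differentiable_on_def by metis
  have "continuous_on {r..s} (snd c \<circ> ?p)"
    by (rule continuous_on_eq[OF co]) (use rs eq in auto)
  \<comment> \<open>The two curves agree on \<open>{0..1}\<close> only, so at the ends of the
    interval a two-sided derivative could be lost; the ends are declared break points.\<close>
  moreover have "(snd c \<circ> ?p) C1_differentiable_on {r..s} - {r, s}"
    unfolding C1_differentiable_on_def
  proof (intro exI[of _ D] conjI ballI)
    fix t assume t: "t \<in> {r..s} - {r, s}"
    show "((snd c \<circ> ?p) has_vector_derivative D t) (at t)"
      by (rule has_vector_derivative_transform_within_open[of "snd c \<circ> \<delta>" _ _ "{r<..<s}"])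
         (use t D(1)[of t] rs eq in auto)
  next
    show "continuous_on ({r..s} - {r, s}) D" by (rule continuous_on_subset[OF D(2)]) auto
  qed
  ultimately show "(snd c \<circ> ?p) piecewise_C1_differentiable_on {r..s}"
    unfolding piecewise_C1_differentiable_on_def by (intro conjI exI[of _ "{r, s}"]) auto
qed

lemma loop_class_integral:
  assumes "locally_exact \<omega>" "C1_loop X A \<delta>"
  shows "class_integral X A (loop_class X \<delta>) \<omega> = cint \<omega> (frag_of (path_simplex \<delta>))"
proof (rule class_integral_eq[OF assms(1) loop_class_def])
  show "frag_of (path_simplex \<delta>) \<in> loop_class X \<delta>" by (simp add: loop_class_def homologous_rel_refl)
  show "piecewise_C1_path X A (simplex_path \<sigma>)" if "\<sigma> \<in> Poly_Mapping.keys (frag_of (path_simplex \<delta>))" for \<sigma>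
    using that loop_piecewise_C1[OF assms(2)] by simp
qed

lemma transition_nonzero:
  assumes "c \<in> A" "d \<in> A" "x \<in> fst c" "x \<in> fst d" shows "deriv (transition c d) (snd c x) \<noteq> 0"
  using transition_chain[of c d c x] transition_self[of c x] assms by auto

text \<open>A change of chart multiplies both velocities by the same nonzero complex number
  \<open>T\<close>, hence the determinant by the square of \<open>norm T\<close>.\<close>

lemma crossing_det_chart:
  assumes \<gamma>: "C1_loop X A \<gamma>" and \<delta>: "C1_loop X A \<delta>" and c: "c \<in> A" "\<gamma> s \<in> fst c" and eq: "\<delta> t = \<gamma> s"
  shows "sgn (Im (cnj (vector_derivative (snd c \<circ> \<gamma>) (at s)) * vector_derivative (snd c \<circ> \<delta>) (at t)))
    = sgn (crossing_det A \<gamma> \<delta> (s, t))"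
proof -
  define d where "d = chart_at A (\<gamma> s)"
  have d: "d \<in> A" "\<gamma> s \<in> fst d" using chart_at[OF C1_loopD(3)[OF \<gamma>]] by (auto simp: d_def)
  define T where "T = deriv (transition d c) (snd d (\<gamma> s))"
  have T: "T \<noteq> 0" unfolding T_def by (rule transition_nonzero[OF d(1) c(1) d(2) c(2)])
  have v: "vector_derivative (snd c \<circ> \<epsilon>) (at u) = T * vector_derivative (snd d \<circ> \<epsilon>) (at u)"
    if \<epsilon>: "C1_loop X A \<epsilon>" "\<epsilon> u = \<gamma> s" for \<epsilon> u
  proof (rule vector_derivative_at)
    have "\<epsilon> u \<in> fst d" "\<epsilon> u \<in> fst c" using \<epsilon>(2) c d by auto
    from velocity_change_chart[OF d(1) c(1) this UNIV_I C1_loopD(4)[OF \<epsilon>(1)] C1_loopD(6)[OF \<epsilon>(1) d(1) this(1)]]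
    show "((snd c \<circ> \<epsilon>) has_vector_derivative T * vector_derivative (snd d \<circ> \<epsilon>) (at u)) (at u)"
      by (simp add: T_def \<epsilon>(2))
  qed
  define p q where "p = vector_derivative (snd d \<circ> \<gamma>) (at s)" and "q = vector_derivative (snd d \<circ> \<delta>) (at t)"
  have "cnj (T * p) * (T * q) = of_real ((norm T)\<^sup>2) * (cnj p * q)"
    by (simp only: complex_norm_square) (simp add: algebra_simps)
  then have "Im (cnj (T * p) * (T * q)) = Im (of_real ((norm T)\<^sup>2) * (cnj p * q))" by (rule arg_cong)
  also have "\<dots> = (norm T)\<^sup>2 * Im (cnj p * q)"
    by (simp only: times_complex.sel Im_complex_of_real Re_complex_of_real mult_zero_left add_0_right)
  finally have "Im (cnj (T * p) * (T * q)) = (norm T)\<^sup>2 * Im (cnj p * q)" .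
  then have "sgn (Im (cnj (T * p) * (T * q))) = sgn (Im (cnj p * q))" using T by (simp add: sgn_mult)
  then show ?thesis
    unfolding v[OF \<gamma> refl] v[OF \<delta> eq] crossing_det_def by (simp add: Let_def d_def p_def q_def)
qed

lemma crossing_det_periodic:
  assumes \<gamma>: "C1_loop X A \<gamma>" and \<delta>: "C1_loop X A \<delta>" and "s' - s \<in> \<int>" "t' - t \<in> \<int>"
  shows "crossing_det A \<gamma> \<delta> (s', t') = crossing_det A \<gamma> \<delta> (s, t)"
proof -
  have v: "vector_derivative (snd c \<circ> \<epsilon>) (at u') = vector_derivative (snd c \<circ> \<epsilon>) (at u)"
    if \<epsilon>: "C1_loop X A \<epsilon>" and u: "u' - u \<in> \<int>" for \<epsilon> u u' and c :: "'a chart"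
    by (rule periodic_Ints[of "\<lambda>u. vector_derivative (snd c \<circ> \<epsilon>) (at u)", OF _ u], rule vector_derivative_periodic)
       (simp add: C1_loopD(2)[OF \<epsilon>])
  have "\<gamma> s' = \<gamma> s" by (rule periodic_Ints[of \<gamma>, OF C1_loopD(2)[OF \<gamma>] assms(3)])
  then show ?thesis using v[OF \<gamma> assms(3)] v[OF \<delta> assms(4)] by (simp add: crossing_det_def Let_def)
qed

end

section \<open>Signed crossings as periods of the dual form\<close>

context riemann_surface
begin

lemma frac_crossing:
  assumes \<gamma>: "C1_loop X A \<gamma>" and \<delta>: "C1_loop X A \<delta>" and "\<delta> t = \<gamma> s"
  shows "(frac s, frac t) \<in> crossings \<gamma> \<delta>"
  using frac_lt_1[of s] frac_lt_1[of t] assms(3)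
    periodic_frac[of \<gamma>, OF C1_loopD(2)[OF \<gamma>]] periodic_frac[of \<delta>, OF C1_loopD(2)[OF \<delta>]]
  by (simp add: crossings_def)

text \<open>By periodicity a meeting at arbitrary parameters is an integer translate of one of the
  finitely many crossings in the unit square.\<close>

lemma transversal_finite_hits:
  assumes \<gamma>: "C1_loop X A \<gamma>" and \<delta>: "C1_loop X A \<delta>" and tr: "transversal A \<gamma> \<delta>"
  shows "finite {s \<in> {l..u}. \<gamma> s \<in> range \<delta>}" "finite {t \<in> {l..u}. \<delta> t \<in> range \<gamma>}"
proof -
  note fin = tr[unfolded transversal_def, THEN conjunct1] and fc = frac_crossing[OF \<gamma> \<delta>]
  have "{s \<in> {l..u}. \<gamma> s \<in> range \<delta>} \<subseteq> {s \<in> {l..u}. frac s \<in> fst ` crossings \<gamma> \<delta>}"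
    using fc by force
  then show "finite {s \<in> {l..u}. \<gamma> s \<in> range \<delta>}"
    by (rule finite_subset) (intro finite_frac_preimage finite_imageI fin)
  have "{t \<in> {l..u}. \<delta> t \<in> range \<gamma>} \<subseteq> {t \<in> {l..u}. frac t \<in> snd ` crossings \<gamma> \<delta>}"
    using fc by force
  then show "finite {t \<in> {l..u}. \<delta> t \<in> range \<gamma>}"
    by (rule finite_subset) (intro finite_frac_preimage finite_imageI fin)
qed

end

text \<open>The fractions 1/3 and 1/2 of \<open>r k\<close> serve as the inner and outer radii of
  the bump. The start \<open>a\<close> of the subdivision is left free, so that its junctions can be
  moved off another curve.\<close>

locale loop_arcs = surface_pou X A I ch \<rho> d\<rho> K for X :: "'a topology" and A I ch \<rho> d\<rho> K +
  fixes \<delta> :: "real \<Rightarrow> 'a" and N :: nat and a :: real and c :: "nat \<Rightarrow> 'a chart" and z0 :: "nat \<Rightarrow> complex" and r :: "nat \<Rightarrow> real"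
    and \<psi> \<psi>1 \<psi>2
  assumes loop: "C1_loop X A \<delta>" and N: "0 < N" and c: "k < N \<Longrightarrow> c k \<in> A"
    and r: "k < N \<Longrightarrow> 0 < r k" and disc: "k < N \<Longrightarrow> cball (z0 k) (r k) \<subseteq> chart_image (c k)"
    and near: "k < N \<Longrightarrow> u \<in> {0..1} \<Longrightarrow> \<delta> (a + (real k + u) / N) \<in> fst (c k) \<and>
      snd (c k) (\<delta> (a + (real k + u) / N)) \<in> ball (z0 k) (r k / 3)"
    and bump: "k < N \<Longrightarrow> bump (z0 k) (r k / 3) (r k / 2) (\<psi> k) (\<psi>1 k) (\<psi>2 k)"
begin

definition arc :: "nat \<Rightarrow> real \<Rightarrow> complex" where
  "arc k u = snd (c k) (\<delta> (a + (real k + u) / N))"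

lemma pt_arc: "k < N \<Longrightarrow> u \<in> {0..1} \<Longrightarrow> pt (c k) (arc k u) = \<delta> (a + (real k + u) / N)"
  using near c by (simp add: arc_def)

lemma arc_velocity:
  assumes "k < N" "u \<in> {0..1}"
  shows "(arc k has_vector_derivative (1 / N) *\<^sub>R vector_derivative (snd (c k) \<circ> \<delta>) (at (a + (real k + u) / N))) (at u)"
proof -
  have h: "((\<lambda>u. a + (real k + u) / N) has_vector_derivative 1 / N) (at u)"
    using N by (auto intro!: derivative_eq_intros simp: has_real_derivative_iff_has_vector_derivative[symmetric])
  have g: "((snd (c k) \<circ> \<delta>) has_vector_derivative vector_derivative (snd (c k) \<circ> \<delta>) (at (a + (real k + u) / N))) (at (a + (real k + u) / N))"
    by (rule C1_loopD(6)[OF loop c[OF assms(1)]]) (use near[OF assms] in simp)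
  have "arc k = (snd (c k) \<circ> \<delta>) \<circ> (\<lambda>u. a + (real k + u) / N)" by (simp add: arc_def fun_eq_iff)
  then show ?thesis using vector_diff_chain_at[OF h g] by (simp only:)
qed

lemma arc_C1: assumes k: "k < N" shows "arc k C1_differentiable_on {0..1}"
proof -
  have "continuous_on {t. \<delta> t \<in> fst (c k)} (\<lambda>t. vector_derivative (snd (c k) \<circ> \<delta>) (at t))"
    using C1_loopD(5)[OF loop c[OF k]] unfolding C1_differentiable_on_eq by blast
  then have "continuous_on {0..1} (\<lambda>u. vector_derivative (snd (c k) \<circ> \<delta>) (at (a + (real k + u) / N)))"
    by (rule continuous_on_compose2) (use near[OF k] N in \<open>auto intro!: continuous_intros\<close>)
  then have "continuous_on {0..1} (\<lambda>u. (1 / N) *\<^sub>R vector_derivative (snd (c k) \<circ> \<delta>) (at (a + (real k + u) / N)))"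
    by (rule continuous_on_scaleR[OF continuous_on_const])
  then show ?thesis unfolding C1_differentiable_on_def
    by (intro exI[of _ "\<lambda>u. (1 / N) *\<^sub>R vector_derivative (snd (c k) \<circ> \<delta>) (at (a + (real k + u) / N))"] conjI ballI)
       (rule arc_velocity[OF k], assumption+)
qed

lemma arc_surface_arc:
  assumes k: "k < N" shows "surface_arc X A (c k) (z0 k) (r k / 3) (r k / 2) (r k) (\<psi> k) (\<psi>1 k) (\<psi>2 k) (arc k)"
proof (rule surface_arc.intro[OF riemann_surface_axioms surface_arc_axioms.intro])
  show "path_image (arc k) \<subseteq> ball (z0 k) (r k / 3)" using near[OF k] by (auto simp: path_image_def arc_def)
qed (use k c r[OF k] disc bump arc_C1 in auto)

lemma arc_ends:
  assumes k: "k < N"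
  shows "pt (c k) (pathstart (arc k)) = \<delta> (a + real k / N)" "pt (c k) (pathfinish (arc k)) = \<delta> (a + real (Suc k) / N)"
  using pt_arc[OF k, of 0] pt_arc[OF k, of 1] by (simp_all add: pathstart_def pathfinish_def add.commute)

text \<open>Each piece ends where the next one starts, and the last ends where the first starts
  because the curve has period 1.\<close>

lemma arcs_cyclic:
  "(\<Sum>k<N. of_bool (pt (c k) (pathfinish (arc k)) = x)) = (\<Sum>k<N. of_bool (pt (c k) (pathstart (arc k)) = x) :: complex)"
proof -
  let ?f = "\<lambda>k. of_bool (\<delta> (a + real k / N) = x) :: complex"
  have "(\<Sum>k<N. ?f (Suc k) - ?f k) = ?f N - ?f 0" by (rule sum_lessThan_telescope)
  also have "\<dots> = 0" using N C1_loopD(2)[OF loop, of a] by simp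
  finally have "(\<Sum>k<N. ?f (Suc k)) = (\<Sum>k<N. ?f k)" by (simp only: sum_subtractf right_minus_eq)
  moreover have "(\<Sum>k<N. of_bool (pt (c k) (pathfinish (arc k)) = x)) = (\<Sum>k<N. ?f (Suc k))"
    "(\<Sum>k<N. of_bool (pt (c k) (pathstart (arc k)) = x)) = (\<Sum>k<N. ?f k)"
    by (intro sum.cong refl, simp only: arc_ends lessThan_iff)+
  ultimately show ?thesis by simp
qed

end

sublocale loop_arcs \<subseteq> surface_arcs X A I ch \<rho> d\<rho> K N c z0 "\<lambda>k. r k / 3" "\<lambda>k. r k / 2" r \<psi> \<psi>1 \<psi>2 arc
  by (intro surface_arcs.intro surface_pou_axioms surface_arcs_axioms.intro arc_surface_arc arcs_cyclic)

context loop_arcs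
begin

text \<open>On each piece the primitive in the disc and the primitive along the curve have the same
  increment; the increments along the curve telescope to the period.\<close>

lemma loop_dual_pairing:
  assumes \<eta>: "closed_form \<eta>" "\<And>d x v. d \<in> A \<Longrightarrow> x \<in> fst d - junctions \<Longrightarrow> \<eta> d (snd d x) v = total d (snd d x) v"
    and \<omega>: "closed_form \<omega>"
  shows "Sint (wedge \<omega> \<eta>) = - 2 * \<i> * of_real kappa * cint \<omega> (frag_of (path_simplex \<delta>))"
proof -
  have le: "locally_exact \<omega>" using \<omega> by (simp add: closed_form_def)
  have "\<exists>P. pathprim \<omega> (cball (z0 k) (r k)) (pt (c k)) P" if k: "k < N" for k
  proof -
    have "continuous_map (top_of_set (cball (z0 k) (r k))) X (pt (c k))"
      using continuous_map_from_subtopology_mono[OF continuous_pt[OF c[OF k]] disc[OF k]] .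
    then show ?thesis using pathprim_exists[OF le compact_cball convex_cball] by metis
  qed
  then have "\<forall>k. \<exists>P. k < N \<longrightarrow> pathprim \<omega> (cball (z0 k) (r k)) (pt (c k)) P" by blast
  from choice[OF this] obtain P where P: "\<And>k. k < N \<Longrightarrow> pathprim \<omega> (cball (z0 k) (r k)) (pt (c k)) (P k)" by blast
  obtain Q where Q: "pathprim \<omega> {a..a + 1} \<delta> Q"
    using pathprim_exists[OF le compact_Icc convex_real_interval(5) C1_loopD(4)[OF loop]] by metis
  have step: "P k (pathfinish (arc k)) - P k (pathstart (arc k)) = Q (a + real (Suc k) / N) - Q (a + real k / N)" if k: "k < N" for k
  proof -
    have ran: "(\<lambda>u. a + (real k + u) / N) ` {0..1} \<subseteq> {a..a + 1}"
    proof (rule image_subsetI)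
      fix u :: real assume u: "u \<in> {0..1}"
      have "real k + u \<le> real N" using k u by auto
      then show "a + (real k + u) / N \<in> {a..a + 1}" using u N by (simp add: divide_le_eq)
    qed
    have q: "pathprim \<omega> {0..1} (\<lambda>u. \<delta> (a + (real k + u) / N)) (\<lambda>u. Q (a + (real k + u) / N))"
      by (rule pathprim_compose[OF Q _ ran]) (use N in \<open>auto intro!: continuous_intros\<close>)
    have "arc k ` {0..1} \<subseteq> cball (z0 k) (r k)" using near[OF k] r[OF k] by (fastforce simp: arc_def)
    then have "pathprim \<omega> {0..1} (\<lambda>u. pt (c k) (arc k u)) (\<lambda>u. P k (arc k u))"
      by (rule pathprim_compose[OF P[OF k] C1_path_facts(3)[OF arc_C1[OF k]]])
    then have "pathprim \<omega> {0..1} (\<lambda>u. \<delta> (a + (real k + u) / N)) (\<lambda>u. P k (arc k u))"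
      by (rule pathprim_cong) (simp add: pt_arc[OF k])
    from pathprim_unique[OF le _ this q, of 0 1] show ?thesis by (simp add: pathstart_def pathfinish_def add.commute)
  qed
  have "(\<Sum>k<N. P k (pathfinish (arc k)) - P k (pathstart (arc k))) = (\<Sum>k<N. Q (a + real (Suc k) / N) - Q (a + real k / N))"
    using step by simp
  also have "\<dots> = Q (a + real N / N) - Q (a + real 0 / N)" by (rule sum_lessThan_telescope)
  also have "\<dots> = cint \<omega> (frag_of (path_simplex \<delta>))" using loop_period[OF le loop Q] N by simp
  finally show ?thesis using dual_pairing[OF \<eta> \<omega> P] by simp
qed

lemma off_arcs_loop: "x \<in> topspace X \<Longrightarrow> x \<notin> range \<delta> \<Longrightarrow> x \<in> off_arcs"
proof -
  assume x: "x \<in> topspace X" "x \<notin> range \<delta>"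
  have "x \<in> surface_arc.off X (c k) (arc k)" if k: "k < N" for k
    unfolding surface_arc.off_def[OF arc_surface_arc[OF k]]
  proof (intro DiffI x(1) notI)
    assume "x \<in> {x \<in> fst (c k). snd (c k) x \<in> path_image (arc k)}"
    then obtain u where u: "x \<in> fst (c k)" "snd (c k) x = arc k u" "u \<in> {0..1}" by (auto simp: path_image_def)
    then have "x = \<delta> (a + (real k + u) / N)" using pt_arc[OF k u(3)] pt_snd[OF c[OF k] u(1)] by simp
    then show False using x(2) by blast
  qed
  then show ?thesis using x(1) by (simp add: off_arcs_def)
qed

end

text \<open>\<open>avoid\<close> keeps the junctions off \<gamma>, so \<gamma> meets every arc only
  in its interior, where the jump formula holds.\<close>

locale loop_crossing = loop_arcs X A I ch \<rho> d\<rho> K \<delta> N a c z0 r \<psi> \<psi>1 \<psi>2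
    for X :: "'a topology" and A I ch \<rho> d\<rho> K \<delta> N a c z0 r \<psi> \<psi>1 \<psi>2 +
  fixes \<gamma> :: "real \<Rightarrow> 'a"
  assumes \<gamma>: "C1_loop X A \<gamma>" and transversal: "transversal A \<gamma> \<delta>"
    and avoid: "k \<le> N \<Longrightarrow> \<delta> (a + real k / N) \<notin> range \<gamma>"
begin

abbreviation sign :: "real \<Rightarrow> real \<Rightarrow> real" where "sign s t \<equiv> sgn (crossing_det A \<gamma> \<delta> (s, t))"



lemmas crossing_frac = frac_crossing[OF \<gamma> loop]

lemma finite_crossings: "finite (crossings \<gamma> \<delta>)" using transversal by (simp add: transversal_def)

lemma sign_frac: "sign (frac s) (frac t) = sign s t"
  using crossing_det_periodic[OF \<gamma> loop, of "frac s" s "frac t" t] by (simp add: frac_def)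

lemma crossing_nonzero: "\<delta> t = \<gamma> s \<Longrightarrow> sign s t \<noteq> 0"
  using transversal crossing_frac[of t s] sign_frac[of s t] by (auto simp: transversal_def sgn_0_0)

lemmas finite_hits = transversal_finite_hits[OF \<gamma> loop transversal]

lemma off_hits_near: "\<forall>\<^sub>F h in at_right 0. \<gamma> (s + h) \<notin> range \<delta> \<and> \<gamma> (s - h) \<notin> range \<delta>"
proof -
  let ?F = "{t \<in> {s - 1..s + 1}. \<gamma> t \<in> range \<delta>} - {s}"
  have "open (- ?F)" by (intro open_Compl finite_imp_closed finite_Diff finite_hits)
  then obtain e where e: "e > 0" "ball s e \<subseteq> - ?F" using openE[of "- ?F" s] by blast
  show ?thesis unfolding eventually_at_right_field
  proof (intro exI[of _ "min e 1"] conjI allI impI)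
    fix h assume h: "0 < h" "h < min e 1"
    have "s + h \<in> ball s e" "s - h \<in> ball s e" using h by (auto simp: dist_real_def)
    then have "s + h \<notin> ?F" "s - h \<notin> ?F" using e(2) by blast+
    then show "\<gamma> (s + h) \<notin> range \<delta>" "\<gamma> (s - h) \<notin> range \<delta>" using h by auto
  qed (use e in simp)
qed

abbreviation arc_pot :: "nat \<Rightarrow> 'a \<Rightarrow> complex" where "arc_pot k \<equiv> surface_arc.pot (c k) (\<psi> k) (arc k)"

text \<open>If \<gamma> is off the arc at \<open>s\<close>, the potential is continuous there and
  the sum is empty. Otherwise \<psi> equals 1 nearby, the potential is the cut logarithm, and its
  jumps are known; the velocity of the arc differs from that of \<delta> by the positive factor
  \<open>1 / N\<close>.\<close>

lemma arc_pot_jump: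
  assumes k: "k < N"
  shows "((\<lambda>h. arc_pot k (\<gamma> (s + h)) - arc_pot k (\<gamma> (s - h))) \<longlongrightarrow>
     (\<Sum>u | u \<in> {0..1} \<and> \<delta> (a + (real k + u) / N) = \<gamma> s. - 2 * pi * \<i> * of_real (sign s (a + (real k + u) / N)))) (at_right 0)"
proof (cases "\<gamma> s \<in> surface_arc.off X (c k) (arc k)")
  case True
  note ar = arc_surface_arc[OF k]
  have empty: "{u. u \<in> {0..1} \<and> \<delta> (a + (real k + u) / N) = \<gamma> s} = {}"
  proof (rule equals0I)
    fix u assume "u \<in> {u. u \<in> {0..1} \<and> \<delta> (a + (real k + u) / N) = \<gamma> s}"
    then have u: "u \<in> {0..1}" "\<delta> (a + (real k + u) / N) = \<gamma> s" by auto
    then have "\<gamma> s \<in> fst (c k)" "snd (c k) (\<gamma> s) = arc k u" using near[OF k u(1)] by (auto simp: arc_def)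
    then have "\<gamma> s \<in> {x \<in> fst (c k). snd (c k) x \<in> path_image (arc k)}" using u(1) by (auto simp: path_image_def)
    then show False using True unfolding surface_arc.off_def[OF ar] by blast
  qed
  let ?U = "surface_arc.off X (c k) (arc k)"
  have p: "prim (ext (c k) (arc_form (\<psi> k) (\<psi>1 k) (arc k))) ?U (arc_pot k)" by (rule surface_arc.prim_off[OF ar])
  then have oU: "openin X ?U" unfolding prim_def by (rule conjunct1)
  define V where "V = {t. \<gamma> t \<in> ?U}"
  have oV: "open V"
    using openin_continuous_map_preimage[OF C1_loopD(1)[OF \<gamma>] oU] unfolding V_def by (simp only: open_openin topspace_euclidean UNIV_I simp_thms)
  have "continuous_map (top_of_set V) (subtopology X ?U) \<gamma>"
    using C1_loopD(4)[OF \<gamma>] by (auto simp: continuous_map_in_subtopology V_def)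
  from continuous_map_compose[OF this prim_continuous[OF p]]
  have "continuous_on V (arc_pot k \<circ> \<gamma>)" by simp
  moreover have "s \<in> V" using True unfolding V_def by (rule CollectI)
  ultimately have ic: "isCont (arc_pot k \<circ> \<gamma>) s" unfolding continuous_on_eq_continuous_at[OF oV] by (rule bspec)
  have "((\<lambda>h. (arc_pot k \<circ> \<gamma>) (s + h)) \<longlongrightarrow> (arc_pot k \<circ> \<gamma>) s) (at_right 0)"
    by (rule isCont_tendsto_compose[OF ic]) (auto intro!: tendsto_eq_intros)
  moreover have "((\<lambda>h. (arc_pot k \<circ> \<gamma>) (s - h)) \<longlongrightarrow> (arc_pot k \<circ> \<gamma>) s) (at_right 0)"
    by (rule isCont_tendsto_compose[OF ic]) (auto intro!: tendsto_eq_intros)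
  ultimately have "((\<lambda>h. (arc_pot k \<circ> \<gamma>) (s + h) - (arc_pot k \<circ> \<gamma>) (s - h)) \<longlongrightarrow> (arc_pot k \<circ> \<gamma>) s - (arc_pot k \<circ> \<gamma>) s) (at_right 0)"
    by (rule tendsto_diff)
  then show ?thesis unfolding empty o_def sum.empty diff_self .
next
  case False
  note ar = arc_surface_arc[OF k]
  have gs: "\<gamma> s \<in> fst (c k)" "snd (c k) (\<gamma> s) \<in> path_image (arc k)"
    using False C1_loopD(3)[OF \<gamma>, of s] unfolding surface_arc.off_def[OF ar] by auto
  define Z where "Z h = snd (c k) (\<gamma> (s + h))" for h
  define v where "v = vector_derivative (snd (c k) \<circ> \<gamma>) (at s)"
  have Z0: "Z 0 = snd (c k) (\<gamma> s)" by (simp add: Z_def)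
  have Zv: "(Z has_vector_derivative v) (at 0)"
  proof -
    have h: "((\<lambda>h. s + h) has_vector_derivative 1) (at 0)" by (auto intro!: derivative_eq_intros)
    have "((snd (c k) \<circ> \<gamma>) has_vector_derivative v) (at (s + 0))"
      using C1_loopD(6)[OF \<gamma> c[OF k] gs(1)] by (simp add: v_def)
    from vector_diff_chain_at[OF h this] show ?thesis by (simp add: Z_def[abs_def] o_def)
  qed
  have iff: "arc k u = Z 0 \<longleftrightarrow> \<delta> (a + (real k + u) / N) = \<gamma> s" if u: "u \<in> {0..1}" for u
  proof
    show "\<delta> (a + (real k + u) / N) = \<gamma> s" if "arc k u = Z 0"
      using pt_arc[OF k u] pt_snd[OF c[OF k] gs(1)] that Z0 by simp
    show "arc k u = Z 0" if "\<delta> (a + (real k + u) / N) = \<gamma> s" using that by (simp add: arc_def Z0)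
  qed
  have sg: "sgn (Im (cnj v * vector_derivative (arc k) (at u))) = sign s (a + (real k + u) / N)"
    if u: "u \<in> {0..1}" "arc k u = Z 0" for u
  proof -
    let ?w = "vector_derivative (snd (c k) \<circ> \<delta>) (at (a + (real k + u) / N))"
    have "vector_derivative (arc k) (at u) = (1 / N) *\<^sub>R ?w" by (rule vector_derivative_at[OF arc_velocity[OF k u(1)]])
    then have "Im (cnj v * vector_derivative (arc k) (at u)) = (1 / N) * Im (cnj v * ?w)" by (simp add: algebra_simps)
    then have "sgn (Im (cnj v * vector_derivative (arc k) (at u))) = sgn (Im (cnj v * ?w))" using N by (simp only: sgn_mult) simp
    also have "\<dots> = sign s (a + (real k + u) / N)"
      unfolding v_def by (rule crossing_det_chart[OF \<gamma> loop c[OF k] gs(1)]) (use iff u in blast)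
    finally show ?thesis .
  qed
  have fin: "finite {u \<in> {0..1}. arc k u = Z 0}"
  proof (rule finite_subset)
    show "{u \<in> {0..1}. arc k u = Z 0} \<subseteq> (\<lambda>t. (t - a) * N - k) ` {t \<in> {a..a + (k + 1) / N}. \<delta> t \<in> range \<gamma>}"
    proof
      fix u assume "u \<in> {u \<in> {0..1}. arc k u = Z 0}"
      then have u: "u \<in> {0..1}" "\<delta> (a + (real k + u) / N) = \<gamma> s" using iff by auto
      then have "a + (real k + u) / N \<in> {t \<in> {a..a + (k + 1) / N}. \<delta> t \<in> range \<gamma>}"
        by (auto intro!: divide_right_mono)
      moreover have "u = (a + (real k + u) / N - a) * N - k" using N by simp
      ultimately show "u \<in> (\<lambda>t. (t - a) * N - k) ` {t \<in> {a..a + (k + 1) / N}. \<delta> t \<in> range \<gamma>}" by (rule rev_image_eqI)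
    qed
  qed (intro finite_imageI finite_hits)
  have ends: "arc k 0 \<noteq> Z 0" "arc k 1 \<noteq> Z 0"
  proof -
    have "\<delta> (a + real k / N) \<noteq> \<gamma> s" "\<delta> (a + real (Suc k) / N) \<noteq> \<gamma> s" using avoid[of k] avoid[of "Suc k"] k by auto
    then show "arc k 0 \<noteq> Z 0" "arc k 1 \<noteq> Z 0" using iff[of 0] iff[of 1] by (simp_all add: add.commute)
  qed
  have off: "\<forall>\<^sub>F h in at_right 0. Z h \<notin> arc k ` {0..1} \<and> Z (- h) \<notin> arc k ` {0..1}"
    and pot: "\<forall>\<^sub>F h in at_right 0. arc_int (arc k) 0 1 (Z h) - arc_int (arc k) 0 1 (Z (- h)) = arc_pot k (\<gamma> (s + h)) - arc_pot k (\<gamma> (s - h))"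
  proof -
    define U where "U = {x \<in> fst (c k). snd (c k) x \<in> ball (z0 k) (r k / 3)}"
    have oU: "openin X U" unfolding U_def by (rule open_preimage[OF c[OF k] open_ball])
    have sU: "\<gamma> s \<in> U" using gs surface_arc.im[OF ar] by (auto simp: U_def)
    obtain e where e: "e > 0" "\<And>y. dist y s < e \<Longrightarrow> \<gamma> y \<in> U"
      using continuous_map_nbhd[OF C1_loopD(4)[OF \<gamma>] oU UNIV_I sU] by auto
    have ev: "\<forall>\<^sub>F h in at_right 0. \<gamma> (s + h) \<in> U \<and> \<gamma> (s - h) \<in> U"
      unfolding eventually_at_right_field
    proof (intro exI[of _ e] conjI allI impI e(1))
      fix h assume h: "0 < h" "h < e"
      show "\<gamma> (s + h) \<in> U" "\<gamma> (s - h) \<in> U" by (rule e(2), use h in \<open>simp add: dist_real_def\<close>)+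
    qed
    have no: "snd (c k) x \<notin> arc k ` {0..1}" if x: "x \<in> U" "x \<notin> range \<delta>" for x
    proof
      assume "snd (c k) x \<in> arc k ` {0..1}"
      then obtain u where u: "u \<in> {0..1}" "snd (c k) x = arc k u" by auto
      have "x \<in> fst (c k)" using x by (simp add: U_def)
      then have "x = \<delta> (a + (real k + u) / N)" using pt_arc[OF k u(1)] u(2) c[OF k] by (metis pt_snd)
      then show False using x by blast
    qed
    show "\<forall>\<^sub>F h in at_right 0. Z h \<notin> arc k ` {0..1} \<and> Z (- h) \<notin> arc k ` {0..1}"
      using ev off_hits_near[of s] by eventually_elim (simp add: Z_def no)
    have ap: "arc_pot k x = arc_int (arc k) 0 1 (snd (c k) x)" if x: "x \<in> U" for x
      using x surface_arc.pot_off(2)[OF ar, of x] surface_arc.bumpD(2)[OF ar, of "snd (c k) x"]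
      by (simp add: U_def arc_log_eq_arc_int)
    show "\<forall>\<^sub>F h in at_right 0. arc_int (arc k) 0 1 (Z h) - arc_int (arc k) 0 1 (Z (- h)) = arc_pot k (\<gamma> (s + h)) - arc_pot k (\<gamma> (s - h))"
      using ev by eventually_elim (simp add: Z_def ap)
  qed
  have det: "Im (cnj v * vector_derivative (arc k) (at u)) \<noteq> 0" if u: "u \<in> {0..1}" "arc k u = Z 0" for u
    using sg[OF u] crossing_nonzero[of "a + (real k + u) / N" s] iff[OF u(1)] u(2) by auto
  have "((\<lambda>h. arc_int (arc k) 0 1 (Z h) - arc_int (arc k) 0 1 (Z (- h))) \<longlongrightarrow>
     (\<Sum>u | u \<in> {0..1} \<and> arc k u = Z 0. - 2 * pi * \<i> * of_real (sgn (Im (cnj v * vector_derivative (arc k) (at u)))))) (at_right 0)"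
    by (rule arc_int_jumps[OF arc_C1[OF k] Zv off fin det _ _ _ ends]) auto
  also have "(\<Sum>u | u \<in> {0..1} \<and> arc k u = Z 0. - 2 * pi * \<i> * of_real (sgn (Im (cnj v * vector_derivative (arc k) (at u)))))
     = (\<Sum>u | u \<in> {0..1} \<and> \<delta> (a + (real k + u) / N) = \<gamma> s. - 2 * pi * \<i> * of_real (sign s (a + (real k + u) / N)))"
    by (rule sum.cong) (use iff sg in auto)
  finally show ?thesis by (rule tendsto_cong[THEN iffD1, OF pot])
qed

text \<open>A parameter in the window is uniquely \<open>a + (k + u) / N\<close> with
  \<open>u < 1\<close>. The value \<open>u = 1\<close>, which would count a meeting twice, is a
  junction and excluded by \<open>avoid\<close>.\<close>

lemma arc_sum:
  fixes f :: "real \<Rightarrow> complex"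
  shows "(\<Sum>k<N. \<Sum>u | u \<in> {0..1} \<and> \<delta> (a + (real k + u) / N) = \<gamma> s. f (a + (real k + u) / N))
    = (\<Sum>t | t \<in> {a..<a + 1} \<and> \<delta> t = \<gamma> s. f t)"
proof -
  let ?S = "\<lambda>k. {u. u \<in> {0..1} \<and> \<delta> (a + (real k + u) / N) = \<gamma> s}" and ?T = "{t. t \<in> {a..<a + 1} \<and> \<delta> t = \<gamma> s}"
  have fT: "finite ?T" by (rule finite_subset[OF _ finite_hits(2)[of a "a + 1"]]) auto
  have S: "u < 1" if "k < N" "u \<in> ?S k" for k u
  proof -
    have "u \<noteq> 1"
    proof
      assume "u = 1"
      then have "\<delta> (a + real (Suc k) / N) = \<gamma> s" using that(2) by (simp add: add.commute)
      then show False using avoid[of "Suc k"] that(1) by auto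
    qed
    then show ?thesis using that(2) by auto
  qed
  have idx: "nat \<lfloor>(t - a) * N\<rfloor> < N" "real (nat \<lfloor>(t - a) * N\<rfloor>) + frac ((t - a) * N) = (t - a) * N" if "t \<in> {a..<a + 1}" for t
  proof -
    have "0 \<le> (t - a) * N" "(t - a) * N < N" using that N by auto
    then show "nat \<lfloor>(t - a) * N\<rfloor> < N" "real (nat \<lfloor>(t - a) * N\<rfloor>) + frac ((t - a) * N) = (t - a) * N"
      by (auto simp: frac_def nat_less_iff floor_less_iff)
  qed
  have rng: "a + (real k + u) / N \<in> {a..<a + 1}" if "k < N" "u \<in> {0..<1}" for k u
  proof -
    have "real k + u < real N" using that by auto
    then show ?thesis using that N by (simp add: divide_less_eq)
  qed
  have "(\<Sum>p\<in>Sigma {..<N} ?S. f (a + (real (fst p) + snd p) / N)) = (\<Sum>t\<in>?T. f t)"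
  proof (rule sum.reindex_bij_witness[where i = "\<lambda>t. (nat \<lfloor>(t - a) * N\<rfloor>, frac ((t - a) * N))" and j = "\<lambda>p. a + (real (fst p) + snd p) / N"])
    fix p assume "p \<in> Sigma {..<N} ?S"
    then have p: "fst p < N" "snd p \<in> ?S (fst p)" by auto
    have u: "snd p \<in> {0..<1}" using S[OF p] p(2) by auto
    have e: "(a + (real (fst p) + snd p) / N - a) * N = real (fst p) + snd p" using N by simp
    have "\<lfloor>real (fst p) + snd p\<rfloor> = int (fst p)" using u by (simp add: floor_eq_iff)
    moreover have "frac (real (fst p) + snd p) = snd p" unfolding frac_unique_iff using u by auto
    ultimately show "(nat \<lfloor>(a + (real (fst p) + snd p) / N - a) * N\<rfloor>, frac ((a + (real (fst p) + snd p) / N - a) * N)) = p"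
      unfolding e by simp
    show "a + (real (fst p) + snd p) / N \<in> ?T" using rng[OF p(1) u] p(2) by simp
  next
    fix t assume t: "t \<in> ?T"
    then have t': "t \<in> {a..<a + 1}" by simp
    have e: "a + (real (nat \<lfloor>(t - a) * N\<rfloor>) + frac ((t - a) * N)) / N = t" unfolding idx(2)[OF t'] using N by simp
    then show "a + (real (fst (nat \<lfloor>(t - a) * N\<rfloor>, frac ((t - a) * N))) + snd (nat \<lfloor>(t - a) * N\<rfloor>, frac ((t - a) * N))) / N = t"
      by (simp only: fst_conv snd_conv)
    have "frac ((t - a) * N) \<in> {0..1}" using frac_lt_1[of "(t - a) * N"] by simp
    then show "(nat \<lfloor>(t - a) * N\<rfloor>, frac ((t - a) * N)) \<in> Sigma {..<N} ?S" using idx(1)[OF t'] e t by simp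
  qed simp
  moreover have "(\<Sum>k<N. \<Sum>u\<in>?S k. f (a + (real k + u) / N)) = (\<Sum>p\<in>Sigma {..<N} ?S. f (a + (real (fst p) + snd p) / N))"
  proof (subst sum.Sigma)
    show "\<forall>k\<in>{..<N}. finite (?S k)"
    proof
      fix k assume k: "k \<in> {..<N}"
      have "inj_on (\<lambda>u. a + (real k + u) / N) (?S k)" using N by (auto simp: inj_on_def)
      moreover have "(\<lambda>u. a + (real k + u) / N) ` ?S k \<subseteq> ?T"
      proof (rule image_subsetI)
        fix u assume u: "u \<in> ?S k"
        then have "u \<in> {0..<1}" using S[of k u] k by auto
        then show "a + (real k + u) / N \<in> ?T" using rng[of k u] k u by simp
      qed
      ultimately show "finite (?S k)" by (intro finite_imageD[OF finite_subset[OF _ fT]])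
    qed
  qed (auto simp: case_prod_beta)
  ultimately show ?thesis by simp
qed

text \<open>Crossings are recorded in the unit square at the origin, whereas the period of \<gamma>
  starts at \<open>b\<close> and that of \<delta> at \<open>a\<close>.\<close>

lemma window_sum:
  fixes f :: "real \<Rightarrow> real \<Rightarrow> complex"
  assumes f: "\<And>s t. f (frac s) (frac t) = f s t"
  shows "(\<Sum>s | s \<in> {b..<b + 1} \<and> \<gamma> s \<in> range \<delta>. \<Sum>t | t \<in> {a..<a + 1} \<and> \<delta> t = \<gamma> s. f s t) = (\<Sum>p\<in>crossings \<gamma> \<delta>. f (fst p) (snd p))"
proof -
  let ?S = "{s. s \<in> {b..<b + 1} \<and> \<gamma> s \<in> range \<delta>}" and ?T = "\<lambda>s. {t. t \<in> {a..<a + 1} \<and> \<delta> t = \<gamma> s}"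
  have fS: "finite ?S" by (rule finite_subset[OF _ finite_hits(1)[of b "b + 1"]]) auto
  have fT: "finite (?T s)" for s by (rule finite_subset[OF _ finite_hits(2)[of a "a + 1"]]) auto
  have pw: "\<gamma> (b + frac (s - b)) = \<gamma> s" "\<delta> (a + frac (t - a)) = \<delta> t" for s t
    by (rule periodic_Ints[of \<gamma>, OF C1_loopD(2)[OF \<gamma>] frac_window(2)], rule periodic_Ints[of \<delta>, OF C1_loopD(2)[OF loop] frac_window(2)])
  have "(\<Sum>s\<in>?S. \<Sum>t\<in>?T s. f s t) = (\<Sum>p\<in>Sigma ?S ?T. f (fst p) (snd p))"
    by (subst sum.Sigma) (use fS fT in \<open>auto simp: case_prod_beta\<close>)
  also have "\<dots> = (\<Sum>p\<in>crossings \<gamma> \<delta>. f (fst p) (snd p))"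
  proof (rule sum.reindex_bij_witness[where i = "\<lambda>p. (b + frac (fst p - b), a + frac (snd p - a))" and j = "\<lambda>p. (frac (fst p), frac (snd p))"])
    fix p assume "p \<in> Sigma ?S ?T"
    then have p: "fst p \<in> {b..<b + 1}" "snd p \<in> {a..<a + 1}" "\<delta> (snd p) = \<gamma> (fst p)" by auto
    show "(b + frac (fst (frac (fst p), frac (snd p)) - b), a + frac (snd (frac (fst p), frac (snd p)) - a)) = p"
      unfolding fst_conv snd_conv frac_window(3)[OF p(1)] frac_window(3)[OF p(2)] by simp
    show "(frac (fst p), frac (snd p)) \<in> crossings \<gamma> \<delta>" by (rule crossing_frac[OF p(3)])
    show "f (fst (frac (fst p), frac (snd p))) (snd (frac (fst p), frac (snd p))) = f (fst p) (snd p)"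
      by (simp only: fst_conv snd_conv f)
  next
    fix p assume "p \<in> crossings \<gamma> \<delta>"
    then have p: "fst p \<in> {0..<1}" "snd p \<in> {0..<1}" "\<gamma> (fst p) = \<delta> (snd p)" by (auto simp: crossings_def)
    show "(frac (fst (b + frac (fst p - b), a + frac (snd p - a))), frac (snd (b + frac (fst p - b), a + frac (snd p - a)))) = p"
      unfolding fst_conv snd_conv frac_window(4)[OF p(1)] frac_window(4)[OF p(2)] by simp
    show "(b + frac (fst p - b), a + frac (snd p - a)) \<in> Sigma ?S ?T"
      using frac_window(1)[of b "fst p"] frac_window(1)[of a "snd p"] p(3) by (simp add: pw)
  qed
  finally show ?thesis .
qed

text \<open>Along \<gamma> a primitive of \<eta> is continuous while the potential jumps; off the
  crossings their difference is locally constant. Over a full period the potential returns to its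
  value, so the period of \<eta> is minus the sum of the jumps of the potential.\<close>

lemma dual_period:
  assumes \<eta>: "closed_form \<eta>" "\<And>d x v. d \<in> A \<Longrightarrow> x \<in> fst d - junctions \<Longrightarrow> \<eta> d (snd d x) v = total d (snd d x) v"
  shows "cint \<eta> (frag_of (path_simplex \<gamma>)) = 2 * pi * \<i> * (\<Sum>p\<in>crossings \<gamma> \<delta>. of_real (sgn (crossing_det A \<gamma> \<delta> p)))"
proof -
  have le: "locally_exact \<eta>" using \<eta>(1) by (simp add: closed_form_def)
  \<comment> \<open>A start of the period at which \<gamma> does not meet \<delta>, so that no jump
    sits at an end of the window.\<close>
  have "infinite ({0..<1::real} - fst ` crossings \<gamma> \<delta>)"
    by (intro Diff_infinite_finite finite_imageI finite_crossings) (simp add: infinite_Ico)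
  then obtain b where b: "b \<in> {0..<1}" "b \<notin> fst ` crossings \<gamma> \<delta>" by (metis DiffE all_not_in_conv finite.emptyI)
  have gb: "\<gamma> b \<notin> range \<delta>"
  proof
    assume "\<gamma> b \<in> range \<delta>"
    then obtain t where "\<delta> t = \<gamma> b" by auto
    then have "(frac b, frac t) \<in> crossings \<gamma> \<delta>" by (rule crossing_frac)
    then show False using b by (auto simp: frac_eq_id intro: rev_image_eqI)
  qed
  obtain P where P: "pathprim \<eta> {b..b + 1} \<gamma> P"
    using pathprim_exists[OF le compact_Icc convex_real_interval(5) C1_loopD(4)[OF \<gamma>]] by metis
  define f where "f s = P s - potential (\<gamma> s)" for s
  define S where "S = {s. s \<in> {b..<b + 1} \<and> \<gamma> s \<in> range \<delta>}"
  define J where "J s = 2 * pi * \<i> * (\<Sum>t | t \<in> {a..<a + 1} \<and> \<delta> t = \<gamma> s. of_real (sign s t))" for s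
  have gb1: "\<gamma> (b + 1) \<notin> range \<delta>" using gb C1_loopD(2)[OF \<gamma>, of b] by simp
  have Sb: "S \<subseteq> {b<..<b + 1}" using gb by (auto simp: S_def less_le)
  have "f (b + 1) - f b = sum J S"
  proof (rule jump_sum)
    show "finite S" unfolding S_def by (rule finite_subset[OF _ finite_hits(1)[of b "b + 1"]]) auto
    show "S \<subseteq> {b<..<b + 1}" by (rule Sb)
    show "b \<le> b + 1" by simp
    fix s assume s: "s \<in> {b..b + 1} - S"
    have "\<gamma> s \<notin> range \<delta>" using s gb1 by (cases "s = b + 1") (auto simp: S_def)
    then have "\<gamma> s \<in> off_arcs" by (rule off_arcs_loop[OF C1_loopD(3)[OF \<gamma>]])
    then obtain e where e: "e > 0" "\<forall>y\<in>{b..b+1}. dist y s < e \<longrightarrow> P y - P s = potential (\<gamma> y) - potential (\<gamma> s)"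
      using pathprimD[OF P _ prim_potential[OF \<eta>(2)]] s by (metis DiffE)
    then show "\<exists>e>0. \<forall>y\<in>{b..b + 1}. dist y s < e \<longrightarrow> f y = f s"
      by (intro exI[of _ e]) (auto simp: f_def diff_swap)
  next
    fix s assume "s \<in> S"
    then have s: "s \<in> {b<..<b + 1}" using Sb by blast
    have "continuous_on {b..b + 1} P" by (rule pathprim_continuous[OF le P])
    then have ic: "isCont P s" using s by (intro continuous_on_interior[of "{b..b+1}"]) auto
    have Pj: "((\<lambda>h. P (s + h) - P (s - h)) \<longlongrightarrow> P s - P s) (at_right 0)"
      by (intro tendsto_diff isCont_tendsto_compose[OF ic]) (auto intro!: tendsto_eq_intros)
    have pj: "((\<lambda>h. potential (\<gamma> (s + h)) - potential (\<gamma> (s - h))) \<longlongrightarrow>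
       (\<Sum>k<N. \<Sum>u | u \<in> {0..1} \<and> \<delta> (a + (real k + u) / N) = \<gamma> s. - 2 * pi * \<i> * of_real (sign s (a + (real k + u) / N)))) (at_right 0)"
      unfolding potential_def sum_subtractf[symmetric] by (rule tendsto_sum) (use arc_pot_jump in auto)
    have "(\<Sum>k<N. \<Sum>u | u \<in> {0..1} \<and> \<delta> (a + (real k + u) / N) = \<gamma> s. - 2 * pi * \<i> * of_real (sign s (a + (real k + u) / N))) = - J s"
      by (subst arc_sum[of "\<lambda>t. - 2 * pi * \<i> * of_real (sign s t)"]) (simp add: J_def sum_distrib_left sum_negf)
    with tendsto_diff[OF Pj pj] show "((\<lambda>h. f (s + h) - f (s - h)) \<longlongrightarrow> J s) (at_right 0)"
      by (simp add: f_def algebra_simps)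
  qed
  moreover have "f (b + 1) - f b = P (b + 1) - P b" using C1_loopD(2)[OF \<gamma>, of b] by (simp add: f_def)
  moreover have "sum J S = 2 * pi * \<i> * (\<Sum>p\<in>crossings \<gamma> \<delta>. of_real (sign (fst p) (snd p)))"
  proof -
    have "(\<Sum>s\<in>S. \<Sum>t | t \<in> {a..<a + 1} \<and> \<delta> t = \<gamma> s. complex_of_real (sign s t)) = (\<Sum>p\<in>crossings \<gamma> \<delta>. of_real (sign (fst p) (snd p)))"
      unfolding S_def by (rule window_sum) (simp only: sign_frac)
    then show ?thesis by (simp add: J_def[abs_def] sum_distrib_left[symmetric])
  qed
  ultimately show ?thesis using loop_period[OF le \<gamma> P] by simp
qed

end

section \<open>The bilinear relations\<close>

context surface_pou
begin

lemma loop_arc_chart: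
  assumes "C1_loop X A \<delta>"
  shows "\<exists>c z0 r G. c \<in> A \<and> 0 < r \<and> cball z0 r \<subseteq> chart_image c \<and> open G \<and> t \<in> G \<and>
    (\<forall>y\<in>G. \<delta> y \<in> fst c \<and> snd c (\<delta> y) \<in> ball z0 (r / 3))"
proof -
  obtain c where c: "c \<in> A" "\<delta> t \<in> fst c" using point_chart[OF C1_loopD(3)[OF assms]] by metis
  obtain r where r: "0 < r" "cball (snd c (\<delta> t)) r \<subseteq> chart_image c"
    using open_contains_cball chart_image_open[OF c(1)] snd_in[OF c(2)] by metis
  define U where "U = {x \<in> fst c. snd c x \<in> ball (snd c (\<delta> t)) (r / 3)}"
  have "openin X U" unfolding U_def by (rule open_preimage[OF c(1) open_ball])
  from openin_continuous_map_preimage[OF C1_loopD(1)[OF assms] this] have "open {y. \<delta> y \<in> U}"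
    by (simp only: open_openin topspace_euclidean UNIV_I simp_thms)
  moreover have "t \<in> {y. \<delta> y \<in> U}" using c r by (simp add: U_def)
  ultimately show ?thesis using c(1) r by (intro exI[of _ c] exI[of _ "snd c (\<delta> t)"] exI[of _ r] exI[of _ "{y. \<delta> y \<in> U}"]) (auto simp: U_def)
qed

text \<open>A Lebesgue number fixes the number \<open>N\<close> of pieces. Only afterwards is the
  start \<open>a\<close> chosen, outside the finitely many values that would put a junction on
  \<gamma>.\<close>

lemma loop_crossing_exists:
  assumes \<gamma>: "C1_loop X A \<gamma>" and \<delta>: "C1_loop X A \<delta>" and tr: "transversal A \<gamma> \<delta>"
  shows "\<exists>N a c z0 r \<psi> \<psi>1 \<psi>2. loop_crossing X A I ch \<rho> d\<rho> K \<delta> N a c z0 r \<psi> \<psi>1 \<psi>2 \<gamma>"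
proof -
  define Q where "Q G q \<longleftrightarrow> fst q \<in> A \<and> 0 < snd (snd q) \<and> cball (fst (snd q)) (snd (snd q)) \<subseteq> chart_image (fst q) \<and>
    (\<forall>y\<in>G. \<delta> y \<in> fst (fst q) \<and> snd (fst q) (\<delta> y) \<in> ball (fst (snd q)) (snd (snd q) / 3))" for G and q :: "'a chart \<times> complex \<times> real"
  \<comment> \<open>The start lies in \<open>{0..<1}\<close> and a period has length 1, so
    parameters up to 2 occur.\<close>
  have cov: "{0..2::real} \<subseteq> \<Union>{G. open G \<and> (\<exists>q. Q G q)}"
  proof
    fix t :: real
    obtain c z0 r G where "c \<in> A" "0 < r" "cball z0 r \<subseteq> chart_image c" "open G" "t \<in> G"
      "\<forall>y\<in>G. \<delta> y \<in> fst c \<and> snd c (\<delta> y) \<in> ball z0 (r / 3)"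
      using loop_arc_chart[OF \<delta>, of t] by blast
    then have "Q G (c, z0, r)" by (simp add: Q_def)
    then show "t \<in> \<Union>{G. open G \<and> (\<exists>q. Q G q)}" using \<open>open G\<close> \<open>t \<in> G\<close> by blast
  qed
  obtain e where e: "0 < e" "\<And>t. t \<in> {0..2} \<Longrightarrow> \<exists>G\<in>{G. open G \<and> (\<exists>q. Q G q)}. ball t e \<subseteq> G"
    using Heine_Borel_lemma[OF compact_Icc cov] by (metis (no_types, lifting) mem_Collect_eq)
  obtain N where N: "N \<noteq> 0" "inverse (real N) < e" using real_arch_inverse[of e] e(1) by blast
  define B where "B = {t \<in> {0..2}. \<delta> t \<in> range \<gamma>}"
  \<comment> \<open>The starts \<open>a\<close> in the unit window for which some
    \<open>a + real k / N\<close> is a parameter of a meeting with \<gamma> lie in these translates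
    of \<open>B\<close>.\<close>
  have "finite (\<Union>k\<le>N. (\<lambda>t. t - real k / N) ` B)"
    unfolding B_def by (intro finite_UN_I finite_imageI transversal_finite_hits(2)[OF \<gamma> \<delta> tr]) simp
  then have "infinite ({0..<1} - (\<Union>k\<le>N. (\<lambda>t. t - real k / N) ` B))"
    by (rule Diff_infinite_finite) (simp add: infinite_Ico)
  then obtain a where a: "a \<in> {0..<1}" "a \<notin> (\<Union>k\<le>N. (\<lambda>t. t - real k / N) ` B)" by (metis DiffE all_not_in_conv finite.emptyI)
  have tk: "a + real k / N \<in> {0..2}" if "k \<le> N" for k
  proof -
    have "real k / N \<le> 1" "0 \<le> real k / N" using that N by auto
    then show ?thesis using a(1) by auto
  qed
  have avoid: "\<delta> (a + real k / N) \<notin> range \<gamma>" if k: "k \<le> N" for k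
  proof
    assume "\<delta> (a + real k / N) \<in> range \<gamma>"
    then have "a + real k / N \<in> B" using tk[OF k] by (simp add: B_def)
    then have "a \<in> (\<lambda>t. t - real k / N) ` B" by (rule rev_image_eqI) simp
    then show False using a(2) k by blast
  qed
  have "\<exists>q. k < N \<longrightarrow> Q (ball (a + real k / N) e) q" for k
  proof (cases "k < N")
    case True
    then obtain G q where "Q G q" "ball (a + real k / N) e \<subseteq> G" using e(2)[OF tk[of k]] by auto
    then have "Q (ball (a + real k / N) e) q" unfolding Q_def by blast
    then show ?thesis by blast
  qed simp
  then obtain q where q: "\<And>k. k < N \<Longrightarrow> Q (ball (a + real k / N) e) (q k)" by metis
  define c z0 r where "c k = fst (q k)" and "z0 k = fst (snd (q k))" and "r k = snd (snd (q k))" for k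
  have q1: "c k \<in> A" "0 < r k" "cball (z0 k) (r k) \<subseteq> chart_image (c k)" if "k < N" for k
    using q[OF that] by (auto simp: Q_def c_def z0_def r_def)
  have near: "\<delta> (a + (real k + u) / N) \<in> fst (c k) \<and> snd (c k) (\<delta> (a + (real k + u) / N)) \<in> ball (z0 k) (r k / 3)"
    if k: "k < N" and u: "u \<in> {0..1}" for k u
  proof -
    have "\<bar>u / N\<bar> \<le> 1 / N" using u by (simp add: divide_right_mono)
    then have "\<bar>u / N\<bar> < e" using N(2) by (simp add: inverse_eq_divide)
    then have "a + (real k + u) / N \<in> ball (a + real k / N) e" by (simp add: dist_real_def add_divide_distrib)
    then show ?thesis using q[OF k] unfolding Q_def c_def z0_def r_def by blast
  qed
  have "\<exists>p. k < N \<longrightarrow> bump (z0 k) (r k / 3) (r k / 2) (fst p) (fst (snd p)) (snd (snd p))" for k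
  proof (cases "k < N")
    case True
    then have "\<exists>\<psi> \<psi>1 \<psi>2. bump (z0 k) (r k / 3) (r k / 2) \<psi> \<psi>1 \<psi>2" using q1(2)[of k] by (intro bump_exists) auto
    then show ?thesis by (metis fst_conv snd_conv)
  qed simp
  then obtain p where p: "\<And>k. k < N \<Longrightarrow> bump (z0 k) (r k / 3) (r k / 2) (fst (p k)) (fst (snd (p k))) (snd (snd (p k)))" by metis
  have "loop_arcs X A I ch \<rho> d\<rho> K \<delta> N a c z0 r (\<lambda>k. fst (p k)) (\<lambda>k. fst (snd (p k))) (\<lambda>k. snd (snd (p k)))"
    by (intro loop_arcs.intro surface_pou_axioms loop_arcs_axioms.intro \<delta> q1 near p) (use N in auto)
  then have "loop_crossing X A I ch \<rho> d\<rho> K \<delta> N a c z0 r (\<lambda>k. fst (p k)) (\<lambda>k. fst (snd (p k))) (\<lambda>k. snd (snd (p k))) \<gamma>"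
    by (intro loop_crossing.intro loop_crossing_axioms.intro \<gamma> tr avoid)
  then show ?thesis by blast
qed

text \<open>A Poincare dual of the class up to a constant. Stated through the pairing with all
  closed forms, it refers to the class alone and no longer to a curve.\<close>

definition dual_to :: "'a one_form \<Rightarrow> 'a chain set \<Rightarrow> bool" where
  "dual_to \<eta> k \<longleftrightarrow> closed_form \<eta> \<and>
    (\<forall>\<omega>. closed_form \<omega> \<longrightarrow> Sint (wedge \<omega> \<eta>) = - 2 * \<i> * of_real kappa * class_integral X A k \<omega>)"

text \<open>The curves that witness the product yield both facts: the second supplies the dual form,
  and its crossings with the first give the period.\<close>

lemma dual_of_intersection:
  assumes "has_intersection_product X A h k n"
  shows "\<exists>\<eta>. dual_to \<eta> k \<and> class_integral X A h \<eta> = 2 * pi * \<i> * of_int n"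
proof -
  obtain \<gamma> \<delta> where *: "C1_loop X A \<gamma>" "C1_loop X A \<delta>" "loop_class X \<gamma> = h" "loop_class X \<delta> = k" "transversal A \<gamma> \<delta>"
    "real_of_int n = (\<Sum>p\<in>crossings \<gamma> \<delta>. sgn (crossing_det A \<gamma> \<delta> p))"
    using assms unfolding has_intersection_product_def by blast
  obtain N a c z0 r \<psi> \<psi>1 \<psi>2 where "loop_crossing X A I ch \<rho> d\<rho> K \<delta> N a c z0 r \<psi> \<psi>1 \<psi>2 \<gamma>"
    using loop_crossing_exists[OF *(1,2,5)] by blast
  then interpret lc: loop_crossing X A I ch \<rho> d\<rho> K \<delta> N a c z0 r \<psi> \<psi>1 \<psi>2 \<gamma> .
  obtain \<eta> where \<eta>: "closed_form \<eta>" "\<And>d x v. d \<in> A \<Longrightarrow> x \<in> fst d - lc.junctions \<Longrightarrow> \<eta> d (snd d x) v = lc.total d (snd d x) v"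
    using lc.dual_form_exists by blast
  have per: "class_integral X A (loop_class X \<epsilon>) \<omega> = cint \<omega> (frag_of (path_simplex \<epsilon>))"
    if "closed_form \<omega>" "C1_loop X A \<epsilon>" for \<omega> \<epsilon>
    using loop_class_integral that by (simp add: closed_form_def)
  have "dual_to \<eta> k"
    unfolding dual_to_def using lc.loop_dual_pairing[OF \<eta>] per[OF _ *(2)] \<eta>(1) *(4) by simp
  moreover have "(\<Sum>p\<in>crossings \<gamma> \<delta>. complex_of_real (sgn (crossing_det A \<gamma> \<delta> p))) = of_real (real_of_int n)"
    unfolding *(6) by (rule of_real_sum[symmetric])
  then have "class_integral X A h \<eta> = 2 * pi * \<i> * of_int n"
    using lc.dual_period[OF \<eta>] per[OF \<eta>(1) *(1)] *(3) by simp
  ultimately show ?thesis by blast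
qed

lemma prim_add_cmult:
  assumes "prim \<omega> U F" "prim \<eta> V G" shows "prim (\<lambda>c z v. \<omega> c z v + t * \<eta> c z v) (U \<inter> V) (\<lambda>y. F y + t * G y)"
  unfolding prim_def
proof (intro conjI ballI)
  show "openin X (U \<inter> V)" using assms by (auto simp: prim_def)
  fix c x assume "c \<in> A" "x \<in> U \<inter> V \<inter> fst c"
  then show "((\<lambda>z. F (pt c z) + t * G (pt c z)) has_derivative (\<lambda>v. \<omega> c (snd c x) v + t * \<eta> c (snd c x) v)) (at (snd c x))"
    by (intro has_derivative_add has_derivative_mult_right primD[OF assms(1)] primD[OF assms(2)]) auto
qed

lemma closed_form_add_cmult:
  assumes "closed_form \<omega>" "closed_form \<eta>" shows "closed_form (\<lambda>c z v. \<omega> c z v + t * \<eta> c z v)"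
proof -
  have "locally_exact (\<lambda>c z v. \<omega> c z v + t * \<eta> c z v)"
    unfolding locally_exact_def
  proof
    fix x assume x: "x \<in> topspace X"
    have "locally_exact \<omega>" "locally_exact \<eta>" using assms unfolding closed_form_def by auto
    note le = this[unfolded locally_exact_def]
    from bspec[OF le(1) x] bspec[OF le(2) x]
    obtain U F V G where p: "x \<in> U" "prim \<omega> U F" "x \<in> V" "prim \<eta> V G" by (elim exE conjE)
    show "\<exists>U F. x \<in> U \<and> prim (\<lambda>c z v. \<omega> c z v + t * \<eta> c z v) U F"
      by (rule exI[of _ "U \<inter> V"], rule exI, rule conjI[OF IntI[OF p(1,3)] prim_add_cmult[OF p(2,4)]])
  qed
  moreover have "continuous_form (\<lambda>c z v. \<omega> c z v + t * \<eta> c z v)"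
    using assms by (auto simp: closed_form_def continuous_form_def intro!: continuous_intros)
  ultimately show ?thesis by (simp add: closed_form_def)
qed

lemma cint_add_cmult:
  assumes \<omega>: "closed_form \<omega>" and \<eta>: "closed_form \<eta>" and \<delta>: "C1_loop X A \<delta>"
  shows "cint (\<lambda>c z v. \<omega> c z v + t * \<eta> c z v) (frag_of (path_simplex \<delta>))
    = cint \<omega> (frag_of (path_simplex \<delta>)) + t * cint \<eta> (frag_of (path_simplex \<delta>))"
proof -
  have le: "locally_exact \<omega>" "locally_exact \<eta>" "locally_exact (\<lambda>c z v. \<omega> c z v + t * \<eta> c z v)"
    using \<omega> \<eta> closed_form_add_cmult[OF \<omega> \<eta>] by (auto simp: closed_form_def)
  obtain P where P: "pathprim \<omega> {0..1} \<delta> P" using pathprim_exists[OF le(1) compact_Icc convex_real_interval(5) C1_loopD(4)[OF \<delta>]] by metis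
  obtain Q where Q: "pathprim \<eta> {0..1} \<delta> Q" using pathprim_exists[OF le(2) compact_Icc convex_real_interval(5) C1_loopD(4)[OF \<delta>]] by metis
  have "pathprim (\<lambda>c z v. \<omega> c z v + t * \<eta> c z v) {0..1} \<delta> (\<lambda>s. P s + t * Q s)"
  proof (rule pathprimI[OF C1_loopD(4)[OF \<delta>]])
    fix s :: real assume s: "s \<in> {0..1}"
    obtain U F V G where U: "\<delta> s \<in> U" "prim \<omega> U F" "\<delta> s \<in> V" "prim \<eta> V G"
      using le(1,2) C1_loopD(3)[OF \<delta>, of s] unfolding locally_exact_def by metis
    obtain e1 where e1: "e1 > 0" "\<forall>y\<in>{0..1}. dist y s < e1 \<longrightarrow> P y - P s = F (\<delta> y) - F (\<delta> s)" using pathprimD[OF P s U(2,1)] by metis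
    obtain e2 where e2: "e2 > 0" "\<forall>y\<in>{0..1}. dist y s < e2 \<longrightarrow> Q y - Q s = G (\<delta> y) - G (\<delta> s)" using pathprimD[OF Q s U(4,3)] by metis
    have "(P y + t * Q y) - (P s + t * Q s) = (F (\<delta> y) + t * G (\<delta> y)) - (F (\<delta> s) + t * G (\<delta> s))"
      if y: "y \<in> {0..1}" "dist y s < min e1 e2" for y
    proof -
      have "(P y + t * Q y) - (P s + t * Q s) = (P y - P s) + t * (Q y - Q s)" by (simp add: algebra_simps)
      also have "\<dots> = (F (\<delta> y) - F (\<delta> s)) + t * (G (\<delta> y) - G (\<delta> s))" using e1 e2 y by simp
      finally show ?thesis by (simp add: algebra_simps)
    qed
    then show "\<exists>U F e. prim (\<lambda>c z v. \<omega> c z v + t * \<eta> c z v) U F \<and> \<delta> s \<in> U \<and> e > 0 \<and>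
      (\<forall>y\<in>{0..1}. dist y s < e \<longrightarrow> (P y + t * Q y) - (P s + t * Q s) = F (\<delta> y) - F (\<delta> s))"
      using prim_add_cmult[OF U(2,4), of t] U(1,3) e1(1) e2(1)
      by (intro exI[of _ "U \<inter> V"] exI[of _ "\<lambda>y. F y + t * G y"] exI[of _ "min e1 e2"]) auto
  qed
  note R = pint_path_simplex[OF le(3) this]
  show ?thesis unfolding R pint_path_simplex[OF le(1) P] pint_path_simplex[OF le(2) Q] by (simp add: algebra_simps)
qed

lemma Sint_add_cmult:
  assumes "closed_form \<omega>" "closed_form \<eta>" "closed_form \<theta>"
  shows "Sint (wedge (\<lambda>c z v. \<omega> c z v + t * \<eta> c z v) \<theta>) = Sint (wedge \<omega> \<theta>) + t * Sint (wedge \<eta> \<theta>)"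
proof -
  have s: "Sintegrable (wedge \<omega> \<theta>)" "Sintegrable (wedge \<eta> \<theta>)"
    using assms by (auto simp: closed_form_def intro!: Sintegrable_continuous continuous_wedge)
  have "Sint (\<lambda>c z. \<Sum>j\<in>{0, 1::nat}. (if j = 0 then wedge \<omega> \<theta> else (\<lambda>c z. t * wedge \<eta> \<theta> c z)) c z)
    = (\<Sum>j\<in>{0, 1::nat}. Sint (if j = 0 then wedge \<omega> \<theta> else (\<lambda>c z. t * wedge \<eta> \<theta> c z)))"
    by (rule Sint_sum) (use s Sintegrable_cmult in auto)
  moreover have "wedge (\<lambda>c z v. \<omega> c z v + t * \<eta> c z v) \<theta> = (\<lambda>c z. wedge \<omega> \<theta> c z + t * wedge \<eta> \<theta> c z)"
    by (simp add: wedge_def fun_eq_iff algebra_simps)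
  ultimately show ?thesis by (simp add: Sint_cmult)
qed

text \<open>Closedness, periods and pairing go through one induction, since the last two use the
  closedness of the partial sum.\<close>

lemma linear_combination:
  assumes "finite J" "closed_form \<omega>" "\<forall>j\<in>J. closed_form (\<eta> j)"
  shows "closed_form (\<lambda>c z v. \<omega> c z v + (\<Sum>j\<in>J. t j * \<eta> j c z v)) \<and>
    (\<forall>\<delta>. C1_loop X A \<delta> \<longrightarrow> cint (\<lambda>c z v. \<omega> c z v + (\<Sum>j\<in>J. t j * \<eta> j c z v)) (frag_of (path_simplex \<delta>))
      = cint \<omega> (frag_of (path_simplex \<delta>)) + (\<Sum>j\<in>J. t j * cint (\<eta> j) (frag_of (path_simplex \<delta>)))) \<and>
    (\<forall>\<theta>. closed_form \<theta> \<longrightarrow> Sint (wedge (\<lambda>c z v. \<omega> c z v + (\<Sum>j\<in>J. t j * \<eta> j c z v)) \<theta>)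
      = Sint (wedge \<omega> \<theta>) + (\<Sum>j\<in>J. t j * Sint (wedge (\<eta> j) \<theta>)))"
  using assms
proof (induction J rule: finite_induct)
  case empty then show ?case by simp
next
  case (insert i J)
  let ?T = "\<lambda>c z v. \<omega> c z v + (\<Sum>j\<in>J. t j * \<eta> j c z v)"
  have eq: "(\<lambda>c z v. \<omega> c z v + (\<Sum>j\<in>insert i J. t j * \<eta> j c z v)) = (\<lambda>c z v. ?T c z v + t i * \<eta> i c z v)"
    using insert.hyps by (simp add: fun_eq_iff algebra_simps)
  have cT: "closed_form ?T" and ci: "closed_form (\<eta> i)" using insert by auto
  have "cint ?T (frag_of (path_simplex \<delta>)) = cint \<omega> (frag_of (path_simplex \<delta>)) + (\<Sum>j\<in>J. t j * cint (\<eta> j) (frag_of (path_simplex \<delta>)))"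
    if "C1_loop X A \<delta>" for \<delta> using insert that by auto
  moreover have "Sint (wedge ?T \<theta>) = Sint (wedge \<omega> \<theta>) + (\<Sum>j\<in>J. t j * Sint (wedge (\<eta> j) \<theta>))" if "closed_form \<theta>" for \<theta>
    using insert that by auto
  ultimately show ?case unfolding eq
    using closed_form_add_cmult[OF cT ci] cint_add_cmult[OF cT ci] Sint_add_cmult[OF cT ci] insert.hyps
    by (simp add: algebra_simps)
qed

lemma closed_form_cnj: "closed_form \<omega> \<Longrightarrow> closed_form (cnj_form \<omega>)"
  unfolding closed_form_def locally_exact_def by (metis prim_cnj continuous_form_cnj)

lemma Sint_wedge_swap: "Sint (wedge \<omega> \<eta>) = - Sint (wedge \<eta> \<omega>)"
proof -
  have "wedge \<omega> \<eta> = (\<lambda>c z. (- 1) * wedge \<eta> \<omega> c z)" by (simp add: wedge_def fun_eq_iff algebra_simps)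
  then show ?thesis using Sint_cmult[of "- 1" "wedge \<eta> \<omega>"] by simp
qed

text \<open>The two periods are, up to the same factor, the surface integrals of the wedge product
  in its two orders.\<close>

lemma dual_swap:
  assumes "dual_to \<eta> k" "dual_to \<theta> h"
  shows "class_integral X A h \<eta> = - class_integral X A k \<theta>"
proof -
  define m where "m = - 2 * \<i> * complex_of_real kappa"
  have m: "m \<noteq> 0" using kappa_pos by (simp add: m_def)
  have "m * class_integral X A h \<eta> = Sint (wedge \<eta> \<theta>)" "m * class_integral X A k \<theta> = Sint (wedge \<theta> \<eta>)"
    using assms unfolding dual_to_def m_def by simp_all
  then have "m * class_integral X A h \<eta> = m * (- class_integral X A k \<theta>)"
    using Sint_wedge_swap[of \<eta> \<theta>] by (simp only: mult_minus_right)
  then show ?thesis unfolding mult_left_cancel[OF m] .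
qed

text \<open>The curves that witness this product have a dual form \<open>\<eta>'\<close> of their
  own. Swapping through \<theta> twice shows that \<eta> and \<open>\<eta>'\<close> have the same
  period over \<open>h\<close>; so one dual form per class, chosen once, serves all
  products.\<close>

lemma dual_intersection:
  assumes hk: "has_intersection_product X A h k n" and h: "dual_to \<theta> h" and k: "dual_to \<eta> k"
  shows "class_integral X A h \<eta> = 2 * pi * \<i> * of_int n" "class_integral X A k \<theta> = - (2 * pi * \<i> * of_int n)"
proof -
  obtain \<eta>' where e: "dual_to \<eta>' k" "class_integral X A h \<eta>' = 2 * pi * \<i> * of_int n" using dual_of_intersection[OF hk] by blast
  show *: "class_integral X A h \<eta> = 2 * pi * \<i> * of_int n" using dual_swap[OF k h] dual_swap[OF e(1) h] e(2) by simp
  show "class_integral X A k \<theta> = - (2 * pi * \<i> * of_int n)" using dual_swap[OF h k] * by simp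
qed

text \<open>The condition \<open>stokes\<close> is what holomorphic and antiholomorphic \<omega>'
  have in common, so that one argument yields both the vanishing and the positivity.\<close>

lemma riemann_bilinear:
  assumes conn: "connected_space X" and sb: "symplectic_basis X A g a b"
    and \<omega>: "closed_form \<omega>" and \<omega>': "closed_form \<omega>'"
    and stokes: "\<And>T h. prim T (topspace X) h \<Longrightarrow> continuous_form T \<Longrightarrow> Sint (wedge T \<omega>') = 0"
  shows "Sint (wedge \<omega> \<omega>') = of_real (kappa / pi) *
    (\<Sum>k=1..g. class_integral X A (a k) \<omega> * class_integral X A (b k) \<omega>' - class_integral X A (b k) \<omega> * class_integral X A (a k) \<omega>')"
proof -
  let ?p = "class_integral X A"
  let ?J = "{1..g} <+> {1..g}" and ?e = "case_sum a b"
  have basis: "integer_basis (homology_group 1 X) ?J ?e"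
    and aa: "\<And>j k. j \<in> {1..g} \<Longrightarrow> k \<in> {1..g} \<Longrightarrow> has_intersection_product X A (a j) (a k) 0"
    and bb: "\<And>j k. j \<in> {1..g} \<Longrightarrow> k \<in> {1..g} \<Longrightarrow> has_intersection_product X A (b j) (b k) 0"
    and ab: "\<And>j k. j \<in> {1..g} \<Longrightarrow> k \<in> {1..g} \<Longrightarrow> has_intersection_product X A (a j) (b k) (if j = k then 1 else 0)"
    using sb unfolding symplectic_basis_def by blast+
  have "\<forall>i\<in>?J. \<exists>\<eta>. dual_to \<eta> (?e i)"
    using dual_of_intersection[OF aa] dual_of_intersection[OF bb] by fastforce
  from bchoice[OF this] obtain \<eta> where "\<forall>i\<in>?J. dual_to (\<eta> i) (?e i)" ..
  then have \<eta>: "dual_to (\<eta> i) (?e i)" if "i \<in> ?J" for i using that by (rule bspec)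
  \<comment> \<open>The product of a basis class with itself supplies a closed curve of class C1
    that represents it.\<close>
  have "\<forall>i\<in>?J. \<exists>\<delta>. C1_loop X A \<delta> \<and> loop_class X \<delta> = ?e i"
  proof
    fix i assume "i \<in> ?J"
    then have "\<exists>n. has_intersection_product X A (?e i) (?e i) n" using aa bb by (cases i) (auto intro!: exI[of _ 0])
    then show "\<exists>\<delta>. C1_loop X A \<delta> \<and> loop_class X \<delta> = ?e i" unfolding has_intersection_product_def by blast
  qed
  from bchoice[OF this] obtain \<delta> where "\<forall>i\<in>?J. C1_loop X A (\<delta> i) \<and> loop_class X (\<delta> i) = ?e i" ..
  then have \<delta>: "C1_loop X A (\<delta> i) \<and> loop_class X (\<delta> i) = ?e i" if "i \<in> ?J" for i using that by (rule bspec)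
  have per: "?p (?e i) \<theta> = cint \<theta> (frag_of (path_simplex (\<delta> i)))" if "closed_form \<theta>" "i \<in> ?J" for \<theta> i
    using loop_class_integral[of \<theta> "\<delta> i"] \<delta>[OF that(2)] that(1) by (simp add: closed_form_def)
  \<comment> \<open>Over \<open>a j\<close> only the dual of \<open>b j\<close> has a nonzero
    period, \<open>2 * pi * \<i>\<close>; over \<open>b j\<close> only the dual of
    \<open>a j\<close>, \<open>- (2 * pi * \<i>)\<close>. These coefficients cancel all periods of
    \<omega>.\<close>
  define t where "t = case_sum (\<lambda>k. ?p (b k) \<omega> / (2 * pi * \<i>)) (\<lambda>k. - ?p (a k) \<omega> / (2 * pi * \<i>))"
  define T where "T = (\<lambda>c z v. \<omega> c z v + (\<Sum>j\<in>?J. t j * \<eta> j c z v))"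
  have fin: "finite ?J" by simp
  have cl: "\<forall>i\<in>?J. closed_form (\<eta> i)"
  proof
    fix i assume "i \<in> ?J"
    from \<eta>[OF this] show "closed_form (\<eta> i)" by (simp add: dual_to_def)
  qed
  note L = linear_combination[where t = t, OF fin \<omega> cl, folded T_def]
  have sum_J: "(\<Sum>j\<in>?J. F j) = (\<Sum>k=1..g. F (Inl k)) + (\<Sum>k=1..g. F (Inr k))" for F :: "nat + nat \<Rightarrow> complex"
    by (simp add: sum.Plus)
  have da: "dual_to (\<eta> (Inl k)) (a k)" and db: "dual_to (\<eta> (Inr k)) (b k)" if "k \<in> {1..g}" for k
    using \<eta>[OF InlI[OF that]] \<eta>[OF InrI[OF that]] by simp_all
  have "?p (?e i) T = 0" if i: "i \<in> ?J" for i
  proof -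
    have cT: "closed_form T" using L by simp
    have "(\<Sum>j\<in>?J. t j * cint (\<eta> j) (frag_of (path_simplex (\<delta> i)))) = (\<Sum>j\<in>?J. t j * ?p (?e i) (\<eta> j))"
      by (rule sum.cong[OF refl]) (simp only: per[OF bspec[OF cl] i])
    then have "?p (?e i) T = ?p (?e i) \<omega> + (\<Sum>j\<in>?J. t j * ?p (?e i) (\<eta> j))"
      using L per[OF cT i] per[OF \<omega> i] \<delta>[OF i] by simp
    also have "(\<Sum>j\<in>?J. t j * ?p (?e i) (\<eta> j)) = - ?p (?e i) \<omega>"
    proof (cases i)
      case (Inl j)
      then have j: "j \<in> {1..g}" using i by auto
      have "?p (a j) (\<eta> (Inl k)) = 0" "?p (a j) (\<eta> (Inr k)) = (if k = j then 2 * pi * \<i> else 0)" if k: "k \<in> {1..g}" for k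
        using dual_intersection(1)[OF aa[OF j k] da[OF j] da[OF k]] dual_intersection(1)[OF ab[OF j k] da[OF j] db[OF k]] by auto
      note A = this
      have "(\<Sum>k=1..g. t (Inl k) * ?p (a j) (\<eta> (Inl k))) = (\<Sum>k=1..g. 0)"
        by (rule sum.cong[OF refl]) (simp only: A(1) mult_zero_right)
      moreover have "(\<Sum>k=1..g. t (Inr k) * ?p (a j) (\<eta> (Inr k))) = (\<Sum>k=1..g. if k = j then - ?p (a j) \<omega> else 0)"
      proof (rule sum.cong[OF refl])
        fix k assume k: "k \<in> {1..g}"
        show "t (Inr k) * ?p (a j) (\<eta> (Inr k)) = (if k = j then - ?p (a j) \<omega> else 0)"
          unfolding A(2)[OF k] by (simp add: t_def)
      qed
      moreover have "(\<Sum>k=1..g. if k = j then - ?p (a j) \<omega> else 0) = - ?p (a j) \<omega>" using j by simp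
      moreover have "?e i = a j" using Inl by simp
      ultimately show ?thesis unfolding sum_J by simp
    next
      case (Inr j)
      then have j: "j \<in> {1..g}" using i by auto
      have "?p (b j) (\<eta> (Inr k)) = 0" "?p (b j) (\<eta> (Inl k)) = (if k = j then - (2 * pi * \<i>) else 0)" if k: "k \<in> {1..g}" for k
        using dual_intersection(1)[OF bb[OF j k] db[OF j] db[OF k]] dual_intersection(2)[OF ab[OF k j] da[OF k] db[OF j]] by auto
      note A = this
      have "(\<Sum>k=1..g. t (Inr k) * ?p (b j) (\<eta> (Inr k))) = (\<Sum>k=1..g. 0)"
        by (rule sum.cong[OF refl]) (simp only: A(1) mult_zero_right)
      moreover have "(\<Sum>k=1..g. t (Inl k) * ?p (b j) (\<eta> (Inl k))) = (\<Sum>k=1..g. if k = j then - ?p (b j) \<omega> else 0)"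
      proof (rule sum.cong[OF refl])
        fix k assume k: "k \<in> {1..g}"
        show "t (Inl k) * ?p (b j) (\<eta> (Inl k)) = (if k = j then - ?p (b j) \<omega> else 0)"
          unfolding A(2)[OF k] by (simp add: t_def)
      qed
      moreover have "(\<Sum>k=1..g. if k = j then - ?p (b j) \<omega> else 0) = - ?p (b j) \<omega>" using j by simp
      moreover have "?e i = b j" using Inr by simp
      ultimately show ?thesis unfolding sum_J by simp
    qed
    finally show ?thesis by simp
  qed
  then have zero: "cint T c = 0" if "i \<in> ?J" "c \<in> ?e i" for i c
  proof -
    have cT: "closed_form T" using L by simp
    have "homologous_rel 1 X {} (frag_of (path_simplex (\<delta> i))) c" using \<delta>[OF that(1)] that(2) unfolding loop_class_def by (metis mem_Collect_eq)
    then have "cint T (frag_of (path_simplex (\<delta> i))) = cint T c" using cint_homologous cT by (simp add: closed_form_def)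
    then show ?thesis using per[OF cT that(1)] \<open>\<And>i. i \<in> ?J \<Longrightarrow> ?p (?e i) T = 0\<close>[OF that(1)] by simp
  qed
  have cT: "closed_form T" using L by simp
  then have le: "locally_exact T" and co: "continuous_form T" by (auto simp: closed_form_def)
  have z: "cint T z = 0" if "singular_relcycle 1 X {} z" for z
    by (rule cint_cycle_zero[OF le basis _ that]) (rule zero)
  have "\<exists>h. prim T (topspace X) h" by (rule global_primitive[OF le conn z])
  then obtain h where "prim T (topspace X) h" ..
  then have "Sint (wedge T \<omega>') = 0" by (rule stokes[OF _ co])
  then have "Sint (wedge \<omega> \<omega>') + (\<Sum>j\<in>?J. t j * Sint (wedge (\<eta> j) \<omega>')) = 0" using L \<omega>' by simp
  moreover have "Sint (wedge (\<eta> j) \<omega>') = 2 * \<i> * of_real kappa * ?p (?e j) \<omega>'" if "j \<in> ?J" for j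
    using \<eta>[OF that] \<omega>' Sint_wedge_swap[of "\<eta> j" \<omega>'] by (simp add: dual_to_def)
  ultimately have "Sint (wedge \<omega> \<omega>') = - (\<Sum>j\<in>?J. t j * (2 * \<i> * of_real kappa * ?p (?e j) \<omega>'))"
    by (simp add: eq_neg_iff_add_eq_0)
  also have "\<dots> = (\<Sum>k=1..g. of_real (kappa / pi) * (?p (a k) \<omega> * ?p (b k) \<omega>' - ?p (b k) \<omega> * ?p (a k) \<omega>'))"
    unfolding sum_J sum.distrib[symmetric] sum_negf[symmetric]
  proof (rule sum.cong[OF refl])
    fix k
    \<comment> \<open>The factor \<open>kappa / pi\<close> is the quotient of
      \<open>2 * \<i> * kappa\<close> from the duality and \<open>2 * pi * \<i>\<close> from the
      coefficients.\<close>
    have alg: "- (y / (2 * p * \<i>) * (2 * \<i> * q * u) + - x / (2 * p * \<i>) * (2 * \<i> * q * v)) = q / p * (x * v - y * u)"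
      if "p \<noteq> 0" for x y u v p q :: complex using that by (simp add: divide_simps) (simp add: algebra_simps)
    show "- (t (Inl k) * (2 * \<i> * of_real kappa * ?p (?e (Inl k)) \<omega>') + t (Inr k) * (2 * \<i> * of_real kappa * ?p (?e (Inr k)) \<omega>'))
      = of_real (kappa / pi) * (?p (a k) \<omega> * ?p (b k) \<omega>' - ?p (b k) \<omega> * ?p (a k) \<omega>')"
      using alg[of "of_real pi" "?p (b k) \<omega>" "of_real kappa" "?p (a k) \<omega>'" "?p (a k) \<omega>" "?p (b k) \<omega>'"] by (simp add: t_def)
  qed
  finally show ?thesis by (simp add: sum_distrib_left)
qed

end

context riemann_surface
begin

text \<open>On a coordinate disc the holomorphic coefficient has a primitive, and the transformation
  law makes it a primitive of the form in every other chart.\<close>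

lemma holomorphic_differential_closed:
  assumes "holomorphic_differential A \<omega>"
  obtains f where "closed_form \<omega>" "\<And>c. c \<in> A \<Longrightarrow> f c holomorphic_on chart_image c"
    "\<And>c z v. c \<in> A \<Longrightarrow> z \<in> chart_image c \<Longrightarrow> \<omega> c z v = f c z * v"
proof -
  have "\<forall>c\<in>A. \<exists>f. f holomorphic_on chart_image c \<and> (\<forall>z\<in>chart_image c. \<forall>v. \<omega> c z v = f z * v)"
    using assms by (simp add: holomorphic_differential_def)
  from bchoice[OF this] obtain f where f: "\<And>c. c \<in> A \<Longrightarrow> f c holomorphic_on chart_image c"
    "\<And>c z v. c \<in> A \<Longrightarrow> z \<in> chart_image c \<Longrightarrow> \<omega> c z v = f c z * v" by blast
  have law: "\<omega> c z v = \<omega> d (transition c d z) (deriv (transition c d) z * v)"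
    if "c \<in> A" "d \<in> A" "z \<in> snd c ` (fst c \<inter> fst d)" for c d z v
    using assms that unfolding holomorphic_differential_def by blast
  have "locally_exact \<omega>" unfolding locally_exact_def
  proof
    fix x assume "x \<in> topspace X"
    then obtain c where c: "c \<in> A" "x \<in> fst c" using point_chart by blast
    obtain e where e: "e > 0" "ball (snd c x) e \<subseteq> chart_image c"
      using openE[OF chart_image_open[OF c(1)] snd_in[OF c(2)]] by blast
    let ?B = "ball (snd c x) e"
    obtain F where F: "\<And>z. z \<in> ?B \<Longrightarrow> (F has_field_derivative f c z) (at z)"
      using holomorphic_convex_primitive'[OF convex_ball open_ball holomorphic_on_subset[OF f(1)[OF c(1)] e(2)]]
        at_within_open[OF _ open_ball] by metis
    define U where "U = {y \<in> fst c. snd c y \<in> ?B}"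
    have "prim \<omega> U (\<lambda>y. F (snd c y))" unfolding prim_def
    proof (intro conjI ballI)
      show "openin X U" unfolding U_def by (rule open_preimage[OF c(1) open_ball])
      fix d y assume d: "d \<in> A" and y: "y \<in> U \<inter> fst d"
      then have yc: "y \<in> fst c" "snd c y \<in> ?B" "y \<in> fst d" by (auto simp: U_def)
      have "(F has_derivative (\<lambda>v. f c (snd c y) * v)) (at (snd c y))"
        using F[OF yc(2)] by (simp add: has_field_derivative_def)
      then have "((\<lambda>z. F (snd c (pt c z))) has_derivative (\<lambda>v. f c (snd c y) * v)) (at (snd c y))"
        by (rule has_derivative_transform_within_open[OF _ open_ball yc(2)]) (use e(2) in auto)
      from has_derivative_change_chart[OF d c(1) yc(3,1) this]
      have *: "((\<lambda>z. F (snd c (pt d z))) has_derivative (\<lambda>v. f c (snd c y) * (deriv (transition d c) (snd d y) * v))) (at (snd d y))" .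
      have "\<omega> d (snd d y) = (\<lambda>v. f c (snd c y) * (deriv (transition d c) (snd d y) * v))"
      proof
        fix v
        have "snd d y \<in> snd d ` (fst d \<inter> fst c)" using yc by auto
        from law[OF d c(1) this, of v]
        show "\<omega> d (snd d y) v = f c (snd c y) * (deriv (transition d c) (snd d y) * v)"
          using f(2)[OF c(1) snd_in[OF yc(1)]] d yc by (simp add: transition_eq)
      qed
      then show "((\<lambda>z. F (snd c (pt d z))) has_derivative \<omega> d (snd d y)) (at (snd d y))" using * by simp
    qed
    moreover have "x \<in> U" using c e by (simp add: U_def)
    ultimately show "\<exists>U F. x \<in> U \<and> prim \<omega> U F" by blast
  qed
  moreover have "continuous_form \<omega>" unfolding continuous_form_def
  proof (intro ballI allI)
    fix c v assume c: "c \<in> A"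
    have "continuous_on (chart_image c) (\<lambda>z. f c z * v)"
      by (intro continuous_intros holomorphic_on_imp_continuous_on f c)
    then show "continuous_on (chart_image c) (\<lambda>z. \<omega> c z v)" by (rule continuous_on_eq) (simp add: f(2)[OF c])
  qed
  ultimately have "closed_form \<omega>" by (simp add: closed_form_def)
  then show ?thesis using f by (rule that)
qed

end

theorem theorem4p1:
  fixes X :: "'a topology" and A :: "'a chart set" and g :: nat
    and a b :: "nat \<Rightarrow> 'a chain set" and \<omega> \<omega>' :: "'a one_form"
  assumes "riemann_surface X A" and "compact_space X" and "connected_space X"
    and "has_genus X g"
    and "symplectic_basis X A g a b"
    and "holomorphic_differential A \<omega>" and "holomorphic_differential A \<omega>'"
  shows "(\<Sum>k=1..g. class_integral X A (a k) \<omega> * class_integral X A (b k) \<omega>'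
                   - class_integral X A (b k) \<omega> * class_integral X A (a k) \<omega>') = 0 \<and>
    (nonzero_form A \<omega> \<longrightarrow>
      (let P = \<i> * (\<Sum>k=1..g. class_integral X A (a k) \<omega> * class_integral X A (b k) (cnj_form \<omega>)
                   - class_integral X A (b k) \<omega> * class_integral X A (a k) (cnj_form \<omega>))
       in P \<in> \<real> \<and> Re P > 0))"
proof -
  obtain I ch \<rho> d\<rho> K where "surface_pou X A I ch \<rho> d\<rho> K"
    using riemann_surface.pou_exists[OF assms(1,2)] by blast
  then interpret surface_pou X A I ch \<rho> d\<rho> K .
  obtain f where f: "closed_form \<omega>" "\<And>c. c \<in> A \<Longrightarrow> f c holomorphic_on chart_image c"
    "\<And>c z v. c \<in> A \<Longrightarrow> z \<in> chart_image c \<Longrightarrow> \<omega> c z v = f c z * v"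
    using holomorphic_differential_closed[OF assms(6)] by metis
  obtain f' where f': "closed_form \<omega>'" "\<And>c. c \<in> A \<Longrightarrow> f' c holomorphic_on chart_image c"
    "\<And>c z v. c \<in> A \<Longrightarrow> z \<in> chart_image c \<Longrightarrow> \<omega>' c z v = f' c z * v"
    using holomorphic_differential_closed[OF assms(7)] by metis
  have form: "is_form \<omega>" "is_form \<omega>'"
    using f(1) f'(1) locally_exact_is_form by (auto simp: closed_form_def)
  let ?Q = "\<lambda>\<omega>'. \<Sum>k=1..g. class_integral X A (a k) \<omega> * class_integral X A (b k) \<omega>'
                   - class_integral X A (b k) \<omega> * class_integral X A (a k) \<omega>'"
  have s1: "Sint (wedge T \<omega>') = 0" if "prim T (topspace X) h" "continuous_form T" for T h
    by (rule stokes_holomorphic[OF that form(2) f'(2,3)])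
  have s2: "Sint (wedge T (cnj_form \<omega>)) = 0" if "prim T (topspace X) h" "continuous_form T" for T h
    by (rule stokes_antiholomorphic[OF that form(1) f(2,3)])
  have k: "kappa / pi > 0" using kappa_pos by simp
  \<comment> \<open>Both forms are multiples of dz in each chart, so their wedge product vanishes
    pointwise.\<close>
  have "Sint (wedge \<omega> \<omega>') = Sint (\<lambda>c z. 0)"
    by (rule Sint_cong) (simp add: wedge_def f(3) f'(3))
  also have "\<dots> = 0" by (simp add: Sint_def)
  finally have "of_real (kappa / pi) * ?Q \<omega>' = 0"
    using riemann_bilinear[OF assms(3,5) f(1) f'(1) s1] by simp
  then have 1: "?Q \<omega>' = 0" using kappa_pos by simp
  have 2: "\<i> * ?Q (cnj_form \<omega>) \<in> \<real> \<and> Re (\<i> * ?Q (cnj_form \<omega>)) > 0" if nz: "nonzero_form A \<omega>"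
  proof -
    obtain t where t: "t > 0" "\<i> * Sint (wedge \<omega> (cnj_form \<omega>)) = of_real t"
      using Sint_positive[OF form(1) f(2,3) nz] by blast
    have "of_real (kappa / pi) * (\<i> * ?Q (cnj_form \<omega>)) = of_real t"
      using riemann_bilinear[OF assms(3,5) f(1) closed_form_cnj[OF f(1)] s2] t(2) by (simp add: mult.left_commute)
    then have "\<i> * ?Q (cnj_form \<omega>) = of_real (t / (kappa / pi))"
      using k by (simp add: field_simps)
    moreover have "t / (kappa / pi) > 0" by (rule divide_pos_pos[OF t(1) k])
    ultimately show ?thesis by simp
  qed
  show ?thesis using 1 2 by (simp add: Let_def)
qed

end
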